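(* There exists a constant $c_2>0$, independent of $h$ and $k$, such that for any $(w_h,\boldsymbol{\chi}_h)\in\mathcal{S}_h$ $$\sup_{(v_h,\boldsymbol{\tau}_h)\in V_h\times\boldsymbol{\Sigma}_h}\frac{\operatorname{Re} B_h(w_h,\boldsymbol{\chi}_h;v_h,\boldsymbol{\tau}_h)}{\|(v_h,\boldsymbol{\tau}_h)\|_{DG}}+\sup_{(v_h,\boldsymbol{\tau}_h)\in V_h\times\boldsymbol{\Sigma}_h}\frac{\operatorname{Im} B_h(w_h,\boldsymbol{\chi}_h;v_h,\boldsymbol{\tau}_h)}{\|(v_h,\boldsymbol{\tau}_h)\|_{DG}}\ \ge\ \frac{c_2}{\gamma_2}\|(w_h,\boldsymbol{\chi}_h)\|_{DG}$$ (suprema over nonzero pairs), where $$\gamma_2:=k+\max_{e\in\mathcal{E}_h^I}\Bigl(\frac{k^2+1}{\beta h_e}+\frac{\beta+\delta}{h_e}+\frac{\delta}{h_e^3}+\frac{1}{\beta h_e^3}\Bigr),$$ $$\|(w_h,\boldsymbol{\chi}_h)\|_{DG}:=\Bigl(k^2\|w_h\|_{L^2(\Omega)}^2+k^2\|w_h\|_{L^2(\Gamma)}^2+\|\boldsymbol{\chi}_h\|_{L^2(\Omega)}^2+c_\Omega\|\nabla_h w_h\|_{L^2(\Gamma)}^2\Bigr)^{1/2}.$$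
   Context: Let $\Omega\subset\mathbb{R}^d$ ($d=2,3$) be a bounded domain with boundary $\Gamma=\partial\Omega$ and outward unit normal $\mathbf{n}_\Omega$, strictly star-shaped with respect to a point $x_\Omega\in\Omega$, i.e. there is $c_\Omega>0$ with $(x-x_\Omega)\cdot\mathbf{n}_\Omega\ge c_\Omega$ for all $x\in\partial\Omega$. $\mathcal{T}_h$ is a family of partitions of $\Omega$ into triangles/tetrahedra, parameterized by $h>0$ and satisfying the minimal angle condition; $h_K=\operatorname{diam}(K)$, $h=\max_{K}h_K$, $h_e=\operatorname{diam}(e)$ for an edge/face $e$; $\mathcal{E}_h^I$ is the set of interior edges/faces. $k>0$ is the wave number, and $\beta,\delta>0$ are given penalty parameters (possibly chosen depending on the mesh). All functions are complex-valued. $(u,v)_\Omega=\int_\Omega u\bar v\,dx$, $\langle u,v\rangle_e=\int_e u\bar v\,ds$, $\langle u,v\rangle_\Gamma=\int_\Gamma u\bar v\,ds$ (with dot products for vector functions); $\mathbf{i}=\sqrt{-1}$. $\nabla_h$ is the piecewise gradient, $\nabla_h|_K=\nabla|_K$ for $K\in\mathcal{T}_h$. On an interior edge/face $e$ shared by $K_1,K_2$ with outward unit normals $\mathbf{n}_1,\mathbf{n}_2$: $\{v\}=\frac12(v_1+v_2)$ and $[[v]]=v_1\mathbf{n}_1+v_2\mathbf{n}_2$ for scalar $v$; $\{\mathbf{v}\}=\frac12(\mathbf{v}_1+\mathbf{v}_2)$ and $[[\mathbf{v}]]=\mathbf{v}_1\cdot\mathbf{n}_1+\mathbf{v}_2\cdot\mathbf{n}_2$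 for vector $\mathbf{v}$. $V_h$ is the space of (discontinuous) functions in $L^2(\Omega)$ whose real and imaginary parts restricted to each $K\in\mathcal{T}_h$ are polynomials of degree $\le 1$; $\boldsymbol{\Sigma}_h$ is the space of vector fields in $(L^2(\Omega))^d$ whose real and imaginary parts restricted to each $K$ lie in $(P_1(K))^d$. The sesquilinear form is $$B_h(w_h,\boldsymbol{\chi}_h;v_h,\boldsymbol{\tau}_h)=(\boldsymbol{\chi}_h,\nabla_h v_h)_\Omega-k^2(w_h,v_h)_\Omega+\mathbf{i}k\langle w_h,v_h\rangle_\Gamma-\sum_{e\in\mathcal{E}_h^I}\langle\{\boldsymbol{\chi}_h\}-\mathbf{i}\beta[[w_h]],[[v_h]]\rangle_e$$ $$-\sum_{e\in\mathcal{E}_h^I}\Bigl(\mathbf{i}\delta\langle[[\boldsymbol{\chi}_h]],[[\boldsymbol{\tau}_h]]\rangle_e-\langle[[w_h]],\{\boldsymbol{\tau}_h\}\rangle_e\Bigr)+(\boldsymbol{\chi}_h,\boldsymbol{\tau}_h)_\Omega-(\nabla_h w_h,\boldsymbol{\tau}_h)_\Omega.$$ $\mathcal{S}_h$ is the set of all $(w_h,\boldsymbol{\chi}_h)\in V_h\times\boldsymbol{\Sigma}_h$ such that $$(\boldsymbol{\chi}_h,\boldsymbol{\tau}_h)_\Omega-(\nabla_h w_h,\boldsymbol{\tau}_h)_\Omega-\sum_{e\in\mathcal{E}_h^I}\Bigl(\mathbf{i}\delta\langle[[\boldsymbol{\chi}_h]],[[\boldsymbol{\tau}_h]]\rangle_e-\langle[[w_h]],\{\boldsymbol{\tau}_h\}\rangle_e\Bigr)=0\qquad\forall\boldsymbol{\tau}_h\in\boldsymbol{\Sigma}_h.$$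 *)

theory Defs
  imports "HOL-Analysis.Analysis"
begin

section \<open>The domain\<close>

text \<open>
  A domain that is partitioned into finitely many simplices is polyhedral, so its boundary is
  flat near every point that has a normal: there the domain is locally an open half-space.
  At the corners and edges of the boundary there is no \<open>n\<close> with this property.
\<close>

definition outward_normal_at :: "(real^'n) set \<Rightarrow> real^'n \<Rightarrow> real^'n \<Rightarrow> bool" where
  "outward_normal_at \<Omega> x n \<longleftrightarrow>
     x \<in> frontier \<Omega> \<and> norm n = 1 \<and>
     (\<exists>r>0. \<Omega> \<inter> ball x r = {y \<in> ball x r. n \<bullet> (y - x) < 0})"

text \<open>
  The last condition says that the domain lies on one side of its boundary (it has no slits),
  without which there is no outward normal on all of the boundary.
\<close>

definition bounded_domain :: "(real^'n) set \<Rightarrow> bool" where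
  "bounded_domain \<Omega> \<longleftrightarrow>
     open \<Omega> \<and> connected \<Omega> \<and> \<Omega> \<noteq> {} \<and> bounded \<Omega> \<and> interior (closure \<Omega>) = \<Omega>"

definition strictly_star_shaped :: "(real^'n) set \<Rightarrow> real^'n \<Rightarrow> real \<Rightarrow> bool" where
  "strictly_star_shaped \<Omega> x0 c \<longleftrightarrow>
     x0 \<in> \<Omega> \<and> c > 0 \<and> (\<forall>x n. outward_normal_at \<Omega> x n \<longrightarrow> (x - x0) \<bullet> n \<ge> c)"


section \<open>Meshes\<close>

text \<open>
  The library notion \<^const>\<open>triangulation\<close> contains finiteness and conformity: any two
  elements meet in a common (possibly empty) face.
\<close>

definition simplicial_partition :: "(real^'n) set \<Rightarrow> (real^'n) set set \<Rightarrow> bool" where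
  "simplicial_partition \<Omega> T \<longleftrightarrow>
     triangulation T \<and> (\<forall>K\<in>T. int CARD('n) simplex K) \<and> \<Union>T = closure \<Omega>"

definition outward_normal :: "(real^'n) set \<Rightarrow> (real^'n) set \<Rightarrow> real^'n" where
  "outward_normal K e = (THE n. norm n = 1 \<and> (\<forall>x\<in>K. \<forall>y\<in>e. n \<bullet> (x - y) \<le> 0))"

definition vec_angle :: "real^'n \<Rightarrow> real^'n \<Rightarrow> real" where
  "vec_angle u v = arccos (u \<bullet> v / (norm u * norm v))"

text \<open>
  All angles of the simplex \<open>K\<close> are at least \<open>\<theta>\<close>: the plane angles of its triangles and
  the interior angles between two of its facets. For a triangle both are the three usual
  angles; for a tetrahedron they are the face angles and the dihedral angles.
\<close>

definition angles_at_least :: "real \<Rightarrow> (real^'n) set \<Rightarrow> bool" where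
  "angles_at_least \<theta> K \<longleftrightarrow>
     (\<forall>a b c. a extreme_point_of K \<and> b extreme_point_of K \<and> c extreme_point_of K \<and>
        a \<noteq> b \<and> b \<noteq> c \<and> a \<noteq> c \<longrightarrow> \<theta> \<le> vec_angle (b - a) (c - a)) \<and>
     (\<forall>e f. e facet_of K \<and> f facet_of K \<and> e \<noteq> f \<longrightarrow>
        \<theta> \<le> pi - vec_angle (outward_normal K e) (outward_normal K f))"

definition mesh_size :: "(real^'n) set set \<Rightarrow> real" where
  "mesh_size T = Max (diameter ` T)"

definition mesh_family :: "(real^'n) set \<Rightarrow> real set \<Rightarrow> (real \<Rightarrow> (real^'n) set set) \<Rightarrow> bool" where
  "mesh_family \<Omega> H Th \<longleftrightarrow>
     (\<forall>h\<in>H. h > 0 \<and> simplicial_partition \<Omega> (Th h) \<and> mesh_size (Th h) = h) \<and>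
     (\<exists>\<theta>>0. \<forall>h\<in>H. \<forall>K\<in>Th h. angles_at_least \<theta> K)"

definition interior_faces :: "(real^'n) set set \<Rightarrow> (real^'n) set set" where
  "interior_faces T =
     {e. \<exists>K1\<in>T. \<exists>K2\<in>T. K1 \<noteq> K2 \<and> e = K1 \<inter> K2 \<and> e facet_of K1 \<and> e facet_of K2}"

text \<open>A boundary face is recorded together with the unique element it belongs to.\<close>

definition boundary_faces ::
    "(real^'n) set \<Rightarrow> (real^'n) set set \<Rightarrow> ((real^'n) set \<times> (real^'n) set) set" where
  "boundary_faces \<Omega> T = {(K, e). K \<in> T \<and> e facet_of K \<and> e \<subseteq> frontier \<Omega>}"


section \<open>Surface integrals\<close>

definition face_normal :: "(real^'n) set \<Rightarrow> real^'n" where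
  "face_normal e = (SOME n. norm n = 1 \<and> (\<forall>x\<in>e. \<forall>y\<in>e. n \<bullet> (x - y) = 0))"

text \<open>
  The surface integral of \<open>f\<close> over the \<open>(d-1)\<close>-dimensional polytope \<open>e\<close>. By Fubini it is the
  Lebesgue integral over the right prism of height one with mid-section \<open>e\<close> of the function that
  equals \<open>f\<close> on \<open>e\<close> and is constant in the normal direction. The choices of the sign of the
  normal and of the base point do not influence the integrand.
\<close>

definition face_integral ::
    "(real^'n) set \<Rightarrow> (real^'n \<Rightarrow> 'b) \<Rightarrow> 'b::{banach, second_countable_topology}" where
  "face_integral e f =
     (let n = face_normal e; p = (SOME p. p \<in> e)
      in LINT x:{y + t *\<^sub>R n | y t. y \<in> e \<and> -1/2 \<le> t \<and> t \<le> 1/2}|lebesgue.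
           f (x - ((x - p) \<bullet> n) *\<^sub>R n))"


section \<open>Discrete spaces\<close>

definition dotc :: "complex^'n \<Rightarrow> complex^'n \<Rightarrow> complex" where
  "dotc u v = (\<Sum>i\<in>UNIV. u $ i * cnj (v $ i))"

definition cvec :: "real^'n \<Rightarrow> complex^'n" where
  "cvec n = (\<chi> i. complex_of_real (n $ i))"

definition L2 :: "(real^'n) set \<Rightarrow> (real^'n \<Rightarrow> 'b::euclidean_space) \<Rightarrow> bool" where
  "L2 \<Omega> f \<longleftrightarrow> f \<in> borel_measurable (lebesgue_on \<Omega>) \<and>
     integrable (lebesgue_on \<Omega>) (\<lambda>x. (norm (f x))\<^sup>2)"

definition P1_on :: "(real^'n) set \<Rightarrow> (real^'n \<Rightarrow> real) \<Rightarrow> bool" where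
  "P1_on K f \<longleftrightarrow> (\<exists>a b. \<forall>x\<in>K. f x = a \<bullet> x + b)"

text \<open>
  The elements of the discrete spaces are classes of functions modulo null sets. They are
  represented by functions that are affine on the interior of each element; the values on
  the boundaries of the elements are irrelevant. Traces on faces are one-sided limits.
\<close>

definition V_h :: "(real^'n) set \<Rightarrow> (real^'n) set set \<Rightarrow> (real^'n \<Rightarrow> complex) set" where
  "V_h \<Omega> T = {v. L2 \<Omega> v \<and>
     (\<forall>K\<in>T. P1_on (interior K) (\<lambda>x. Re (v x)) \<and> P1_on (interior K) (\<lambda>x. Im (v x)))}"

definition Sigma_h :: "(real^'n) set \<Rightarrow> (real^'n) set set \<Rightarrow> (real^'n \<Rightarrow> complex^'n) set" where
  "Sigma_h \<Omega> T = {\<tau>. L2 \<Omega> \<tau> \<and>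
     (\<forall>K\<in>T. \<forall>i. P1_on (interior K) (\<lambda>x. Re (\<tau> x $ i)) \<and> P1_on (interior K) (\<lambda>x. Im (\<tau> x $ i)))}"

definition nonzero_pairs ::
    "(real^'n) set \<Rightarrow> (real^'n) set set \<Rightarrow> ((real^'n \<Rightarrow> complex) \<times> (real^'n \<Rightarrow> complex^'n)) set" where
  "nonzero_pairs \<Omega> T =
     {(v, \<tau>) \<in> V_h \<Omega> T \<times> Sigma_h \<Omega> T. \<not> (AE x in lebesgue_on \<Omega>. v x = 0 \<and> \<tau> x = 0)}"

definition trace_on :: "(real^'n) set \<Rightarrow> (real^'n \<Rightarrow> 'b::t2_space) \<Rightarrow> real^'n \<Rightarrow> 'b" where
  "trace_on K v x = Lim (at x within interior K) v"

definition grad :: "(real^'n \<Rightarrow> complex) \<Rightarrow> real^'n \<Rightarrow> complex^'n" where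
  "grad v x = (\<chi> i. frechet_derivative v (at x) (axis i 1))"

definition grad_h :: "(real^'n) set set \<Rightarrow> (real^'n \<Rightarrow> complex) \<Rightarrow> real^'n \<Rightarrow> complex^'n" where
  "grad_h T v x = (if \<exists>K\<in>T. x \<in> interior K then grad v x else 0)"


section \<open>Averages and jumps\<close>

text \<open>On an interior face the sums below have exactly two terms, one for each adjacent element.\<close>

definition adjacent :: "(real^'n) set set \<Rightarrow> (real^'n) set \<Rightarrow> (real^'n) set set" where
  "adjacent T e = {K \<in> T. e facet_of K}"

definition avg ::
    "(real^'n) set set \<Rightarrow> (real^'n) set \<Rightarrow> (real^'n \<Rightarrow> complex^'n) \<Rightarrow> real^'n \<Rightarrow> complex^'n" where
  "avg T e \<tau> x = (1/2) *\<^sub>R (\<Sum>K\<in>adjacent T e. trace_on K \<tau> x)"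

definition jump ::
    "(real^'n) set set \<Rightarrow> (real^'n) set \<Rightarrow> (real^'n \<Rightarrow> complex) \<Rightarrow> real^'n \<Rightarrow> complex^'n" where
  "jump T e v x = (\<Sum>K\<in>adjacent T e. trace_on K v x *s cvec (outward_normal K e))"

definition jump_vec ::
    "(real^'n) set set \<Rightarrow> (real^'n) set \<Rightarrow> (real^'n \<Rightarrow> complex^'n) \<Rightarrow> real^'n \<Rightarrow> complex" where
  "jump_vec T e \<tau> x = (\<Sum>K\<in>adjacent T e. dotc (trace_on K \<tau> x) (cvec (outward_normal K e)))"


section \<open>Inner products, forms and norms\<close>

definition ip :: "(real^'n) set \<Rightarrow> (real^'n \<Rightarrow> complex) \<Rightarrow> (real^'n \<Rightarrow> complex) \<Rightarrow> complex" where
  "ip \<Omega> u v = (LINT x:\<Omega>|lebesgue. u x * cnj (v x))"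

definition ip_vec ::
    "(real^'n) set \<Rightarrow> (real^'n \<Rightarrow> complex^'n) \<Rightarrow> (real^'n \<Rightarrow> complex^'n) \<Rightarrow> complex" where
  "ip_vec \<Omega> u v = (LINT x:\<Omega>|lebesgue. dotc (u x) (v x))"

definition ip_face :: "(real^'n) set \<Rightarrow> (real^'n \<Rightarrow> complex) \<Rightarrow> (real^'n \<Rightarrow> complex) \<Rightarrow> complex" where
  "ip_face e u v = face_integral e (\<lambda>x. u x * cnj (v x))"

definition ip_face_vec ::
    "(real^'n) set \<Rightarrow> (real^'n \<Rightarrow> complex^'n) \<Rightarrow> (real^'n \<Rightarrow> complex^'n) \<Rightarrow> complex" where
  "ip_face_vec e u v = face_integral e (\<lambda>x. dotc (u x) (v x))"

definition ip_bdry ::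
    "(real^'n) set \<Rightarrow> (real^'n) set set \<Rightarrow> (real^'n \<Rightarrow> complex) \<Rightarrow> (real^'n \<Rightarrow> complex) \<Rightarrow> complex" where
  "ip_bdry \<Omega> T u v = (\<Sum>(K, e)\<in>boundary_faces \<Omega> T. ip_face e (trace_on K u) (trace_on K v))"

definition norm_sq :: "(real^'n) set \<Rightarrow> (real^'n \<Rightarrow> 'b::real_normed_vector) \<Rightarrow> real" where
  "norm_sq \<Omega> f = (LINT x:\<Omega>|lebesgue. (norm (f x))\<^sup>2)"

definition norm_sq_bdry ::
    "(real^'n) set \<Rightarrow> (real^'n) set set \<Rightarrow> (real^'n \<Rightarrow> 'b::real_normed_vector) \<Rightarrow> real" where
  "norm_sq_bdry \<Omega> T f =
     (\<Sum>(K, e)\<in>boundary_faces \<Omega> T. face_integral e (\<lambda>x. (norm (trace_on K f x))\<^sup>2))"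

definition B_h ::
    "(real^'n) set \<Rightarrow> (real^'n) set set \<Rightarrow> real \<Rightarrow> real \<Rightarrow> real \<Rightarrow>
     (real^'n \<Rightarrow> complex) \<Rightarrow> (real^'n \<Rightarrow> complex^'n) \<Rightarrow>
     (real^'n \<Rightarrow> complex) \<Rightarrow> (real^'n \<Rightarrow> complex^'n) \<Rightarrow> complex" where
  "B_h \<Omega> T k \<beta> \<delta> w \<sigma> v \<tau> =
     ip_vec \<Omega> \<sigma> (grad_h T v) - complex_of_real (k\<^sup>2) * ip \<Omega> w v
     + \<i> * complex_of_real k * ip_bdry \<Omega> T w v
     - (\<Sum>e\<in>interior_faces T.
          ip_face_vec e (\<lambda>x. avg T e \<sigma> x - (\<i> * complex_of_real \<beta>) *s jump T e w x) (jump T e v))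
     - (\<Sum>e\<in>interior_faces T.
          \<i> * complex_of_real \<delta> * ip_face e (jump_vec T e \<sigma>) (jump_vec T e \<tau>)
          - ip_face_vec e (jump T e w) (avg T e \<tau>))
     + ip_vec \<Omega> \<sigma> \<tau> - ip_vec \<Omega> (grad_h T w) \<tau>"

definition S_h ::
    "(real^'n) set \<Rightarrow> (real^'n) set set \<Rightarrow> real \<Rightarrow>
     ((real^'n \<Rightarrow> complex) \<times> (real^'n \<Rightarrow> complex^'n)) set" where
  "S_h \<Omega> T \<delta> = {(w, \<sigma>) \<in> V_h \<Omega> T \<times> Sigma_h \<Omega> T. \<forall>\<tau>\<in>Sigma_h \<Omega> T.
     ip_vec \<Omega> \<sigma> \<tau> - ip_vec \<Omega> (grad_h T w) \<tau>
     - (\<Sum>e\<in>interior_faces T.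
          \<i> * complex_of_real \<delta> * ip_face e (jump_vec T e \<sigma>) (jump_vec T e \<tau>)
          - ip_face_vec e (jump T e w) (avg T e \<tau>)) = 0}"

definition norm_DG ::
    "(real^'n) set \<Rightarrow> (real^'n) set set \<Rightarrow> real \<Rightarrow> real \<Rightarrow>
     (real^'n \<Rightarrow> complex) \<Rightarrow> (real^'n \<Rightarrow> complex^'n) \<Rightarrow> real" where
  "norm_DG \<Omega> T c k w \<sigma> =
     sqrt (k\<^sup>2 * norm_sq \<Omega> w + k\<^sup>2 * norm_sq_bdry \<Omega> T w + norm_sq \<Omega> \<sigma>
           + c * norm_sq_bdry \<Omega> T (grad_h T w))"

definition gamma2 :: "(real^'n) set set \<Rightarrow> real \<Rightarrow> real \<Rightarrow> real \<Rightarrow> real" where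
  "gamma2 T k \<beta> \<delta> =
     k + Max ((\<lambda>e. (k\<^sup>2 + 1) / (\<beta> * diameter e) + (\<beta> + \<delta>) / diameter e
                   + \<delta> / diameter e ^ 3 + 1 / (\<beta> * diameter e ^ 3)) ` interior_faces T)"

end

theory Submission
  imports Defs
begin

text \<open>Test the form with \<open>v = w\<close>: the real part is \<open>|\<sigma>|\<^sup>2 - k\<^sup>2 |w|\<^sup>2\<close>, and the imaginary part controls
  \<open>k |w|\<^sup>2\<close> on the boundary and the penalised jumps. To control \<open>k\<^sup>2 |w|\<^sup>2\<close>, use Rellich's multiplier
  \<open>v = (x - x0) \<bullet> \<nabla>w\<close>, which is again piecewise affine. The divergence theorem on each simplex turns
  the real part of the form into \<open>d k\<^sup>2 |w|\<^sup>2\<close> and boundary terms, where star-shapedness gives the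
  square of the boundary gradient with a favourable sign. On interior faces the gradient terms reduce to
  the tangential jump of \<open>\<nabla>w\<close>, bounded by the jump of \<open>w\<close> over \<open>h\<close> (inverse inequality), and the
  defect \<open>\<sigma> - \<nabla>w\<close>. The equation defining \<open>S_h\<close>, tested with the defect itself, bounds the defect by
  the jumps over powers of \<open>h\<close>, and these jumps are controlled by the imaginary part of the
  first test.\<close>

section \<open>Integration on hyperplane pieces\<close>

text \<open>Both tests give quadratic bounds, whereas the suprema divide by a norm; homogeneity
  closes the gap. With \<open>N\<close> the norm of \<open>(w, \<sigma>)\<close>, the test with
  \<open>w\<close> has a denominator of order \<open>N\<close> and the multiplier one of order
  \<open>gamma2\<close> times \<open>N\<close>, since its L2 norm is weighted by \<open>k\<close>.
  As \<tau> is free, it is set to a constant of norm \<open>N\<close>, which keeps every denominator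
  positive without spoiling these orders. Rellich's identity leaves the coefficient
  \<open>1 - d/2\<close> in front of \<open>|\<nabla>w|^2\<close>, negative for
  \<open>d = 3\<close>. Writing \<open>|\<nabla>w|^2\<close> as \<open>|\<sigma>|^2\<close> up to
  the defect, and \<open>|\<sigma>|^2 - k^2 |w|^2\<close> as the real part of the first test, leaves
  \<open>k^2 |w|^2\<close> with coefficient one. The angle condition enters through one number:
  heights of elements with an interior face are at least a fixed multiple of the smallest diameter
  of an interior face, and the maximum in \<open>gamma2\<close>, taken at that face, bounds all
  powers of its inverse. The volume integrals to be evaluated have integrands quadratic along rays
  from a vertex, so the moments \<open>1/d\<close>, \<open>1/(d+1)\<close>, \<open>1/(d+2)\<close>
  of a cone suffice.\<close>

lemma det_scaled_identity_plus_rank1: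
  fixes n a :: "real^'n"
  assumes "norm n = 1" "t \<noteq> 0"
  shows "det (matrix (\<lambda>u. t *\<^sub>R u + (n \<bullet> u) *\<^sub>R a)) = t ^ (CARD('n) - 1) * (t + n \<bullet> a)"
proof -
  obtain k :: 'n where True by simp
  \<comment> \<open>After rotating \<open>n\<close> onto a coordinate axis, the rank one term alters
    only column \<open>k\<close> of \<open>t\<close> times the identity.\<close>
  obtain f where f: "orthogonal_transformation f" "f n = axis k (1::real)"
    using orthogonal_transformation_exists[of n "axis k 1"] assms by (auto simp: norm_axis_1)
  have lf: "linear f" using f(1) by (simp add: orthogonal_transformation)
  define g where "g = (\<lambda>u. t *\<^sub>R u + (n \<bullet> u) *\<^sub>R a)"
  define g' where "g' = (\<lambda>u. t *\<^sub>R u + (axis k 1 \<bullet> u) *\<^sub>R f a)"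
  have lg: "linear g" "linear g'"
    unfolding g_def g'_def by (auto intro!: linearI simp: algebra_simps inner_add_right)
  have comm: "f \<circ> g = g' \<circ> f"
  proof
    fix u
    have "n \<bullet> u = axis k 1 \<bullet> f u"
      using f by (metis orthogonal_transformation_def)
    then show "(f \<circ> g) u = (g' \<circ> f) u"
      unfolding g_def g'_def comp_def
      by (simp add: linear_add[OF lf] linear_scale[OF lf])
  qed
  have "matrix f ** matrix g = matrix g' ** matrix f"
    using comm by (metis lf lg matrix_compose)
  then have "det (matrix f) * det (matrix g) = det (matrix g') * det (matrix f)"
    by (metis det_mul)
  moreover have "det (matrix f) \<noteq> 0"
    using orthogonal_transformation_det[OF f(1)] by force
  ultimately have 1: "det (matrix g) = det (matrix g')" by simp
  \<comment> \<open>\<open>x\<close> solves the linear system with matrix \<open>mat t\<close> whose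
    right-hand side is the altered column, so Cramer's rule returns the determinant as
    \<open>x $ k\<close> times \<open>t ^ CARD('n)\<close>.\<close>
  define x where "x = (1/t) *\<^sub>R (t *\<^sub>R axis k 1 + f a)"
  have "mat t *v x = t *\<^sub>R x"
    by (auto simp: vec_eq_iff mat_def matrix_vector_mult_def if_distrib[of "\<lambda>c. c * _"] sum.delta cong: if_cong)
  then have "mat t *v x = t *\<^sub>R axis k 1 + f a"
    using assms(2) unfolding x_def by simp
  then have "matrix g' = (\<chi> i j. if j = k then (mat t *v x)$i else (mat t :: real^'n^'n)$i$j)"
    unfolding g'_def by (auto simp: vec_eq_iff matrix_def mat_def inner_axis_axis) (auto simp: axis_def)
  then have "det (matrix g') = x $ k * det (mat t :: real^'n^'n)"
    by (simp add: cramer_lemma)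
  also have "det (mat t :: real^'n^'n) = t ^ CARD('n)"
    by (subst det_diagonal) (auto simp: mat_def)
  also have "x $ k = (t + f a $ k) / t" unfolding x_def using assms(2) by (simp add: field_simps)
  also have "f a $ k = n \<bullet> a"
    using f by (metis orthogonal_transformation_def inner_axis' mult_1 inner_real_def)
  also have "(t + n \<bullet> a) / t * t ^ CARD('n) = t ^ (CARD('n) - 1) * (t + n \<bullet> a)"
    using assms(2) by (simp add: power_eq_if)
  finally show ?thesis using 1 unfolding g_def by simp
qed

section \<open>Renaming coordinates and the change of variables theorem\<close>

definition reindex :: "('m \<Rightarrow> 'n) \<Rightarrow> real^'n \<Rightarrow> real^'m" where
  "reindex \<phi> x = (\<chi> i. x $ \<phi> i)"

lemma linear_reindex: "linear (reindex \<phi>)"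
  by (intro linearI) (auto simp: reindex_def vec_eq_iff)

lemma reindex_inner:
  assumes "bij \<phi>"
  shows "reindex \<phi> x \<bullet> reindex \<phi> y = x \<bullet> y"
  unfolding inner_vec_def reindex_def using assms by (simp add: sum.reindex_bij_betw[of \<phi> UNIV UNIV "\<lambda>i. x $ i * y $ i"])

lemma reindex_inverse:
  assumes "bij \<phi>"
  shows "reindex \<phi> (reindex (inv \<phi>) x) = x" "reindex (inv \<phi>) (reindex \<phi> y) = y"
  using assms by (auto simp: reindex_def vec_eq_iff bij_is_inj bij_is_surj surj_f_inv_f)

lemma continuous_reindex: "continuous_on S (reindex \<phi>)"
  by (simp add: linear_continuous_on linear_conv_bounded_linear[symmetric] linear_reindex)

lemma borel_measurable_reindex [measurable]: "reindex \<phi> \<in> borel \<rightarrow>\<^sub>M borel"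
  by (rule borel_measurable_continuous_onI[OF continuous_reindex])

text \<open>Boxes go to boxes with the same side lengths in another order, and these volumes
  determine \<open>lborel\<close>.\<close>

lemma lborel_reindex:
  fixes \<phi> :: "'m::finite \<Rightarrow> 'n::finite"
  assumes "bij \<phi>"
  shows "distr lborel lborel (reindex \<phi>) = lborel"
proof (rule lborel_eqI[symmetric])
  fix l u :: "real^'m" assume le: "\<And>b. b \<in> Basis \<Longrightarrow> l \<bullet> b \<le> u \<bullet> b"
  have eq: "reindex \<phi> -` box l u = box (reindex (inv \<phi>) l) (reindex (inv \<phi>) u)"
    using assms by (auto simp: mem_box_cart reindex_def) (metis bij_inv_eq_iff)+
  have le': "l $ i \<le> u $ i" for i using le[OF axis_in_Basis_iff[THEN iffD2], of 1 i] by (simp add: inner_axis)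
  have "emeasure (distr lborel lborel (reindex \<phi>)) (box l u) = emeasure lborel (box (reindex (inv \<phi>) l) (reindex (inv \<phi>) u))"
    by (subst emeasure_distr) (auto simp: eq)
  also have "\<dots> = (\<Prod>b\<in>Basis. (reindex (inv \<phi>) u - reindex (inv \<phi>) l) \<bullet> b)"
    using le' by (intro emeasure_lborel_box) (auto simp: Basis_vec_def inner_axis reindex_def)
  also have "(\<Prod>b\<in>Basis. (reindex (inv \<phi>) u - reindex (inv \<phi>) l) \<bullet> b) = (\<Prod>i\<in>UNIV. u $ inv \<phi> i - l $ inv \<phi> i)"
    by (simp add: Basis_vec_def UNION_singleton_eq_range prod.reindex inj_on_def axis_eq_axis inner_axis reindex_def)
  also have "\<dots> = (\<Prod>i\<in>UNIV. u $ i - l $ i)"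
    by (rule prod.reindex_bij_betw[OF bij_imp_bij_inv[OF assms]])
  also have "\<dots> = (\<Prod>b\<in>Basis. (u - l) \<bullet> b)"
    by (simp add: Basis_vec_def UNION_singleton_eq_range prod.reindex inj_on_def axis_eq_axis inner_axis reindex_def)
  finally show "emeasure (distr lborel lborel (reindex \<phi>)) (box l u) = (\<Prod>b\<in>Basis. (u - l) \<bullet> b)" .
qed simp

lemma integral_reindex:
  fixes \<phi> :: "'m::finite \<Rightarrow> 'n::finite" and F :: "real^'m \<Rightarrow> real"
  assumes "bij \<phi>" "F \<in> borel_measurable borel"
  shows "(LINT x|lborel. F (reindex \<phi> x)) = (LINT x|lborel. F x)"
    and "integrable lborel (\<lambda>x. F (reindex \<phi> x)) = integrable lborel F"
proof -
  have m: "reindex \<phi> \<in> lborel \<rightarrow>\<^sub>M lborel" by simp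
  show "(LINT x|lborel. F (reindex \<phi> x)) = (LINT x|lborel. F x)"
    using integral_distr[OF m, of F] assms by (simp add: lborel_reindex)
  show "integrable lborel (\<lambda>x. F (reindex \<phi> x)) = integrable lborel F"
    using integrable_distr_eq[OF m, of F] assms by (simp add: lborel_reindex)
qed

text \<open>Bridge between the Bochner integrals over \<open>lborel\<close> used for prisms and
  cones and the gauge integrals in which \<open>has_absolute_integral_change_of_variables\<close> is
  stated.\<close>

lemma integral_lebesgue_eq_lborel:
  fixes f :: "'a::euclidean_space \<Rightarrow> real"
  assumes "set_integrable lborel S f"
  shows "f absolutely_integrable_on S" "integral S f = (LINT x:S|lborel. f x)"
proof -
  have m: "(\<lambda>x. indicat_real S x *\<^sub>R f x) \<in> lborel \<rightarrow>\<^sub>M borel"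
    using assms borel_measurable_integrable unfolding set_integrable_def by blast
  show 1: "f absolutely_integrable_on S"
    using assms integrable_completion[OF m] unfolding set_integrable_def by simp
  show "integral S f = (LINT x:S|lborel. f x)"
    using set_lebesgue_integral_eq_integral(2)[OF 1] integral_completion[OF m]
    by (simp add: set_lebesgue_integral_def)
qed

text \<open>The maps to be used have derivatives that are rank one perturbations of a multiple of
  the identity, so \<open>det_scaled_identity_plus_rank1\<close> evaluates the Jacobian. Functions
  pass through \<open>real^1\<close> to fit the vector-valued theorem.\<close>

lemma change_of_variables_rank1_wellorder:
  fixes g a :: "real^'m::{finite,wellorder} \<Rightarrow> real^'m::_" and f t :: "real^'m::_ \<Rightarrow> real"
  assumes S: "S \<in> sets borel"
    and der: "\<And>x. x \<in> S \<Longrightarrow> (g has_derivative (\<lambda>u. t x *\<^sub>R u + (n \<bullet> u) *\<^sub>R a x)) (at x within S)"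
    and inj: "inj_on g S" and t: "\<And>x. x \<in> S \<Longrightarrow> t x \<noteq> 0" and n: "norm n = 1"
    and f: "set_integrable lborel (g ` S) f"
    and D: "set_borel_measurable lborel S (\<lambda>x. \<bar>t x ^ (CARD('m) - 1) * (t x + n \<bullet> a x)\<bar> * f (g x))"
  shows "(LINT x:S|lborel. \<bar>t x ^ (CARD('m) - 1) * (t x + n \<bullet> a x)\<bar> * f (g x)) = (LINT x:g ` S|lborel. f x)"
proof -
  let ?D = "\<lambda>x. \<bar>t x ^ (CARD('m) - 1) * (t x + n \<bullet> a x)\<bar> * f (g x)"
  let ?f = "\<lambda>x. vec (f x) :: real^1"
  let ?D' = "\<lambda>x. \<bar>det (matrix (\<lambda>u. t x *\<^sub>R u + (n \<bullet> u) *\<^sub>R a x))\<bar> *\<^sub>R ?f (g x)"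
  have "?f absolutely_integrable_on (g ` S) \<and> integral (g ` S) ?f = vec (integral (g ` S) f)"
    using integral_lebesgue_eq_lborel(1)[OF f] by (simp add: absolutely_integrable_on_1_iff integral_on_1_eq)
  then have "?D' absolutely_integrable_on S \<and> integral S ?D' = vec (integral (g ` S) f)"
    using has_absolute_integral_change_of_variables[OF _ der inj, of ?f "vec (integral (g ` S) f)"] S by simp
  moreover have eq: "?D' x $ 1 = ?D x" if "x \<in> S" for x
    using det_scaled_identity_plus_rank1[OF n t[OF that], of "a x"] by simp
  ultimately have 1: "(\<lambda>x. ?D' x $ 1) absolutely_integrable_on S" "integral S (\<lambda>x. ?D' x $ 1) = integral (g ` S) f"
    by (auto simp: absolutely_integrable_on_1_iff integral_on_1_eq vec_eq_iff)
  have "?D absolutely_integrable_on S \<longleftrightarrow> (\<lambda>x. ?D' x $ 1) absolutely_integrable_on S"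
    by (rule set_integrable_cong[OF refl refl eq[symmetric]])
  moreover have "integral S ?D = integral S (\<lambda>x. ?D' x $ 1)"
    by (rule Henstock_Kurzweil_Integration.integral_cong[OF eq[symmetric]])
  ultimately have 2: "?D absolutely_integrable_on S" "integral S ?D = integral (g ` S) f"
    using 1 by auto
  \<comment> \<open>The measurability in \<open>D\<close> carries integrability back from the
    completed measure to \<open>lborel\<close>.\<close>
  have "set_integrable lborel S ?D"
    using 2(1) D integrable_completion unfolding set_integrable_def set_borel_measurable_def by blast
  from integral_lebesgue_eq_lborel(2)[OF this] integral_lebesgue_eq_lborel(2)[OF f] 2(2)
  show ?thesis by (simp only:)
qed

text \<open>Conjugation by the isometry \<open>R\<close> keeps the shape of the derivative:
  \<open>n\<close> and \<open>a\<close> are replaced by their images and inner products do not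
  change. The type \<open>'m\<close> occurs only in \<open>card\<close>; it is a well-ordered
  stand-in for \<open>'n\<close>.\<close>

lemma change_of_variables_rank1_aux:
  fixes g a :: "real^'n \<Rightarrow> real^'n" and f t :: "real^'n \<Rightarrow> real"
  assumes card: "CARD('m::{finite,wellorder}) = CARD('n)"
    and S: "S \<in> sets borel" and gS: "g ` S \<in> sets borel"
    and der: "\<And>x. x \<in> S \<Longrightarrow> (g has_derivative (\<lambda>u. t x *\<^sub>R u + (n \<bullet> u) *\<^sub>R a x)) (at x within S)"
    and inj: "inj_on g S" and t: "\<And>x. x \<in> S \<Longrightarrow> t x \<noteq> 0" and n: "norm n = 1"
    and f: "set_integrable lborel (g ` S) f"
    and D: "set_borel_measurable lborel S (\<lambda>x. \<bar>t x ^ (CARD('n) - 1) * (t x + n \<bullet> a x)\<bar> * f (g x))"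
  shows "(LINT x:S|lborel. \<bar>t x ^ (CARD('n) - 1) * (t x + n \<bullet> a x)\<bar> * f (g x)) = (LINT x:g ` S|lborel. f x)"
proof -
  obtain \<phi> :: "'m::_ \<Rightarrow> 'n" where \<phi>: "bij \<phi>"
    using card finite_same_card_bij[of "UNIV::'m set" "UNIV::'n set"] by auto
  have i\<phi>: "bij (inv \<phi>)" using \<phi> by (rule bij_imp_bij_inv)
  define R where "R = (reindex \<phi> :: real^'n \<Rightarrow> real^'m::_)"
  define Q where "Q = (reindex (inv \<phi>) :: real^'m::_ \<Rightarrow> real^'n)"
  have RQ [simp]: "R (Q x) = x" "Q (R y) = y" for x y
    unfolding R_def Q_def using reindex_inverse[OF \<phi>] by auto
  have lin: "linear R" "linear Q" unfolding R_def Q_def by (rule linear_reindex)+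
  have inner: "R x \<bullet> R y = x \<bullet> y" for x y unfolding R_def by (rule reindex_inner[OF \<phi>])
  have imR: "R ` X = Q -` X" for X using RQ by (metis (no_types, lifting) image_eqI subsetI subset_antisym vimage_eq image_subset_iff)
  define g' where "g' = R \<circ> g \<circ> Q"
  have gim: "g' ` (R ` S) = R ` (g ` S)" unfolding g'_def by (simp add: image_comp comp_def)
  have ind: "indicat_real (R ` X) x = indicator X (Q x)" for X x
    unfolding imR by (simp add: indicator_def)
  have Qm [measurable]: "Q \<in> borel \<rightarrow>\<^sub>M borel" unfolding Q_def by simp
  let ?D = "\<lambda>x. \<bar>t x ^ (CARD('n) - 1) * (t x + n \<bullet> a x)\<bar> * f (g x)"
  let ?D' = "\<lambda>x. \<bar>t (Q x) ^ (CARD('m) - 1) * (t (Q x) + R n \<bullet> R (a (Q x)))\<bar> * f (Q (g' x))"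
  have D': "?D' x = ?D (Q x)" for x unfolding g'_def by (simp add: inner card)
  have fm: "(\<lambda>x. indicat_real (g ` S) x *\<^sub>R f x) \<in> borel_measurable borel"
    using f borel_measurable_integrable unfolding set_integrable_def by force
  have Dm: "(\<lambda>x. indicat_real S x *\<^sub>R ?D x) \<in> borel_measurable borel"
    using D unfolding set_borel_measurable_def by simp
  have "(LINT x:R ` S|lborel. ?D' x) = (LINT x:g' ` (R ` S)|lborel. (f \<circ> Q) x)"
    unfolding comp_def
  proof (rule change_of_variables_rank1_wellorder)
    show "R ` S \<in> sets borel" unfolding imR using measurable_sets[OF Qm S] by simp
    show "inj_on g' (R ` S)"
      using inj unfolding inj_on_def g'_def by (auto) (metis RQ(2))
    show "norm (R n) = 1" using n inner[of n n] by (simp add: norm_eq_sqrt_inner)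
    show "set_integrable lborel (g' ` R ` S) (\<lambda>x. f (Q x))"
      unfolding gim set_integrable_def ind
      using integral_reindex(2)[OF i\<phi> fm] f unfolding Q_def set_integrable_def by simp
    show "set_borel_measurable lborel (R ` S) ?D'"
      unfolding set_borel_measurable_def ind D' using measurable_compose[OF Qm Dm] by simp
  next
    fix x assume "x \<in> R ` S"
    then have x: "Q x \<in> S" by auto
    show "t (Q x) \<noteq> 0" using t x by auto
    have QS: "Q ` (R ` S) = S" by (simp add: image_comp comp_def)
    have dQ: "(Q has_derivative Q) (at x within R ` S)" and dR: "(R has_derivative R) (at y within Y)" for y Y
      using lin by (auto intro!: bounded_linear_imp_has_derivative simp: linear_conv_bounded_linear)
    have "(g has_derivative (\<lambda>u. t (Q x) *\<^sub>R u + (n \<bullet> u) *\<^sub>R a (Q x))) (at (Q x) within Q ` (R ` S))"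
      unfolding QS by (rule der[OF x])
    from has_derivative_in_compose[OF dQ this]
    have "((\<lambda>x. R (g (Q x))) has_derivative (\<lambda>u. R (t (Q x) *\<^sub>R Q u + (n \<bullet> Q u) *\<^sub>R a (Q x)))) (at x within R ` S)"
      by (rule has_derivative_compose[OF _ dR])
    moreover have "R (t (Q x) *\<^sub>R Q u + (n \<bullet> Q u) *\<^sub>R a (Q x)) = t (Q x) *\<^sub>R u + (R n \<bullet> u) *\<^sub>R R (a (Q x))" for u
    proof -
      have "R (t (Q x) *\<^sub>R Q u + (n \<bullet> Q u) *\<^sub>R a (Q x)) = t (Q x) *\<^sub>R R (Q u) + (n \<bullet> Q u) *\<^sub>R R (a (Q x))"
        unfolding linear_add[OF lin(1)] linear_scale[OF lin(1)] ..
      moreover have "n \<bullet> Q u = R n \<bullet> R (Q u)"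
        by (rule inner[symmetric])
      ultimately show ?thesis unfolding RQ(1) by (simp only:)
    qed
    ultimately show "(g' has_derivative (\<lambda>u. t (Q x) *\<^sub>R u + (R n \<bullet> u) *\<^sub>R R (a (Q x)))) (at x within R ` S)"
      unfolding g'_def comp_def by simp
  qed
  moreover have "(LINT x:R ` S|lborel. ?D' x) = (LINT x:S|lborel. ?D x)"
    unfolding set_lebesgue_integral_def ind D'
    using integral_reindex(1)[OF i\<phi> Dm] unfolding Q_def by simp
  moreover have "(LINT x:g' ` (R ` S)|lborel. (f \<circ> Q) x) = (LINT x:g ` S|lborel. f x)"
    unfolding set_lebesgue_integral_def ind gim comp_def
    using integral_reindex(1)[OF i\<phi> fm] unfolding Q_def by simp
  ultimately show ?thesis by simp
qed

text \<open>The numeral types \<open>2\<close> and \<open>3\<close> serve as the well-ordered index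
  type.\<close>

lemma change_of_variables_rank1:
  fixes g a :: "real^'n \<Rightarrow> real^'n" and f t :: "real^'n \<Rightarrow> real"
  assumes card: "CARD('n) = 2 \<or> CARD('n) = 3"
    and S: "S \<in> sets borel" and gS: "g ` S \<in> sets borel"
    and der: "\<And>x. x \<in> S \<Longrightarrow> (g has_derivative (\<lambda>u. t x *\<^sub>R u + (n \<bullet> u) *\<^sub>R a x)) (at x within S)"
    and inj: "inj_on g S" and t: "\<And>x. x \<in> S \<Longrightarrow> t x \<noteq> 0" and n: "norm n = 1"
    and f: "set_integrable lborel (g ` S) f"
    and D: "set_borel_measurable lborel S (\<lambda>x. \<bar>t x ^ (CARD('n) - 1) * (t x + n \<bullet> a x)\<bar> * f (g x))"
  shows "(LINT x:S|lborel. \<bar>t x ^ (CARD('n) - 1) * (t x + n \<bullet> a x)\<bar> * f (g x)) = (LINT x:g ` S|lborel. f x)"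
  using card
proof
  assume "CARD('n) = 2"
  then have "CARD(2) = CARD('n)" by simp
  from change_of_variables_rank1_aux[OF this S gS der inj t n f D] show ?thesis by simp
next
  assume "CARD('n) = 3"
  then have "CARD(3) = CARD('n)" by simp
  from change_of_variables_rank1_aux[OF this S gS der inj t n f D] show ?thesis by simp
qed

section \<open>Surface integrals as integrals over prisms\<close>

definition prism :: "(real^'n) set \<Rightarrow> real^'n \<Rightarrow> (real^'n) set" where
  "prism e n = {y + t *\<^sub>R n | y t. y \<in> e \<and> -1/2 \<le> t \<and> t \<le> 1/2}"

definition drop_to :: "real^'n \<Rightarrow> real^'n \<Rightarrow> real^'n \<Rightarrow> real^'n" where
  "drop_to n p x = x - ((x - p) \<bullet> n) *\<^sub>R n"

definition unit_normal :: "(real^'n) set \<Rightarrow> real^'n \<Rightarrow> bool" where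
  "unit_normal e n \<longleftrightarrow> norm n = 1 \<and> (\<forall>x\<in>e. \<forall>y\<in>e. n \<bullet> (x - y) = 0)"

lemma unit_normalD:
  assumes "unit_normal e n"
  shows "norm n = 1" "n \<bullet> n = 1" "\<And>x y. x \<in> e \<Longrightarrow> y \<in> e \<Longrightarrow> n \<bullet> (x - y) = 0" "\<And>x y. x \<in> e \<Longrightarrow> y \<in> e \<Longrightarrow> (x - y) \<bullet> n = 0"
  using assms by (auto simp: unit_normal_def norm_eq_1 inner_commute)

lemma drop_to_prism:
  assumes "unit_normal e n" "p \<in> e" "y \<in> e"
  shows "drop_to n p (y + t *\<^sub>R n) = y" "(y + t *\<^sub>R n - p) \<bullet> n = t"
proof -
  have *: "(y + t *\<^sub>R n - p) \<bullet> n = (y - p) \<bullet> n + t * (n \<bullet> n)"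
    by (simp add: algebra_simps)
  then show "(y + t *\<^sub>R n - p) \<bullet> n = t"
    using unit_normalD[OF assms(1)] assms(2,3) by simp
  then show "drop_to n p (y + t *\<^sub>R n) = y"
    by (simp add: drop_to_def)
qed

lemma prism_uminus:
  fixes n :: "real^'n"
  shows "prism e (- n) = prism e n"
proof -
  have "prism e (- n) \<subseteq> prism e n" for n :: "real^'n"
  proof
    fix x assume "x \<in> prism e (-n)"
    then obtain y t where "x = y + t *\<^sub>R (-n)" "y \<in> e" "-1/2 \<le> t" "t \<le> 1/2"
      unfolding prism_def by auto
    then have "x = y + (-t) *\<^sub>R n \<and> y \<in> e \<and> -1/2 \<le> -t \<and> -t \<le> 1/2" by simp
    then show "x \<in> prism e n" unfolding prism_def by blast
  qed
  from this[of n] this[of "-n"] show ?thesis by auto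
qed

lemma compact_prism: "compact e \<Longrightarrow> compact (prism e n)"
proof -
  assume e: "compact e"
  have "prism e n = (\<lambda>(y, t). y + t *\<^sub>R n) ` (e \<times> {-1/2..1/2})"
    unfolding prism_def by (auto simp: image_iff) (metis atLeastAtMost_iff mem_Sigma_iff)+
  moreover have "compact ((\<lambda>(y, t). y + t *\<^sub>R n) ` (e \<times> {-1/2..1/2::real}))"
    by (intro compact_continuous_image compact_Times e) (auto intro!: continuous_intros simp: split_beta)
  ultimately show ?thesis by simp
qed

lemma continuous_on_drop_to [continuous_intros]: "continuous_on S (drop_to n p)"
  unfolding drop_to_def by (intro continuous_intros)

lemma drop_to_in:
  assumes "unit_normal e n" "p \<in> e" "x \<in> prism e n"
  shows "drop_to n p x \<in> e"
  using assms drop_to_prism(1)[OF assms(1,2)] unfolding prism_def by auto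

lemma prism_decomp:
  assumes "unit_normal e n" "p \<in> e"
  shows "x \<in> prism e n \<longleftrightarrow> drop_to n p x \<in> e \<and> 0 \<le> (x - p) \<bullet> n + 1/2 \<and> (x - p) \<bullet> n + 1/2 \<le> 1"
proof
  assume "x \<in> prism e n"
  then show "drop_to n p x \<in> e \<and> 0 \<le> (x - p) \<bullet> n + 1/2 \<and> (x - p) \<bullet> n + 1/2 \<le> 1"
    using drop_to_prism[OF assms] unfolding prism_def by auto
next
  assume *: "drop_to n p x \<in> e \<and> 0 \<le> (x - p) \<bullet> n + 1/2 \<and> (x - p) \<bullet> n + 1/2 \<le> 1"
  have "x = drop_to n p x + ((x - p) \<bullet> n) *\<^sub>R n" by (simp add: drop_to_def)
  then show "x \<in> prism e n" using * unfolding prism_def by force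
qed

text \<open>Neither choice in \<open>face_integral\<close> matters: a change of sign of the normal
  preserves the prism and the projection, and two base points differ by a vector orthogonal to
  \<open>n\<close>.\<close>

lemma face_integral_eq:
  fixes f :: "real^'n \<Rightarrow> 'b::{banach, second_countable_topology}"
  assumes n: "unit_normal e n" and p: "p \<in> e"
    and unique: "\<And>m. unit_normal e m \<Longrightarrow> m = n \<or> m = - n"
  shows "face_integral e f = (LINT x:prism e n|lebesgue. f (drop_to n p x))"
proof -
  have "unit_normal e (face_normal e)"
    using n someI[of "\<lambda>n. norm n = 1 \<and> (\<forall>x\<in>e. \<forall>y\<in>e. n \<bullet> (x - y) = 0)" n]
    unfolding face_normal_def unit_normal_def by blast
  then have fn: "face_normal e = n \<or> face_normal e = - n" using unique by blast
  define q where "q = (SOME p. p \<in> e)"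
  have q: "q \<in> e" unfolding q_def using p by (rule someI)
  have "(x - q) \<bullet> n = (x - p) \<bullet> n" for x
    using unit_normalD(4)[OF n p q] by (simp add: inner_diff_left)
  then have "f (x - ((x - q) \<bullet> face_normal e) *\<^sub>R face_normal e) = f (drop_to n p x)" for x
    using fn by (auto simp: drop_to_def)
  moreover have "prism e (face_normal e) = prism e n" using fn prism_uminus by metis
  ultimately show ?thesis
    unfolding face_integral_def Let_def q_def[symmetric] prism_def by simp
qed

lemma set_integrable_compact:
  fixes f :: "'a::euclidean_space \<Rightarrow> 'b::{banach, second_countable_topology}"
  assumes "compact S" "continuous_on S f"
  shows "set_integrable lborel S f" "set_integrable lebesgue S f"
    "(LINT x:S|lebesgue. f x) = (LINT x:S|lborel. f x)"
proof -
  have *: "integrable lborel (\<lambda>x. indicator S x *\<^sub>R f x)"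
    by (rule borel_integrable_compact[OF assms])
  then have m: "(\<lambda>x. indicator S x *\<^sub>R f x) \<in> lborel \<rightarrow>\<^sub>M borel" by (rule borel_measurable_integrable)
  show "set_integrable lborel S f" "set_integrable lebesgue S f"
    "(LINT x:S|lebesgue. f x) = (LINT x:S|lborel. f x)"
    using * integrable_completion[OF m] integral_completion[OF m]
    by (auto simp: set_integrable_def set_lebesgue_integral_def)
qed

lemma continuous_on_drop_to_compose:
  assumes "unit_normal e n" "p \<in> e" "continuous_on e f"
  shows "continuous_on (prism e n) (\<lambda>x. f (drop_to n p x))"
  by (rule continuous_on_compose2[OF assms(3) continuous_on_drop_to]) (auto simp: drop_to_in[OF assms(1,2)])

text \<open>The substitution \<open>t \<mapsto> t ^ Suc m\<close> in the normal direction replaces Fubini's theorem.\<close>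

lemma prism_moment:
  fixes n :: "real^'n" and f :: "real^'n \<Rightarrow> real"
  assumes card: "CARD('n) = 2 \<or> CARD('n) = 3"
    and n: "unit_normal e n" and p: "p \<in> e" and e: "compact e" and f: "continuous_on e f"
  shows "(LINT x:prism e n|lborel. ((x - p) \<bullet> n + 1/2) ^ m * f (drop_to n p x))
    = (LINT x:prism e n|lborel. f (drop_to n p x)) / (m + 1)"
proof -
  \<comment> \<open>\<open>T\<close> is the height inside the prism, shifted to run from 0 on the
    bottom to 1 on the top.\<close>
  define T where "T = (\<lambda>x. (x - p) \<bullet> n + 1/2)"
  define g where "g = (\<lambda>x. drop_to n p x + (T x ^ Suc m - 1/2) *\<^sub>R n)"
  note P = prism_decomp[OF n p]
  have nn: "n \<bullet> n = 1" using unit_normalD[OF n] by simp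
  have dn: "(drop_to n p x - p) \<bullet> n = 0" for x
    unfolding drop_to_def using nn by (simp add: algebra_simps)
  have Tg: "T (g x) = T x ^ Suc m" for x
    unfolding T_def[of] g_def using dn[of x] nn by (simp add: T_def algebra_simps)
  have gd: "drop_to n p (g x) = drop_to n p x" for x
  proof -
    have "(g x - p) \<bullet> n = T x ^ Suc m - 1/2" using Tg[of x] by (simp add: T_def)
    then show ?thesis unfolding drop_to_def[of n p "g x"] by (simp add: g_def)
  qed
  have xT: "x = drop_to n p x + (T x - 1/2) *\<^sub>R n" for x by (simp add: drop_to_def T_def)
  have T01: "0 \<le> T x" "T x \<le> 1" if "x \<in> prism e n" for x using that P by (auto simp: T_def)
  have img: "g ` prism e n = prism e n"
  proof (intro equalityI subsetI)
    fix y assume "y \<in> g ` prism e n"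
    then obtain x where x: "x \<in> prism e n" "y = g x" by auto
    have "0 \<le> T (g x)" "T (g x) \<le> 1" unfolding Tg using T01[OF x(1)] power_le_one[of "T x" "Suc m"] by auto
    moreover have "drop_to n p (g x) \<in> e" unfolding gd using x(1) P by blast
    ultimately show "y \<in> prism e n" unfolding x(2) P T_def by simp
  next
    fix y assume y: "y \<in> prism e n"
    define r where "r = root (Suc m) (T y)"
    have r: "r ^ Suc m = T y" "0 \<le> r" "r \<le> 1" unfolding r_def using T01[OF y] by (auto simp del: power_Suc)
    define x where "x = drop_to n p y + (r - 1/2) *\<^sub>R n"
    have de: "drop_to n p y \<in> e" using y P by blast
    have Tx: "T x = r" unfolding x_def using drop_to_prism(2)[OF n p de, of "r - 1/2"] by (simp add: T_def)
    have dx: "drop_to n p x = drop_to n p y" unfolding x_def using drop_to_prism(1)[OF n p de] .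
    have "x \<in> prism e n" unfolding P using Tx r de dx by (simp add: T_def)
    moreover have "g x = y" unfolding g_def Tx dx r(1) using xT[of y] by simp
    ultimately show "y \<in> g ` prism e n" by force
  qed
  have inj: "inj_on g (prism e n)"
  proof (rule inj_onI)
    fix x y assume xy: "x \<in> prism e n" "y \<in> prism e n" "g x = g y"
    have "T x ^ Suc m = T y ^ Suc m" using xy(3) Tg by metis
    then have "T x = T y" using T01 xy(1,2) power_eq_imp_eq_base[of "T x" "Suc m" "T y"] by blast
    moreover have "drop_to n p x = drop_to n p y" using xy(3) gd by metis
    ultimately show "x = y" using xT by metis
  qed
  have cP: "compact (prism e n)" by (rule compact_prism[OF e])
  have contT: "continuous_on S T" for S unfolding T_def by (intro continuous_intros)
  \<comment> \<open>With this \<open>a\<close> the Jacobian \<open>1 + n \<bullet> a\<close> is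
    \<open>m + 1\<close> times \<open>T ^ m\<close>, the weight whose integral is sought.\<close>
  define a where "a = (\<lambda>x. (real (Suc m) * T x ^ m - 1) *\<^sub>R n)"
  define F where "F = (\<lambda>x. f (drop_to n p x))"
  have Fc: "continuous_on (prism e n) F" unfolding F_def by (rule continuous_on_drop_to_compose[OF n p f])
  have "(LINT x:prism e n|lborel. \<bar>1 ^ (CARD('n) - 1) * (1 + n \<bullet> a x)\<bar> * F (g x)) = (LINT x:g ` prism e n|lborel. F x)"
  proof (rule change_of_variables_rank1[OF card])
    show "prism e n \<in> sets borel" "g ` prism e n \<in> sets borel"
      unfolding img using cP by (auto simp: compact_imp_closed)
    show "inj_on g (prism e n)" by (rule inj)
    show "norm n = 1" using unit_normalD[OF n] by simp
    show "set_integrable lborel (g ` prism e n) F"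
      unfolding img by (rule set_integrable_compact[OF cP Fc])
    have "F (g x) = F x" for x unfolding F_def gd ..
    then show "set_borel_measurable lborel (prism e n) (\<lambda>x. \<bar>1 ^ (CARD('n) - 1) * (1 + n \<bullet> a x)\<bar> * F (g x))"
      unfolding set_borel_measurable_def a_def
      using borel_measurable_continuous_on_indicator[of "prism e n" "\<lambda>x. \<bar>1 ^ (CARD('n) - 1) * (1 + n \<bullet> ((real (Suc m) * T x ^ m - 1) *\<^sub>R n))\<bar> * F x"]
        borel_closed[OF compact_imp_closed[OF cP]]
      by (simp add: continuous_intros contT Fc)
    have dT: "(T has_derivative (\<lambda>u. u \<bullet> n)) (at x within X)" for x X
      unfolding T_def by (auto intro!: derivative_eq_intros)
    have g: "g = (\<lambda>x. x - (T x - 1/2) *\<^sub>R n + (T x ^ Suc m - 1/2) *\<^sub>R n)"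
      unfolding g_def T_def drop_to_def by (rule ext) simp
    show "(g has_derivative (\<lambda>u. 1 *\<^sub>R u + (n \<bullet> u) *\<^sub>R a x)) (at x within prism e n)" for x
      unfolding g a_def
      by (auto intro!: derivative_eq_intros dT simp: algebra_simps inner_commute simp del: power_Suc)
  qed auto
  then have "(LINT x:prism e n|lborel. \<bar>1 ^ (CARD('n) - 1) * (1 + n \<bullet> a x)\<bar> * F (g x)) = (LINT x:prism e n|lborel. F x)"
    unfolding img .
  moreover have "\<bar>1 ^ (CARD('n) - 1) * (1 + n \<bullet> a x)\<bar> * F (g x) = real (Suc m) * (T x ^ m * F x)" if "x \<in> prism e n" for x
    unfolding a_def F_def gd using nn T01[OF that] by simp
  then have "(LINT x:prism e n|lborel. \<bar>1 ^ (CARD('n) - 1) * (1 + n \<bullet> a x)\<bar> * F (g x)) = (LINT x:prism e n|lborel. real (Suc m) * (T x ^ m * F x))"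
    using cP by (intro set_lebesgue_integral_cong) (auto simp: compact_imp_closed)
  ultimately have "real (Suc m) * (LINT x:prism e n|lborel. T x ^ m * F x) = (LINT x:prism e n|lborel. F x)"
    by (simp only: set_integral_mult_right)
  then show ?thesis
    unfolding F_def T_def by (simp add: eq_divide_eq mult.commute add.commute)
qed

section \<open>Integration over cones\<close>

definition cone_over :: "real^'n \<Rightarrow> (real^'n) set \<Rightarrow> (real^'n) set" where
  "cone_over p e = {p + t *\<^sub>R (y - p) | t y. y \<in> e \<and> 0 \<le> t \<and> t \<le> 1}"

lemma compact_cone_over: "compact e \<Longrightarrow> compact (cone_over p e)"
proof -
  assume e: "compact e"
  have "cone_over p e = (\<lambda>(y, t). p + t *\<^sub>R (y - p)) ` (e \<times> {0..1})"
    unfolding cone_over_def by (auto simp: image_iff) (metis atLeastAtMost_iff mem_Sigma_iff)+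
  moreover have "compact ((\<lambda>(y, t). p + t *\<^sub>R (y - p)) ` (e \<times> {0..1::real}))"
    by (intro compact_continuous_image compact_Times e) (auto intro!: continuous_intros simp: split_beta)
  ultimately show ?thesis by simp
qed

text \<open>The point at height \<open>T\<close> over \<open>y\<close> in the prism goes to the
  point at fraction \<open>T\<close> of the segment from \<open>v\<close> to \<open>y\<close>. The
  derivative of this map has \<open>t = T\<close> and \<open>t + n \<bullet> a = h\<close>, whence
  the Jacobian \<open>h\<close> times \<open>T ^ (d - 1)\<close>.\<close>

lemma cone_integral:
  fixes n :: "real^'n" and f :: "real^'n \<Rightarrow> real"
  assumes card: "CARD('n) = 2 \<or> CARD('n) = 3"
    and n: "unit_normal e n" and p: "p \<in> e" and e: "compact e"
    and h: "h > 0" "n \<bullet> (p - v) = h"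
    and f: "continuous_on (cone_over v e) f"
  shows "(LINT x:cone_over v e|lborel. f x)
    = h * (LINT x:prism e n|lborel. ((x - p) \<bullet> n + 1/2) ^ (CARD('n) - 1) * f (v + ((x - p) \<bullet> n + 1/2) *\<^sub>R (drop_to n p x - v)))"
proof -
  define T where "T = (\<lambda>x. (x - p) \<bullet> n + 1/2)"
  define g where "g = (\<lambda>x. v + T x *\<^sub>R (drop_to n p x - v))"
  note P = prism_decomp[OF n p]
  have nn: "n \<bullet> n = 1" using unit_normalD[OF n] by simp
  have T01: "0 \<le> T x" "T x \<le> 1" if "x \<in> prism e n" for x using that P by (auto simp: T_def)
  have xT: "x = drop_to n p x + (T x - 1/2) *\<^sub>R n" for x by (simp add: drop_to_def T_def)
  have dn: "n \<bullet> (drop_to n p x - v) = h" for x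
    unfolding drop_to_def using nn h(2) by (simp add: algebra_simps inner_commute)
  have Tg: "n \<bullet> (g x - v) = T x * h" for x unfolding g_def using dn[of x] by simp
  \<comment> \<open>The bottom \<open>T = 0\<close> of the prism collapses to the apex, so it is
    removed to make \<open>g\<close> injective.\<close>
  define S where "S = prism e n \<inter> {x. T x > 0}"
  have cP: "compact (prism e n)" by (rule compact_prism[OF e])
  have contT: "continuous_on S T" for S unfolding T_def by (intro continuous_intros)
  have contg: "continuous_on S g" for S unfolding g_def by (intro continuous_intros contT)
  have bS: "S \<in> sets borel"
    unfolding S_def
    by (intro sets.Int borel_closed[OF compact_imp_closed[OF cP]] borel_open open_Collect_less continuous_on_const contT)
  have gin: "g x \<in> cone_over v e" if "x \<in> prism e n" for x
    using that T01[OF that] P unfolding g_def cone_over_def by blast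
  have img: "g ` S = cone_over v e - {v}"
  proof (intro equalityI subsetI)
    fix y assume "y \<in> g ` S"
    then obtain x where x: "x \<in> prism e n" "T x > 0" "y = g x" unfolding S_def by auto
    have "n \<bullet> (y - v) > 0" using x h(1) Tg[of x] by simp
    then show "y \<in> cone_over v e - {v}" using gin x by auto
  next
    fix y assume "y \<in> cone_over v e - {v}"
    then obtain t z where z: "z \<in> e" "0 \<le> t" "t \<le> 1" "y = v + t *\<^sub>R (z - v)" "y \<noteq> v"
      unfolding cone_over_def by auto
    then have t: "t > 0" by (cases "t = 0") auto
    define x where "x = z + (t - 1/2) *\<^sub>R n"
    have Tx: "T x = t" "drop_to n p x = z"
      unfolding x_def using drop_to_prism[OF n p z(1), of "t - 1/2"] by (auto simp: T_def)
    have "x \<in> prism e n" using P[of x] Tx z by (simp add: T_def)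
    then have "x \<in> S" unfolding S_def using Tx t by simp
    moreover have "g x = y" unfolding g_def Tx z(4) ..
    ultimately show "y \<in> g ` S" by blast
  qed
  have inj: "inj_on g S"
  proof (rule inj_onI)
    fix x y assume xy: "x \<in> S" "y \<in> S" "g x = g y"
    have "T x = T y" using Tg[of x] Tg[of y] h(1) xy(3) by simp
    moreover from this have "drop_to n p x = drop_to n p y" using xy unfolding g_def S_def by auto
    ultimately show "x = y" using xT by metis
  qed
  \<comment> \<open>What remains of the derivative of \<open>g\<close> in the direction
    \<open>n\<close> after \<open>T\<close> times the identity is split off.\<close>
  define a where "a = (\<lambda>x. drop_to n p x - v - T x *\<^sub>R n)"
  have na: "T x + n \<bullet> a x = h" for x unfolding a_def using dn[of x] nn by (simp add: inner_diff_right)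
  have cC: "compact (cone_over v e)" by (rule compact_cone_over[OF e])
  have inte: "set_integrable lborel (cone_over v e - {v}) f"
    by (rule set_integrable_subset[OF set_integrable_compact(1)[OF cC f]])
       (use cC in \<open>auto simp: compact_imp_closed\<close>)
  \<comment> \<open>As \<open>d \<ge> 2\<close>, the factor \<open>T ^ (d - 1)\<close> vanishes on
    the bottom, so integrating over \<open>S\<close> or over the whole prism gives the same.\<close>
  have D0: "indicator S x *\<^sub>R (\<bar>T x ^ (CARD('n) - 1) * (T x + n \<bullet> a x)\<bar> * f (g x)) =
    indicator (prism e n) x *\<^sub>R (h * (T x ^ (CARD('n) - 1) * f (g x)))" for x
    unfolding S_def na using T01[of x] h(1) card by (auto simp: indicator_def abs_mult power_0_left)
  have fg: "continuous_on (prism e n) (\<lambda>x. f (g x))"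
    by (rule continuous_on_compose2[OF f contg]) (use gin in auto)
  have "(LINT x:S|lborel. \<bar>T x ^ (CARD('n) - 1) * (T x + n \<bullet> a x)\<bar> * f (g x)) = (LINT x:g ` S|lborel. f x)"
  proof (rule change_of_variables_rank1[OF card bS _ _ inj])
    show "g ` S \<in> sets borel" unfolding img using cC by (auto simp: compact_imp_closed)
    show "norm n = 1" using unit_normalD[OF n] by simp
    show "set_integrable lborel (g ` S) f" unfolding img by (rule inte)
    show "set_borel_measurable lborel S (\<lambda>x. \<bar>T x ^ (CARD('n) - 1) * (T x + n \<bullet> a x)\<bar> * f (g x))"
      unfolding set_borel_measurable_def D0
      using borel_measurable_continuous_on_indicator[of "prism e n" "\<lambda>x. h * (T x ^ (CARD('n) - 1) * f (g x))"]
        borel_closed[OF compact_imp_closed[OF cP]]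
      by (simp add: continuous_intros contT fg)
    have dT: "(T has_derivative (\<lambda>u. u \<bullet> n)) (at x within X)" for x X
      unfolding T_def by (auto intro!: derivative_eq_intros)
    define c :: real where "c = 1/2"
    have g: "g = (\<lambda>x. v + T x *\<^sub>R (x - (T x - c) *\<^sub>R n - v))"
      unfolding g_def T_def drop_to_def c_def by (rule ext) simp
    have a: "a x = x - (T x - c) *\<^sub>R n - v - T x *\<^sub>R n" for x
      unfolding a_def T_def drop_to_def c_def by simp
    show "(g has_derivative (\<lambda>u. T x *\<^sub>R u + (n \<bullet> u) *\<^sub>R a x)) (at x within S)" for x
      unfolding g a
      by (rule derivative_eq_intros dT refl ext | simp add: scaleR_diff_right scaleR_diff_left scaleR_add_right scaleR_add_left inner_commute mult.commute)+
    show "T x \<noteq> 0" if "x \<in> S" for x using that unfolding S_def by auto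
  qed
  then have "(LINT x:prism e n|lborel. h * (T x ^ (CARD('n) - 1) * f (g x))) = (LINT x:cone_over v e - {v}|lborel. f x)"
    unfolding set_lebesgue_integral_def D0 img by simp
  also have "\<dots> = (LINT x:cone_over v e|lborel. f x)"
  proof (rule set_integral_cong_set)
    show "AE x in lborel. (x \<in> cone_over v e) = (x \<in> cone_over v e - {v})"
      using AE_lborel_singleton[of v] by eventually_elim auto
    show "set_borel_measurable lborel (cone_over v e) f" "set_borel_measurable lborel (cone_over v e - {v}) f"
      using inte set_integrable_compact(1)[OF cC f] borel_measurable_integrable
      unfolding set_integrable_def set_borel_measurable_def by blast+
  qed
  finally show ?thesis unfolding g_def T_def by simp
qed

section \<open>Integrals as positive functionals on continuous functions\<close>

definition positive_functional :: "'a::topological_space set \<Rightarrow> (('a \<Rightarrow> real) \<Rightarrow> real) \<Rightarrow> bool" where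
  "positive_functional S J \<longleftrightarrow>
    (\<forall>f g. continuous_on S f \<longrightarrow> continuous_on S g \<longrightarrow> J (\<lambda>x. f x + g x) = J f + J g) \<and>
    (\<forall>c f. continuous_on S f \<longrightarrow> J (\<lambda>x. c * f x) = c * J f) \<and>
    (\<forall>f. continuous_on S f \<longrightarrow> (\<forall>x\<in>S. 0 \<le> f x) \<longrightarrow> 0 \<le> J f)"

lemma positive_functional_add:
  "positive_functional S J \<Longrightarrow> continuous_on S f \<Longrightarrow> continuous_on S g \<Longrightarrow> J (\<lambda>x. f x + g x) = J f + J g"
  by (simp add: positive_functional_def)

lemma positive_functional_cmult:
  "positive_functional S J \<Longrightarrow> continuous_on S f \<Longrightarrow> J (\<lambda>x. c * f x) = c * J f"
  by (simp add: positive_functional_def)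

lemma positive_functional_nonneg:
  "positive_functional S J \<Longrightarrow> continuous_on S f \<Longrightarrow> (\<And>x. x \<in> S \<Longrightarrow> 0 \<le> f x) \<Longrightarrow> 0 \<le> J f"
  by (simp add: positive_functional_def)

lemma positive_functional_diff:
  assumes "positive_functional S J" "continuous_on S f" "continuous_on S g"
  shows "J (\<lambda>x. f x - g x) = J f - J g"
  using positive_functional_add[OF assms(1,2) continuous_on_minus[OF assms(3)]]
    positive_functional_cmult[OF assms(1,3), of "-1"] by simp

lemma positive_functional_mono:
  assumes "positive_functional S J" "continuous_on S f" "continuous_on S g" "\<And>x. x \<in> S \<Longrightarrow> f x \<le> g x"
  shows "J f \<le> J g"
  using positive_functional_nonneg[OF assms(1) continuous_on_diff[OF assms(3,2)]] assms(4)
    positive_functional_diff[OF assms(1,3,2)] by simp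

lemma positive_functional_cong:
  assumes "positive_functional S J" "continuous_on S f" "\<And>x. x \<in> S \<Longrightarrow> f x = g x"
  shows "J f = J g"
proof -
  have "continuous_on S g" using assms(2,3) by (simp cong: continuous_on_cong)
  then show ?thesis
    using assms by (intro antisym positive_functional_mono[OF assms(1)]) auto
qed

lemma positive_functional_sum:
  assumes "positive_functional S J" "finite A" "\<And>a. a \<in> A \<Longrightarrow> continuous_on S (f a)"
  shows "J (\<lambda>x. \<Sum>a\<in>A. f a x) = (\<Sum>a\<in>A. J (f a))"
  using assms(2,3)
proof (induction A)
  case empty
  then show ?case using positive_functional_cmult[OF assms(1), of "\<lambda>_. 0" 0] by simp
next
  case (insert a A)
  then show ?case
    by (simp add: positive_functional_add[OF assms(1)] continuous_on_sum)
qed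

lemma positive_functional_const:
  "positive_functional S J \<Longrightarrow> J (\<lambda>x. c) = c * J (\<lambda>x. 1)"
  using positive_functional_cmult[of S J "\<lambda>x. 1" c] by simp

lemma positive_functional_integral:
  fixes K :: "'a::euclidean_space set"
  assumes "compact K"
  shows "positive_functional K (\<lambda>f. LINT x:K|lebesgue. f x)"
  unfolding positive_functional_def
  using set_integrable_compact(2)[OF assms] compact_imp_closed[OF assms]
  by (auto simp: set_integral_add) (auto simp: set_lebesgue_integral_def indicator_def intro!: integral_nonneg)

text \<open>Uniqueness of the normal up to sign means that \<open>e\<close> spans a hyperplane; this
  makes \<open>face_integral e\<close> independent of the normal chosen inside it.\<close>

definition hyperplane_piece :: "(real^'n) set \<Rightarrow> real^'n \<Rightarrow> bool" where
  "hyperplane_piece e n \<longleftrightarrow> compact e \<and> e \<noteq> {} \<and> unit_normal e n \<and> (\<forall>m. unit_normal e m \<longrightarrow> m = n \<or> m = - n)"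

lemma face_integral_lborel:
  fixes f :: "real^'n \<Rightarrow> real"
  assumes "hyperplane_piece e n" "p \<in> e" "continuous_on e f"
  shows "face_integral e f = (LINT x:prism e n|lborel. f (drop_to n p x))"
proof -
  have n: "unit_normal e n" and e: "compact e" using assms by (auto simp: hyperplane_piece_def)
  have "face_integral e f = (LINT x:prism e n|lebesgue. f (drop_to n p x))"
    using assms by (intro face_integral_eq) (auto simp: hyperplane_piece_def)
  also have "\<dots> = (LINT x:prism e n|lborel. f (drop_to n p x))"
    by (rule set_integrable_compact(3)[OF compact_prism[OF e] continuous_on_drop_to_compose[OF n assms(2,3)]])
  finally show ?thesis .
qed

text \<open>Transported from the prism by composition with the projection. From here on face and
  volume integrals obey the same rules, with continuity as side condition.\<close>

lemma positive_functional_face: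
  assumes "hyperplane_piece e n"
  shows "positive_functional e (face_integral e :: (real^'n \<Rightarrow> real) \<Rightarrow> real)"
proof -
  obtain p where p: "p \<in> e" using assms by (auto simp: hyperplane_piece_def)
  have n: "unit_normal e n" and e: "compact e" using assms by (auto simp: hyperplane_piece_def)
  have P: "positive_functional (prism e n) (\<lambda>f. LINT x:prism e n|lebesgue. f x)"
    by (rule positive_functional_integral[OF compact_prism[OF e]])
  have eq: "face_integral e f = (LINT x:prism e n|lebesgue. f (drop_to n p x))" for f :: "real^'n \<Rightarrow> real"
    using assms p by (intro face_integral_eq) (auto simp: hyperplane_piece_def)
  note c = continuous_on_drop_to_compose[OF n p]
  show ?thesis
    unfolding positive_functional_def eq
    using positive_functional_add[OF P c c] positive_functional_cmult[OF P c] positive_functional_nonneg[OF P c]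
      drop_to_in[OF n p] by auto
qed

lemma face_integral_bounded_linear:
  fixes f :: "real^'n \<Rightarrow> 'b::{banach, second_countable_topology}" and T :: "'b \<Rightarrow> 'c::{banach, second_countable_topology}"
  assumes "hyperplane_piece e n" "continuous_on e f" "bounded_linear T"
  shows "T (face_integral e f) = face_integral e (\<lambda>x. T (f x))"
proof -
  obtain p where p: "p \<in> e" using assms by (auto simp: hyperplane_piece_def)
  have n: "unit_normal e n" and e: "compact e" using assms by (auto simp: hyperplane_piece_def)
  have eq: "face_integral e f = (LINT x:prism e n|lebesgue. f (drop_to n p x))" for f :: "real^'n \<Rightarrow> 'd::{banach, second_countable_topology}"
    using assms p by (intro face_integral_eq) (auto simp: hyperplane_piece_def)
  have "integrable lebesgue (\<lambda>x. indicat_real (prism e n) x *\<^sub>R f (drop_to n p x))"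
    using set_integrable_compact(2)[OF compact_prism[OF e] continuous_on_drop_to_compose[OF n p assms(2)]]
    by (simp add: set_integrable_def)
  from integral_bounded_linear[OF assms(3) this] show ?thesis
    unfolding eq set_lebesgue_integral_def linear_scale[OF bounded_linear.linear[OF assms(3)]] by (rule sym)
qed

lemma face_integral_cong:
  fixes f g :: "real^'n \<Rightarrow> 'b::{banach, second_countable_topology}"
  assumes "hyperplane_piece e n" "\<And>x. x \<in> e \<Longrightarrow> f x = g x"
  shows "face_integral e f = face_integral e g"
proof -
  obtain p where p: "p \<in> e" using assms by (auto simp: hyperplane_piece_def)
  have n: "unit_normal e n" and e: "compact e" using assms by (auto simp: hyperplane_piece_def)
  have eq: "face_integral e f = (LINT x:prism e n|lebesgue. f (drop_to n p x))" for f :: "real^'n \<Rightarrow> 'b"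
    using assms p by (intro face_integral_eq) (auto simp: hyperplane_piece_def)
  have "indicator (prism e n) x *\<^sub>R f (drop_to n p x) = indicator (prism e n) x *\<^sub>R g (drop_to n p x)" for x
    using assms(2)[OF drop_to_in[OF n p]] by (auto simp: indicator_def)
  then show ?thesis unfolding eq set_lebesgue_integral_def by (simp only:)
qed

text \<open>In the coordinates \<open>y\<close> and \<open>t\<close> of the cone the volume element
  is \<open>h\<close> times \<open>t ^ (d - 1)\<close> times the surface element, so the powers 1,
  \<open>t\<close>, \<open>t^2\<close> contribute \<open>1/d\<close>, \<open>1/(d+1)\<close>,
  \<open>1/(d+2)\<close>.\<close>

lemma cone_quadratic:
  fixes n :: "real^'n" and f :: "real^'n \<Rightarrow> real"
  assumes card: "CARD('n) = 2 \<or> CARD('n) = 3"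
    and n: "hyperplane_piece e n"
    and h: "h > 0" "\<And>y. y \<in> e \<Longrightarrow> n \<bullet> (y - v) = h"
    and f: "continuous_on (cone_over v e) f"
    and ABC: "continuous_on e A" "continuous_on e B" "continuous_on e C"
    and fABC: "\<And>y t. y \<in> e \<Longrightarrow> f (v + t *\<^sub>R (y - v)) = A y + t * B y + t\<^sup>2 * C y"
  shows "(LINT x:cone_over v e|lebesgue. f x) =
    h * (face_integral e A / CARD('n) + face_integral e B / (CARD('n) + 1) + face_integral e C / (CARD('n) + 2))"
proof -
  obtain p where p: "p \<in> e" using n by (auto simp: hyperplane_piece_def)
  have n': "unit_normal e n" and e: "compact e" using n by (auto simp: hyperplane_piece_def)
  define T where "T = (\<lambda>x. (x - p) \<bullet> n + 1/2)"
  have contT: "continuous_on S T" for S unfolding T_def by (intro continuous_intros)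
  let ?I = "\<lambda>f. LINT x:prism e n|lborel. f x"
  let ?d = "CARD('n)"
  note c = continuous_on_drop_to_compose[OF n' p]
  have P: "positive_functional (prism e n) (\<lambda>f. LINT x:prism e n|lebesgue. f x)"
    by (rule positive_functional_integral[OF compact_prism[OF e]])
  have leb: "(LINT x:prism e n|lebesgue. f x) = ?I f" if "continuous_on (prism e n) f" for f :: "real^'n \<Rightarrow> real"
    by (rule set_integrable_compact(3)[OF compact_prism[OF e] that])
  have mom: "(LINT x:prism e n|lebesgue. T x ^ m * A (drop_to n p x)) = face_integral e A / (m + 1)"
    if A: "continuous_on e A" for A m
    unfolding face_integral_lborel[OF n p A] prism_moment[OF card n' p e A, symmetric]
    by (subst leb) (auto intro!: continuous_intros contT c[OF A] simp: T_def)
  have "(LINT x:cone_over v e|lebesgue. f x) = (LINT x:cone_over v e|lborel. f x)"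
    by (rule set_integrable_compact(3)[OF compact_cone_over[OF e] f])
  also have "\<dots> = h * ?I (\<lambda>x. T x ^ (?d - 1) * f (v + T x *\<^sub>R (drop_to n p x - v)))"
    unfolding T_def by (rule cone_integral[OF card n' p e h(1) h(2)[OF p] f])
  also have "?I (\<lambda>x. T x ^ (?d - 1) * f (v + T x *\<^sub>R (drop_to n p x - v))) =
    ?I (\<lambda>x. T x ^ (?d - 1) * A (drop_to n p x) + T x ^ ?d * B (drop_to n p x) + T x ^ (?d + 1) * C (drop_to n p x))"
  proof (rule set_lebesgue_integral_cong)
    show "prism e n \<in> sets lborel" using compact_prism[OF e] by (simp add: compact_imp_closed)
    show "\<forall>x. x \<in> prism e n \<longrightarrow> T x ^ (?d - 1) * f (v + T x *\<^sub>R (drop_to n p x - v)) =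
      T x ^ (?d - 1) * A (drop_to n p x) + T x ^ ?d * B (drop_to n p x) + T x ^ (?d + 1) * C (drop_to n p x)"
    proof (intro allI impI)
      fix x assume x: "x \<in> prism e n"
      have pw: "T x ^ ?d = T x ^ (?d - 1) * T x" "T x ^ (?d + 1) = T x ^ (?d - 1) * (T x)\<^sup>2"
        using card by (auto simp: power_numeral_reduce power2_eq_square power3_eq_cube)
      show "T x ^ (?d - 1) * f (v + T x *\<^sub>R (drop_to n p x - v)) =
        T x ^ (?d - 1) * A (drop_to n p x) + T x ^ ?d * B (drop_to n p x) + T x ^ (?d + 1) * C (drop_to n p x)"
        unfolding pw fABC[OF drop_to_in[OF n' p x]] by (simp only: distrib_left mult.assoc)
    qed
  qed
  also have "\<dots> = (LINT x:prism e n|lebesgue. T x ^ (?d - 1) * A (drop_to n p x) + T x ^ ?d * B (drop_to n p x) + T x ^ (?d + 1) * C (drop_to n p x))"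
    by (rule leb[symmetric]) (intro continuous_intros contT c ABC)
  also have "\<dots> = face_integral e A / (real (?d - 1) + 1) + face_integral e B / (?d + 1) + face_integral e C / (real (?d + 1) + 1)"
    using mom[OF ABC(1), of "?d - 1"] mom[OF ABC(2), of ?d] mom[OF ABC(3), of "?d + 1"]
    by (simp only: positive_functional_add[OF P] continuous_on_add continuous_on_mult continuous_on_power contT c ABC of_nat_add of_nat_1)
  also have "real (?d - 1) + 1 = ?d" using card by auto
  finally show ?thesis by (simp add: add.assoc)
qed

section \<open>Simplices and the divergence theorem\<close>

locale simplex_vertices =
  fixes V :: "(real^'n) set"
  assumes card_n: "CARD('n) = 2 \<or> CARD('n) = 3"
    and card_V: "card V = CARD('n) + 1"
    and indep: "\<not> affine_dependent V"
begin

definition K :: "(real^'n) set" where "K = convex hull V"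

definition opp :: "real^'n \<Rightarrow> (real^'n) set" where "opp p = convex hull (V - {p})"

lemma fin: "finite V"
  by (rule card_ge_0_finite) (simp add: card_V)

lemma affine_hull_V: "affine hull V = UNIV"
  by (rule affine_independent_span_eq[OF indep]) (use card_V in simp)

lemma bary_ex: "\<exists>c. sum c V = 1 \<and> x = (\<Sum>q\<in>V. c q *\<^sub>R q)"
proof -
  have "x \<in> {y. \<exists>u. sum u V = 1 \<and> (\<Sum>v\<in>V. u v *\<^sub>R v) = y}"
    by (rule affine_hull_V[unfolded affine_hull_finite[OF fin], THEN equalityD2, THEN subsetD, OF UNIV_I])
  then show ?thesis by blast
qed

text \<open>The difference of the affine representations of \<open>u\<close> and of 0.\<close>

lemma bary_dir_ex: "\<exists>c. sum c V = 0 \<and> u = (\<Sum>q\<in>V. c q *\<^sub>R q)"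
proof -
  obtain a where a: "sum a V = 1" "u = (\<Sum>q\<in>V. a q *\<^sub>R q)" using bary_ex by blast
  obtain b where b: "sum b V = 1" "0 = (\<Sum>q\<in>V. b q *\<^sub>R q)" using bary_ex by blast
  have "sum (\<lambda>q. a q - b q) V = 0" using a(1) b(1) by (simp add: sum_subtractf)
  moreover have "(\<Sum>q\<in>V. (a q - b q) *\<^sub>R q) = u"
    using a(2)[symmetric] b(2)[symmetric] by (simp add: sum_subtractf scaleR_left_diff_distrib)
  ultimately have "sum (\<lambda>q. a q - b q) V = 0" "u = (\<Sum>q\<in>V. (a q - b q) *\<^sub>R q)"
    by simp_all
  then show ?thesis by blast
qed

text \<open>The other \<open>d\<close> vertices span a hyperplane that misses \<open>p\<close>; the
  normal is signed so that it points from \<open>p\<close> towards it.\<close>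

lemma normal_ex:
  assumes p: "p \<in> V"
  shows "\<exists>n h. norm n = 1 \<and> h > 0 \<and> (\<forall>q\<in>V-{p}. n \<bullet> (q - p) = h)"
proof -
  have ind': "\<not> affine_dependent (V - {p})" using indep affine_dependent_subset by blast
  have cV': "card (V - {p}) = CARD('n)" using p card_V fin by simp
  have "aff_dim (V - {p}) = int (DIM(real^'n) - 1)"
    using aff_dim_affine_independent[OF ind'] cV' card_n by (auto simp: of_nat_diff)
  from iffD1[OF aff_dim_eq_hyperplane this]
  obtain a b where a: "a \<noteq> 0" "affine hull (V - {p}) = {x. a \<bullet> x = b}"
    by (elim exE conjE)
  have "p \<notin> affine hull (V - {p})" using indep p unfolding affine_dependent_def by blast
  then have ap: "b - a \<bullet> p \<noteq> 0" unfolding a(2) by simp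
  have q: "a \<bullet> (q - p) = b - a \<bullet> p" if "q \<in> V - {p}" for q
    using hull_inc[of q "V - {p}" affine] that unfolding a(2) by (simp add: inner_diff_right)
  define n where "n = (sgn (b - a \<bullet> p) / norm a) *\<^sub>R a"
  have "norm n = 1" using a(1) ap unfolding n_def by (simp add: abs_sgn_eq)
  moreover have "\<forall>q\<in>V-{p}. n \<bullet> (q - p) = \<bar>b - a \<bullet> p\<bar> / norm a"
    unfolding n_def using q by (auto simp: abs_sgn)
  moreover have "\<bar>b - a \<bullet> p\<bar> / norm a > 0" using a ap by simp
  ultimately show ?thesis by blast
qed

text \<open>It points from the vertex \<open>p\<close> to the opposite facet, hence is outward on
  that facet; \<open>ht p\<close> below is the height over it.\<close>

definition nu :: "real^'n \<Rightarrow> real^'n" where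
  "nu p = (SOME n. \<exists>h>0. norm n = 1 \<and> (\<forall>q\<in>V-{p}. n \<bullet> (q - p) = h))"

definition ht :: "real^'n \<Rightarrow> real" where
  "ht p = (SOME h. h > 0 \<and> (\<forall>q\<in>V-{p}. nu p \<bullet> (q - p) = h))"

lemma nu_ht:
  assumes p: "p \<in> V"
  shows "norm (nu p) = 1" "ht p > 0" "\<And>q. q \<in> V - {p} \<Longrightarrow> nu p \<bullet> (q - p) = ht p"
proof -
  have 1: "\<exists>h>0. norm (nu p) = 1 \<and> (\<forall>q\<in>V-{p}. nu p \<bullet> (q - p) = h)"
    unfolding nu_def by (rule someI_ex) (use normal_ex[OF p] in blast)
  then show "norm (nu p) = 1" by blast
  have 2: "ht p > 0 \<and> (\<forall>q\<in>V-{p}. nu p \<bullet> (q - p) = ht p)"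
    unfolding ht_def by (rule someI_ex) (use 1 in blast)
  then show "ht p > 0" "\<And>q. q \<in> V - {p} \<Longrightarrow> nu p \<bullet> (q - p) = ht p" by blast+
qed

lemma V_minus_nonempty: "V - {p} \<noteq> {}"
proof
  assume "V - {p} = {}"
  then have "V \<subseteq> {p}" by blast
  then have "card V \<le> card {p}" by (intro card_mono) auto
  then show False using card_V card_n by auto
qed

lemma nu_opp:
  assumes p: "p \<in> V" and y: "y \<in> opp p"
  shows "nu p \<bullet> (y - p) = ht p"
proof -
  have "V - {p} \<subseteq> {y. nu p \<bullet> y = ht p + nu p \<bullet> p}"
    using nu_ht(3)[OF p] by (auto simp: inner_diff_right algebra_simps)
  then have "opp p \<subseteq> {y. nu p \<bullet> y = ht p + nu p \<bullet> p}"
    unfolding opp_def by (rule hull_minimal) (rule convex_hyperplane)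
  then show ?thesis using y by (auto simp: inner_diff_right)
qed

lemma compact_K: "compact K" and compact_opp: "compact (opp p)"
  unfolding K_def opp_def using fin by (auto intro: finite_imp_compact_convex_hull)

lemma opp_nonempty: "opp p \<noteq> {}"
  unfolding opp_def using V_minus_nonempty by simp

lemma opp_subset: "opp p \<subseteq> K"
  unfolding K_def opp_def by (rule hull_mono) blast

lemma V_subset: "V \<subseteq> K"
  unfolding K_def by (rule hull_subset)

text \<open>Coefficients with sum \<open>s = 1\<close> describe points and those with
  \<open>s = 0\<close> directions; both cases are used.\<close>

lemma sum_dir:
  assumes p: "p \<in> V" and c: "sum c V = s"
  shows "nu p \<bullet> ((\<Sum>q\<in>V. c q *\<^sub>R q) - s *\<^sub>R p) = (s - c p) * ht p"
proof -
  have "(\<Sum>q\<in>V. c q *\<^sub>R q) - s *\<^sub>R p = (\<Sum>q\<in>V. c q *\<^sub>R (q - p))"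
    using c by (simp add: scaleR_right_diff_distrib sum_subtractf scaleR_left.sum[symmetric])
  also have "nu p \<bullet> \<dots> = (\<Sum>q\<in>V. c q * (nu p \<bullet> (q - p)))" by (simp add: inner_sum_right)
  also have "\<dots> = (\<Sum>q\<in>V - {p}. c q * (nu p \<bullet> (q - p)))"
    by (simp add: sum.remove[OF fin p])
  also have "\<dots> = (\<Sum>q\<in>V - {p}. c q) * ht p"
    by (simp add: nu_ht(3)[OF p] sum_distrib_right)
  also have "(\<Sum>q\<in>V - {p}. c q) = s - c p" using sum.remove[OF fin p, of c] c by simp
  finally show ?thesis .
qed

text \<open>The barycentric coordinate of \<open>x\<close> at \<open>p\<close>, written through the
  height so that it is an affine function on the whole space.\<close>

definition lam :: "real^'n \<Rightarrow> real^'n \<Rightarrow> real" where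
  "lam p x = 1 - nu p \<bullet> (x - p) / ht p"

lemma lam_eq:
  assumes p: "p \<in> V" and c: "sum c V = 1" "x = (\<Sum>q\<in>V. c q *\<^sub>R q)"
  shows "lam p x = c p"
  using sum_dir[OF p c(1)] nu_ht(2)[OF p] unfolding lam_def c(2) by (simp add: field_simps)

lemma lam_sum: "(\<Sum>p\<in>V. lam p x) = 1" "(\<Sum>p\<in>V. lam p x *\<^sub>R p) = x"
proof -
  obtain c where c: "sum c V = 1" "x = (\<Sum>q\<in>V. c q *\<^sub>R q)" using bary_ex by blast
  have "lam p x = c p" if "p \<in> V" for p using lam_eq[OF that c] .
  then show "(\<Sum>p\<in>V. lam p x) = 1" "(\<Sum>p\<in>V. lam p x *\<^sub>R p) = x" using c by auto
qed

lemma continuous_lam: "continuous_on S (lam p)"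
  unfolding lam_def divide_inverse by (intro continuous_intros)

lemma K_lam: "x \<in> K \<longleftrightarrow> (\<forall>p\<in>V. 0 \<le> lam p x)"
proof
  assume "x \<in> K"
  then obtain c where c: "\<forall>q\<in>V. 0 \<le> c q" "sum c V = 1" "x = (\<Sum>q\<in>V. c q *\<^sub>R q)"
    unfolding K_def convex_hull_finite[OF fin] by auto
  then show "\<forall>p\<in>V. 0 \<le> lam p x" using lam_eq[OF _ c(2,3)] by simp
next
  assume "\<forall>p\<in>V. 0 \<le> lam p x"
  then show "x \<in> K" unfolding K_def convex_hull_finite[OF fin] mem_Collect_eq
    by (intro exI[of _ "\<lambda>p. lam p x"] conjI lam_sum)
qed

text \<open>Where some coordinate is not positive, a small step along \<open>nu p\<close> makes it
  negative and leaves \<open>K\<close>.\<close>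

lemma interior_K: "x \<in> interior K \<longleftrightarrow> (\<forall>p\<in>V. 0 < lam p x)"
proof
  assume x: "x \<in> interior K"
  show "\<forall>p\<in>V. 0 < lam p x"
  proof (rule ccontr)
    assume "\<not> (\<forall>p\<in>V. 0 < lam p x)"
    then obtain p where p: "p \<in> V" "lam p x \<le> 0" by (auto simp: not_less)
    obtain e where e: "e > 0" "ball x e \<subseteq> K" using x mem_interior by blast
    define y where "y = x + (e/2) *\<^sub>R nu p"
    have "y \<in> ball x e" unfolding y_def using e(1) nu_ht(1)[OF p(1)] by (simp add: dist_norm)
    then have "0 \<le> lam p y" using e(2) K_lam p(1) by blast
    moreover have "nu p \<bullet> nu p = 1" using nu_ht(1)[OF p(1)] by (simp add: norm_eq_1)
    then have "lam p y = lam p x - (e/2) / ht p"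
      unfolding lam_def y_def by (simp add: inner_diff_right inner_add_right add_divide_distrib diff_divide_distrib)
    ultimately show False using p(2) e(1) nu_ht(2)[OF p(1)] by (smt (verit) divide_pos_pos half_gt_zero)
  qed
next
  assume x: "\<forall>p\<in>V. 0 < lam p x"
  have "{x. \<forall>p\<in>V. 0 < lam p x} = (\<Inter>p\<in>V. {x. 0 < lam p x})" by auto
  then have "open {x. \<forall>p\<in>V. 0 < lam p x}"
    using fin by (auto intro!: open_INT open_Collect_less continuous_on_const continuous_lam)
  moreover have "{x. \<forall>p\<in>V. 0 < lam p x} \<subseteq> K" using K_lam by (auto simp: less_imp_le)
  ultimately show "x \<in> interior K" using x interior_maximal by blast
qed

text \<open>Splitting \<open>p\<close> off the convex hull exhibits \<open>K\<close> as a cone with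
  apex \<open>p\<close>; this opens it to \<open>cone_quadratic\<close> from each of its
  vertices.\<close>

lemma cone_K: assumes p: "p \<in> V" shows "cone_over p (opp p) = K"
proof -
  have "K = convex hull (insert p (V - {p}))" unfolding K_def using p by (simp add: insert_absorb)
  also have "\<dots> = {x. \<exists>u\<ge>0. \<exists>v\<ge>0. \<exists>b. u + v = 1 \<and> b \<in> opp p \<and> x = u *\<^sub>R p + v *\<^sub>R b}"
    unfolding opp_def by (rule convex_hull_insert[OF V_minus_nonempty])
  also have "\<dots> = cone_over p (opp p)"
  proof (intro equalityI subsetI)
    fix x assume "x \<in> {x. \<exists>u\<ge>0. \<exists>v\<ge>0. \<exists>b. u + v = 1 \<and> b \<in> opp p \<and> x = u *\<^sub>R p + v *\<^sub>R b}"
    then obtain u v b where *: "0 \<le> u" "0 \<le> v" "b \<in> opp p" "u + v = 1" "x = u *\<^sub>R p + v *\<^sub>R b" by auto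
    then have "u = 1 - v" by simp
    have "x = p + v *\<^sub>R (b - p)" unfolding *(5) \<open>u = 1 - v\<close> by (simp add: algebra_simps)
    then show "x \<in> cone_over p (opp p)" unfolding cone_over_def using * by fastforce
  next
    fix x assume "x \<in> cone_over p (opp p)"
    then obtain t y where *: "x = p + t *\<^sub>R (y - p)" "y \<in> opp p" "0 \<le> t" "t \<le> 1" unfolding cone_over_def by auto
    then have "x = (1 - t) *\<^sub>R p + t *\<^sub>R y" by (simp add: algebra_simps)
    then have "0 \<le> 1 - t \<and> 0 \<le> t \<and> 1 - t + t = 1 \<and> y \<in> opp p \<and> x = (1 - t) *\<^sub>R p + t *\<^sub>R y" using * by simp
    then show "x \<in> {x. \<exists>u\<ge>0. \<exists>v\<ge>0. \<exists>b. u + v = 1 \<and> b \<in> opp p \<and> x = u *\<^sub>R p + v *\<^sub>R b}" by blast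
  qed
  finally show ?thesis ..
qed

lemma unit_normal_nu:
  assumes p: "p \<in> V"
  shows "unit_normal (opp p) (nu p)"
  unfolding unit_normal_def
proof (intro conjI ballI nu_ht(1)[OF p])
  fix x y assume "x \<in> opp p" "y \<in> opp p"
  from nu_opp[OF p this(1)] nu_opp[OF p this(2)] show "nu p \<bullet> (x - y) = 0"
    by (simp add: inner_diff_right)
qed

lemma V_in_opp: "q \<in> V - {p} \<Longrightarrow> q \<in> opp p"
  unfolding opp_def by (rule hull_inc)

text \<open>Expand a direction around a vertex \<open>q0\<close> of the facet: only the vertex
  \<open>p\<close> contributes to \<open>m \<bullet> u\<close>, so \<open>m\<close> is determined by
  its product with \<open>q0 - p\<close>.\<close>

lemma unit_normal_unique:
  assumes p: "p \<in> V" and m: "unit_normal (opp p) m"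
  shows "m = nu p \<or> m = - nu p"
proof -
  obtain q0 where q0: "q0 \<in> V - {p}" using V_minus_nonempty by blast
  define \<kappa> where "\<kappa> = (m \<bullet> (q0 - p)) / ht p"
  have "m \<bullet> u = (\<kappa> *\<^sub>R nu p) \<bullet> u" for u
  proof -
    obtain c where c: "sum c V = 0" "u = (\<Sum>q\<in>V. c q *\<^sub>R q)" using bary_dir_ex by blast
    have "u = (\<Sum>q\<in>V. c q *\<^sub>R (q - q0))"
      using c by (simp add: scaleR_right_diff_distrib sum_subtractf scaleR_left.sum[symmetric])
    then have "m \<bullet> u = (\<Sum>q\<in>V. c q * (m \<bullet> (q - q0)))" by (simp add: inner_sum_right)
    also have "\<dots> = c p * (m \<bullet> (p - q0)) + (\<Sum>q\<in>V-{p}. c q * (m \<bullet> (q - q0)))" by (rule sum.remove[OF fin p])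
    also have "(\<Sum>q\<in>V-{p}. c q * (m \<bullet> (q - q0))) = 0"
      using m q0 V_in_opp unfolding unit_normal_def by (intro sum.neutral) auto
    finally have 1: "m \<bullet> u = - c p * (m \<bullet> (q0 - p))" by (simp add: inner_diff_right algebra_simps)
    have "nu p \<bullet> u = - c p * ht p" using sum_dir[OF p c(1)] c(2) by simp
    then show ?thesis using 1 nu_ht(2)[OF p] unfolding \<kappa>_def by simp
  qed
  then have mk: "m = \<kappa> *\<^sub>R nu p" by (metis vector_eq_rdot)
  then have "\<bar>\<kappa>\<bar> = 1" using m nu_ht(1)[OF p] unfolding unit_normal_def by simp
  then have "\<kappa> = 1 \<or> \<kappa> = -1" by linarith
  then show ?thesis using mk by auto
qed

lemma hyperplane_piece_opp: "p \<in> V \<Longrightarrow> hyperplane_piece (opp p) (nu p)"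
  unfolding hyperplane_piece_def
  using compact_opp opp_nonempty unit_normal_nu unit_normal_unique by blast

lemma nu_le:
  assumes p: "p \<in> V" and x: "x \<in> K" and y: "y \<in> opp p"
  shows "nu p \<bullet> (x - y) \<le> 0"
proof -
  have "0 \<le> lam p x" using K_lam x p by blast
  then have "nu p \<bullet> (x - p) \<le> ht p" unfolding lam_def using nu_ht(2)[OF p] by (simp add: field_simps)
  then show ?thesis using nu_opp[OF p y] by (simp add: inner_diff_right)
qed

text \<open>On pairs of points of the facet the defining inequality holds in both directions and
  forces a normal; the vertex \<open>p\<close> then decides the sign.\<close>

lemma outward_normal_opp:
  assumes p: "p \<in> V"
  shows "outward_normal K (opp p) = nu p"
  unfolding outward_normal_def
proof (rule the_equality)
  show "norm (nu p) = 1 \<and> (\<forall>x\<in>K. \<forall>y\<in>opp p. nu p \<bullet> (x - y) \<le> 0)"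
    by (intro conjI ballI nu_ht(1)[OF p] nu_le[OF p])
next
  fix m assume m: "norm m = 1 \<and> (\<forall>x\<in>K. \<forall>y\<in>opp p. m \<bullet> (x - y) \<le> 0)"
  have "m \<bullet> (x - y) = 0" if "x \<in> opp p" "y \<in> opp p" for x y
  proof -
    have "m \<bullet> (x - y) \<le> 0" "m \<bullet> (y - x) \<le> 0" using m that opp_subset[of p] by blast+
    then show ?thesis by (simp add: inner_diff_right)
  qed
  then have "unit_normal (opp p) m" unfolding unit_normal_def using m by blast
  then consider "m = nu p" | "m = - nu p" using unit_normal_unique[OF p] by blast
  then show "m = nu p"
  proof cases
    case 2
    obtain q where q: "q \<in> V - {p}" using V_minus_nonempty by blast
    have "m \<bullet> (p - q) \<le> 0" using m V_subset p V_in_opp[OF q] by blast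
    then have False using 2 nu_ht(2)[OF p] nu_ht(3)[OF p q] by (simp add: inner_diff_right)
    then show ?thesis ..
  qed
qed

lemma facet_K: "e facet_of K \<longleftrightarrow> (\<exists>p\<in>V. e = opp p)"
  unfolding K_def facet_of_convex_hull_affine_independent[OF indep] opp_def[symmetric]
  using opp_nonempty by blast

lemma extreme_opp: "x extreme_point_of opp p \<longleftrightarrow> x \<in> V - {p}"
proof -
  have "\<not> affine_dependent (V - {p})" using indep affine_dependent_subset by blast
  then show ?thesis unfolding opp_def by (rule extreme_point_of_convex_hull_affine_independent)
qed

lemma extreme_K: "x extreme_point_of K \<longleftrightarrow> x \<in> V"
  unfolding K_def by (rule extreme_point_of_convex_hull_affine_independent[OF indep])

text \<open>The vertex is recovered from its facet as the one extreme point of the simplex that the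
  facet misses.\<close>

lemma inj_opp: "inj_on opp V"
proof (rule inj_onI)
  fix p q assume pq: "p \<in> V" "q \<in> V" "opp p = opp q"
  have "p \<in> V - {p} \<longleftrightarrow> p \<in> V - {q}"
    using extreme_opp[of p p] extreme_opp[of p q] pq(3) by simp
  then show "p = q" using pq(1) by simp
qed

end

section \<open>Affine maps with explicit linear part\<close>

definition affine_map :: "('a::real_vector \<Rightarrow> 'b::real_vector) \<Rightarrow> ('a \<Rightarrow> 'b) \<Rightarrow> bool" where
  "affine_map W L \<longleftrightarrow> linear L \<and> (\<forall>x y. W x - W y = L (x - y))"

lemma affine_mapD:
  assumes "affine_map W L"
  shows "linear L" "W x - W y = L (x - y)" "W x = W y + L (x - y)"
  using assms unfolding affine_map_def by (auto simp: algebra_simps)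

lemma continuous_affine_map:
  fixes W :: "'a::euclidean_space \<Rightarrow> 'b::real_normed_vector"
  assumes "affine_map W L"
  shows "continuous_on S W"
proof -
  have "continuous_on S (\<lambda>x. W 0 + L (x - 0))"
    using linear_continuous_on[OF linear_conv_bounded_linear[THEN iffD1, OF affine_mapD(1)[OF assms]], of S]
    by (auto intro!: continuous_intros)
  then show ?thesis
    using continuous_on_cong[of S S W "\<lambda>x. W 0 + L (x - 0)"] affine_mapD(3)[OF assms, of _ 0] by blast
qed

lemma continuous_linear:
  fixes L :: "'a::euclidean_space \<Rightarrow> 'b::real_normed_vector"
  assumes "linear L"
  shows "continuous_on S (\<lambda>x. L (x - p))"
proof -
  have "continuous_on ((\<lambda>x. x - p) ` S) L"
    by (rule linear_continuous_on[OF linear_conv_bounded_linear[THEN iffD1, OF assms]])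
  then show ?thesis
    by (rule continuous_on_compose2) (auto intro!: continuous_intros)
qed

lemma norm2_add: "(norm (a + b))\<^sup>2 = (norm a)\<^sup>2 + 2 * (a \<bullet> b) + (norm (b::'a::real_inner))\<^sup>2"
  by (simp only: power2_norm_eq_inner inner_add_left inner_add_right inner_commute[of b a])

lemma affine_map_const: "affine_map (\<lambda>x. c) (\<lambda>x. 0)"
  by (simp add: affine_map_def linear_zero)

section \<open>Quadratic moments, trace and inverse inequalities on a simplex\<close>

context simplex_vertices
begin

lemma dim_ge_2: "2 \<le> (real CARD('n))" using card_n by auto

lemmas pos_opp = positive_functional_face[OF hyperplane_piece_opp]
lemmas pos_K = positive_functional_integral[OF compact_K]

lemma cone_quadratic_K:
  assumes p: "p \<in> V" and f: "continuous_on K f"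
    and ABC: "continuous_on (opp p) A" "continuous_on (opp p) B" "continuous_on (opp p) C"
    and fABC: "\<And>y t. y \<in> opp p \<Longrightarrow> f (p + t *\<^sub>R (y - p)) = A y + t * B y + t\<^sup>2 * C y"
  shows "(LINT x:K|lebesgue. f x) =
    ht p * (face_integral (opp p) A / real CARD('n) + face_integral (opp p) B / (real CARD('n) + 1) + face_integral (opp p) C / (real CARD('n) + 2))"
proof -
  have f': "continuous_on (cone_over p (opp p)) f" using f cone_K[OF p] by simp
  show ?thesis
    using cone_quadratic[OF card_n hyperplane_piece_opp[OF p] nu_ht(2)[OF p] nu_opp[OF p] f' ABC fABC]
    unfolding cone_K[OF p] by (simp add: add.commute)
qed

text \<open>Along the ray from \<open>p\<close> to \<open>y\<close> the map is
  \<open>W p + t L (y - p)\<close>, so its squared norm is quadratic in \<open>t\<close>.\<close>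

lemma integral_square_cone:
  fixes W :: "real^'n \<Rightarrow> 'b::euclidean_space"
  assumes p: "p \<in> V" and W: "affine_map W L"
  shows "(LINT x:K|lebesgue. (norm (W x))\<^sup>2) =
    ht p * face_integral (opp p) (\<lambda>y. (norm (W p))\<^sup>2 / real CARD('n) + 2 * (W p \<bullet> L (y - p)) / (real CARD('n) + 1) + (norm (L (y - p)))\<^sup>2 / (real CARD('n) + 2))"
proof -
  note cW = continuous_affine_map[OF W] note cL = continuous_linear[OF affine_mapD(1)[OF W]]
  note P = pos_opp[OF p]
  let ?A = "\<lambda>y::real^'n. (norm (W p))\<^sup>2" and ?B = "\<lambda>y. 2 * (W p \<bullet> L (y - p))" and ?C = "\<lambda>y. (norm (L (y - p)))\<^sup>2"
  have cA: "continuous_on (opp p) ?A" and cB: "continuous_on (opp p) ?B" and cC: "continuous_on (opp p) ?C"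
    by (intro continuous_intros cL)+
  have "(norm (W (p + t *\<^sub>R (y - p))))\<^sup>2 = ?A y + t * ?B y + t\<^sup>2 * ?C y" for y t
  proof -
    have "W (p + t *\<^sub>R (y - p)) = W p + t *\<^sub>R L (y - p)"
      using affine_mapD(3)[OF W, of "p + t *\<^sub>R (y - p)" p] linear_scale[OF affine_mapD(1)[OF W]] by simp
    then show ?thesis by (simp add: norm2_add power_mult_distrib)
  qed
  then have "(LINT x:K|lebesgue. (norm (W x))\<^sup>2) =
    ht p * (face_integral (opp p) ?A / real CARD('n) + face_integral (opp p) ?B / (real CARD('n) + 1) + face_integral (opp p) ?C / (real CARD('n) + 2))"
    by (intro cone_quadratic_K[OF p] cA cB cC) (intro continuous_intros cW)
  also have "face_integral (opp p) ?A / real CARD('n) = face_integral (opp p) (\<lambda>y. ?A y / real CARD('n))"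
    using positive_functional_cmult[OF P cA, of "1/(real CARD('n))"] by simp
  also have "face_integral (opp p) ?B / (real CARD('n) + 1) = face_integral (opp p) (\<lambda>y. ?B y / (real CARD('n) + 1))"
    using positive_functional_cmult[OF P cB, of "1/(real CARD('n) + 1)"] by simp
  also have "face_integral (opp p) ?C / (real CARD('n) + 2) = face_integral (opp p) (\<lambda>y. ?C y / (real CARD('n) + 2))"
    using positive_functional_cmult[OF P cC, of "1/(real CARD('n) + 2)"] by simp
  also have "face_integral (opp p) (\<lambda>y. ?A y / real CARD('n)) + face_integral (opp p) (\<lambda>y. ?B y / (real CARD('n) + 1)) =
    face_integral (opp p) (\<lambda>y. ?A y / real CARD('n) + ?B y / (real CARD('n) + 1))"
    by (rule positive_functional_add[OF P, symmetric]) (use dim_ge_2 in \<open>auto intro!: continuous_intros cL\<close>)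
  also have "\<dots> + face_integral (opp p) (\<lambda>y. ?C y / (real CARD('n) + 2)) =
    face_integral (opp p) (\<lambda>y. ?A y / real CARD('n) + ?B y / (real CARD('n) + 1) + ?C y / (real CARD('n) + 2))"
    by (rule positive_functional_add[OF P, symmetric]) (use dim_ge_2 in \<open>auto intro!: continuous_intros cL\<close>)
  finally show ?thesis .
qed

text \<open>Both sides are facet integrals of quadratic forms in \<open>W p\<close> and
  \<open>L (y - p)\<close>, so the estimate can be proved for each \<open>y\<close>
  separately.\<close>

lemma trace_inequality:
  fixes W :: "real^'n \<Rightarrow> 'b::euclidean_space"
  assumes p: "p \<in> V" and W: "affine_map W L"
  shows "ht p * face_integral (opp p) (\<lambda>y. (norm (W y))\<^sup>2) \<le> 2 * (real CARD('n) + 1) * (LINT x:K|lebesgue. (norm (W x))\<^sup>2)"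
proof -
  note cW = continuous_affine_map[OF W] note cL = continuous_linear[OF affine_mapD(1)[OF W]]
  note P = pos_opp[OF p]
  have pw: "1 / (2 * (real CARD('n) + 1)) * (norm (W y))\<^sup>2 \<le> (norm (W p))\<^sup>2 / real CARD('n) + 2 * (W p \<bullet> L (y - p)) / (real CARD('n) + 1) + (norm (L (y - p)))\<^sup>2 / (real CARD('n) + 2)" for y
  proof -
    let ?a = "W p" and ?b = "L (y - p)"
    \<comment> \<open>The constant \<open>2 (d + 1)\<close> is the one for which the difference of
      the two quadratic forms becomes a multiple of this perfect square.\<close>
    have "0 \<le> (norm ((real CARD('n) + 2) *\<^sub>R ?a + real CARD('n) *\<^sub>R ?b))\<^sup>2" by simp
    also have "\<dots> = (real CARD('n) + 2)\<^sup>2 * (norm ?a)\<^sup>2 + 2 * real CARD('n) * (real CARD('n) + 2) * (?a \<bullet> ?b) + (real CARD('n))\<^sup>2 * (norm ?b)\<^sup>2"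
      by (simp add: norm2_add power_mult_distrib)
    finally have "0 \<le> ((real CARD('n) + 2)\<^sup>2 * (norm ?a)\<^sup>2 + 2 * real CARD('n) * (real CARD('n) + 2) * (?a \<bullet> ?b) + (real CARD('n))\<^sup>2 * (norm ?b)\<^sup>2) / (2 * (real CARD('n) + 1) * real CARD('n) * (real CARD('n) + 2))"
      using dim_ge_2 by (intro divide_nonneg_nonneg) auto
    also have "\<dots> = (norm ?a)\<^sup>2 / real CARD('n) + 2 * (?a \<bullet> ?b) / (real CARD('n) + 1) + (norm ?b)\<^sup>2 / (real CARD('n) + 2) - 1 / (2 * (real CARD('n) + 1)) * ((norm ?a)\<^sup>2 + 2 * (?a \<bullet> ?b) + (norm ?b)\<^sup>2)"
      using dim_ge_2 by (simp add: divide_simps) (simp add: algebra_simps power2_eq_square)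
    also have "(norm ?a)\<^sup>2 + 2 * (?a \<bullet> ?b) + (norm ?b)\<^sup>2 = (norm (W y))\<^sup>2"
      using affine_mapD(3)[OF W, of y p] by (simp add: norm2_add)
    finally show ?thesis by simp
  qed
  have "1 / (2 * (real CARD('n) + 1)) * face_integral (opp p) (\<lambda>y. (norm (W y))\<^sup>2) =
    face_integral (opp p) (\<lambda>y. 1 / (2 * (real CARD('n) + 1)) * (norm (W y))\<^sup>2)"
    by (rule positive_functional_cmult[OF P, symmetric]) (intro continuous_intros cW)
  also have "\<dots> \<le> face_integral (opp p) (\<lambda>y. (norm (W p))\<^sup>2 / real CARD('n) + 2 * (W p \<bullet> L (y - p)) / (real CARD('n) + 1) + (norm (L (y - p)))\<^sup>2 / (real CARD('n) + 2))"
    by (rule positive_functional_mono[OF P _ _ pw]) (use dim_ge_2 in \<open>auto intro!: continuous_intros cW cL\<close>)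
  finally have "ht p * (1 / (2 * (real CARD('n) + 1)) * face_integral (opp p) (\<lambda>y. (norm (W y))\<^sup>2)) \<le> (LINT x:K|lebesgue. (norm (W x))\<^sup>2)"
    unfolding integral_square_cone[OF p W] using nu_ht(2)[OF p] by (intro mult_left_mono) auto
  then show ?thesis using dim_ge_2 by (simp add: field_simps)
qed

abbreviation vol :: real where "vol \<equiv> (LINT x:K|lebesgue. 1)"

lemma volume_face:
  assumes p: "p \<in> V"
  shows "real CARD('n) * vol = ht p * face_integral (opp p) (\<lambda>y. 1)"
proof -
  have "vol = ht p * (face_integral (opp p) (\<lambda>y. 1) / real CARD('n) + face_integral (opp p) (\<lambda>y. 0) / (real CARD('n) + 1) + face_integral (opp p) (\<lambda>y. 0) / (real CARD('n) + 2))"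
    by (rule cone_quadratic_K[OF p]) auto
  moreover have "face_integral (opp p) (\<lambda>y. 0::real) = 0"
    using positive_functional_const[OF pos_opp[OF p], of 0] by simp
  ultimately show ?thesis using dim_ge_2 by simp
qed

text \<open>Again pointwise on the facet: completing the square in \<open>L (y - p)\<close> leaves a
  fixed multiple of the squared norm at \<open>p\<close>, and the constant integrates to the volume
  by \<open>volume_face\<close>.\<close>

lemma vertex_value:
  fixes W :: "real^'n \<Rightarrow> 'b::euclidean_space"
  assumes p: "p \<in> V" and W: "affine_map W L"
  shows "(norm (W p))\<^sup>2 * vol \<le> (real CARD('n) + 1)\<^sup>2 * (LINT x:K|lebesgue. (norm (W x))\<^sup>2)"
proof -
  note cW = continuous_affine_map[OF W] note cL = continuous_linear[OF affine_mapD(1)[OF W]]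
  note P = pos_opp[OF p]
  have pw: "(norm (W p))\<^sup>2 / (real CARD('n) * (real CARD('n) + 1)\<^sup>2) \<le> (norm (W p))\<^sup>2 / real CARD('n) + 2 * (W p \<bullet> L (y - p)) / (real CARD('n) + 1) + (norm (L (y - p)))\<^sup>2 / (real CARD('n) + 2)" for y
  proof -
    let ?a = "W p" and ?b = "L (y - p)"
    have "0 \<le> (norm ((real CARD('n) + 2) *\<^sub>R ?a + (real CARD('n) + 1) *\<^sub>R ?b))\<^sup>2" by simp
    also have "\<dots> = (real CARD('n) + 2)\<^sup>2 * (norm ?a)\<^sup>2 + 2 * (real CARD('n) + 1) * (real CARD('n) + 2) * (?a \<bullet> ?b) + (real CARD('n) + 1)\<^sup>2 * (norm ?b)\<^sup>2"
      by (simp add: norm2_add power_mult_distrib)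
    finally have "0 \<le> ((real CARD('n) + 2)\<^sup>2 * (norm ?a)\<^sup>2 + 2 * (real CARD('n) + 1) * (real CARD('n) + 2) * (?a \<bullet> ?b) + (real CARD('n) + 1)\<^sup>2 * (norm ?b)\<^sup>2) / ((real CARD('n) + 1)\<^sup>2 * (real CARD('n) + 2))"
      using dim_ge_2 by (intro divide_nonneg_nonneg) auto
    also have "\<dots> = (norm ?a)\<^sup>2 / real CARD('n) + 2 * (?a \<bullet> ?b) / (real CARD('n) + 1) + (norm ?b)\<^sup>2 / (real CARD('n) + 2) - (norm ?a)\<^sup>2 / (real CARD('n) * (real CARD('n) + 1)\<^sup>2)"
      using dim_ge_2 by (simp add: divide_simps) (simp add: algebra_simps power2_eq_square)
    finally show ?thesis by simp
  qed
  have "(norm (W p))\<^sup>2 / (real CARD('n) * (real CARD('n) + 1)\<^sup>2) * face_integral (opp p) (\<lambda>y. 1) = face_integral (opp p) (\<lambda>y. (norm (W p))\<^sup>2 / (real CARD('n) * (real CARD('n) + 1)\<^sup>2))"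
    by (rule positive_functional_const[OF P, symmetric])
  also have "\<dots> \<le> face_integral (opp p) (\<lambda>y. (norm (W p))\<^sup>2 / real CARD('n) + 2 * (W p \<bullet> L (y - p)) / (real CARD('n) + 1) + (norm (L (y - p)))\<^sup>2 / (real CARD('n) + 2))"
    by (rule positive_functional_mono[OF P _ _ pw]) (use dim_ge_2 in \<open>auto intro!: continuous_intros cW cL\<close>)
  finally have "ht p * ((norm (W p))\<^sup>2 / (real CARD('n) * (real CARD('n) + 1)\<^sup>2) * face_integral (opp p) (\<lambda>y. 1)) \<le> (LINT x:K|lebesgue. (norm (W x))\<^sup>2)"
    unfolding integral_square_cone[OF p W] using nu_ht(2)[OF p] by (intro mult_left_mono) auto
  also have "ht p * ((norm (W p))\<^sup>2 / (real CARD('n) * (real CARD('n) + 1)\<^sup>2) * face_integral (opp p) (\<lambda>y. 1)) = (norm (W p))\<^sup>2 / (real CARD('n) * (real CARD('n) + 1)\<^sup>2) * (real CARD('n) * vol)"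
    unfolding volume_face[OF p] by simp
  finally show ?thesis using dim_ge_2 by (simp add: field_simps)
qed

text \<open>The divergence theorem for the field \<open>|W|\<^sup>2 (x - x0)\<close>: if \<open>x0\<close> is a vertex, only the
  opposite facet contributes, and the general case is an affine combination of these.\<close>

lemma divergence_vertex:
  fixes W :: "real^'n \<Rightarrow> 'b::euclidean_space"
  assumes p: "p \<in> V" and W: "affine_map W L"
  shows "(LINT x:K|lebesgue. (real CARD('n)) * (norm (W x))\<^sup>2 + 2 * (W x \<bullet> L (x - p))) = ht p * face_integral (opp p) (\<lambda>y. (norm (W y))\<^sup>2)"
proof -
  note cW = continuous_affine_map[OF W] note cL = continuous_linear[OF affine_mapD(1)[OF W]]
  note P = pos_opp[OF p]
  let ?A = "\<lambda>y::real^'n. (norm (W p))\<^sup>2" and ?B = "\<lambda>y. 2 * (W p \<bullet> L (y - p))" and ?C = "\<lambda>y. (norm (L (y - p)))\<^sup>2"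
  have c: "continuous_on (opp p) ?A" "continuous_on (opp p) ?B" "continuous_on (opp p) ?C"
    by (intro continuous_intros cL)+
  \<comment> \<open>The factors \<open>d\<close>, \<open>d + 1\<close>, \<open>d + 2\<close> cancel
    the denominators of the cone moments, so that the three pieces reassemble to the squared norm of
    \<open>W\<close> on the facet.\<close>
  have eq: "real CARD('n) * (norm (W (p + t *\<^sub>R (y - p))))\<^sup>2 + 2 * (W (p + t *\<^sub>R (y - p)) \<bullet> L (p + t *\<^sub>R (y - p) - p))
    = (real CARD('n)) * ?A y + t * ((real CARD('n) + 1) * ?B y) + t\<^sup>2 * ((real CARD('n) + 2) * ?C y)" for y t
  proof -
    have "W (p + t *\<^sub>R (y - p)) = W p + t *\<^sub>R L (y - p)"
      using affine_mapD(3)[OF W, of "p + t *\<^sub>R (y - p)" p] linear_scale[OF affine_mapD(1)[OF W]] by simp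
    moreover have "L (p + t *\<^sub>R (y - p) - p) = t *\<^sub>R L (y - p)"
      using linear_scale[OF affine_mapD(1)[OF W]] by simp
    ultimately show ?thesis
      by (simp add: norm2_add power_mult_distrib inner_add_left power2_norm_eq_inner[of "L _"] del: inner_eq_zero_iff)
         (simp add: algebra_simps power2_eq_square)
  qed
  have "(LINT x:K|lebesgue. (real CARD('n)) * (norm (W x))\<^sup>2 + 2 * (W x \<bullet> L (x - p))) =
    ht p * (face_integral (opp p) (\<lambda>y. (real CARD('n)) * ?A y) / real CARD('n) + face_integral (opp p) (\<lambda>y. (real CARD('n) + 1) * ?B y) / (real CARD('n) + 1)
      + face_integral (opp p) (\<lambda>y. (real CARD('n) + 2) * ?C y) / (real CARD('n) + 2))"
    by (rule cone_quadratic_K[OF p _ _ _ _ eq]) (auto intro!: continuous_intros cW cL)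
  also have "\<dots> = ht p * (face_integral (opp p) ?A + face_integral (opp p) ?B + face_integral (opp p) ?C)"
    using dim_ge_2 by (simp only: positive_functional_cmult[OF P] c) simp
  also have "face_integral (opp p) ?A + face_integral (opp p) ?B + face_integral (opp p) ?C = face_integral (opp p) (\<lambda>y. ?A y + ?B y + ?C y)"
    by (simp only: positive_functional_add[OF P] c continuous_on_add)
  also have "(\<lambda>y. ?A y + ?B y + ?C y) = (\<lambda>y. (norm (W y))\<^sup>2)"
  proof (rule ext)
    fix y show "?A y + ?B y + ?C y = (norm (W y))\<^sup>2"
      unfolding affine_mapD(3)[OF W, of y p] norm2_add by simp
  qed
  finally show ?thesis .
qed

text \<open>Both sides are the signed distance of \<open>x0\<close> from the plane of the facet, the
  quantity that star-shapedness bounds below on the boundary.\<close>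

lemma nu_opp_base:
  assumes p: "p \<in> V" and y: "y \<in> opp p"
  shows "nu p \<bullet> (y - x0) = ht p * lam p x0"
proof -
  have "nu p \<bullet> (y - x0) = nu p \<bullet> (y - p) - nu p \<bullet> (x0 - p)" by (simp add: inner_diff_right)
  also have "\<dots> = ht p * lam p x0" unfolding nu_opp[OF p y] lam_def using nu_ht(2)[OF p] by (simp add: field_simps)
  finally show ?thesis .
qed

lemma divergence:
  fixes W :: "real^'n \<Rightarrow> 'b::euclidean_space"
  assumes W: "affine_map W L"
  shows "real CARD('n) * (LINT x:K|lebesgue. (norm (W x))\<^sup>2) + 2 * (LINT x:K|lebesgue. W x \<bullet> L (x - x0)) =
    (\<Sum>p\<in>V. ht p * lam p x0 * face_integral (opp p) (\<lambda>y. (norm (W y))\<^sup>2))"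
proof -
  note cW = continuous_affine_map[OF W] note cL = continuous_linear[OF affine_mapD(1)[OF W]]
  let ?f = "\<lambda>p x. (real CARD('n)) * (norm (W x))\<^sup>2 + 2 * (W x \<bullet> L (x - p))"
  \<comment> \<open>The barycentric coordinates of \<open>x0\<close> sum to one and reproduce
    \<open>x0\<close>, also when \<open>x0\<close> lies outside \<open>K\<close> and some of them
    are negative.\<close>
  have Lx: "L (x - x0) = (\<Sum>p\<in>V. lam p x0 *\<^sub>R L (x - p))" for x
  proof -
    have "x - x0 = (\<Sum>p\<in>V. lam p x0 *\<^sub>R (x - p))"
      using lam_sum[of x0] by (simp add: scaleR_right_diff_distrib sum_subtractf scaleR_left.sum[symmetric])
    then show ?thesis by (simp add: linear_sum[OF affine_mapD(1)[OF W]] linear_scale[OF affine_mapD(1)[OF W]])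
  qed
  have "real CARD('n) * (norm (W x))\<^sup>2 + 2 * (W x \<bullet> L (x - x0)) = (\<Sum>p\<in>V. lam p x0 * ?f p x)" for x
  proof -
    have "(\<Sum>p\<in>V. lam p x0 * ?f p x) = (\<Sum>p\<in>V. lam p x0) * (real CARD('n) * (norm (W x))\<^sup>2) + 2 * (\<Sum>p\<in>V. lam p x0 * (W x \<bullet> L (x - p)))"
      by (simp add: distrib_left sum.distrib sum_distrib_left sum_distrib_right mult.commute mult.left_commute)
    also have "(\<Sum>p\<in>V. lam p x0 * (W x \<bullet> L (x - p))) = W x \<bullet> L (x - x0)"
      unfolding Lx by (simp add: inner_sum_right)
    finally show ?thesis using lam_sum(1) by simp
  qed
  then have "(LINT x:K|lebesgue. (real CARD('n)) * (norm (W x))\<^sup>2 + 2 * (W x \<bullet> L (x - x0))) = (LINT x:K|lebesgue. (\<Sum>p\<in>V. lam p x0 * ?f p x))"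
    by simp
  also have "\<dots> = (\<Sum>p\<in>V. LINT x:K|lebesgue. lam p x0 * ?f p x)"
    by (rule positive_functional_sum[OF pos_K fin]) (intro continuous_intros cW cL)
  also have "\<dots> = (\<Sum>p\<in>V. lam p x0 * (LINT x:K|lebesgue. ?f p x))"
    by simp
  also have "\<dots> = (\<Sum>p\<in>V. ht p * lam p x0 * face_integral (opp p) (\<lambda>y. (norm (W y))\<^sup>2))"
    by (intro sum.cong refl) (simp add: divergence_vertex[OF _ W])
  also have "(LINT x:K|lebesgue. (real CARD('n)) * (norm (W x))\<^sup>2 + 2 * (W x \<bullet> L (x - x0))) =
    (LINT x:K|lebesgue. (real CARD('n)) * (norm (W x))\<^sup>2) + (LINT x:K|lebesgue. 2 * (W x \<bullet> L (x - x0)))"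
    by (rule positive_functional_add[OF pos_K]) (intro continuous_intros cW cL)+
  also have "\<dots> = (real CARD('n)) * (LINT x:K|lebesgue. (norm (W x))\<^sup>2) + 2 * (LINT x:K|lebesgue. W x \<bullet> L (x - x0))"
    by simp
  finally show ?thesis .
qed

text \<open>A direction is a combination of the vertices with coefficients of sum zero; each is at
  most \<open>norm u / r\<close>, since times the height it is up to sign a normal component of
  \<open>u\<close>. Then \<open>L u\<close> is the same combination of the vertex values, which
  \<open>vertex_value\<close> bounds. One factor \<open>d + 1\<close> is Cauchy-Schwarz over the
  vertices, three come from adding up their bounds.\<close>

lemma inverse_inequality:
  fixes W :: "real^'n \<Rightarrow> 'b::euclidean_space"
  assumes W: "affine_map W L" and r: "r > 0" "\<And>p. p \<in> V \<Longrightarrow> r \<le> ht p"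
  shows "(norm (L u))\<^sup>2 * vol \<le> (real CARD('n) + 1) ^ 4 / r\<^sup>2 * (norm u)\<^sup>2 * (LINT x:K|lebesgue. (norm (W x))\<^sup>2)"
proof -
  obtain c where c: "sum c V = 0" "u = (\<Sum>q\<in>V. c q *\<^sub>R q)" using bary_dir_ex[of u] by (elim exE conjE)
  have cb: "\<bar>c p\<bar> \<le> norm u / r" if p: "p \<in> V" for p
  proof -
    have "nu p \<bullet> u = - c p * ht p" using sum_dir[OF p c(1)] c(2) by simp
    then have "\<bar>c p\<bar> * ht p = \<bar>nu p \<bullet> u\<bar>" using nu_ht(2)[OF p] by (simp add: abs_mult)
    also have "\<dots> \<le> norm (nu p) * norm u" by (rule Cauchy_Schwarz_ineq2)
    finally have "\<bar>c p\<bar> * ht p \<le> norm u" using nu_ht(1)[OF p] by simp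
    moreover have "\<bar>c p\<bar> * r \<le> \<bar>c p\<bar> * ht p" using r(2)[OF p] by (intro mult_left_mono) auto
    ultimately show ?thesis using r(1) by (simp add: pos_le_divide_eq)
  qed
  obtain q0 where q0: "q0 \<in> V" using V_minus_nonempty by blast
  have "u = (\<Sum>q\<in>V. c q *\<^sub>R (q - q0))"
    using c by (simp add: scaleR_right_diff_distrib sum_subtractf scaleR_left.sum[symmetric])
  then have "L u = (\<Sum>q\<in>V. c q *\<^sub>R L (q - q0))"
    by (simp add: linear_sum[OF affine_mapD(1)[OF W]] linear_scale[OF affine_mapD(1)[OF W]])
  also have "\<dots> = (\<Sum>q\<in>V. c q *\<^sub>R W q) - sum c V *\<^sub>R W q0"
    unfolding affine_mapD(2)[OF W, symmetric] by (simp add: scaleR_right_diff_distrib sum_subtractf scaleR_left.sum)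
  finally have Lu: "L u = (\<Sum>q\<in>V. c q *\<^sub>R W q)" using c(1) by simp
  have "norm (L u) \<le> (\<Sum>q\<in>V. norm u / r * norm (W q))"
    unfolding Lu norm_scaleR by (rule sum_norm_le) (simp only: norm_scaleR, intro mult_right_mono cb norm_ge_zero)
  also have "\<dots> = norm u / r * (\<Sum>q\<in>V. norm (W q))" by (rule sum_distrib_left[symmetric])
  finally have "(norm (L u))\<^sup>2 \<le> (norm u / r * (\<Sum>q\<in>V. norm (W q)))\<^sup>2" by (intro power_mono) auto
  also have "\<dots> = (norm u)\<^sup>2 / r\<^sup>2 * (\<Sum>q\<in>V. norm (W q))\<^sup>2" by (simp add: power_mult_distrib power_divide)
  also have "\<dots> \<le> (norm u)\<^sup>2 / r\<^sup>2 * ((real CARD('n) + 1) * (\<Sum>q\<in>V. (norm (W q))\<^sup>2))"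
    using sum_squared_le_sum_of_squares[of "\<lambda>q. norm (W q)" V] fin card_V
    by (intro mult_left_mono) (simp_all add: add.commute mult.commute)
  finally have 1: "(norm (L u))\<^sup>2 \<le> (norm u)\<^sup>2 / r\<^sup>2 * ((real CARD('n) + 1) * (\<Sum>q\<in>V. (norm (W q))\<^sup>2))" .
  have vol0: "0 \<le> vol" by (rule positive_functional_nonneg[OF pos_K]) auto
  have "(\<Sum>q\<in>V. (norm (W q))\<^sup>2) * vol \<le> (\<Sum>q\<in>V. (real CARD('n) + 1)\<^sup>2 * (LINT x:K|lebesgue. (norm (W x))\<^sup>2))"
    unfolding sum_distrib_right by (intro sum_mono vertex_value[OF _ W])
  also have "\<dots> = (real CARD('n) + 1) ^ 3 * (LINT x:K|lebesgue. (norm (W x))\<^sup>2)"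
    using card_V by (simp add: power3_eq_cube power2_eq_square add.commute)
  finally have 2: "(\<Sum>q\<in>V. (norm (W q))\<^sup>2) * vol \<le> (real CARD('n) + 1) ^ 3 * (LINT x:K|lebesgue. (norm (W x))\<^sup>2)" .
  have "(norm (L u))\<^sup>2 * vol \<le> ((norm u)\<^sup>2 / r\<^sup>2 * ((real CARD('n) + 1) * (\<Sum>q\<in>V. (norm (W q))\<^sup>2))) * vol"
    by (rule mult_right_mono[OF 1 vol0])
  also have "\<dots> = (norm u)\<^sup>2 / r\<^sup>2 * (real CARD('n) + 1) * ((\<Sum>q\<in>V. (norm (W q))\<^sup>2) * vol)" by simp
  also have "\<dots> \<le> (norm u)\<^sup>2 / r\<^sup>2 * (real CARD('n) + 1) * ((real CARD('n) + 1) ^ 3 * (LINT x:K|lebesgue. (norm (W x))\<^sup>2))"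
    by (intro mult_left_mono[OF 2]) simp
  also have "\<dots> = (real CARD('n) + 1) ^ 4 / r\<^sup>2 * (norm u)\<^sup>2 * (LINT x:K|lebesgue. (norm (W x))\<^sup>2)"
    by (simp add: power4_eq_xxxx power3_eq_cube)
  finally show ?thesis .
qed

text \<open>Apply the inverse inequality to the affine map that agrees with \<open>J\<close> on the facet and vanishes
  at the opposite vertex.\<close>

lemma tangential_inverse_inequality:
  fixes J :: "real^'n \<Rightarrow> 'b::euclidean_space"
  assumes p: "p \<in> V" and J: "affine_map J L" and r: "r > 0" "\<And>p. p \<in> V \<Longrightarrow> r \<le> ht p"
    and u: "nu p \<bullet> u = 0"
  shows "(norm (L u))\<^sup>2 * face_integral (opp p) (\<lambda>y. 1) \<le> (real CARD('n) + 1) ^ 4 / r\<^sup>2 * (norm u)\<^sup>2 * face_integral (opp p) (\<lambda>y. (norm (J y))\<^sup>2)"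
proof -
  \<comment> \<open>\<open>lam p\<close> is 1 at the vertex and 0 on the facet, so the subtraction
    removes the value at \<open>p\<close> and nothing on the facet.\<close>
  define J' where "J' = (\<lambda>x. J x - lam p x *\<^sub>R J p)"
  define L' where "L' = (\<lambda>u. L u + (nu p \<bullet> u / ht p) *\<^sub>R J p)"
  have "linear L'" unfolding L'_def
    by (intro linearI) (auto simp: linear_add[OF affine_mapD(1)[OF J]] linear_scale[OF affine_mapD(1)[OF J]]
      inner_add_right add_divide_distrib algebra_simps)
  moreover have "J' x - J' y = L' (x - y)" for x y
    unfolding J'_def L'_def lam_def affine_mapD(2)[OF J, symmetric]
    by (simp add: inner_diff_right diff_divide_distrib algebra_simps)
  ultimately have J': "affine_map J' L'" unfolding affine_map_def by blast
  note cL = continuous_linear[OF affine_mapD(1)[OF J']]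
  have J'p: "J' p = 0" unfolding J'_def lam_def by simp
  have P: "positive_functional (opp p) (face_integral (opp p))" by (rule pos_opp[OF p])
  have J'y: "L' (y - p) = J y" if "y \<in> opp p" for y
  proof -
    have "J' y = J y" unfolding J'_def lam_def using nu_opp[OF p that] nu_ht(2)[OF p] by simp
    then show ?thesis using affine_mapD(2)[OF J', of y p] J'p by simp
  qed
  have "(LINT x:K|lebesgue. (norm (J' x))\<^sup>2) = ht p * face_integral (opp p) (\<lambda>y. (norm (L' (y - p)))\<^sup>2 / (real CARD('n) + 2))"
    unfolding integral_square_cone[OF p J'] J'p by simp
  also have "face_integral (opp p) (\<lambda>y. (norm (L' (y - p)))\<^sup>2 / (real CARD('n) + 2)) = face_integral (opp p) (\<lambda>y. 1/(real CARD('n) + 2) * (norm (J y))\<^sup>2)"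
    by (rule positive_functional_cong[OF P]) (use J'y dim_ge_2 in \<open>auto intro!: continuous_intros cL continuous_affine_map[OF J]\<close>)
  also have "\<dots> = 1/(real CARD('n) + 2) * face_integral (opp p) (\<lambda>y. (norm (J y))\<^sup>2)"
    by (rule positive_functional_cmult[OF P]) (intro continuous_intros continuous_affine_map[OF J])
  finally have int: "(LINT x:K|lebesgue. (norm (J' x))\<^sup>2) = ht p / (real CARD('n) + 2) * face_integral (opp p) (\<lambda>y. (norm (J y))\<^sup>2)" by simp
  \<comment> \<open>The correction in \<open>L'\<close> is a multiple of
    \<open>nu p \<bullet> u\<close>, which vanishes for tangential \<open>u\<close>.\<close>
  have "L' u = L u" unfolding L'_def using u by simp
  from inverse_inequality[OF J' r, of u, unfolded this int]
  have "(norm (L u))\<^sup>2 * vol \<le> (real CARD('n) + 1) ^ 4 / r\<^sup>2 * (norm u)\<^sup>2 * (ht p / (real CARD('n) + 2) * face_integral (opp p) (\<lambda>y. (norm (J y))\<^sup>2))" .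
  then have "real CARD('n) * ((norm (L u))\<^sup>2 * vol) \<le> (real CARD('n)) * ((real CARD('n) + 1) ^ 4 / r\<^sup>2 * (norm u)\<^sup>2 * (ht p / (real CARD('n) + 2) * face_integral (opp p) (\<lambda>y. (norm (J y))\<^sup>2)))"
    using dim_ge_2 by (intro mult_left_mono) auto
  moreover have "real CARD('n) * ((norm (L u))\<^sup>2 * vol) = ht p * ((norm (L u))\<^sup>2 * face_integral (opp p) (\<lambda>y. 1))"
    using volume_face[OF p] by (simp add: algebra_simps)
  moreover have "real CARD('n) * ((real CARD('n) + 1) ^ 4 / r\<^sup>2 * (norm u)\<^sup>2 * (ht p / (real CARD('n) + 2) * face_integral (opp p) (\<lambda>y. (norm (J y))\<^sup>2)))
    = ht p * (real CARD('n) / (real CARD('n) + 2) * ((real CARD('n) + 1) ^ 4 / r\<^sup>2 * (norm u)\<^sup>2 * face_integral (opp p) (\<lambda>y. (norm (J y))\<^sup>2)))"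
    by (simp add: ac_simps)
  ultimately have "ht p * ((norm (L u))\<^sup>2 * face_integral (opp p) (\<lambda>y. 1)) \<le> ht p * (real CARD('n) / (real CARD('n) + 2) * ((real CARD('n) + 1) ^ 4 / r\<^sup>2 * (norm u)\<^sup>2 * face_integral (opp p) (\<lambda>y. (norm (J y))\<^sup>2)))"
    by (simp only:)
  then have "(norm (L u))\<^sup>2 * face_integral (opp p) (\<lambda>y. 1) \<le> (real CARD('n)) / (real CARD('n) + 2) * ((real CARD('n) + 1) ^ 4 / r\<^sup>2 * (norm u)\<^sup>2 * face_integral (opp p) (\<lambda>y. (norm (J y))\<^sup>2))"
    using nu_ht(2)[OF p] by (simp only: mult_le_cancel_left_pos)
  also have "\<dots> \<le> 1 * ((real CARD('n) + 1) ^ 4 / r\<^sup>2 * (norm u)\<^sup>2 * face_integral (opp p) (\<lambda>y. (norm (J y))\<^sup>2))"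
  proof (rule mult_right_mono)
    have "0 \<le> face_integral (opp p) (\<lambda>y. (norm (J y))\<^sup>2)"
      by (rule positive_functional_nonneg[OF P]) (auto intro!: continuous_intros continuous_affine_map[OF J])
    then show "0 \<le> (real CARD('n) + 1) ^ 4 / r\<^sup>2 * (norm u)\<^sup>2 * face_integral (opp p) (\<lambda>y. (norm (J y))\<^sup>2)"
      by simp
  qed (use dim_ge_2 in simp)
  finally show ?thesis by simp
qed

end

section \<open>Minimal angles and heights\<close>

lemma vec_angle_ge_imp:
  fixes u v :: "real^'n"
  assumes "u \<noteq> 0" "v \<noteq> 0" "0 \<le> \<theta>" "\<theta> \<le> pi" "\<theta> \<le> vec_angle u v"
  shows "u \<bullet> v \<le> cos \<theta> * (norm u * norm v)"
proof -
  have n: "norm u * norm v > 0" using assms(1,2) by simp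
  have b: "\<bar>u \<bullet> v / (norm u * norm v)\<bar> \<le> 1"
    using Cauchy_Schwarz_ineq2[of u v] n by (simp add: abs_mult)
  then have b': "- 1 \<le> u \<bullet> v / (norm u * norm v)" "u \<bullet> v / (norm u * norm v) \<le> 1" by linarith+
  have "cos (vec_angle u v) \<le> cos \<theta>"
    using assms(3-5) arccos_ubound[OF b'] unfolding vec_angle_def by (intro cos_monotone_0_pi_le) auto
  then have "u \<bullet> v / (norm u * norm v) \<le> cos \<theta>"
    unfolding vec_angle_def using b' by (simp add: cos_arccos)
  then show ?thesis using n by (simp add: pos_divide_le_eq)
qed

text \<open>The squared distance of \<open>u\<close> from the line spanned by \<open>v\<close> is
  \<open>|u|^2 - (u \<bullet> v)^2 / |v|^2\<close>; the sign condition allows the upper bound on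
  \<open>u \<bullet> v\<close> to be squared.\<close>

lemma dist_line_acute:
  fixes u v :: "'a::real_inner"
  assumes "v \<noteq> 0" "0 \<le> u \<bullet> v" "u \<bullet> v \<le> c * (norm u * norm v)"
  shows "(1 - c\<^sup>2) * (norm u)\<^sup>2 \<le> (norm (u - t *\<^sub>R v))\<^sup>2"
proof -
  let ?x = "u \<bullet> v" and ?U = "(norm u)\<^sup>2" and ?V = "(norm v)\<^sup>2"
  have V: "?V > 0" using assms(1) by simp
  have "?x\<^sup>2 \<le> (c * (norm u * norm v))\<^sup>2" using assms(2,3) by (intro power_mono) auto
  then have x2: "?x\<^sup>2 \<le> c\<^sup>2 * ?U * ?V" by (simp add: power_mult_distrib mult.assoc)
  have e: "(norm (u - t *\<^sub>R v))\<^sup>2 = ?U - 2 * t * ?x + t\<^sup>2 * ?V"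
    using norm2_add[of u "- (t *\<^sub>R v)"] by (simp add: power_mult_distrib)
  have "?V * (norm (u - t *\<^sub>R v))\<^sup>2 = (?x - t * ?V)\<^sup>2 + ?U * ?V - ?x\<^sup>2"
    unfolding e by (simp add: algebra_simps power2_eq_square)
  also have "\<dots> \<ge> ?U * ?V - c\<^sup>2 * ?U * ?V"
    using x2 zero_le_power2[of "?x - t * ?V"] by linarith
  finally have "?V * ((1 - c\<^sup>2) * ?U) \<le> ?V * (norm (u - t *\<^sub>R v))\<^sup>2" by (simp add: algebra_simps)
  then show ?thesis using V by (simp only: mult_le_cancel_left_pos)
qed

text \<open>If the angle at \<open>A\<close> is obtuse then the one at \<open>C\<close> is acute and \<open>BC\<close> is longer than \<open>AB\<close>.\<close>

lemma dist_line_triangle: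
  fixes A B C :: "real^'n"
  assumes d: "A \<noteq> B" "A \<noteq> C" "B \<noteq> C" and th: "0 < \<theta>" "\<theta> \<le> 1"
    and A: "\<theta> \<le> vec_angle (B - A) (C - A)" and C: "\<theta> \<le> vec_angle (A - C) (B - C)"
  shows "sin \<theta> * norm (B - A) \<le> norm (B - (A + t *\<^sub>R (C - A)))"
proof -
  have thpi: "0 \<le> \<theta>" "\<theta> \<le> pi" using th pi_gt3 by auto
  have sc: "1 - (cos \<theta>)\<^sup>2 = (sin \<theta>)\<^sup>2" by (simp add: sin_squared_eq)
  let ?u = "B - A" and ?v = "C - A"
  have "(sin \<theta>)\<^sup>2 * (norm ?u)\<^sup>2 \<le> (norm (?u - t *\<^sub>R ?v))\<^sup>2"
  proof (cases "0 \<le> ?u \<bullet> ?v")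
    case True
    have "?u \<bullet> ?v \<le> cos \<theta> * (norm ?u * norm ?v)"
      using d thpi A by (intro vec_angle_ge_imp) auto
    from dist_line_acute[OF _ True this, of t] show ?thesis using d sc by simp
  next
    case False
    let ?w = "B - C" and ?z = "A - C"
    have wz: "?w \<bullet> ?z = ?v \<bullet> ?v - ?u \<bullet> ?v" by (simp add: algebra_simps inner_commute)
    then have pos: "0 \<le> ?w \<bullet> ?z" using False inner_ge_zero[of ?v] by linarith
    have "?z \<bullet> ?w \<le> cos \<theta> * (norm ?z * norm ?w)"
      using d thpi C by (intro vec_angle_ge_imp) auto
    then have "?w \<bullet> ?z \<le> cos \<theta> * (norm ?w * norm ?z)" by (simp add: inner_commute mult.commute)
    from dist_line_acute[OF _ pos this, of "1 - t"]
    have 1: "(sin \<theta>)\<^sup>2 * (norm ?w)\<^sup>2 \<le> (norm (?w - (1 - t) *\<^sub>R ?z))\<^sup>2" using d sc by simp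
    \<comment> \<open>The same point of the line \<open>AC\<close>, now measured from
      \<open>C\<close>; hence the parameter \<open>1 - t\<close>.\<close>
    have 2: "?w - (1 - t) *\<^sub>R ?z = ?u - t *\<^sub>R ?v" by (simp add: algebra_simps)
    have "(norm ?w)\<^sup>2 = (norm ?u)\<^sup>2 - 2 * (?u \<bullet> ?v) + (norm ?v)\<^sup>2"
      by (simp add: power2_norm_eq_inner algebra_simps inner_commute)
    then have "(norm ?u)\<^sup>2 \<le> (norm ?w)\<^sup>2" using False by (smt (verit) zero_le_power2)
    then have "(sin \<theta>)\<^sup>2 * (norm ?u)\<^sup>2 \<le> (sin \<theta>)\<^sup>2 * (norm ?w)\<^sup>2" by (intro mult_left_mono) auto
    then show ?thesis using 1 unfolding 2 by linarith
  qed
  also have "?u - t *\<^sub>R ?v = B - (A + t *\<^sub>R (C - A))" by simp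
  finally have "(sin \<theta> * norm ?u)\<^sup>2 \<le> (norm (B - (A + t *\<^sub>R (C - A))))\<^sup>2" by (simp only: power_mult_distrib)
  then show ?thesis by (rule power2_le_imp_le) simp
qed

context simplex_vertices
begin

text \<open>The barycentric coordinates sum to one, so their gradients \<open>- nu q / ht q\<close>
  sum to zero.\<close>

lemma normals_sum: "(\<Sum>q\<in>V. (nu q \<bullet> u) / ht q) = 0"
proof -
  have "(\<Sum>q\<in>V. lam q 0) - (\<Sum>q\<in>V. lam q u) = 0" using lam_sum(1)[of 0] lam_sum(1)[of u] by simp
  then have "(\<Sum>q\<in>V. lam q 0 - lam q u) = 0" by (simp add: sum_subtractf)
  moreover have "lam q 0 - lam q u = (nu q \<bullet> u) / ht q" for q
    unfolding lam_def by (simp add: inner_diff_right diff_divide_distrib)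
  ultimately show ?thesis by simp
qed

text \<open>Put \<open>s = sin \<theta>\<close>. The plane angles make all edges comparable with
  those at \<open>p\<close>, at the price \<open>s^2\<close>; the other \<open>s^2\<close> compares
  an edge at \<open>p\<close> with the height. In a triangle the height is the distance of
  \<open>p\<close> from the opposite side. In a tetrahedron it is the distance of \<open>p\<close>
  from an edge of the opposite facet times the sine of a dihedral angle; that angle is taken acute,
  for then being at least \<theta> bounds its sine below.\<close>

lemma height_lower_bound:
  assumes th: "0 < \<theta>" "\<theta> \<le> 1" and ang: "angles_at_least \<theta> K" and p: "p \<in> V"
  shows "(sin \<theta>) ^ 4 * diameter K \<le> ht p"
proof -
  define s where "s = sin \<theta>"
  have s: "0 < s" "s \<le> 1" unfolding s_def using th pi_gt3 by (auto intro: sin_gt_zero)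
  have plane: "\<theta> \<le> vec_angle (b - a) (c - a)" if "a \<in> V" "b \<in> V" "c \<in> V" "a \<noteq> b" "b \<noteq> c" "a \<noteq> c" for a b c
    using ang that unfolding angles_at_least_def extreme_K by blast
  have line: "s * norm (b - a) \<le> norm (b - (a + t *\<^sub>R (c - a)))"
    if "a \<in> V" "b \<in> V" "c \<in> V" "a \<noteq> b" "b \<noteq> c" "a \<noteq> c" for a b c t
    unfolding s_def by (rule dist_line_triangle) (use that th plane in auto)
  have edge: "s * norm (b - a) \<le> norm (b - c)"
    if "a \<in> V" "b \<in> V" "c \<in> V" "a \<noteq> b" "b \<noteq> c" "a \<noteq> c" for a b c
    using line[OF that, of 1] by simp
  have s2: "s\<^sup>2 * x \<le> x" "s\<^sup>2 * x \<le> s * x" "s * x \<le> x" if "0 \<le> x" for x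
    using that s by (auto simp: power2_eq_square mult_le_one intro!: mult_left_le_one_le mult_right_mono)
  \<comment> \<open>Two edges with a common vertex compare with one factor \<open>s\<close>; edges
    without one need an intermediate edge and a second factor.\<close>
  have edges: "s\<^sup>2 * norm (u - v) \<le> norm (p - a)" if uv: "u \<in> V" "v \<in> V" "u \<noteq> v" and a: "a \<in> V" "a \<noteq> p" for u v a
  proof -
    have 1: "s\<^sup>2 * norm (u - v) \<le> norm (p - a)" if "u \<in> {p, a}" "u \<in> V" "v \<in> V" "u \<noteq> v" for u v
    proof (cases "v \<in> {p, a}")
      case True
      then have "norm (u - v) = norm (p - a)" using that by (auto simp: norm_minus_commute)
      then show ?thesis using s2 by simp
    next
      case False
      have "s * norm (u - v) \<le> norm (p - a)"
        using that(1)
      proof (elim insertE emptyE)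
        assume "u = p" then show ?thesis using edge[of v p a] False that p a by (auto simp: norm_minus_commute)
      next
        assume "u = a" then show ?thesis using edge[of v a p] False that p a by (auto simp: norm_minus_commute)
      qed
      then show ?thesis using s2(2)[of "norm (u - v)"] by simp
    qed
    show ?thesis
    proof (cases "u \<in> {p, a} \<or> v \<in> {p, a}")
      case True
      then show ?thesis using 1[of u v] 1[of v u] uv by (auto simp: norm_minus_commute)
    next
      case False
      then have "s * norm (u - v) \<le> norm (u - a)" "s * norm (a - u) \<le> norm (a - p)"
        using edge[of v u a] edge[of u a p] uv p a by auto
      then have "s * (s * norm (u - v)) \<le> s * norm (u - a)" "s * norm (u - a) \<le> norm (p - a)"
        using s by (auto simp: norm_minus_commute)
      then show ?thesis by (simp add: power2_eq_square)
    qed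
  qed
  \<comment> \<open>The diameter of a simplex is attained between two of its vertices.\<close>
  have diam: "s\<^sup>2 * diameter K \<le> norm (p - a)" if a: "a \<in> V" "a \<noteq> p" for a
  proof -
    have "diameter K \<le> norm (p - a) / s\<^sup>2"
    proof (rule diameter_le)
      fix x y assume "x \<in> K" "y \<in> K"
      then obtain u v where uv: "u \<in> V" "v \<in> V" "norm (x - y) \<le> norm (u - v)"
        unfolding K_def using simplex_extremal_le_exists[OF fin] by blast
      have "s\<^sup>2 * norm (u - v) \<le> norm (p - a)"
        using edges[OF uv(1,2) _ a] by (cases "u = v") auto
      then have "norm (u - v) \<le> norm (p - a) / s\<^sup>2" using s by (simp add: field_simps)
      then show "norm (x - y) \<le> norm (p - a) / s\<^sup>2" using uv(3) by linarith
    qed (use s in auto)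
    then show ?thesis using s by (simp add: field_simps)
  qed
  have K0: "0 \<le> diameter K" by (rule diameter_ge_0) (use compact_K compact_imp_bounded in blast)
  have "\<exists>a\<in>V - {p}. s\<^sup>2 * norm (p - a) \<le> ht p"
    using card_n
  proof
    assume "CARD('n) = 2"
    then have "card (V - {p}) = 2" using card_V p fin by simp
    then obtain a b where ab: "V - {p} = {a, b}" "a \<noteq> b" unfolding card_2_iff by (elim exE conjE)
    then have in': "a \<in> V" "b \<in> V" "a \<noteq> p" "b \<noteq> p" by auto
    \<comment> \<open>The foot of the perpendicular from \<open>p\<close> on the opposite
      side.\<close>
    define x where "x = p + ht p *\<^sub>R nu p"
    have nn: "nu p \<bullet> nu p = 1" using nu_ht(1)[OF p] by (simp add: norm_eq_1)
    have lx: "lam p x = 0" unfolding lam_def x_def using nn nu_ht(2)[OF p] by simp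
    have "(\<Sum>q\<in>V. lam q x) = lam p x + (lam a x + lam b x)" "(\<Sum>q\<in>V. lam q x *\<^sub>R q) = lam p x *\<^sub>R p + (lam a x *\<^sub>R a + lam b x *\<^sub>R b)"
      unfolding sum.remove[OF fin p] ab using ab(2) by simp_all
    moreover define \<beta> where "\<beta> = lam b x"
    ultimately have l: "lam a x = 1 - \<beta>" and xe: "x = lam a x *\<^sub>R a + \<beta> *\<^sub>R b"
      using lam_sum[of x] lx by simp_all
    note xe[unfolded l]
    also have "(1 - \<beta>) *\<^sub>R a + \<beta> *\<^sub>R b = a + \<beta> *\<^sub>R (b - a)" by (simp add: algebra_simps)
    finally have xeq: "x = a + \<beta> *\<^sub>R (b - a)" .
    have "s * norm (p - a) \<le> norm (p - x)"
      unfolding xeq using line[of a p b \<beta>] in' p ab(2) by auto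
    also have "norm (p - x) = ht p" unfolding x_def using nu_ht[OF p] by simp
    finally have "s\<^sup>2 * norm (p - a) \<le> ht p" using s2(2)[of "norm (p - a)"] by simp
    then show ?thesis using in' by blast
  next
    assume c3: "CARD('n) = 3"
    \<comment> \<open>The relation \<open>normals_sum\<close> in the direction \<open>nu p\<close>
      forces another normal to have a negative product with \<open>nu p\<close>, that is, an acute
      dihedral angle.\<close>
    have "\<exists>q\<in>V - {p}. nu q \<bullet> nu p < 0"
    proof (rule ccontr)
      assume "\<not> (\<exists>q\<in>V - {p}. nu q \<bullet> nu p < 0)"
      then have "0 \<le> (nu q \<bullet> nu p) / ht q" if "q \<in> V - {p}" for q
        using that nu_ht(2)[of q] by (auto simp: not_less intro!: divide_nonneg_pos)
      then have "0 \<le> (\<Sum>q\<in>V - {p}. (nu q \<bullet> nu p) / ht q)" by (rule sum_nonneg)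
      moreover have "(nu p \<bullet> nu p) / ht p > 0" using nu_ht(1,2)[OF p] by (simp add: norm_eq_1)
      ultimately have "(\<Sum>q\<in>V. (nu q \<bullet> nu p) / ht q) > 0" unfolding sum.remove[OF fin p] by linarith
      then show False using normals_sum by simp
    qed
    then obtain q where q: "q \<in> V" "q \<noteq> p" "nu q \<bullet> nu p < 0" by blast
    define c where "c = nu q \<bullet> nu p"
    have npq: "norm (nu p) = 1" "norm (nu q) = 1" "nu p \<bullet> nu p = 1" "nu q \<bullet> nu q = 1"
      using nu_ht(1)[OF p] nu_ht(1)[OF q(1)] by (auto simp: norm_eq_1)
    have "opp p \<noteq> opp q" using inj_opp p q(1,2) unfolding inj_on_def by metis
    moreover have "opp p facet_of K" "opp q facet_of K" using facet_K p q(1) by auto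
    ultimately have "\<theta> \<le> pi - vec_angle (outward_normal K (opp p)) (outward_normal K (opp q))"
      using ang unfolding angles_at_least_def by blast
    then have "vec_angle (nu p) (nu q) \<le> pi - \<theta>"
      unfolding outward_normal_opp[OF p] outward_normal_opp[OF q(1)] by simp
    then have ac: "arccos c \<le> pi - \<theta>" unfolding vec_angle_def c_def using npq by (simp add: inner_commute)
    have cb: "\<bar>c\<bar> \<le> 1" unfolding c_def using Cauchy_Schwarz_ineq2[of "nu q" "nu p"] npq by simp
    then have "cos (pi - \<theta>) \<le> cos (arccos c)"
      using ac arccos_lbound[of c] th by (intro cos_monotone_0_pi_le) auto
    then have "- cos \<theta> \<le> c" using cb by (simp add: cos_arccos_abs)
    moreover have "c < 0" using q(3) c_def by simp
    ultimately have "c\<^sup>2 \<le> (cos \<theta>)\<^sup>2" using power_mono[of "-c" "cos \<theta>" 2] by simp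
    then have c2: "s\<^sup>2 \<le> 1 - c\<^sup>2" unfolding s_def by (simp add: sin_squared_eq)
    have "card (V - {p} - {q}) = 2" using card_V p q fin c3 by simp
    then obtain a b where ab: "V - {p} - {q} = {a, b}" "a \<noteq> b" unfolding card_2_iff by (elim exE conjE)
    then have in': "a \<in> V" "b \<in> V" "a \<noteq> p" "b \<noteq> p" "a \<noteq> q" "b \<noteq> q" by auto
    \<comment> \<open>The part of \<open>nu p\<close> inside the plane of the facet opposite
      \<open>q\<close>; it is orthogonal to the edge \<open>ab\<close> common to the two
      facets.\<close>
    define m where "m = nu p - c *\<^sub>R nu q"
    have mm: "m \<bullet> nu q = 0" "nu p \<bullet> m = 1 - c\<^sup>2" "(norm m)\<^sup>2 = 1 - c\<^sup>2"
      unfolding m_def power2_norm_eq_inner using npq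
      by (auto simp: inner_diff_left inner_diff_right c_def[symmetric] inner_commute[of "nu p" "nu q"] power2_eq_square)
    have c1: "1 - c\<^sup>2 > 0" using c2 s by (smt (verit) zero_less_power)
    \<comment> \<open>The perpendicular from the line \<open>ab\<close> to \<open>p\<close> within
      that plane. Its length is \<open>ht p / sqrt (1 - c^2)\<close>, and \<open>1 - c^2\<close> is
      the squared sine of the dihedral angle.\<close>
    define z' where "z' = (- ht p / (1 - c\<^sup>2)) *\<^sub>R m"
    define y where "y = p - a - z'"
    have "nu q \<bullet> (p - a) = 0"
      using unit_normalD(3)[OF unit_normal_nu[OF q(1)]] V_in_opp[of p q] V_in_opp[of a q] p q(2) in' by blast
    then have yq: "nu q \<bullet> y = 0" unfolding y_def z'_def using mm(1)[unfolded inner_commute[of m]] by (simp add: inner_diff_right inner_add_right)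
    have "nu p \<bullet> (p - a) = - ht p" using nu_ht(3)[OF p, of a] in' by (simp add: inner_diff_right)
    moreover have "nu p \<bullet> z' = - ht p" unfolding z'_def using mm(2) c1 by simp
    ultimately have yp: "nu p \<bullet> y = 0" unfolding y_def by (simp add: inner_diff_right)
    obtain e where e: "sum e V = 0" "y = (\<Sum>r\<in>V. e r *\<^sub>R r)" using bary_dir_ex[of y] by (elim exE conjE)
    have "e p = 0" using sum_dir[OF p e(1)] e(2)[symmetric] yp nu_ht(2)[OF p] by simp
    moreover have "e q = 0" using sum_dir[OF q(1) e(1)] e(2)[symmetric] yq nu_ht(2)[OF q(1)] by simp
    moreover have "q \<in> V - {p}" using q by blast
    moreover have "sum e V = e p + (e q + (e a + e b))" "(\<Sum>r\<in>V. e r *\<^sub>R r) = e p *\<^sub>R p + (e q *\<^sub>R q + (e a *\<^sub>R a + e b *\<^sub>R b))"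
      unfolding sum.remove[OF fin p] sum.remove[OF finite_Diff[OF fin] \<open>q \<in> V - {p}\<close>] ab using ab(2) by simp_all
    ultimately have "e a = - e b" "y = e a *\<^sub>R a + e b *\<^sub>R b" using e by simp_all
    then have "y = e b *\<^sub>R (b - a)" by (simp add: algebra_simps)
    then have z'eq: "z' = p - (a + e b *\<^sub>R (b - a))" unfolding y_def by (simp add: algebra_simps)
    have "s * norm (p - a) \<le> norm z'"
      unfolding z'eq using line[of a p b "e b"] in' p ab(2) by auto
    then have "(s * norm (p - a))\<^sup>2 \<le> (norm z')\<^sup>2" using s by (intro power_mono) auto
    also have "(norm z')\<^sup>2 = (ht p)\<^sup>2 / (1 - c\<^sup>2)"
      unfolding z'_def norm_scaleR power_mult_distrib mm(3) using c1 by (simp add: power2_eq_square)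
    also have "\<dots> \<le> (ht p)\<^sup>2 / s\<^sup>2" using c2 s c1 by (intro divide_left_mono) auto
    finally have "(s\<^sup>2 * norm (p - a))\<^sup>2 \<le> (ht p)\<^sup>2"
      using s by (simp add: pos_le_divide_eq power_mult_distrib power2_eq_square ac_simps)
    then have "s\<^sup>2 * norm (p - a) \<le> ht p" by (rule power2_le_imp_le) (use nu_ht(2)[OF p] in simp)
    then show ?thesis using in' by blast
  qed
  then obtain a where a: "a \<in> V" "a \<noteq> p" "s\<^sup>2 * norm (p - a) \<le> ht p" by blast
  have "s\<^sup>2 * (s\<^sup>2 * diameter K) \<le> s\<^sup>2 * norm (p - a)" by (intro mult_left_mono diam a) simp
  then show ?thesis using a(3) unfolding s_def by (simp add: power4_eq_xxxx power2_eq_square mult.assoc)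
qed

section \<open>Relatively interior points of facets\<close>

definition relint_point :: "real^'n \<Rightarrow> real^'n \<Rightarrow> bool" where
  "relint_point p x \<longleftrightarrow> lam p x = 0 \<and> (\<forall>q\<in>V - {p}. 0 < lam q x)"

lemma lam_diff: "lam p y - lam p x = - (nu p \<bullet> (y - x)) / ht p"
  unfolding lam_def by (simp add: inner_diff_right diff_divide_distrib)

text \<open>Near such a point the other barycentric coordinates stay positive, so the sign of
  \<open>lam p\<close> alone decides membership.\<close>

lemma half_ball:
  assumes p: "p \<in> V" and x: "relint_point p x"
  obtains r where "r > 0" "\<And>y. y \<in> ball x r \<Longrightarrow> y \<in> K \<longleftrightarrow> nu p \<bullet> (y - x) \<le> 0"
    "\<And>y. y \<in> ball x r \<Longrightarrow> y \<in> interior K \<longleftrightarrow> nu p \<bullet> (y - x) < 0"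
proof -
  have "{y. \<forall>q\<in>V - {p}. 0 < lam q y} = (\<Inter>q\<in>V - {p}. {y. 0 < lam q y})" by auto
  then have "open {y. \<forall>q\<in>V - {p}. 0 < lam q y}"
    using fin by (auto intro!: open_INT open_Collect_less continuous_on_const continuous_lam)
  then obtain r where r: "r > 0" "ball x r \<subseteq> {y. \<forall>q\<in>V - {p}. 0 < lam q y}"
    using x unfolding relint_point_def open_contains_ball by blast
  have lp: "lam p y = - (nu p \<bullet> (y - x)) / ht p" for y
    using lam_diff[of p y x] x unfolding relint_point_def by simp
  show thesis
  proof
    fix y assume "y \<in> ball x r"
    then have q: "\<forall>q\<in>V - {p}. 0 < lam q y" using r by blast
    then have q': "0 \<le> lam a y" "0 < lam a y" if "a \<in> V" "a \<noteq> p" for a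
      using that by (auto simp: less_imp_le)
    have "y \<in> K \<longleftrightarrow> 0 \<le> lam p y" unfolding K_lam using p q'(1) by metis
    then show "y \<in> K \<longleftrightarrow> nu p \<bullet> (y - x) \<le> 0" unfolding lp using nu_ht(2)[OF p] by (simp add: zero_le_divide_iff divide_le_0_iff)
    have "y \<in> interior K \<longleftrightarrow> 0 < lam p y" unfolding interior_K using p q'(2) by metis
    then show "y \<in> interior K \<longleftrightarrow> nu p \<bullet> (y - x) < 0" unfolding lp using nu_ht(2)[OF p] by (simp add: zero_less_divide_iff divide_less_0_iff)
  qed (rule r(1))
qed

lemma opp_lam: "p \<in> V \<Longrightarrow> x \<in> opp p \<Longrightarrow> lam p x = 0"
  unfolding lam_def using nu_opp nu_ht(2)[of p] by simp

lemma relint_point_in_opp: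
  assumes p: "p \<in> V" and x: "relint_point p x"
  shows "x \<in> opp p" "x \<in> rel_interior (opp p)"
proof -
  have f: "finite (V - {p})" using fin by simp
  have "(\<Sum>q\<in>V - {p}. lam q x) = 1" "(\<Sum>q\<in>V - {p}. lam q x *\<^sub>R q) = x"
    using lam_sum[of x] x unfolding sum.remove[OF fin p] relint_point_def by simp_all
  then have "x \<in> {y. \<exists>u. (\<forall>q\<in>V - {p}. 0 < u q) \<and> sum u (V - {p}) = 1 \<and> (\<Sum>q\<in>V - {p}. u q *\<^sub>R q) = y}"
    unfolding mem_Collect_eq using x unfolding relint_point_def by (intro exI[of _ "\<lambda>q. lam q x"] conjI) blast+
  then show "x \<in> rel_interior (opp p)"
    unfolding opp_def using explicit_subset_rel_interior_convex_hull_minimal[OF f] by blast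
  then show "x \<in> opp p" using rel_interior_subset by blast
qed

text \<open>Lets an arbitrary point of the facet be approached through relatively interior
  ones.\<close>

lemma relint_point_segment:
  assumes p: "p \<in> V" and x: "relint_point p x" and y: "y \<in> opp p" and t: "0 < t" "t \<le> 1"
  shows "relint_point p (y + t *\<^sub>R (x - y))"
proof -
  have aff: "lam q (y + t *\<^sub>R (x - y)) = (1 - t) * lam q y + t * lam q x" for q
    unfolding lam_def by (simp add: inner_diff_right inner_add_right add_divide_distrib diff_divide_distrib algebra_simps)
  have "0 \<le> lam q y" if "q \<in> V" for q using K_lam opp_subset y that by blast
  then show ?thesis
    using x t opp_lam[OF p y] unfolding relint_point_def aff by (auto intro!: add_nonneg_pos)
qed

end

definition vertices :: "(real^'n) set \<Rightarrow> (real^'n) set" where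
  "vertices K = {x. x extreme_point_of K}"

text \<open>The centroid, computed from the extreme points of \<open>e\<close> alone, so that two
  elements sharing the face use the same reference point.\<close>

definition center :: "(real^'n) set \<Rightarrow> real^'n" where
  "center e = (\<Sum>q\<in>vertices e. (1 / card (vertices e)) *\<^sub>R q)"

lemma (in simplex_vertices) center_opp:
  assumes p: "p \<in> V"
  shows "relint_point p (center (opp p))"
proof -
  have v: "vertices (opp p) = V - {p}" unfolding vertices_def using extreme_opp by auto
  have c: "card (V - {p}) = CARD('n)" using p card_V fin by simp
  define a where "a = (\<lambda>q. if q = p then 0 else 1 / CARD('n))"
  have a: "sum a V = 1" "center (opp p) = (\<Sum>q\<in>V. a q *\<^sub>R q)"
    unfolding center_def v c sum.remove[OF fin p] a_def using c card_n by (auto simp: sum.If_cases)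
  show ?thesis
    unfolding relint_point_def using lam_eq[OF _ a] p card_n by (auto simp: a_def)
qed

section \<open>Faces of a mesh and the splitting of sums and integrals\<close>

locale simplicial_mesh =
  fixes \<Omega> :: "(real^'n) set" and T :: "(real^'n) set set"
  assumes card_n: "CARD('n) = 2 \<or> CARD('n) = 3"
    and domain: "bounded_domain \<Omega>"
    and part: "simplicial_partition \<Omega> T"
begin

lemma finT: "finite T"
  using part unfolding simplicial_partition_def triangulation_def by blast

lemma UnT: "\<Union>T = closure \<Omega>"
  using part unfolding simplicial_partition_def by blast

lemma int_face: "K \<in> T \<Longrightarrow> K' \<in> T \<Longrightarrow> (K \<inter> K') face_of K" "K \<in> T \<Longrightarrow> K' \<in> T \<Longrightarrow> (K \<inter> K') face_of K'"
  using part unfolding simplicial_partition_def triangulation_def by (blast, metis inf_commute)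

lemma open_\<Omega>: "open \<Omega>" and int_cl: "interior (closure \<Omega>) = \<Omega>"
  using domain unfolding bounded_domain_def by blast+

lemma sv:
  assumes "K \<in> T"
  shows "simplex_vertices (vertices K)" "simplex_vertices.K (vertices K) = K"
proof -
  have "int CARD('n) simplex K" using part assms unfolding simplicial_partition_def by blast
  then obtain C where C: "\<not> affine_dependent C" "int (card C) = int CARD('n) + 1" "K = convex hull C"
    unfolding simplex_def by (elim exE conjE)
  have "vertices K = C" unfolding vertices_def C(3) using extreme_point_of_convex_hull_affine_independent[OF C(1)] by auto
  moreover have "simplex_vertices C" by unfold_locales (use C card_n in auto)
  ultimately show "simplex_vertices (vertices K)" "simplex_vertices.K (vertices K) = K"
    using C(3) simplex_vertices.K_def by auto
qed

lemma facet_opp: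
  assumes "K \<in> T"
  shows "e facet_of K \<longleftrightarrow> (\<exists>p\<in>vertices K. e = simplex_vertices.opp (vertices K) p)"
  using simplex_vertices.facet_K[OF sv(1)[OF assms], of e] sv(2)[OF assms] by simp

abbreviation "opp \<equiv> simplex_vertices.opp"

lemma facetE:
  assumes "K \<in> T" "e facet_of K"
  obtains p where "p \<in> vertices K" "e = opp (vertices K) p"
    "outward_normal K e = simplex_vertices.nu (vertices K) p"
  using facet_opp[OF assms(1)] assms(2) simplex_vertices.outward_normal_opp[OF sv(1)[OF assms(1)]] sv(2)[OF assms(1)]
  by metis

lemma compact_T: "K \<in> T \<Longrightarrow> compact K" and convex_T: "K \<in> T \<Longrightarrow> convex K"
  and aff_dim_T: "K \<in> T \<Longrightarrow> aff_dim K = CARD('n)"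
  using part unfolding simplicial_partition_def
  by (auto dest: compact_simplex convex_simplex aff_dim_simplex)

lemma interior_nonempty: assumes "K \<in> T" shows "interior K \<noteq> {}"
proof -
  interpret S: simplex_vertices "vertices K" by (rule sv(1)[OF assms])
  have "affine hull K = UNIV"
    using S.affine_hull_V sv(2)[OF assms] unfolding S.K_def by (metis affine_hull_convex_hull)
  then have "rel_interior K = interior K" by (rule rel_interior_interior)
  moreover have "K \<noteq> {}" using S.V_subset S.V_minus_nonempty sv(2)[OF assms] by blast
  ultimately show ?thesis using rel_interior_eq_empty[OF convex_T[OF assms]] by simp
qed

lemma facet_half_ball:
  assumes "K \<in> T" "e facet_of K"
  obtains r where "r > 0" "\<And>y. y \<in> ball (center e) r \<Longrightarrow> y \<in> K \<longleftrightarrow> outward_normal K e \<bullet> (y - center e) \<le> 0"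
    "\<And>y. y \<in> ball (center e) r \<Longrightarrow> y \<in> interior K \<longleftrightarrow> outward_normal K e \<bullet> (y - center e) < 0"
proof -
  obtain p where p: "p \<in> vertices K" "e = opp (vertices K) p" "outward_normal K e = simplex_vertices.nu (vertices K) p"
    using facetE[OF assms] .
  interpret S: simplex_vertices "vertices K" by (rule sv(1)[OF assms(1)])
  have SK: "S.K = K" by (rule sv(2)[OF assms(1)])
  obtain r where "r > 0" "\<And>y. y \<in> ball (center e) r \<Longrightarrow> y \<in> K \<longleftrightarrow> outward_normal K e \<bullet> (y - center e) \<le> 0"
    "\<And>y. y \<in> ball (center e) r \<Longrightarrow> y \<in> interior K \<longleftrightarrow> outward_normal K e \<bullet> (y - center e) < 0"
    using S.half_ball[OF p(1) S.center_opp[OF p(1)], unfolded SK, folded p(2) p(3)] by blast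
  then show thesis using that by blast
qed

lemma hyperplane_piece_facet:
  assumes "K \<in> T" "e facet_of K"
  shows "hyperplane_piece e (outward_normal K e)"
  using facetE[OF assms] simplex_vertices.hyperplane_piece_opp[OF sv(1)[OF assms(1)]] by metis

lemma unit_outward:
  assumes "K \<in> T" "e facet_of K"
  shows "unit_normal e (outward_normal K e)" "norm (outward_normal K e) = 1" "compact e" "e \<noteq> {}"
  using hyperplane_piece_facet[OF assms] unfolding hyperplane_piece_def unit_normal_def by blast+

text \<open>A face of an element that meets its interior is the whole element; this applies to the
  intersection from both sides.\<close>

lemma disjoint_interior:
  assumes "K \<in> T" "K' \<in> T" "x \<in> interior K" "x \<in> interior K'"
  shows "K = K'"
proof -
  have x: "x \<in> K \<inter> K'" using assms interior_subset by blast
  have "K \<inter> K' = K" using face_of_disjoint_interior[OF int_face(1)[OF assms(1,2)]] x assms(3) by blast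
  moreover have "K \<inter> K' = K'" using face_of_disjoint_interior[OF int_face(2)[OF assms(1,2)]] x assms(4) by blast
  ultimately show ?thesis by simp
qed

text \<open>With equal normals, points slightly below the center of the face would lie in the
  interiors of both elements.\<close>

lemma normals_opposite:
  assumes "K \<in> T" "K' \<in> T" "K \<noteq> K'" "e facet_of K" "e facet_of K'"
  shows "outward_normal K' e = - outward_normal K e"
proof (rule ccontr)
  assume neg: "outward_normal K' e \<noteq> - outward_normal K e"
  have "outward_normal K' e = outward_normal K e"
    using hyperplane_piece_facet[OF assms(1,4)] unit_outward(1)[OF assms(2,5)] neg
    unfolding hyperplane_piece_def by blast
  moreover obtain r where r: "r > 0"
    "\<And>y. y \<in> ball (center e) r \<Longrightarrow> y \<in> interior K \<longleftrightarrow> outward_normal K e \<bullet> (y - center e) < 0"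
    using facet_half_ball[OF assms(1,4)] by metis
  moreover obtain r' where r': "r' > 0"
    "\<And>y. y \<in> ball (center e) r' \<Longrightarrow> y \<in> interior K' \<longleftrightarrow> outward_normal K' e \<bullet> (y - center e) < 0"
    using facet_half_ball[OF assms(2,5)] by metis
  moreover define y where "y = center e - (min r r' / 2) *\<^sub>R outward_normal K e"
  moreover have "y \<in> ball (center e) r" "y \<in> ball (center e) r'"
    unfolding y_def using r(1) r'(1) unit_outward(2)[OF assms(1,4)] by (auto simp: dist_norm)
  moreover have "outward_normal K e \<bullet> (y - center e) < 0"
    unfolding y_def using r(1) r'(1) unit_normalD(2)[OF unit_outward(1)[OF assms(1,4)]] by simp
  ultimately have "y \<in> interior K" "y \<in> interior K'" by auto
  then show False using disjoint_interior assms(1-3) by blast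
qed

text \<open>The normal of a third element would be opposite to two vectors that are opposite to each
  other.\<close>

lemma adjacent_interior:
  assumes "K \<in> T" "K' \<in> T" "K \<noteq> K'" "e facet_of K" "e facet_of K'"
  shows "adjacent T e = {K, K'}"
proof -
  have "L = K \<or> L = K'" if L: "L \<in> T" "e facet_of L" for L
  proof (rule ccontr)
    assume n: "\<not> (L = K \<or> L = K')"
    have "outward_normal L e = - outward_normal K e" "outward_normal L e = - outward_normal K' e"
      "outward_normal K' e = - outward_normal K e"
      using n normals_opposite[OF assms(1) L(1) _ assms(4) L(2)] normals_opposite[OF assms(2) L(1) _ assms(5) L(2)]
        normals_opposite[OF assms] by auto
    then have "outward_normal K e = - outward_normal K e" by simp
    then have "outward_normal K e = 0" by (simp only: vec_eq_iff) simp
    then show False using unit_outward(2)[OF assms(1,4)] by simp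
  qed
  then show ?thesis unfolding adjacent_def using assms by auto
qed

text \<open>A strictly larger intersection would have dimension strictly between
  \<open>d - 1\<close> and \<open>d\<close>.\<close>

lemma facet_shared:
  assumes "K \<in> T" "K' \<in> T" "K \<noteq> K'" "e facet_of K" "e facet_of K'"
  shows "e = K \<inter> K'"
proof (rule ccontr)
  assume ne: "e \<noteq> K \<inter> K'"
  have e: "e \<subseteq> K \<inter> K'" using assms facet_of_imp_subset by blast
  have "K \<inter> K' \<noteq> K"
  proof
    assume "K \<inter> K' = K"
    then have "K face_of K'" using int_face(2)[OF assms(1,2)] by simp
    from face_of_aff_dim_lt[OF convex_T[OF assms(2)] this assms(3)] show False
      using aff_dim_T assms(1,2) by simp
  qed
  from face_of_aff_dim_lt[OF convex_T[OF assms(1)] int_face(1)[OF assms(1,2)] this]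
  have 1: "aff_dim (K \<inter> K') < CARD('n)" using aff_dim_T[OF assms(1)] by simp
  have "e face_of (K \<inter> K')"
    by (rule face_of_subset[OF facet_of_imp_face_of[OF assms(4)] e]) simp
  from face_of_aff_dim_lt[OF convex_Int[OF convex_T[OF assms(1)] convex_T[OF assms(2)]] this ne]
  have "aff_dim e < aff_dim (K \<inter> K')" .
  moreover have "aff_dim e = CARD('n) - 1"
    using assms(4) aff_dim_T[OF assms(1)] card_n unfolding facet_of_def by auto
  ultimately show False using 1 card_n by (simp add: of_nat_diff)
qed

lemma interior_faceI:
  assumes "K \<in> T" "K' \<in> T" "K \<noteq> K'" "e facet_of K" "e facet_of K'"
  shows "e \<in> interior_faces T"
  unfolding interior_faces_def using facet_shared[OF assms] assms by blast

lemma interior_faceE: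
  assumes "e \<in> interior_faces T"
  obtains K K' where "K \<in> T" "K' \<in> T" "K \<noteq> K'" "e facet_of K" "e facet_of K'" "adjacent T e = {K, K'}"
    "outward_normal K' e = - outward_normal K e"
proof -
  obtain K K' where K: "K \<in> T" "K' \<in> T" "K \<noteq> K'" "e facet_of K" "e facet_of K'"
    using assms unfolding interior_faces_def by blast
  show thesis using that[OF K adjacent_interior[OF K] normals_opposite[OF K]] .
qed

text \<open>No other element touches a relatively interior point of the facet, so near it the domain
  is the interior of \<open>K\<close>, which is a half-ball there.\<close>

lemma outward_normal_at_boundary:
  assumes "K \<in> T" "e facet_of K" "e \<notin> interior_faces T" "p \<in> vertices K" "e = opp (vertices K) p"
    and x: "simplex_vertices.relint_point (vertices K) p x"
  shows "outward_normal_at \<Omega> x (outward_normal K e)"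
proof -
  interpret S: simplex_vertices "vertices K" by (rule sv(1)[OF assms(1)])
  have SK: "S.K = K" by (rule sv(2)[OF assms(1)])
  have nu: "outward_normal K e = S.nu p"
    using S.outward_normal_opp[OF assms(4)] SK assms(5) by simp
  obtain r where r: "r > 0" "\<And>y. y \<in> ball x r \<Longrightarrow> y \<in> interior K \<longleftrightarrow> outward_normal K e \<bullet> (y - x) < 0"
    using S.half_ball[OF assms(4) x, unfolded SK, folded nu] by metis
  have xe: "x \<in> e" "x \<in> rel_interior e" using S.relint_point_in_opp[OF assms(4) x] assms(5) by auto
  have notin: "x \<notin> K'" if K': "K' \<in> T" "K' \<noteq> K" for K'
  proof
    assume xK': "x \<in> K'"
    have eK: "e \<subseteq> K" using assms(2) facet_of_imp_subset by blast
    then have "(K \<inter> K') \<inter> rel_interior e \<noteq> {}" using xe xK' by blast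
    \<comment> \<open>A face of \<open>K\<close> that meets the relative interior of
      \<open>e\<close> contains all of \<open>e\<close>.\<close>
    then have e: "e \<subseteq> K \<inter> K'" by (rule subset_of_face_of[OF int_face(1)[OF assms(1) K'(1)] eK])
    have "e face_of (K \<inter> K')" by (rule face_of_subset[OF facet_of_imp_face_of[OF assms(2)] e]) simp
    then have "e face_of K'" using face_of_trans int_face(2)[OF assms(1) K'(1)] by blast
    then have "e facet_of K'" using assms(2) aff_dim_T[OF assms(1)] aff_dim_T[OF K'(1)] unfolding facet_of_def by simp
    then show False using interior_faceI[OF assms(1) K'(1) K'(2)[symmetric] assms(2)] assms(3) by blast
  qed
  have "closed (\<Union>(T - {K}))" using finT compact_T by (intro closed_Union) (auto intro: compact_imp_closed)
  then have "open (- \<Union>(T - {K}))" by (simp add: open_Compl)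
  moreover have "x \<in> - \<Union>(T - {K})" using notin by blast
  ultimately obtain r' where r': "r' > 0" "ball x r' \<subseteq> - \<Union>(T - {K})"
    unfolding open_contains_ball by blast
  define s where "s = min r r'"
  have s: "s > 0" "ball x s \<subseteq> ball x r" "ball x s \<subseteq> ball x r'" unfolding s_def using r r' by auto
  have "y \<in> \<Omega> \<longleftrightarrow> outward_normal K e \<bullet> (y - x) < 0" if y: "y \<in> ball x s" for y
  proof -
    have "y \<in> \<Omega> \<longleftrightarrow> y \<in> interior K"
    proof
      assume "y \<in> \<Omega>"
      have "\<Omega> \<inter> ball x s \<subseteq> K"
      proof
        fix z assume z: "z \<in> \<Omega> \<inter> ball x s"
        then have "z \<in> \<Union>T" using UnT closure_subset by blast
        then show "z \<in> K" using z s r' by blast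
      qed
      then show "y \<in> interior K" using \<open>y \<in> \<Omega>\<close> y open_\<Omega> by (meson IntI interiorI open_Int open_ball)
    next
      assume "y \<in> interior K"
      \<comment> \<open>The domain has no slits: the interior of its closure is the domain
        itself.\<close>
      moreover have "interior K \<subseteq> interior (closure \<Omega>)" using assms(1) UnT by (intro interior_mono) blast
      ultimately show "y \<in> \<Omega>" using int_cl by blast
    qed
    then show ?thesis using r(2) y s by blast
  qed
  then have eq: "\<Omega> \<inter> ball x s = {y \<in> ball x s. outward_normal K e \<bullet> (y - x) < 0}" by blast
  have "x \<in> ball x s" using s by simp
  then have "x \<notin> \<Omega>" using eq by force
  moreover have "x \<in> closure \<Omega>" using xe assms(1,2) UnT facet_of_imp_subset by blast
  ultimately have "x \<in> frontier \<Omega>" using open_\<Omega> by (simp add: frontier_def interior_open)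
  then show ?thesis unfolding outward_normal_at_def using eq s(1) unit_outward(2)[OF assms(1,2)] by blast
qed

text \<open>Relatively interior points of the facet lie on the frontier by the half-ball
  description, and every other point of the facet is their limit, so the open set \<Omega> cannot
  contain it.\<close>

lemma boundary_face_normal:
  assumes "K \<in> T" "e facet_of K" "e \<notin> interior_faces T"
  shows "outward_normal_at \<Omega> (center e) (outward_normal K e)" "e \<subseteq> frontier \<Omega>"
proof -
  obtain p where p: "p \<in> vertices K" "e = opp (vertices K) p"
    using facetE[OF assms(1,2)] .
  interpret S: simplex_vertices "vertices K" by (rule sv(1)[OF assms(1)])
  have SK: "S.K = K" by (rule sv(2)[OF assms(1)])
  have c: "S.relint_point p (center e)" unfolding p(2) by (rule S.center_opp[OF p(1)])
  note o = outward_normal_at_boundary[OF assms p]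
  show "outward_normal_at \<Omega> (center e) (outward_normal K e)" by (rule o[OF c])
  show "e \<subseteq> frontier \<Omega>"
  proof
    fix y assume y: "y \<in> e"
    have "y \<notin> \<Omega>"
    proof
      assume "y \<in> \<Omega>"
      then obtain r where r: "r > 0" "ball y r \<subseteq> \<Omega>" using open_\<Omega> open_contains_ball by blast
      define t where "t = min 1 (r / 2 / (norm (center e - y) + 1))"
      have d: "norm (center e - y) + 1 > 0" by (smt (verit) norm_ge_zero)
      have t: "0 < t" "t \<le> 1" unfolding t_def using r(1) d by auto
      have "t * norm (center e - y) \<le> r / 2 / (norm (center e - y) + 1) * (norm (center e - y) + 1)"
        unfolding t_def using r(1) d by (intro mult_mono) auto
      also have "\<dots> = r / 2" using d by (metis nonzero_eq_divide_eq less_irrefl)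
      finally have "t * norm (center e - y) < r" using r(1) by simp
      then have "y + t *\<^sub>R (center e - y) \<in> ball y r" using t by (simp add: dist_norm)
      then have "y + t *\<^sub>R (center e - y) \<in> \<Omega>" using r(2) by blast
      moreover have "S.relint_point p (y + t *\<^sub>R (center e - y))"
        by (rule S.relint_point_segment[OF p(1) c _ t]) (use y p(2) in simp)
      from o[OF this] have "y + t *\<^sub>R (center e - y) \<in> frontier \<Omega>" unfolding outward_normal_at_def by blast
      ultimately show False using open_\<Omega> by (simp add: frontier_def interior_open)
    qed
    moreover have "y \<in> closure \<Omega>" using y assms(1,2) UnT facet_of_imp_subset by blast
    ultimately show "y \<in> frontier \<Omega>" using open_\<Omega> by (simp add: frontier_def interior_open)
  qed
qed

text \<open>The half-balls of the two elements fill a whole ball in the closure of \<Omega>, so the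
  center of the face belongs to the domain.\<close>

lemma interior_face_not_frontier:
  assumes "e \<in> interior_faces T"
  shows "\<not> e \<subseteq> frontier \<Omega>"
proof -
  obtain K K' where K: "K \<in> T" "K' \<in> T" "K \<noteq> K'" "e facet_of K" "e facet_of K'"
    "outward_normal K' e = - outward_normal K e" using interior_faceE[OF assms] by metis
  obtain r where r: "r > 0" "\<And>y. y \<in> ball (center e) r \<Longrightarrow> y \<in> K \<longleftrightarrow> outward_normal K e \<bullet> (y - center e) \<le> 0"
    using facet_half_ball[OF K(1,4)] by metis
  obtain r' where r': "r' > 0" "\<And>y. y \<in> ball (center e) r' \<Longrightarrow> y \<in> K' \<longleftrightarrow> outward_normal K' e \<bullet> (y - center e) \<le> 0"
    using facet_half_ball[OF K(2,5)] by metis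
  have "ball (center e) (min r r') \<subseteq> closure \<Omega>"
  proof
    fix y assume y: "y \<in> ball (center e) (min r r')"
    have "y \<in> K \<or> y \<in> K'" using r(2)[of y] r'(2)[of y] y K(6) by (auto simp: inner_minus_left)
    then show "y \<in> closure \<Omega>" using UnT K by blast
  qed
  then have "ball (center e) (min r r') \<subseteq> interior (closure \<Omega>)" by (intro interior_maximal) auto
  moreover have "center e \<in> ball (center e) (min r r')" using r(1) r'(1) by simp
  ultimately have "center e \<in> \<Omega>" using int_cl by blast
  moreover obtain p where p: "p \<in> vertices K" "e = opp (vertices K) p" using facetE[OF K(1,4)] .
  have "center e \<in> e"
    using simplex_vertices.relint_point_in_opp(1)[OF sv(1)[OF K(1)] p(1) simplex_vertices.center_opp[OF sv(1)[OF K(1)] p(1)]] p(2) by simp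
  ultimately show ?thesis using open_\<Omega> by (auto simp: frontier_def interior_open)
qed

lemma boundary_faces_eq: "boundary_faces \<Omega> T = {(K, e). K \<in> T \<and> e facet_of K \<and> e \<notin> interior_faces T}"
  unfolding boundary_faces_def using interior_face_not_frontier boundary_face_normal(2) by blast

lemma facets_eq: "K \<in> T \<Longrightarrow> {e. e facet_of K} = opp (vertices K) ` vertices K"
  using facet_opp by blast

lemma finite_facets: "K \<in> T \<Longrightarrow> finite {e. e facet_of K}" and card_facets: "K \<in> T \<Longrightarrow> card {e. e facet_of K} = CARD('n) + 1"
  using facets_eq simplex_vertices.fin[OF sv(1)] simplex_vertices.inj_opp[OF sv(1)] simplex_vertices.card_V[OF sv(1)]
  by (auto simp: card_image)

lemma finite_interior_faces: "finite (interior_faces T)"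
proof (rule finite_subset)
  show "interior_faces T \<subseteq> (\<Union>K\<in>T. {e. e facet_of K})" unfolding interior_faces_def by blast
  show "finite (\<Union>K\<in>T. {e. e facet_of K})" using finT finite_facets by blast
qed

lemma finite_boundary_faces: "finite (boundary_faces \<Omega> T)"
proof (rule finite_subset)
  show "boundary_faces \<Omega> T \<subseteq> T \<times> (\<Union>K\<in>T. {e. e facet_of K})" unfolding boundary_faces_def by blast
  show "finite (T \<times> (\<Union>K\<in>T. {e. e facet_of K}))" using finT finite_facets by blast
qed

text \<open>Sorts the pairs of an element and a facet: a boundary facet occurs in one pair, an
  interior face in one for each adjacent element.\<close>

lemma sum_facets:
  fixes g :: "(real^'n) set \<Rightarrow> (real^'n) set \<Rightarrow> 'b::comm_monoid_add"
  shows "(\<Sum>K\<in>T. \<Sum>e\<in>{e. e facet_of K}. g K e) =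
    (\<Sum>(K, e)\<in>boundary_faces \<Omega> T. g K e) + (\<Sum>e\<in>interior_faces T. \<Sum>K\<in>adjacent T e. g K e)"
proof -
  have "(\<Sum>K\<in>T. \<Sum>e\<in>{e. e facet_of K}. g K e) = (\<Sum>(K, e)\<in>(SIGMA K:T. {e. e facet_of K}). g K e)"
    using finT finite_facets by (intro sum.Sigma) auto
  also have "(SIGMA K:T. {e. e facet_of K}) = boundary_faces \<Omega> T \<union> prod.swap ` (SIGMA e:interior_faces T. adjacent T e)"
    unfolding boundary_faces_eq adjacent_def by force
  also have "(\<Sum>(K, e)\<in>\<dots>. g K e) = (\<Sum>(K, e)\<in>boundary_faces \<Omega> T. g K e) + (\<Sum>(K, e)\<in>prod.swap ` (SIGMA e:interior_faces T. adjacent T e). g K e)"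
  proof (rule sum.union_disjoint)
    show "finite (prod.swap ` (SIGMA e:interior_faces T. adjacent T e))"
      using finite_interior_faces finT unfolding adjacent_def by auto
    show "boundary_faces \<Omega> T \<inter> prod.swap ` (SIGMA e:interior_faces T. adjacent T e) = {}"
      unfolding boundary_faces_eq by auto
  qed (rule finite_boundary_faces)
  also have "(\<Sum>(K, e)\<in>prod.swap ` (SIGMA e:interior_faces T. adjacent T e). g K e) = (\<Sum>(e, K)\<in>(SIGMA e:interior_faces T. adjacent T e). g K e)"
    by (subst sum.reindex) (auto simp: inj_on_def split_beta)
  also have "\<dots> = (\<Sum>e\<in>interior_faces T. \<Sum>K\<in>adjacent T e. g K e)"
    using finite_interior_faces finT unfolding adjacent_def by (intro sum.Sigma[symmetric]) auto
  finally show ?thesis .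
qed

text \<open>The frontiers of the elements form a null set; off it a point lies in the interior of
  exactly one element or outside the domain. Hence the values of \<open>F\<close> on the skeleton do
  not enter.\<close>

lemma integral_mesh:
  fixes F :: "real^'n \<Rightarrow> 'b::euclidean_space"
  assumes F: "\<And>K x. K \<in> T \<Longrightarrow> x \<in> interior K \<Longrightarrow> F x = \<Phi> K x" and cont: "\<And>K. K \<in> T \<Longrightarrow> continuous_on K (\<Phi> K)"
  shows "set_integrable lebesgue \<Omega> F" "(LINT x:\<Omega>|lebesgue. F x) = (\<Sum>K\<in>T. LINT x:K|lebesgue. \<Phi> K x)"
proof -
  define G where "G = (\<lambda>x. \<Sum>K\<in>T. indicator K x *\<^sub>R \<Phi> K x)"
  have iK: "integrable lebesgue (\<lambda>x. indicator K x *\<^sub>R \<Phi> K x)" if "K \<in> T" for K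
    using set_integrable_compact(2)[OF compact_T[OF that] cont[OF that]] by (simp add: set_integrable_def)
  have iG: "integrable lebesgue G" unfolding G_def by (intro Bochner_Integration.integrable_sum iK)
  define N where "N = (\<Union>K\<in>T. frontier K)"
  have N: "negligible N" unfolding N_def
    using finT convex_T by (intro negligible_Union) (auto intro: negligible_convex_frontier)
  have eq: "indicator \<Omega> x *\<^sub>R F x = G x" if x: "x \<notin> N" for x
  proof (cases "\<exists>K\<in>T. x \<in> interior K")
    case True
    then obtain K where K: "K \<in> T" "x \<in> interior K" by blast
    have "interior K \<subseteq> interior (closure \<Omega>)" using K(1) UnT by (intro interior_mono) blast
    then have "x \<in> \<Omega>" using K(2) int_cl by blast
    have "x \<notin> K'" if K': "K' \<in> T" "K' \<noteq> K" for K'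
    proof
      assume "x \<in> K'"
      then have "x \<in> interior K'" using x K' unfolding N_def frontier_def
        using closure_subset[of K'] by blast
      then show False using disjoint_interior[OF K(1) K'(1) K(2)] K'(2) by blast
    qed
    then have "G x = (\<Sum>L\<in>T. if L = K then \<Phi> K x else 0)"
      unfolding G_def using K(2) interior_subset[of K] by (intro sum.cong refl) (auto simp: indicator_def)
    also have "\<dots> = \<Phi> K x" using K(1) finT by simp
    finally show ?thesis using \<open>x \<in> \<Omega>\<close> F[OF K] by simp
  next
    case False
    then have "x \<notin> K" if "K \<in> T" for K
      using that x unfolding N_def frontier_def using closure_subset[of K] by blast
    moreover from this have "x \<notin> \<Omega>" using UnT closure_subset[of \<Omega>] by blast
    ultimately show ?thesis unfolding G_def by simp
  qed
  have aG: "G absolutely_integrable_on UNIV" using iG by (simp add: set_integrable_def)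
  have aF: "(\<lambda>x. indicator \<Omega> x *\<^sub>R F x) absolutely_integrable_on UNIV"
    by (rule absolutely_integrable_spike[OF aG N]) (simp add: eq)
  then show "set_integrable lebesgue \<Omega> F" by (simp add: set_integrable_def)
  have "integral UNIV (\<lambda>x. indicator \<Omega> x *\<^sub>R F x) = integral UNIV G"
    by (rule integral_spike[OF N]) (simp add: eq)
  then have "(LINT x:\<Omega>|lebesgue. F x) = (LINT x|lebesgue. G x)"
    using set_lebesgue_integral_eq_integral(2)[OF aG] set_lebesgue_integral_eq_integral(2)[OF aF]
    by (simp add: set_lebesgue_integral_def)
  also have "\<dots> = (\<Sum>K\<in>T. LINT x:K|lebesgue. \<Phi> K x)"
    unfolding G_def set_lebesgue_integral_def by (rule Bochner_Integration.integral_sum) (rule iK)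
  finally show "(LINT x:\<Omega>|lebesgue. F x) = (\<Sum>K\<in>T. LINT x:K|lebesgue. \<Phi> K x)" .
qed

end

section \<open>Piecewise affine functions on a mesh\<close>

lemma linear_functional_cart:
  fixes L :: "real^'n \<Rightarrow> 'b::real_vector"
  assumes "linear L"
  shows "L u = (\<Sum>i\<in>UNIV. u $ i *\<^sub>R L (axis i 1))"
proof -
  have "u = (\<Sum>i\<in>UNIV. u $ i *\<^sub>R axis i 1)"
    by (simp add: vec_eq_iff axis_def if_distrib cong: if_cong)
  then have "L u = L (\<Sum>i\<in>UNIV. u $ i *\<^sub>R axis i 1)" by simp
  then show ?thesis by (simp add: linear_sum[OF assms] linear_scale[OF assms])
qed

lemma affine_map_bounded_linear_compose:
  assumes "affine_map W L" "linear B"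
  shows "affine_map (\<lambda>x. B (W x)) (\<lambda>u. B (L u))"
  using assms linear_compose[of L B] unfolding affine_map_def comp_def
  by (metis linear_diff)

lemma affine_map_add:
  assumes "affine_map W L" "affine_map W' L'"
  shows "affine_map (\<lambda>x. W x + W' x) (\<lambda>u. L u + L' u)"
  using assms unfolding affine_map_def
  by (auto intro: linear_compose_add) (metis add_diff_add)

lemma affine_map_diff:
  assumes "affine_map W L" "affine_map W' L'"
  shows "affine_map (\<lambda>x. W x - W' x) (\<lambda>u. L u - L' u)"
  using affine_map_add[OF assms(1) affine_map_bounded_linear_compose[OF assms(2), of uminus]]
  by (simp add: linear_iff)

lemma affine_map_vec:
  fixes W :: "'n::finite \<Rightarrow> 'a::real_vector \<Rightarrow> 'b::real_vector"
  assumes "\<And>i. affine_map (W i) (L i)"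
  shows "affine_map (\<lambda>x. \<chi> i. W i x) (\<lambda>u. \<chi> i. L i u)"
  unfolding affine_map_def
  using affine_mapD[OF assms]
  by (auto simp: vec_eq_iff linear_iff)

lemma P1_on_iff: "P1_on S f \<longleftrightarrow> (\<exists>W L. affine_map W L \<and> (\<forall>x\<in>S. f x = W x))"
proof
  assume "P1_on S f"
  then obtain a b where "\<forall>x\<in>S. f x = a \<bullet> x + b" unfolding P1_on_def by blast
  moreover have "affine_map (\<lambda>x. a \<bullet> x + b) (\<lambda>u. a \<bullet> u)"
    unfolding affine_map_def by (auto intro!: linearI simp: inner_add_right inner_diff_right)
  ultimately show "\<exists>W L. affine_map W L \<and> (\<forall>x\<in>S. f x = W x)" by blast
next
  assume "\<exists>W L. affine_map W L \<and> (\<forall>x\<in>S. f x = W x)"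
  then obtain W L where W: "affine_map W L" "\<forall>x\<in>S. f x = W x" by blast
  have Wx: "W x = (\<chi> i. L (axis i 1)) \<bullet> x + W 0" for x
    using affine_mapD(3)[OF W(1), of x 0] linear_functional_cart[OF affine_mapD(1)[OF W(1)], of x]
    by (simp add: inner_vec_def mult.commute)
  have "\<forall>x\<in>S. f x = (\<chi> i. L (axis i 1)) \<bullet> x + W 0"
    by (intro ballI trans[OF bspec[OF W(2)] Wx])
  then show "P1_on S f" unfolding P1_on_def by (intro exI)
qed

lemma complex_P1_iff:
  "(P1_on S (\<lambda>x. Re (f x)) \<and> P1_on S (\<lambda>x. Im (f x))) \<longleftrightarrow> (\<exists>W L. affine_map W L \<and> (\<forall>x\<in>S. f x = W x))"
proof
  assume "P1_on S (\<lambda>x. Re (f x)) \<and> P1_on S (\<lambda>x. Im (f x))"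
  then obtain W L W' L' where W: "affine_map W L" "\<forall>x\<in>S. Re (f x) = W x" "affine_map W' L'" "\<forall>x\<in>S. Im (f x) = W' x"
    unfolding P1_on_iff by blast
  have "affine_map (\<lambda>x. Complex (W x) (W' x)) (\<lambda>u. Complex (L u) (L' u))"
    unfolding affine_map_def using affine_mapD[OF W(1)] affine_mapD[OF W(3)]
    by (auto simp: complex_eq_iff linear_iff)
  moreover have "\<forall>x\<in>S. f x = Complex (W x) (W' x)" using W by (auto simp: complex_eq_iff)
  ultimately show "\<exists>W L. affine_map W L \<and> (\<forall>x\<in>S. f x = W x)" by blast
next
  assume "\<exists>W L. affine_map W L \<and> (\<forall>x\<in>S. f x = W x)"
  then obtain W L where W: "affine_map W L" "\<forall>x\<in>S. f x = W x" by blast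
  have "linear Re" "linear Im" using bounded_linear_Re bounded_linear_Im bounded_linear.linear by blast+
  then show "P1_on S (\<lambda>x. Re (f x)) \<and> P1_on S (\<lambda>x. Im (f x))"
    unfolding P1_on_iff using W(2)
    by (intro conjI exI[of _ "\<lambda>x. Re (W x)"] exI[of _ "\<lambda>u. Re (L u)"] exI[of _ "\<lambda>x. Im (W x)"] exI[of _ "\<lambda>u. Im (L u)"]
      affine_map_bounded_linear_compose[OF W(1)]) auto
qed

lemma complex_vec_P1_iff:
  fixes f :: "real^'n \<Rightarrow> complex^'m"
  shows "(\<forall>i. P1_on S (\<lambda>x. Re (f x $ i)) \<and> P1_on S (\<lambda>x. Im (f x $ i))) \<longleftrightarrow> (\<exists>W L. affine_map W L \<and> (\<forall>x\<in>S. f x = W x))"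
proof
  assume "\<forall>i. P1_on S (\<lambda>x. Re (f x $ i)) \<and> P1_on S (\<lambda>x. Im (f x $ i))"
  then have "\<forall>i. \<exists>W. \<exists>L. affine_map W L \<and> (\<forall>x\<in>S. f x $ i = W x)" unfolding complex_P1_iff .
  then obtain W where "\<forall>i. \<exists>L. affine_map (W i) L \<and> (\<forall>x\<in>S. f x $ i = W i x)" by metis
  then obtain L where W: "\<And>i. affine_map (W i) (L i)" "\<And>i. \<forall>x\<in>S. f x $ i = W i x" by metis
  have "\<forall>x\<in>S. f x = (\<chi> i. W i x)" using W(2) by (simp add: vec_eq_iff)
  then show "\<exists>W L. affine_map W L \<and> (\<forall>x\<in>S. f x = W x)"
    by (intro exI conjI) (rule affine_map_vec[OF W(1)])
next
  assume "\<exists>W L. affine_map W L \<and> (\<forall>x\<in>S. f x = W x)"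
  then obtain W L where W: "affine_map W L" "\<forall>x\<in>S. f x = W x" by blast
  show "\<forall>i. P1_on S (\<lambda>x. Re (f x $ i)) \<and> P1_on S (\<lambda>x. Im (f x $ i))"
  proof
    fix i
    have "linear (\<lambda>z::complex^'m. z $ i)" by (simp add: linear_iff)
    from affine_map_bounded_linear_compose[OF W(1) this] show "P1_on S (\<lambda>x. Re (f x $ i)) \<and> P1_on S (\<lambda>x. Im (f x $ i))"
      unfolding complex_P1_iff using W(2) by (intro exI conjI) auto
  qed
qed

text \<open>A direction scaled to fit into a ball of \<open>S\<close> reveals the linear part; this
  makes the affine continuation of a piece unique.\<close>

lemma affine_map_eq_on_open:
  fixes W :: "'a::real_normed_vector \<Rightarrow> 'b::real_vector"
  assumes W: "affine_map W L" "affine_map W' L'" and S: "open S" "S \<noteq> {}" "\<And>x. x \<in> S \<Longrightarrow> W x = W' x"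
  shows "W = W'" "L = L'"
proof -
  obtain z r where z: "r > 0" "ball z r \<subseteq> S" using S(1,2) open_contains_ball by blast
  have Wz: "W z = W' z" using z by (intro S(3)) auto
  have "L u = L' u" for u
  proof -
    define t where "t = r / 2 / (norm u + 1)"
    have d: "norm u + 1 > 0" by (smt (verit) norm_ge_zero)
    have t: "t > 0" unfolding t_def using z(1) d by simp
    have "t * (norm u + 1) = r / 2" unfolding t_def using d by (metis nonzero_eq_divide_eq less_irrefl)
    then have "t * norm u < r" using z(1) t by (simp add: algebra_simps)
    then have "z + t *\<^sub>R u \<in> ball z r" using t by (simp add: dist_norm)
    then have "W (z + t *\<^sub>R u) = W' (z + t *\<^sub>R u)" using z(2) S(3) by blast
    then have "L (t *\<^sub>R u) = L' (t *\<^sub>R u)"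
      using affine_mapD(2)[OF W(1), of "z + t *\<^sub>R u" z] affine_mapD(2)[OF W(2), of "z + t *\<^sub>R u" z] Wz by simp
    then show ?thesis
      using t by (simp add: linear_scale[OF affine_mapD(1)[OF W(1)]] linear_scale[OF affine_mapD(1)[OF W(2)]])
  qed
  then show "L = L'" by blast
  moreover have "W x = W' x" for x
    using affine_mapD(3)[OF W(1), of x z] affine_mapD(3)[OF W(2), of x z] Wz \<open>L = L'\<close> by simp
  ultimately show "W = W'" by blast
qed

definition gradient :: "(real^'n \<Rightarrow> 'b) \<Rightarrow> 'b^'n" where
  "gradient L = (\<chi> i. L (axis i 1))"

text \<open>Derivative in the real direction \<open>u\<close> of a complex function with gradient
  \<open>g\<close>; it is bilinear, so nothing is conjugated.\<close>

definition pairing :: "real^'n \<Rightarrow> complex^'n \<Rightarrow> complex" where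
  "pairing u g = (\<Sum>i\<in>UNIV. u $ i *\<^sub>R g $ i)"

lemma linear_pairing: "linear L \<Longrightarrow> L u = pairing u (gradient L)"
  using linear_functional_cart[of L u] by (simp add: pairing_def gradient_def)

lemma linear_pairing_left: "linear (\<lambda>u. pairing u g)"
  by (intro linearI) (simp_all add: pairing_def scaleR_left_distrib sum.distrib scaleR_sum_right)

lemma norm_pairing: "norm (pairing u g) \<le> norm u * norm g"
proof -
  have "norm (pairing u g) \<le> (\<Sum>i\<in>UNIV. \<bar>u $ i\<bar> * \<bar>norm (g $ i)\<bar>)"
    unfolding pairing_def by (rule sum_norm_le) simp
  also have "\<dots> \<le> L2_set (\<lambda>i. u $ i) UNIV * L2_set (\<lambda>i. norm (g $ i)) UNIV"
    by (rule L2_set_mult_ineq)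
  also have "\<dots> = norm u * norm g" by (simp add: norm_vec_def L2_set_def)
  finally show ?thesis .
qed

context simplicial_mesh
begin

definition pw_affine :: "(real^'n \<Rightarrow> 'b::real_normed_vector) \<Rightarrow> bool" where
  "pw_affine f \<longleftrightarrow> (\<forall>K\<in>T. \<exists>W L. affine_map W L \<and> (\<forall>x\<in>interior K. f x = W x))"

text \<open>Continues \<open>f\<close> from the interior of \<open>K\<close> to an affine function
  on the whole space and so replaces the one-sided limits on faces; \<open>ext_eqI\<close> shows
  that there is only one candidate.\<close>

definition ext :: "(real^'n) set \<Rightarrow> (real^'n \<Rightarrow> 'b::real_normed_vector) \<Rightarrow> real^'n \<Rightarrow> 'b" where
  "ext K f = (SOME W. \<exists>L. affine_map W L \<and> (\<forall>x\<in>interior K. f x = W x))"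

definition slope :: "(real^'n) set \<Rightarrow> (real^'n \<Rightarrow> 'b::real_normed_vector) \<Rightarrow> real^'n \<Rightarrow> 'b" where
  "slope K f = (SOME L. affine_map (ext K f) L)"

lemma ext_affine:
  assumes "pw_affine f" "K \<in> T"
  shows "affine_map (ext K f) (slope K f)" "\<And>x. x \<in> interior K \<Longrightarrow> f x = ext K f x"
proof -
  have *: "\<exists>L. affine_map (ext K f) L \<and> (\<forall>x\<in>interior K. f x = ext K f x)"
  proof -
    have "\<exists>W L. affine_map W L \<and> (\<forall>x\<in>interior K. f x = W x)" using assms unfolding pw_affine_def by blast
    from someI_ex[OF this] show ?thesis unfolding ext_def .
  qed
  then show "\<And>x. x \<in> interior K \<Longrightarrow> f x = ext K f x" by blast
  show "affine_map (ext K f) (slope K f)"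
  proof -
    from * obtain L where "affine_map (ext K f) L" by (elim exE conjE)
    then show ?thesis unfolding slope_def by (rule someI[where P = "affine_map (ext K f)"])
  qed
qed

lemma ext_eqI:
  assumes "K \<in> T" "affine_map W L" "\<And>x. x \<in> interior K \<Longrightarrow> f x = W x"
  shows "ext K f = W" "slope K f = L"
proof -
  have *: "\<exists>L. affine_map (ext K f) L \<and> (\<forall>x\<in>interior K. f x = ext K f x)"
  proof -
    have "\<exists>W L. affine_map W L \<and> (\<forall>x\<in>interior K. f x = W x)" using assms by blast
    from someI_ex[OF this] show ?thesis unfolding ext_def .
  qed
  then obtain L' where L': "affine_map (ext K f) L'" "\<forall>x\<in>interior K. f x = ext K f x" by (elim exE conjE)
  from L'(1) have a: "affine_map (ext K f) (slope K f)" unfolding slope_def by (rule someI[where P = "affine_map (ext K f)"])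
  have eq: "ext K f x = W x" if "x \<in> interior K" for x
    using bspec[OF L'(2) that] assms(3)[OF that] by (rule trans[OF sym])
  show "ext K f = W" "slope K f = L"
    using affine_map_eq_on_open[OF a assms(2) open_interior interior_nonempty[OF assms(1)] eq] by auto
qed

lemma continuous_ext: "pw_affine f \<Longrightarrow> K \<in> T \<Longrightarrow> continuous_on S (ext K (f :: real^'n \<Rightarrow> 'b::real_normed_vector))"
  by (rule continuous_affine_map[OF ext_affine(1)])

lemma pw_affineI:
  assumes "\<And>K. K \<in> T \<Longrightarrow> affine_map (W K) (L K)" "\<And>K x. K \<in> T \<Longrightarrow> x \<in> interior K \<Longrightarrow> f x = W K x"
  shows "pw_affine f"
  unfolding pw_affine_def using assms by blast

lemma L2_pw_affine:
  fixes f :: "real^'n \<Rightarrow> 'b::euclidean_space"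
  assumes "pw_affine f"
  shows "L2 \<Omega> f"
proof -
  have s: "\<Omega> \<inter> space lebesgue \<in> sets lebesgue" using open_\<Omega> by (simp add: borel_open)
  have "set_integrable lebesgue \<Omega> f"
    by (rule integral_mesh(1)[of f "\<lambda>K. ext K f"]) (auto intro: ext_affine[OF assms] continuous_ext[OF assms])
  then have "integrable (lebesgue_on \<Omega>) f" using integrable_restrict_space[OF s, of f] by (simp add: set_integrable_def)
  moreover have "set_integrable lebesgue \<Omega> (\<lambda>x. (norm (f x))\<^sup>2)"
    by (rule integral_mesh(1)[of _ "\<lambda>K x. (norm (ext K f x))\<^sup>2"])
       (auto simp: ext_affine(2)[OF assms] intro!: continuous_intros continuous_ext[OF assms])
  then have "integrable (lebesgue_on \<Omega>) (\<lambda>x. (norm (f x))\<^sup>2)"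
    using integrable_restrict_space[OF s, of "\<lambda>x. (norm (f x))\<^sup>2"] by (simp add: set_integrable_def)
  ultimately show ?thesis unfolding L2_def using borel_measurable_integrable by blast
qed

text \<open>Affine pieces on finitely many compact elements are square integrable, which supplies
  the \<open>L2\<close> half of membership.\<close>

lemma V_h_iff: "v \<in> V_h \<Omega> T \<longleftrightarrow> pw_affine v"
  unfolding V_h_def mem_Collect_eq complex_P1_iff pw_affine_def[symmetric] using L2_pw_affine[of v] by blast

lemma Sigma_h_iff: "\<tau> \<in> Sigma_h \<Omega> T \<longleftrightarrow> pw_affine \<tau>"
  unfolding Sigma_h_def mem_Collect_eq complex_vec_P1_iff pw_affine_def[symmetric] using L2_pw_affine[of \<tau>] by blast

lemma pw_affine_diff: "pw_affine f \<Longrightarrow> pw_affine g \<Longrightarrow> pw_affine (\<lambda>x. f x - g x)"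
  by (rule pw_affineI[of "\<lambda>K x. ext K f x - ext K g x" "\<lambda>K x. slope K f x - slope K g x"]; auto simp: ext_affine(2) intro!: affine_map_diff ext_affine)

lemma ext_diff: "pw_affine f \<Longrightarrow> pw_affine g \<Longrightarrow> K \<in> T \<Longrightarrow> ext K (\<lambda>x. f x - g x) x = ext K f x - ext K g x"
  by (rule fun_cong[OF ext_eqI(1)[OF _ affine_map_diff[OF ext_affine(1) ext_affine(1)]]]) (auto simp: ext_affine(2))

lemma pw_affine_const: "pw_affine (\<lambda>x. c)" and ext_const: "K \<in> T \<Longrightarrow> ext K (\<lambda>x. c) = (\<lambda>x. c)"
  by (rule pw_affineI, rule affine_map_const, simp) (rule ext_eqI(1)[OF _ affine_map_const], simp_all)

lemma closure_interior_T: "K \<in> T \<Longrightarrow> closure (interior K) = K"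
  using convex_closure_interior[OF convex_T interior_nonempty] compact_T compact_imp_closed closure_closed by metis

text \<open>Every point of the closed element is a limit point of its interior, where the continuous
  \<open>ext K f\<close> agrees with \<open>f\<close>.\<close>

lemma trace_ext:
  fixes f :: "real^'n \<Rightarrow> 'b::real_normed_vector"
  assumes "pw_affine f" "K \<in> T" "x \<in> K"
  shows "trace_on K f x = ext K f x"
  unfolding trace_on_def
proof (rule tendsto_Lim)
  have "x islimpt interior K"
  proof (cases "x \<in> interior K")
    case True then show ?thesis using interior_limit_point[of x "interior K"] by simp
  next
    case False then show ?thesis using closure_interior_T[OF assms(2)] assms(3) islimpt_in_closure[of x "interior K"] by simp
  qed
  then show "at x within interior K \<noteq> bot" by (simp add: trivial_limit_within)
  have "(ext K f \<longlongrightarrow> ext K f x) (at x within interior K)"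
    using continuous_ext[OF assms(1,2), of UNIV] by (auto simp: continuous_on_eq_continuous_at isCont_def intro: tendsto_within_subset)
  then show "(f \<longlongrightarrow> ext K f x) (at x within interior K)"
    by (rule Lim_transform_eventually) (auto simp: eventually_at_filter ext_affine(2)[OF assms(1,2)])
qed

lemma grad_interior:
  assumes "pw_affine f" "K \<in> T" "x \<in> interior K"
  shows "grad_h T f x = gradient (slope K f)"
proof -
  note a = affine_mapD[OF ext_affine(1)[OF assms(1,2)]]
  have "(ext K f has_derivative slope K f) (at x)"
  proof -
    have "(slope K f has_derivative slope K f) (at (x - 0))"
      using a(1) by (intro bounded_linear_imp_has_derivative) (simp add: linear_conv_bounded_linear)
    then have "((\<lambda>y. ext K f 0 + slope K f y) has_derivative slope K f) (at x)"
      by (auto intro!: derivative_eq_intros)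
    moreover have "ext K f = (\<lambda>y. ext K f 0 + slope K f y)"
    proof (rule HOL.ext)
      fix y show "ext K f y = ext K f 0 + slope K f y" using a(3)[of y 0] by simp
    qed
    ultimately show ?thesis by (simp only:)
  qed
  then have "(f has_derivative slope K f) (at x)"
    by (rule has_derivative_transform_within_open[OF _ open_interior assms(3)]) (simp add: ext_affine(2)[OF assms(1,2)])
  then have "frechet_derivative f (at x) = slope K f" by (rule frechet_derivative_at[symmetric])
  then show ?thesis unfolding grad_h_def grad_def gradient_def using assms(2,3) by auto
qed

lemma pw_affine_grad: "pw_affine f \<Longrightarrow> pw_affine (grad_h T f)"
  by (rule pw_affineI[OF affine_map_const]) (rule grad_interior)

lemma ext_grad: "pw_affine f \<Longrightarrow> K \<in> T \<Longrightarrow> ext K (grad_h T f) = (\<lambda>x. gradient (slope K f))"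
  by (rule ext_eqI(1)[OF _ affine_map_const]) (auto simp: grad_interior)

end

section \<open>Complex inner products and face forms\<close>

lemma dotc_inner: "Re (dotc u v) = u \<bullet> v"
  unfolding dotc_def inner_vec_def by (simp add: inner_complex_def)

lemma dotc_self: "dotc u u = complex_of_real ((norm u)\<^sup>2)"
  unfolding dotc_def power2_norm_eq_inner inner_vec_def
  by (simp add: inner_complex_def complex_mult_cnj power2_eq_square)

lemma dotc_cnj: "cnj (dotc u v) = dotc v u"
  unfolding dotc_def by (simp add: mult.commute)

lemma dotc_scale: "dotc (z *s u) v = z * dotc u v"
  unfolding dotc_def by (simp add: sum_distrib_left mult.assoc)

lemma dotc_diff: "dotc (u - v) w = dotc u w - dotc v w" "dotc (u + v) w = dotc u w + dotc v w"
  unfolding dotc_def by (simp_all add: algebra_simps sum.distrib sum_subtractf)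

lemma norm_vec_scale: "norm (z *s (u::complex^'n)) = norm z * norm u"
proof -
  have "(norm (z *s u))\<^sup>2 = (norm z * norm u)\<^sup>2"
    unfolding norm_vec_def L2_set_def
    by (simp add: norm_mult power_mult_distrib sum_nonneg sum_distrib_left)
  then show ?thesis by (simp add: power2_eq_iff_nonneg)
qed

lemma norm_scale_cvec: "norm (z *s cvec n) = norm z * norm n"
  unfolding norm_vec_scale by (simp add: norm_vec_def cvec_def)

lemma norm_dotc: "norm (dotc u (cvec n)) \<le> norm u * norm n"
proof -
  have "dotc u (cvec n) = pairing n u"
    unfolding dotc_def pairing_def cvec_def by (simp add: scaleR_conv_of_real mult.commute)
  then show ?thesis using norm_pairing[of n u] by (simp add: mult.commute)
qed

lemma continuous_on_scale_vec [continuous_intros]: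
  fixes f :: "'a::topological_space \<Rightarrow> complex" and g :: "'a \<Rightarrow> complex^'n"
  assumes "continuous_on S f" "continuous_on S g"
  shows "continuous_on S (\<lambda>x. f x *s g x)"
  unfolding vector_scalar_mult_def using assms by (auto intro!: continuous_intros)

lemma continuous_on_dotc [continuous_intros]:
  fixes f g :: "'a::topological_space \<Rightarrow> complex^'n"
  assumes "continuous_on S f" "continuous_on S g"
  shows "continuous_on S (\<lambda>x. dotc (f x) (g x))"
  unfolding dotc_def using assms by (auto intro!: continuous_intros)

lemma face_integral_of_real: "face_integral e (\<lambda>x. complex_of_real (f x)) = complex_of_real (face_integral e f)"
  unfolding face_integral_def Let_def by (rule set_integral_complex_of_real)

lemma face_integral_cnj: "face_integral e (\<lambda>x. cnj (f x)) = cnj (face_integral e f)"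
  unfolding face_integral_def Let_def set_lebesgue_integral_def complex_cnj_scaleR[symmetric]
  by (rule Bochner_Integration.integral_cnj)

lemma ip_self: "ip \<Omega> w w = complex_of_real (norm_sq \<Omega> w)"
  unfolding ip_def norm_sq_def complex_norm_square[symmetric] by (rule set_integral_complex_of_real)

lemma ip_vec_self: "ip_vec \<Omega> w w = complex_of_real (norm_sq \<Omega> w)"
  unfolding ip_vec_def norm_sq_def dotc_self by (rule set_integral_complex_of_real)

lemma ip_face_self: "ip_face e w w = complex_of_real (face_integral e (\<lambda>x. (norm (w x))\<^sup>2))"
  unfolding ip_face_def complex_norm_square[symmetric] by (rule face_integral_of_real)

lemma ip_face_vec_self: "ip_face_vec e w w = complex_of_real (face_integral e (\<lambda>x. (norm (w x))\<^sup>2))"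
  unfolding ip_face_vec_def dotc_self by (rule face_integral_of_real)

lemma ip_vec_cnj: "cnj (ip_vec \<Omega> u v) = ip_vec \<Omega> v u"
  unfolding ip_vec_def set_lebesgue_integral_def
  using Bochner_Integration.integral_cnj[of lebesgue "\<lambda>x. indicat_real \<Omega> x *\<^sub>R dotc (u x) (v x)"]
  by (simp only: complex_cnj_scaleR dotc_cnj)

lemma ip_face_vec_cnj: "cnj (ip_face_vec e u v) = ip_face_vec e v u"
  unfolding ip_face_vec_def by (subst face_integral_cnj[symmetric]) (simp add: dotc_cnj)

lemma ip_bdry_self: "ip_bdry \<Omega> T w w = complex_of_real (norm_sq_bdry \<Omega> T w)"
  unfolding ip_bdry_def norm_sq_bdry_def ip_face_self by (simp add: split_beta)

lemma Re_face_integral: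
  assumes "hyperplane_piece e n" "continuous_on e f"
  shows "Re (face_integral e f) = face_integral e (\<lambda>x. Re (f x))"
  by (rule face_integral_bounded_linear[OF assms bounded_linear_Re])

text \<open>Real parts turn Hermitian products into Euclidean inner products, to which
  Cauchy-Schwarz and Young's inequality apply.\<close>

lemma Re_ip_face:
  assumes "hyperplane_piece e n" "continuous_on e a" "continuous_on e b"
  shows "Re (z * ip_face e a b) = face_integral e (\<lambda>x. (z * a x) \<bullet> b x)"
proof -
  have "z * ip_face e a b = face_integral e (\<lambda>x. z * (a x * cnj (b x)))"
    unfolding ip_face_def
    by (rule face_integral_bounded_linear[OF assms(1)]) (use assms in \<open>auto intro!: continuous_intros bounded_linear_mult_right\<close>)
  then have "Re (z * ip_face e a b) = face_integral e (\<lambda>x. Re (z * (a x * cnj (b x))))"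
    by (simp only:) (rule Re_face_integral[OF assms(1)], intro continuous_intros assms)
  also have "(\<lambda>x. Re (z * (a x * cnj (b x)))) = (\<lambda>x. (z * a x) \<bullet> b x)"
    by (simp add: inner_complex_def algebra_simps)
  finally show ?thesis .
qed

lemma Re_ip_face_vec:
  assumes "hyperplane_piece e n" "continuous_on e a" "continuous_on e b"
  shows "Re (ip_face_vec e a b) = face_integral e (\<lambda>x. a x \<bullet> b x)"
  unfolding ip_face_vec_def dotc_inner[symmetric]
  by (rule Re_face_integral[OF assms(1)]) (intro continuous_intros assms)

lemma ip_face_vec_lin:
  fixes a b c :: "real^'n \<Rightarrow> complex^'n"
  assumes "hyperplane_piece e n" "continuous_on e a" "continuous_on e b" "continuous_on e c"
  shows "ip_face_vec e (\<lambda>x. a x - z *s b x) c = ip_face_vec e a c - z * ip_face_vec e b c"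
proof -
  obtain p where p: "p \<in> e" using assms by (auto simp: hyperplane_piece_def)
  have n: "unit_normal e n" and e: "compact e" using assms by (auto simp: hyperplane_piece_def)
  have eq: "face_integral e f = (LINT x:prism e n|lebesgue. f (drop_to n p x))" for f :: "real^'n \<Rightarrow> complex"
    using assms p by (intro face_integral_eq) (auto simp: hyperplane_piece_def)
  have i: "set_integrable lebesgue (prism e n) (\<lambda>x. f (drop_to n p x))" if "continuous_on e f" for f :: "real^'n \<Rightarrow> complex"
    by (rule set_integrable_compact(2)[OF compact_prism[OF e] continuous_on_drop_to_compose[OF n p that]])
  have i1: "set_integrable lebesgue (prism e n) (\<lambda>x. dotc (a (drop_to n p x)) (c (drop_to n p x)))"
    by (rule i[of "\<lambda>x. dotc (a x) (c x)"]) (intro continuous_intros assms)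
  have i2: "set_integrable lebesgue (prism e n) (\<lambda>x. z * dotc (b (drop_to n p x)) (c (drop_to n p x)))"
    by (rule i[of "\<lambda>x. z * dotc (b x) (c x)"]) (intro continuous_intros assms)
  show ?thesis
    unfolding ip_face_vec_def dotc_diff dotc_scale eq
    by (simp only: set_integral_diff(2)[OF i1 i2] set_integral_mult_right)
qed

section \<open>Volume and boundary terms, jumps and the reduced form\<close>

context simplicial_mesh
begin

lemma integral_mesh_inner:
  fixes F :: "real^'n \<Rightarrow> complex"
  assumes F: "\<And>K x. K \<in> T \<Longrightarrow> x \<in> interior K \<Longrightarrow> F x = \<Phi> K x" and cont: "\<And>K. K \<in> T \<Longrightarrow> continuous_on K (\<Phi> K)"
  shows "Re (LINT x:\<Omega>|lebesgue. F x) = (\<Sum>K\<in>T. LINT x:K|lebesgue. Re (\<Phi> K x))"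
proof -
  have "integrable lebesgue (\<lambda>x. indicat_real \<Omega> x *\<^sub>R F x)"
    using integral_mesh(1)[of F \<Phi>] assms by (simp add: set_integrable_def)
  then have "Re (LINT x:\<Omega>|lebesgue. F x) = (LINT x:\<Omega>|lebesgue. Re (F x))"
    unfolding set_lebesgue_integral_def by (subst integral_Re[symmetric]) simp_all
  also have "\<dots> = (\<Sum>K\<in>T. LINT x:K|lebesgue. Re (\<Phi> K x))"
    using assms by (intro integral_mesh(2)) (auto intro!: continuous_intros)
  finally show ?thesis .
qed

lemma norm_sq_eq:
  fixes f :: "real^'n \<Rightarrow> 'b::euclidean_space"
  assumes "pw_affine f"
  shows "norm_sq \<Omega> f = (\<Sum>K\<in>T. LINT x:K|lebesgue. (norm (ext K f x))\<^sup>2)"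
  unfolding norm_sq_def
  by (rule integral_mesh(2)) (auto simp: ext_affine(2)[OF assms] intro!: continuous_intros continuous_ext[OF assms])

lemma Re_ip:
  assumes "pw_affine u" "pw_affine v"
  shows "Re (ip \<Omega> u v) = (\<Sum>K\<in>T. LINT x:K|lebesgue. ext K u x \<bullet> ext K v x)"
proof -
  have "Re (ip \<Omega> u v) = (\<Sum>K\<in>T. LINT x:K|lebesgue. Re (ext K u x * cnj (ext K v x)))"
    unfolding ip_def
    by (rule integral_mesh_inner) (auto simp: ext_affine(2)[OF assms(1)] ext_affine(2)[OF assms(2)]
      intro!: continuous_intros continuous_ext assms)
  then show ?thesis by (simp add: inner_complex_def)
qed

lemma Re_ip_vec:
  assumes "pw_affine u" "pw_affine v"
  shows "Re (ip_vec \<Omega> u v) = (\<Sum>K\<in>T. LINT x:K|lebesgue. ext K u x \<bullet> ext K v x)"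
proof -
  have "Re (ip_vec \<Omega> u v) = (\<Sum>K\<in>T. LINT x:K|lebesgue. Re (dotc (ext K u x) (ext K v x)))"
    unfolding ip_vec_def
    by (rule integral_mesh_inner) (auto simp: ext_affine(2)[OF assms(1)] ext_affine(2)[OF assms(2)]
      intro!: continuous_intros continuous_ext assms)
  then show ?thesis by (simp add: dotc_inner)
qed

lemma bdry_facet: "(K, e) \<in> boundary_faces \<Omega> T \<Longrightarrow> K \<in> T \<and> e facet_of K"
  by (auto simp: boundary_faces_def)

lemma norm_sq_bdry_eq:
  fixes f :: "real^'n \<Rightarrow> 'b::real_normed_vector"
  assumes "pw_affine f"
  shows "norm_sq_bdry \<Omega> T f = (\<Sum>(K, e)\<in>boundary_faces \<Omega> T. face_integral e (\<lambda>x. (norm (ext K f x))\<^sup>2))"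
  unfolding norm_sq_bdry_def
proof (intro sum.cong refl, clarify)
  fix K e assume "(K, e) \<in> boundary_faces \<Omega> T"
  then have K: "K \<in> T" "e facet_of K" using bdry_facet by blast+
  have "trace_on K f x = ext K f x" if "x \<in> e" for x
    using trace_ext[OF assms K(1)] that facet_of_imp_subset[OF K(2)] by blast
  then show "face_integral e (\<lambda>x. (norm (trace_on K f x))\<^sup>2) = face_integral e (\<lambda>x. (norm (ext K f x))\<^sup>2)"
    by (intro face_integral_cong[OF hyperplane_piece_facet[OF K]]) simp
qed

lemma Re_ip_bdry:
  assumes "pw_affine u" "pw_affine v"
  shows "Re (z * ip_bdry \<Omega> T u v) = (\<Sum>(K, e)\<in>boundary_faces \<Omega> T. face_integral e (\<lambda>x. (z * ext K u x) \<bullet> ext K v x))"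
proof -
  have "Re (z * ip_face e (trace_on K u) (trace_on K v)) = face_integral e (\<lambda>x. (z * ext K u x) \<bullet> ext K v x)"
    if "(K, e) \<in> boundary_faces \<Omega> T" for K e
  proof -
    have K: "K \<in> T" "e facet_of K" using bdry_facet that by blast+
    have tr: "trace_on K f x = ext K f x" if "x \<in> e" "pw_affine f" for x and f :: "real^'n \<Rightarrow> complex"
      using trace_ext[OF that(2) K(1)] that(1) facet_of_imp_subset[OF K(2)] by blast
    have "ip_face e (trace_on K u) (trace_on K v) = ip_face e (ext K u) (ext K v)"
      unfolding ip_face_def by (rule face_integral_cong[OF hyperplane_piece_facet[OF K]]) (simp add: tr assms)
    then show ?thesis
      using Re_ip_face[OF hyperplane_piece_facet[OF K] continuous_ext[OF assms(1) K(1)] continuous_ext[OF assms(2) K(1)]] by simp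
  qed
  then show ?thesis
    unfolding ip_bdry_def sum_distrib_left Re_sum by (intro sum.cong refl) (simp add: split_beta)
qed

text \<open>An arbitrary order of the two elements at a face. It fixes the normal
  \<open>nrm e\<close> and the sign of \<open>jmp\<close>; the vector jump, their product, does not
  depend on it.\<close>

definition sides :: "(real^'n) set \<Rightarrow> (real^'n) set \<times> (real^'n) set" where
  "sides e = (SOME (K, K'). K \<in> T \<and> K' \<in> T \<and> K \<noteq> K' \<and> e facet_of K \<and> e facet_of K')"

definition K1 :: "(real^'n) set \<Rightarrow> (real^'n) set" where "K1 e = fst (sides e)"
definition K2 :: "(real^'n) set \<Rightarrow> (real^'n) set" where "K2 e = snd (sides e)"
definition nrm :: "(real^'n) set \<Rightarrow> real^'n" where "nrm e = outward_normal (K1 e) e"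

lemma sides:
  assumes "e \<in> interior_faces T"
  shows "K1 e \<in> T" "K2 e \<in> T" "K1 e \<noteq> K2 e" "e facet_of K1 e" "e facet_of K2 e"
    "adjacent T e = {K1 e, K2 e}" "outward_normal (K2 e) e = - nrm e" "hyperplane_piece e (nrm e)" "norm (nrm e) = 1"
proof -
  obtain K K' where "K \<in> T" "K' \<in> T" "K \<noteq> K'" "e facet_of K" "e facet_of K'"
    using interior_faceE[OF assms] by metis
  then have "\<exists>P. case P of (K, K') \<Rightarrow> K \<in> T \<and> K' \<in> T \<and> K \<noteq> K' \<and> e facet_of K \<and> e facet_of K'" by auto
  from someI_ex[OF this] show 1: "K1 e \<in> T" "K2 e \<in> T" "K1 e \<noteq> K2 e" "e facet_of K1 e" "e facet_of K2 e"
    unfolding K1_def K2_def sides_def[symmetric] by (simp_all add: split_beta)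
  show "adjacent T e = {K1 e, K2 e}" by (rule adjacent_interior[OF 1])
  show "outward_normal (K2 e) e = - nrm e" unfolding nrm_def by (rule normals_opposite[OF 1])
  show "hyperplane_piece e (nrm e)" unfolding nrm_def by (rule hyperplane_piece_facet[OF 1(1,4)])
  show "norm (nrm e) = 1" unfolding nrm_def by (rule unit_outward(2)[OF 1(1,4)])
qed

definition jmp :: "(real^'n) set \<Rightarrow> (real^'n \<Rightarrow> 'b::real_normed_vector) \<Rightarrow> real^'n \<Rightarrow> 'b" where
  "jmp e f x = ext (K1 e) f x - ext (K2 e) f x"

definition mean :: "(real^'n) set \<Rightarrow> (real^'n \<Rightarrow> 'b::real_normed_vector) \<Rightarrow> real^'n \<Rightarrow> 'b" where
  "mean e f x = (1/2) *\<^sub>R (ext (K1 e) f x + ext (K2 e) f x)"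

lemma continuous_jmp:
  assumes "pw_affine f" "e \<in> interior_faces T"
  shows "continuous_on S (jmp e f)" "continuous_on S (mean e f)"
  unfolding jmp_def mean_def by (intro continuous_intros continuous_ext sides assms)+

lemma face_values:
  assumes e: "e \<in> interior_faces T" and x: "x \<in> e"
  shows "pw_affine w \<Longrightarrow> jump T e w x = jmp e w x *s cvec (nrm e)"
    and "pw_affine \<sigma> \<Longrightarrow> jump_vec T e \<sigma> x = dotc (jmp e \<sigma> x) (cvec (nrm e))"
    and "pw_affine \<sigma> \<Longrightarrow> avg T e \<sigma> x = mean e \<sigma> x"
proof -
  note s = sides[OF e]
  have x12: "x \<in> K1 e" "x \<in> K2 e" using x facet_of_imp_subset s(4,5) by blast+
  have cm: "cvec (- n) = - cvec n" for n :: "real^'n" by (simp add: cvec_def vec_eq_iff)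
  show "jump T e w x = jmp e w x *s cvec (nrm e)" if "pw_affine w"
    unfolding jump_def s(6) using s(3) x12 trace_ext[OF that s(1)] trace_ext[OF that s(2)]
    by (simp add: s(7) nrm_def[symmetric] cm jmp_def vec_eq_iff algebra_simps)
  show "jump_vec T e \<sigma> x = dotc (jmp e \<sigma> x) (cvec (nrm e))" if "pw_affine \<sigma>"
    unfolding jump_vec_def s(6) using s(3) x12 trace_ext[OF that s(1)] trace_ext[OF that s(2)]
    by (simp add: s(7) nrm_def[symmetric] cm jmp_def dotc_def algebra_simps sum.distrib sum_subtractf sum_negf)
  show "avg T e \<sigma> x = mean e \<sigma> x" if "pw_affine \<sigma>"
    unfolding avg_def s(6) using s(3) x12 trace_ext[OF that s(1)] trace_ext[OF that s(2)]
    by (simp add: mean_def)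
qed

lemma ip_face_vec_cong:
  assumes e: "e \<in> interior_faces T" and "\<And>x. x \<in> e \<Longrightarrow> a x = a' x" "\<And>x. x \<in> e \<Longrightarrow> b x = b' x"
  shows "ip_face_vec e a b = ip_face_vec e a' b'"
  unfolding ip_face_vec_def by (rule face_integral_cong[OF sides(8)[OF e]]) (simp add: assms)

lemma ip_face_cong:
  assumes e: "e \<in> interior_faces T" and "\<And>x. x \<in> e \<Longrightarrow> a x = a' x" "\<And>x. x \<in> e \<Longrightarrow> b x = b' x"
  shows "ip_face e a b = ip_face e a' b'"
  unfolding ip_face_def by (rule face_integral_cong[OF sides(8)[OF e]]) (simp add: assms)

definition jump_sq :: "(real^'n \<Rightarrow> complex) \<Rightarrow> real" where
  "jump_sq w = (\<Sum>e\<in>interior_faces T. face_integral e (\<lambda>x. (norm (jmp e w x))\<^sup>2))"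

definition normal_jump_sq :: "(real^'n \<Rightarrow> complex^'n) \<Rightarrow> real" where
  "normal_jump_sq \<sigma> = (\<Sum>e\<in>interior_faces T. face_integral e (\<lambda>x. (norm (dotc (jmp e \<sigma> x) (cvec (nrm e))))\<^sup>2))"

text \<open>On \<open>S_h\<close> the terms of the form that contain \<open>\<tau>\<close> cancel.\<close>

definition reduced_form :: "real \<Rightarrow> real \<Rightarrow> (real^'n \<Rightarrow> complex) \<Rightarrow> (real^'n \<Rightarrow> complex^'n) \<Rightarrow> (real^'n \<Rightarrow> complex) \<Rightarrow> complex" where
  "reduced_form k \<beta> w \<sigma> v =
     ip_vec \<Omega> \<sigma> (grad_h T v) - complex_of_real (k\<^sup>2) * ip \<Omega> w v
     + \<i> * complex_of_real k * ip_bdry \<Omega> T w v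
     - (\<Sum>e\<in>interior_faces T. ip_face_vec e (\<lambda>x. mean e \<sigma> x - (\<i> * complex_of_real \<beta>) *s (jmp e w x *s cvec (nrm e))) (\<lambda>x. jmp e v x *s cvec (nrm e)))"

text \<open>Rewrites the one-sided traces as \<open>jmp\<close> and \<open>mean\<close>. The form
  becomes \<open>reduced_form\<close> plus the residual of the equation that defines
  \<open>S_h\<close>.\<close>

lemma S_hD:
  assumes "(w, \<sigma>) \<in> S_h \<Omega> T \<delta>"
  shows "pw_affine w" "pw_affine \<sigma>"
    "pw_affine v \<Longrightarrow> B_h \<Omega> T k \<beta> \<delta> w \<sigma> v \<tau>' = reduced_form k \<beta> w \<sigma> v + (ip_vec \<Omega> \<sigma> \<tau>' - ip_vec \<Omega> (grad_h T w) \<tau>'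
     - (\<Sum>e\<in>interior_faces T. \<i> * complex_of_real \<delta> * ip_face e (jump_vec T e \<sigma>) (jump_vec T e \<tau>') - ip_face_vec e (jump T e w) (avg T e \<tau>')))"
    "pw_affine \<tau> \<Longrightarrow> ip_vec \<Omega> \<sigma> \<tau> - ip_vec \<Omega> (grad_h T w) \<tau>
     = (\<Sum>e\<in>interior_faces T. \<i> * complex_of_real \<delta> * ip_face e (\<lambda>x. dotc (jmp e \<sigma> x) (cvec (nrm e))) (\<lambda>x. dotc (jmp e \<tau> x) (cvec (nrm e)))
       - ip_face_vec e (\<lambda>x. jmp e w x *s cvec (nrm e)) (mean e \<tau>))"
proof -
  show w: "pw_affine w" and s: "pw_affine \<sigma>"
    using assms by (auto simp: S_h_def V_h_iff Sigma_h_iff)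
  show "B_h \<Omega> T k \<beta> \<delta> w \<sigma> v \<tau>' = reduced_form k \<beta> w \<sigma> v + (ip_vec \<Omega> \<sigma> \<tau>' - ip_vec \<Omega> (grad_h T w) \<tau>'
     - (\<Sum>e\<in>interior_faces T. \<i> * complex_of_real \<delta> * ip_face e (jump_vec T e \<sigma>) (jump_vec T e \<tau>') - ip_face_vec e (jump T e w) (avg T e \<tau>')))"
    if v: "pw_affine v"
  proof -
    have "(\<Sum>e\<in>interior_faces T. ip_face_vec e (\<lambda>x. avg T e \<sigma> x - (\<i> * complex_of_real \<beta>) *s jump T e w x) (jump T e v))
      = (\<Sum>e\<in>interior_faces T. ip_face_vec e (\<lambda>x. mean e \<sigma> x - (\<i> * complex_of_real \<beta>) *s (jmp e w x *s cvec (nrm e))) (\<lambda>x. jmp e v x *s cvec (nrm e)))"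
      by (intro sum.cong refl ip_face_vec_cong) (simp_all add: face_values w s v)
    then show ?thesis unfolding B_h_def reduced_form_def by simp
  qed
  show "ip_vec \<Omega> \<sigma> \<tau> - ip_vec \<Omega> (grad_h T w) \<tau>
     = (\<Sum>e\<in>interior_faces T. \<i> * complex_of_real \<delta> * ip_face e (\<lambda>x. dotc (jmp e \<sigma> x) (cvec (nrm e))) (\<lambda>x. dotc (jmp e \<tau> x) (cvec (nrm e)))
       - ip_face_vec e (\<lambda>x. jmp e w x *s cvec (nrm e)) (mean e \<tau>))" if t: "pw_affine \<tau>"
  proof -
    have "ip_vec \<Omega> \<sigma> \<tau> - ip_vec \<Omega> (grad_h T w) \<tau>
     - (\<Sum>e\<in>interior_faces T. \<i> * complex_of_real \<delta> * ip_face e (jump_vec T e \<sigma>) (jump_vec T e \<tau>) - ip_face_vec e (jump T e w) (avg T e \<tau>)) = 0"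
      using assms t unfolding S_h_def by (auto simp: Sigma_h_iff)
    moreover have "(\<Sum>e\<in>interior_faces T. \<i> * complex_of_real \<delta> * ip_face e (jump_vec T e \<sigma>) (jump_vec T e \<tau>) - ip_face_vec e (jump T e w) (avg T e \<tau>))
      = (\<Sum>e\<in>interior_faces T. \<i> * complex_of_real \<delta> * ip_face e (\<lambda>x. dotc (jmp e \<sigma> x) (cvec (nrm e))) (\<lambda>x. dotc (jmp e \<tau> x) (cvec (nrm e)))
       - ip_face_vec e (\<lambda>x. jmp e w x *s cvec (nrm e)) (mean e \<tau>))"
      by (intro sum.cong refl arg_cong2[of _ _ _ _ minus] arg_cong2[of _ _ _ _ times] ip_face_vec_cong ip_face_cong)
         (simp_all add: face_values w s t)
    ultimately show ?thesis by simp
  qed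
qed

lemma B_h_S_h:
  assumes "(w, \<sigma>) \<in> S_h \<Omega> T \<delta>" "pw_affine v" "pw_affine \<tau>"
  shows "B_h \<Omega> T k \<beta> \<delta> w \<sigma> v \<tau> = reduced_form k \<beta> w \<sigma> v"
proof -
  have "ip_vec \<Omega> \<sigma> \<tau> - ip_vec \<Omega> (grad_h T w) \<tau>
     - (\<Sum>e\<in>interior_faces T. \<i> * complex_of_real \<delta> * ip_face e (jump_vec T e \<sigma>) (jump_vec T e \<tau>) - ip_face_vec e (jump T e w) (avg T e \<tau>)) = 0"
    using assms unfolding S_h_def by (auto simp: Sigma_h_iff)
  then show ?thesis using S_hD(3)[OF assms(1,2), of k \<beta> \<tau>] by simp
qed

text \<open>The \<open>S_h\<close> equation with \<open>\<tau> = \<sigma>\<close> expresses the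
  product of \<sigma> and \<nabla>w by the norm of \<sigma>, an imaginary jump term and the means of
  \<sigma> against the jumps of \<open>w\<close>; the last of these cancels the flux term of the
  form.\<close>

lemma reduced_form_diag:
  assumes S: "(w, \<sigma>) \<in> S_h \<Omega> T \<delta>"
  shows "Re (reduced_form k \<beta> w \<sigma> w) = norm_sq \<Omega> \<sigma> - k\<^sup>2 * norm_sq \<Omega> w"
    "Im (reduced_form k \<beta> w \<sigma> w) = k * norm_sq_bdry \<Omega> T w + \<beta> * jump_sq w + \<delta> * normal_jump_sq \<sigma>"
proof -
  note w = S_hD(1)[OF S] and s = S_hD(2)[OF S]
  let ?I = "interior_faces T"
  let ?jw = "\<lambda>e x. jmp e w x *s cvec (nrm e)" and ?js = "\<lambda>e x. dotc (jmp e \<sigma> x) (cvec (nrm e))"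
  have jw: "face_integral e (\<lambda>x. (norm (?jw e x))\<^sup>2) = face_integral e (\<lambda>x. (norm (jmp e w x))\<^sup>2)" if "e \<in> ?I" for e
    using sides(9)[OF that] by (simp add: norm_scale_cvec)
  have "complex_of_real (norm_sq \<Omega> \<sigma>) - ip_vec \<Omega> (grad_h T w) \<sigma> = (\<Sum>e\<in>?I. \<i> * complex_of_real \<delta> * ip_face e (?js e) (?js e) - ip_face_vec e (?jw e) (mean e \<sigma>))"
    using S_hD(4)[OF S s] by (simp add: ip_vec_self)
  \<comment> \<open>Conjugation puts \<sigma> first, as in the form, and turns the sign of
    \<open>\<i> \<delta>\<close>, so that the jumps of \<sigma> end up with the same sign as those
    of \<open>w\<close>.\<close>
  then have "cnj (complex_of_real (norm_sq \<Omega> \<sigma>) - ip_vec \<Omega> (grad_h T w) \<sigma>) = cnj (\<Sum>e\<in>?I. \<i> * complex_of_real \<delta> * ip_face e (?js e) (?js e) - ip_face_vec e (?jw e) (mean e \<sigma>))"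
    by simp
  then have 1: "complex_of_real (norm_sq \<Omega> \<sigma>) - ip_vec \<Omega> \<sigma> (grad_h T w) = - \<i> * complex_of_real \<delta> * complex_of_real (normal_jump_sq \<sigma>) - (\<Sum>e\<in>?I. ip_face_vec e (mean e \<sigma>) (?jw e))"
    by (simp add: ip_vec_cnj ip_face_self ip_face_vec_cnj normal_jump_sq_def sum_subtractf sum_negf sum_distrib_left)
  have "(\<Sum>e\<in>?I. ip_face_vec e (\<lambda>x. mean e \<sigma> x - (\<i> * complex_of_real \<beta>) *s ?jw e x) (?jw e))
    = (\<Sum>e\<in>?I. ip_face_vec e (mean e \<sigma>) (?jw e) - \<i> * complex_of_real \<beta> * complex_of_real (face_integral e (\<lambda>x. (norm (jmp e w x))\<^sup>2)))"
  proof (intro sum.cong refl)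
    fix e assume e: "e \<in> ?I"
    have "ip_face_vec e (\<lambda>x. mean e \<sigma> x - (\<i> * complex_of_real \<beta>) *s ?jw e x) (?jw e)
      = ip_face_vec e (mean e \<sigma>) (?jw e) - \<i> * complex_of_real \<beta> * ip_face_vec e (?jw e) (?jw e)"
      by (rule ip_face_vec_lin[OF sides(8)[OF e]]) (intro continuous_intros continuous_jmp[OF w e] continuous_jmp[OF s e])+
    then show "ip_face_vec e (\<lambda>x. mean e \<sigma> x - (\<i> * complex_of_real \<beta>) *s ?jw e x) (?jw e)
      = ip_face_vec e (mean e \<sigma>) (?jw e) - \<i> * complex_of_real \<beta> * complex_of_real (face_integral e (\<lambda>x. (norm (jmp e w x))\<^sup>2))"
      unfolding ip_face_vec_self jw[OF e] .
  qed
  also have "\<dots> = (\<Sum>e\<in>?I. ip_face_vec e (mean e \<sigma>) (?jw e)) - \<i> * complex_of_real \<beta> * complex_of_real (jump_sq w)"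
    by (simp add: sum_subtractf jump_sq_def sum_distrib_left)
  finally have 2: "reduced_form k \<beta> w \<sigma> w = ip_vec \<Omega> \<sigma> (grad_h T w) - complex_of_real (k\<^sup>2 * norm_sq \<Omega> w)
     + \<i> * complex_of_real (k * norm_sq_bdry \<Omega> T w) - (\<Sum>e\<in>?I. ip_face_vec e (mean e \<sigma>) (?jw e)) + \<i> * complex_of_real (\<beta> * jump_sq w)"
    unfolding reduced_form_def ip_self ip_bdry_self by (simp add: mult.assoc)
  have 3: "reduced_form k \<beta> w \<sigma> w = complex_of_real (norm_sq \<Omega> \<sigma> - k\<^sup>2 * norm_sq \<Omega> w)
     + \<i> * complex_of_real (k * norm_sq_bdry \<Omega> T w + \<beta> * jump_sq w + \<delta> * normal_jump_sq \<sigma>)"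
    unfolding 2 using 1 by (simp add: algebra_simps)
  show "Re (reduced_form k \<beta> w \<sigma> w) = norm_sq \<Omega> \<sigma> - k\<^sup>2 * norm_sq \<Omega> w"
    "Im (reduced_form k \<beta> w \<sigma> w) = k * norm_sq_bdry \<Omega> T w + \<beta> * jump_sq w + \<delta> * normal_jump_sq \<sigma>"
    unfolding 3 by simp_all
qed

end

section \<open>Rellich's identity\<close>

lemma young: "0 < \<epsilon> \<Longrightarrow> x * y \<le> \<epsilon> * x\<^sup>2 + y\<^sup>2 / (4 * (\<epsilon>::real))"
proof -
  assume e: "0 < \<epsilon>"
  have "0 \<le> (2 * \<epsilon> * x - y)\<^sup>2 / (4 * \<epsilon>)" using e by simp
  also have "\<dots> = \<epsilon> * x\<^sup>2 - x * y + y\<^sup>2 / (4 * \<epsilon>)"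
    using e by (simp add: field_simps power2_eq_square)
  finally show ?thesis by simp
qed

lemma inner_young:
  fixes a b :: "'a::real_inner"
  assumes "0 < \<epsilon>" "norm a \<le> x" "norm b \<le> y"
  shows "\<bar>a \<bullet> b\<bar> \<le> \<epsilon> * x\<^sup>2 + y\<^sup>2 / (4 * \<epsilon>)"
proof -
  have "\<bar>a \<bullet> b\<bar> \<le> norm a * norm b" by (rule Cauchy_Schwarz_ineq2)
  also have "\<dots> \<le> x * y" using assms(2,3) norm_ge_zero order_trans by (intro mult_mono) blast+
  also have "\<dots> \<le> \<epsilon> * x\<^sup>2 + y\<^sup>2 / (4 * \<epsilon>)" by (rule young[OF assms(1)])
  finally show ?thesis .
qed

lemma square_sum_le: "(x + y)\<^sup>2 \<le> 2 * (x\<^sup>2 + (y::real)\<^sup>2)"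
  using zero_le_power2[of "x - y"] by (simp add: power2_eq_square algebra_simps)

lemma norm_sum_sq_le: "(norm (a + b))\<^sup>2 \<le> 2 * ((norm a)\<^sup>2 + (norm (b::'a::real_normed_vector))\<^sup>2)"
  and norm_diff_sq_le: "(norm (a - b))\<^sup>2 \<le> 2 * ((norm a)\<^sup>2 + (norm b)\<^sup>2)"
proof -
  have "(norm (a + b))\<^sup>2 \<le> (norm a + norm b)\<^sup>2" "(norm (a - b))\<^sup>2 \<le> (norm a + norm b)\<^sup>2"
    by (intro power_mono norm_triangle_ineq norm_triangle_ineq4 norm_ge_zero)+
  then show "(norm (a + b))\<^sup>2 \<le> 2 * ((norm a)\<^sup>2 + (norm b)\<^sup>2)" "(norm (a - b))\<^sup>2 \<le> 2 * ((norm a)\<^sup>2 + (norm b)\<^sup>2)"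
    using square_sum_le[of "norm a" "norm b"] by linarith+
qed

lemma norm_half_sum_sq_le: "(norm ((1/2) *\<^sub>R (a + b)))\<^sup>2 \<le> (norm a)\<^sup>2 + (norm (b::'a::real_normed_vector))\<^sup>2"
proof -
  have "(norm ((1/2) *\<^sub>R (a + b)))\<^sup>2 = (norm (a + b))\<^sup>2 / 4" by (simp add: power_divide)
  also have "\<dots> \<le> 2 * ((norm a)\<^sup>2 + (norm b)\<^sup>2) / 4" by (intro divide_right_mono norm_sum_sq_le) simp
  also have "\<dots> \<le> (norm a)\<^sup>2 + (norm b)\<^sup>2" by simp
  finally show ?thesis .
qed

text \<open>Removes the normal component; as \<open>n\<close> is real, the bilinear
  \<open>pairing\<close> serves as the product.\<close>

definition tangential :: "real^'n \<Rightarrow> complex^'n \<Rightarrow> complex^'n" where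
  "tangential n G = G - pairing n G *s cvec n"

lemma pairing_scale: "pairing u (z *s g) = z * pairing u g"
  unfolding pairing_def by (simp add: sum_distrib_left algebra_simps scaleR_conv_of_real)

lemma pairing_cvec: "pairing u (cvec n) = complex_of_real (u \<bullet> n)"
  unfolding pairing_def cvec_def inner_vec_def by (simp add: scaleR_conv_of_real)

lemma pairing_diff: "pairing u (g - g') = pairing u g - pairing u g'"
  unfolding pairing_def by (simp add: algebra_simps sum_subtractf)

lemma pairing_tangential: "pairing u (tangential n G) = pairing u G - complex_of_real (u \<bullet> n) * pairing n G"
  unfolding tangential_def pairing_diff pairing_scale pairing_cvec by (simp add: mult.commute)

text \<open>Presents a component as a derivative in a real tangential direction, the form that
  \<open>tangential_inverse_inequality\<close> bounds.\<close>

lemma tangential_nth: "tangential n G $ i = pairing (axis i 1 - (n $ i) *\<^sub>R n) G"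
proof -
  have "pairing (axis i 1 - (n $ i) *\<^sub>R n) G = pairing (axis i 1) G - n $ i *\<^sub>R pairing n G"
    by (simp add: linear_diff[OF linear_pairing_left] linear_scale[OF linear_pairing_left])
  also have "pairing (axis i 1) G = G $ i"
    unfolding pairing_def by (simp add: axis_def if_distrib[of "\<lambda>c. c *\<^sub>R _"] cong: if_cong)
  finally show ?thesis unfolding tangential_def cvec_def by (simp add: scaleR_conv_of_real mult.commute)
qed

text \<open>The gradient part of Rellich's identity on an interior face: with \<open>\<alpha> = x - x0\<close> and
  \<open>a = \<alpha> \<bullet> n\<close>, the field \<open>a G - (\<alpha> \<cdot> G) n\<close> only depends on the tangential part of the jump \<open>G\<close>.\<close>

lemma rellich_face_identity:
  fixes G :: "complex^'n"
  assumes "\<alpha> \<bullet> n = a"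
  shows "a *\<^sub>R G - pairing \<alpha> G *s cvec n = a *\<^sub>R tangential n G - pairing \<alpha> (tangential n G) *s cvec n"
  unfolding pairing_tangential assms
  by (simp add: tangential_def vec_eq_iff cvec_def scaleR_conv_of_real[where 'a = complex] algebra_simps)

text \<open>On the two sides of a face, \<open>g\<close> stands for the gradients of
  \<open>w\<close>, \<open>r\<close> for the defect, so that \<open>g + r\<close> is \<sigma>, and
  \<open>W\<close> for the values of \<open>w\<close>. All terms are products; Young's inequality
  puts \<epsilon> on the factor that is absorbed later and \<open>1/\<epsilon>\<close> on the jumps
  of \<open>w\<close>, the tangential gradient jump and the defect.\<close>

lemma rellich_face_pointwise:
  fixes g1 g2 r1 r2 :: "complex^'n" and W1 W2 :: complex
  assumes n: "norm n = 1" and \<alpha>: "\<alpha> \<bullet> n = a" "norm \<alpha> \<le> R" and \<epsilon>: "0 < \<epsilon>" and k: "0 \<le> k" and b: "0 \<le> \<beta>"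
  shows "- ((2 + 4 * R\<^sup>2) * \<epsilon> * ((norm g1)\<^sup>2 + (norm g2)\<^sup>2) + 2 * \<epsilon> * k\<^sup>2 * ((norm W1)\<^sup>2 + (norm W2)\<^sup>2)
      + (R\<^sup>2 * (norm (tangential n (g1 - g2)))\<^sup>2 + (k\<^sup>2 * R\<^sup>2 + \<beta>\<^sup>2) * (norm (W1 - W2))\<^sup>2 + ((norm r1)\<^sup>2 + (norm r2)\<^sup>2)) / (4 * \<epsilon>))
    \<le> a / 2 * ((norm g1)\<^sup>2 - (norm g2)\<^sup>2) - k\<^sup>2 * a / 2 * ((norm W1)\<^sup>2 - (norm W2)\<^sup>2)
      - ((1/2) *\<^sub>R ((g1 + r1) + (g2 + r2)) - (\<i> * complex_of_real \<beta>) *s ((W1 - W2) *s cvec n)) \<bullet> ((pairing \<alpha> g1 - pairing \<alpha> g2) *s cvec n)"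
proof -
  let ?G = "g1 - g2" and ?t = "tangential n (g1 - g2)" and ?V = "pairing \<alpha> g1 - pairing \<alpha> g2"
  let ?Vn = "?V *s cvec n"
  have R0: "0 \<le> R" using \<alpha>(2) norm_ge_zero order_trans by blast
  have aR: "\<bar>a\<bar> \<le> R" using Cauchy_Schwarz_ineq2[of \<alpha> n] n \<alpha> by simp
  have V: "?V = pairing \<alpha> ?G" by (simp add: pairing_diff)
  have nV: "norm ?Vn \<le> R * norm ?G"
    unfolding norm_scale_cvec n V using norm_pairing[of \<alpha> ?G] mult_right_mono[OF \<alpha>(2) norm_ge_zero[of ?G]] by simp
  have GG: "(norm ?G)\<^sup>2 \<le> 2 * ((norm g1)\<^sup>2 + (norm g2)\<^sup>2)" by (rule norm_diff_sq_le)
  have VV: "(R * norm ?G)\<^sup>2 \<le> 2 * R\<^sup>2 * ((norm g1)\<^sup>2 + (norm g2)\<^sup>2)"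
    using mult_left_mono[OF GG, of "R\<^sup>2"] by (simp add: power_mult_distrib algebra_simps)
  have diffsq: "(norm x)\<^sup>2 - (norm y)\<^sup>2 = (x - y) \<bullet> (x + y)" for x y :: "'c::real_inner"
    by (simp add: power2_norm_eq_inner algebra_simps inner_commute)
  have 1: "a / 2 * ((norm g1)\<^sup>2 - (norm g2)\<^sup>2) - (1/2) *\<^sub>R (g1 + g2) \<bullet> ?Vn \<ge> - (\<epsilon> * (norm (g1 + g2))\<^sup>2 + (R * norm ?t)\<^sup>2 / (4 * \<epsilon>))"
  proof -
    \<comment> \<open>The difference of squares and the flux are both products with
      \<open>g1 + g2\<close>; only their combination is free of the normal part of the gradient
      jump.\<close>
    have "a / 2 * ((norm g1)\<^sup>2 - (norm g2)\<^sup>2) - (1/2) *\<^sub>R (g1 + g2) \<bullet> ?Vn = (g1 + g2) \<bullet> ((1/2) *\<^sub>R (a *\<^sub>R ?G - ?Vn))"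
      unfolding diffsq by (simp add: inner_diff_right inner_commute algebra_simps)
    also have "a *\<^sub>R ?G - ?Vn = a *\<^sub>R ?t - pairing \<alpha> ?t *s cvec n"
      unfolding V by (rule rellich_face_identity[OF \<alpha>(1)])
    also have "\<bar>(g1 + g2) \<bullet> ((1/2) *\<^sub>R (a *\<^sub>R ?t - pairing \<alpha> ?t *s cvec n))\<bar> \<le> \<epsilon> * (norm (g1 + g2))\<^sup>2 + (R * norm ?t)\<^sup>2 / (4 * \<epsilon>)"
    proof (rule inner_young[OF \<epsilon> order_refl])
      have "norm (a *\<^sub>R ?t - pairing \<alpha> ?t *s cvec n) \<le> norm (a *\<^sub>R ?t) + norm (pairing \<alpha> ?t *s cvec n)"
        by (rule norm_triangle_ineq4)
      also have "norm (pairing \<alpha> ?t *s cvec n) \<le> R * norm ?t"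
        unfolding norm_scale_cvec n using norm_pairing[of \<alpha> ?t] mult_right_mono[OF \<alpha>(2) norm_ge_zero[of ?t]] by simp
      also have "norm (a *\<^sub>R ?t) \<le> R * norm ?t" using mult_right_mono[OF aR norm_ge_zero[of ?t]] by simp
      finally show "norm ((1/2) *\<^sub>R (a *\<^sub>R ?t - pairing \<alpha> ?t *s cvec n)) \<le> R * norm ?t" by simp
    qed
    ultimately show ?thesis by linarith
  qed
  have 2: "k\<^sup>2 * a / 2 * ((norm W1)\<^sup>2 - (norm W2)\<^sup>2) \<le> k\<^sup>2 * (\<epsilon> * (norm (W1 + W2))\<^sup>2 + (R * norm (W1 - W2))\<^sup>2 / (4 * \<epsilon>))"
  proof -
    have "a / 2 * ((norm W1)\<^sup>2 - (norm W2)\<^sup>2) = (W1 + W2) \<bullet> ((a / 2) *\<^sub>R (W1 - W2))"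
      unfolding diffsq by (simp add: inner_commute)
    also have "\<dots> \<le> \<bar>(W1 + W2) \<bullet> ((a / 2) *\<^sub>R (W1 - W2))\<bar>" by simp
    also have "\<dots> \<le> \<epsilon> * (norm (W1 + W2))\<^sup>2 + (R * norm (W1 - W2))\<^sup>2 / (4 * \<epsilon>)"
    proof (rule inner_young[OF \<epsilon> order_refl])
      have "\<bar>a / 2\<bar> \<le> R" using aR by linarith
      then show "norm ((a / 2) *\<^sub>R (W1 - W2)) \<le> R * norm (W1 - W2)"
        unfolding norm_scaleR by (rule mult_right_mono) simp
    qed
    finally have "k\<^sup>2 * (a / 2 * ((norm W1)\<^sup>2 - (norm W2)\<^sup>2)) \<le> k\<^sup>2 * (\<epsilon> * (norm (W1 + W2))\<^sup>2 + (R * norm (W1 - W2))\<^sup>2 / (4 * \<epsilon>))"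
      by (intro mult_left_mono) auto
    then show ?thesis by (simp only: times_divide_eq_right mult.assoc times_divide_eq_left)
  qed
  have 3: "\<bar>?Vn \<bullet> ((1/2) *\<^sub>R (r1 + r2))\<bar> \<le> \<epsilon> * (R * norm ?G)\<^sup>2 + (norm ((1/2) *\<^sub>R (r1 + r2)))\<^sup>2 / (4 * \<epsilon>)"
    by (rule inner_young[OF \<epsilon> nV order_refl])
  have "norm ((\<i> * complex_of_real \<beta>) *s ((W1 - W2) *s cvec n)) = \<beta> * norm (W1 - W2)"
    unfolding norm_vec_scale[of "\<i> * complex_of_real \<beta>"] norm_scale_cvec n using b by (simp add: norm_mult)
  then have 4: "\<bar>?Vn \<bullet> ((\<i> * complex_of_real \<beta>) *s ((W1 - W2) *s cvec n))\<bar> \<le> \<epsilon> * (R * norm ?G)\<^sup>2 + (\<beta> * norm (W1 - W2))\<^sup>2 / (4 * \<epsilon>)"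
    by (intro inner_young[OF \<epsilon> nV]) simp
  have split: "((1/2) *\<^sub>R ((g1 + r1) + (g2 + r2)) - (\<i> * complex_of_real \<beta>) *s ((W1 - W2) *s cvec n)) \<bullet> ?Vn
    = (1/2) *\<^sub>R (g1 + g2) \<bullet> ?Vn + ?Vn \<bullet> ((1/2) *\<^sub>R (r1 + r2)) - ?Vn \<bullet> ((\<i> * complex_of_real \<beta>) *s ((W1 - W2) *s cvec n))"
    by (simp add: inner_diff_left inner_add_left inner_add_right inner_commute algebra_simps)
  have s1: "\<epsilon> * (norm (g1 + g2))\<^sup>2 \<le> \<epsilon> * (2 * ((norm g1)\<^sup>2 + (norm g2)\<^sup>2))"
    using \<epsilon> by (intro mult_left_mono norm_sum_sq_le) auto
  have s2: "k\<^sup>2 * (\<epsilon> * (norm (W1 + W2))\<^sup>2) \<le> k\<^sup>2 * (\<epsilon> * (2 * ((norm W1)\<^sup>2 + (norm W2)\<^sup>2)))"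
    using \<epsilon> by (intro mult_left_mono norm_sum_sq_le) auto
  have s3: "\<epsilon> * (R * norm ?G)\<^sup>2 \<le> \<epsilon> * (2 * R\<^sup>2 * ((norm g1)\<^sup>2 + (norm g2)\<^sup>2))"
    using \<epsilon> by (intro mult_left_mono VV) auto
  have "(norm ((1/2) *\<^sub>R (r1 + r2)))\<^sup>2 \<le> (norm r1)\<^sup>2 + (norm r2)\<^sup>2"
    by (rule norm_half_sum_sq_le)
  then have s4: "(norm ((1/2) *\<^sub>R (r1 + r2)))\<^sup>2 / (4 * \<epsilon>) \<le> ((norm r1)\<^sup>2 + (norm r2)\<^sup>2) / (4 * \<epsilon>)"
    using \<epsilon> by (intro divide_right_mono) auto
  have e1: "(2 + 4 * R\<^sup>2) * \<epsilon> * ((norm g1)\<^sup>2 + (norm g2)\<^sup>2) = \<epsilon> * (2 * ((norm g1)\<^sup>2 + (norm g2)\<^sup>2)) + 2 * (\<epsilon> * (2 * R\<^sup>2 * ((norm g1)\<^sup>2 + (norm g2)\<^sup>2)))"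
    by (simp add: algebra_simps)
  have e2: "(R\<^sup>2 * (norm ?t)\<^sup>2 + (k\<^sup>2 * R\<^sup>2 + \<beta>\<^sup>2) * (norm (W1 - W2))\<^sup>2 + ((norm r1)\<^sup>2 + (norm r2)\<^sup>2)) / (4 * \<epsilon>)
    = (R * norm ?t)\<^sup>2 / (4 * \<epsilon>) + k\<^sup>2 * ((R * norm (W1 - W2))\<^sup>2 / (4 * \<epsilon>)) + (\<beta> * norm (W1 - W2))\<^sup>2 / (4 * \<epsilon>) + ((norm r1)\<^sup>2 + (norm r2)\<^sup>2) / (4 * \<epsilon>)"
    by (simp add: power_mult_distrib add_divide_distrib distrib_right)
  have e3: "2 * \<epsilon> * k\<^sup>2 * ((norm W1)\<^sup>2 + (norm W2)\<^sup>2) = k\<^sup>2 * (\<epsilon> * (2 * ((norm W1)\<^sup>2 + (norm W2)\<^sup>2)))"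
    by (simp add: algebra_simps)
  have e4: "k\<^sup>2 * (\<epsilon> * (norm (W1 + W2))\<^sup>2 + (R * norm (W1 - W2))\<^sup>2 / (4 * \<epsilon>)) = k\<^sup>2 * (\<epsilon> * (norm (W1 + W2))\<^sup>2) + k\<^sup>2 * ((R * norm (W1 - W2))\<^sup>2 / (4 * \<epsilon>))"
    by (rule distrib_left)
  show ?thesis
    unfolding split e1 e2 e3 using 1 2[unfolded e4] 3 4 s1 s2 s3 s4 unfolding abs_le_iff by linarith
qed

section \<open>Trace, lifting and divergence estimates on a mesh\<close>

locale regular_mesh = simplicial_mesh \<Omega> T for \<Omega> :: "(real^'n) set" and T +
  fixes x0 :: "real^'n" and c R \<eta> :: real
  assumes c_pos: "0 < c" and R: "\<And>x. x \<in> closure \<Omega> \<Longrightarrow> norm (x - x0) \<le> R"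
    and star: "\<And>x n. outward_normal_at \<Omega> x n \<Longrightarrow> c \<le> (x - x0) \<bullet> n"
    and \<eta>_pos: "0 < \<eta>"
    and heights: "\<And>K e p. K \<in> T \<Longrightarrow> e \<in> interior_faces T \<Longrightarrow> e facet_of K \<Longrightarrow> p \<in> vertices K \<Longrightarrow> \<eta> \<le> simplex_vertices.ht (vertices K) p"
begin

abbreviation FI :: "(real^'n) set \<Rightarrow> (real^'n \<Rightarrow> real) \<Rightarrow> real" where "FI \<equiv> face_integral"

lemma pos_face: "K \<in> T \<Longrightarrow> e facet_of K \<Longrightarrow> positive_functional e (FI e)"
  by (rule positive_functional_face[OF hyperplane_piece_facet])

lemma pos_int: "e \<in> interior_faces T \<Longrightarrow> positive_functional e (FI e)"
  by (rule positive_functional_face[OF sides(8)])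

lemma pos_T: "K \<in> T \<Longrightarrow> positive_functional K (\<lambda>f. LINT x:K|lebesgue. f x)"
  by (rule positive_functional_integral[OF compact_T])

lemma FI_nonneg:
  assumes "pw_affine f" "K \<in> T" "e facet_of K" "L \<in> T"
  shows "0 \<le> FI e (\<lambda>x. (norm (ext L f x))\<^sup>2)"
  by (rule positive_functional_nonneg[OF pos_face[OF assms(2,3)]]) (auto intro!: continuous_intros continuous_ext[OF assms(1,4)])

lemma cell_nonneg:
  assumes "pw_affine f" "K \<in> T"
  shows "0 \<le> (LINT x:K|lebesgue. (norm (ext K f x))\<^sup>2)"
  by (rule positive_functional_nonneg[OF pos_T[OF assms(2)]]) (auto intro!: continuous_intros continuous_ext[OF assms])

lemma norm_sq_nonneg:
  fixes f :: "real^'n \<Rightarrow> 'b::euclidean_space"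
  shows "pw_affine f \<Longrightarrow> 0 \<le> norm_sq \<Omega> f"
  unfolding norm_sq_eq by (intro sum_nonneg cell_nonneg)

lemma norm_sq_bdry_nonneg:
  fixes f :: "real^'n \<Rightarrow> 'b::real_normed_vector"
  shows "pw_affine f \<Longrightarrow> 0 \<le> norm_sq_bdry \<Omega> T f"
  unfolding norm_sq_bdry_eq by (intro sum_nonneg) (auto dest: bdry_facet intro: FI_nonneg)

text \<open>\<open>\<eta>\<close> bounds the heights of those elements that own an interior face,
  since it will be obtained from the diameters of interior faces.\<close>

lemma face_trace:
  fixes f :: "real^'n \<Rightarrow> 'b::euclidean_space"
  assumes f: "pw_affine f" and e: "e \<in> interior_faces T" and K: "K \<in> T" "e facet_of K"
  shows "\<eta> * FI e (\<lambda>x. (norm (ext K f x))\<^sup>2) \<le> 2 * (real CARD('n) + 1) * (LINT x:K|lebesgue. (norm (ext K f x))\<^sup>2)"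
proof -
  obtain p where p: "p \<in> vertices K" "e = opp (vertices K) p" using facetE[OF K] .
  interpret S: simplex_vertices "vertices K" by (rule sv(1)[OF K(1)])
  have SK: "S.K = K" by (rule sv(2)[OF K(1)])
  have "\<eta> * FI e (\<lambda>x. (norm (ext K f x))\<^sup>2) \<le> S.ht p * FI e (\<lambda>x. (norm (ext K f x))\<^sup>2)"
    by (rule mult_right_mono[OF heights[OF K(1) e K(2) p(1)] FI_nonneg[OF f K K(1)]])
  also have "\<dots> \<le> 2 * (real CARD('n) + 1) * (LINT x:K|lebesgue. (norm (ext K f x))\<^sup>2)"
    using S.trace_inequality[OF p(1) ext_affine(1)[OF f K(1)], unfolded SK] p(2) by simp
  finally show ?thesis .
qed

text \<open>Each element is counted at most once for each of its \<open>d + 1\<close> facets; this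
  is the second factor \<open>d + 1\<close>.\<close>

lemma trace_sum:
  fixes f :: "real^'n \<Rightarrow> 'b::euclidean_space"
  assumes f: "pw_affine f"
  shows "\<eta> * (\<Sum>e\<in>interior_faces T. FI e (\<lambda>x. (norm (ext (K1 e) f x))\<^sup>2) + FI e (\<lambda>x. (norm (ext (K2 e) f x))\<^sup>2))
    \<le> 2 * (real CARD('n) + 1)\<^sup>2 * norm_sq \<Omega> f"
proof -
  let ?N = "\<lambda>K. LINT x:K|lebesgue. (norm (ext K f x))\<^sup>2"
  have "\<eta> * (\<Sum>e\<in>interior_faces T. FI e (\<lambda>x. (norm (ext (K1 e) f x))\<^sup>2) + FI e (\<lambda>x. (norm (ext (K2 e) f x))\<^sup>2))
    \<le> (\<Sum>e\<in>interior_faces T. 2 * (real CARD('n) + 1) * (\<Sum>K\<in>adjacent T e. ?N K))"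
    unfolding sum_distrib_left
  proof (rule sum_mono)
    fix e assume e: "e \<in> interior_faces T"
    note s = sides[OF e]
    show "\<eta> * (FI e (\<lambda>x. (norm (ext (K1 e) f x))\<^sup>2) + FI e (\<lambda>x. (norm (ext (K2 e) f x))\<^sup>2)) \<le> (\<Sum>K\<in>adjacent T e. 2 * (real CARD('n) + 1) * ?N K)"
      unfolding s(6) using s(3) face_trace[OF f e s(1,4)] face_trace[OF f e s(2,5)] by (simp add: distrib_left)
  qed
  also have "\<dots> = 2 * (real CARD('n) + 1) * (\<Sum>e\<in>interior_faces T. \<Sum>K\<in>adjacent T e. ?N K)"
    by (rule sum_distrib_left[symmetric])
  also have "\<dots> \<le> 2 * (real CARD('n) + 1) * (\<Sum>K\<in>T. \<Sum>e\<in>{e. e facet_of K}. ?N K)"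
  proof (rule mult_left_mono)
    have "0 \<le> (\<Sum>(K, e)\<in>boundary_faces \<Omega> T. ?N K)"
      by (intro sum_nonneg) (auto dest: bdry_facet intro: cell_nonneg[OF f])
    then show "(\<Sum>e\<in>interior_faces T. \<Sum>K\<in>adjacent T e. ?N K) \<le> (\<Sum>K\<in>T. \<Sum>e\<in>{e. e facet_of K}. ?N K)"
      unfolding sum_facets[of "\<lambda>K e. ?N K"] by linarith
  qed simp
  also have "(\<Sum>K\<in>T. \<Sum>e\<in>{e. e facet_of K}. ?N K) = (real CARD('n) + 1) * norm_sq \<Omega> f"
    unfolding norm_sq_eq[OF f] sum_distrib_left by (intro sum.cong refl) (simp add: card_facets add.commute)
  finally show ?thesis by (simp only: power2_eq_square mult.assoc)
qed

text \<open>Component \<open>i\<close> of the tangential jump is the derivative of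
  \<open>jmp e w\<close> along the projection of the \<open>i\<close>-th unit vector to the face,
  whose length is at most one. Adding the components gives the factor \<open>d\<close>.\<close>

lemma tangential_jump:
  assumes w: "pw_affine (w :: real^'n \<Rightarrow> complex)" and e: "e \<in> interior_faces T"
  shows "(norm (tangential (nrm e) (gradient (slope (K1 e) w) - gradient (slope (K2 e) w))))\<^sup>2 * FI e (\<lambda>x. 1)
    \<le> real CARD('n) * (real CARD('n) + 1) ^ 4 / \<eta>\<^sup>2 * FI e (\<lambda>x. (norm (jmp e w x))\<^sup>2)"
proof -
  note s = sides[OF e]
  let ?G = "gradient (slope (K1 e) w) - gradient (slope (K2 e) w)" and ?n = "nrm e"
  obtain p where p: "p \<in> vertices (K1 e)" "e = opp (vertices (K1 e)) p" "outward_normal (K1 e) e = simplex_vertices.nu (vertices (K1 e)) p"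
    using facetE[OF s(1,4)] .
  interpret S: simplex_vertices "vertices (K1 e)" by (rule sv(1)[OF s(1)])
  have nu: "S.nu p = ?n" using p(3) unfolding nrm_def by simp
  have J: "affine_map (jmp e w) (\<lambda>u. pairing u ?G)"
  proof -
    have "affine_map (\<lambda>x. ext (K1 e) w x - ext (K2 e) w x) (\<lambda>u. slope (K1 e) w u - slope (K2 e) w u)"
      by (intro affine_map_diff ext_affine w s)
    moreover have "slope (K1 e) w u - slope (K2 e) w u = pairing u ?G" for u
      unfolding pairing_diff using linear_pairing[OF affine_mapD(1)[OF ext_affine(1)[OF w s(1)]]]
        linear_pairing[OF affine_mapD(1)[OF ext_affine(1)[OF w s(2)]]] by simp
    ultimately show ?thesis unfolding jmp_def[abs_def] by simp
  qed
  have J0: "0 \<le> FI e (\<lambda>x. (norm (jmp e w x))\<^sup>2)"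
    by (rule positive_functional_nonneg[OF pos_int[OF e]]) (auto intro!: continuous_intros continuous_jmp[OF w e])
  have nn: "?n \<bullet> ?n = 1" using s(9) by (simp add: norm_eq_1)
  have comp: "(norm (tangential ?n ?G $ i))\<^sup>2 * FI e (\<lambda>x. 1) \<le> (real CARD('n) + 1) ^ 4 / \<eta>\<^sup>2 * FI e (\<lambda>x. (norm (jmp e w x))\<^sup>2)" for i
  proof -
    let ?u = "axis i 1 - (?n $ i) *\<^sub>R ?n"
    have un: "?n \<bullet> ?u = 0" using nn by (simp add: inner_diff_right inner_axis)
    have "(norm ?u)\<^sup>2 = 1 - (?n $ i)\<^sup>2"
      unfolding power2_norm_eq_inner using nn
      by (simp add: inner_diff_right inner_diff_left inner_axis inner_axis' inner_axis_axis power2_eq_square)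
    then have u1: "(norm ?u)\<^sup>2 \<le> 1" by simp
    have "(norm (pairing ?u ?G))\<^sup>2 * FI e (\<lambda>y. 1) \<le> (real CARD('n) + 1) ^ 4 / \<eta>\<^sup>2 * (norm ?u)\<^sup>2 * FI e (\<lambda>y. (norm (jmp e w y))\<^sup>2)"
      using S.tangential_inverse_inequality[OF p(1) J \<eta>_pos heights[OF s(1) e s(4)], of ?u] un nu p(2) by simp
    also have "\<dots> \<le> (real CARD('n) + 1) ^ 4 / \<eta>\<^sup>2 * 1 * FI e (\<lambda>y. (norm (jmp e w y))\<^sup>2)"
      using u1 J0 by (intro mult_right_mono mult_left_mono) auto
    finally show ?thesis unfolding tangential_nth by simp
  qed
  have "(norm (tangential ?n ?G))\<^sup>2 * FI e (\<lambda>x. 1) = (\<Sum>i\<in>UNIV. (norm (tangential ?n ?G $ i))\<^sup>2 * FI e (\<lambda>x. 1))"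
    unfolding norm_vec_def L2_set_def by (simp add: sum_nonneg sum_distrib_right)
  also have "\<dots> \<le> (\<Sum>i\<in>(UNIV::'n set). (real CARD('n) + 1) ^ 4 / \<eta>\<^sup>2 * FI e (\<lambda>x. (norm (jmp e w x))\<^sup>2))"
    by (rule sum_mono[OF comp])
  finally show ?thesis by simp
qed

lemma FI_comb:
  assumes "positive_functional e (FI e)" "continuous_on e f" "continuous_on e g"
  shows "FI e (\<lambda>x. a * f x + b * g x) = a * FI e f + b * FI e g"
  using positive_functional_add[OF assms(1), of "\<lambda>x. a * f x" "\<lambda>x. b * g x"]
    positive_functional_cmult[OF assms(1,2)] positive_functional_cmult[OF assms(1,3)] assms(2,3)
  by (simp add: continuous_on_mult_left)

text \<open>Young's inequality leaves traces of the defect itself; \<open>trace_sum\<close> turns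
  them back into its volume norm with a factor one half, so they can be absorbed.\<close>

lemma lifting:
  assumes S: "(w, \<sigma>) \<in> S_h \<Omega> T \<delta>" and d: "0 \<le> \<delta>"
  shows "norm_sq \<Omega> (\<lambda>x. \<sigma> x - grad_h T w x) \<le> 8 * (real CARD('n) + 1)\<^sup>2 / \<eta> * (\<delta>\<^sup>2 * normal_jump_sq \<sigma> + jump_sq w)"
proof -
  note w = S_hD(1)[OF S] and s = S_hD(2)[OF S]
  note g = pw_affine_grad[OF w]
  define r where "r = (\<lambda>x. \<sigma> x - grad_h T w x)"
  have r: "pw_affine r" unfolding r_def by (rule pw_affine_diff[OF s g])
  have er: "ext K r x = ext K \<sigma> x - ext K (grad_h T w) x" if "K \<in> T" for K x
    unfolding r_def by (rule ext_diff[OF s g that])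
  let ?I = "interior_faces T"
  let ?js = "\<lambda>e x. dotc (jmp e \<sigma> x) (cvec (nrm e))" and ?jr = "\<lambda>e x. dotc (jmp e r x) (cvec (nrm e))"
    and ?jw = "\<lambda>e x. jmp e w x *s cvec (nrm e)"
  \<comment> \<open>Chosen so that \<open>4 \<epsilon>\<close> times the constant of
    \<open>trace_sum\<close>, divided by \<eta>, is one half.\<close>
  define \<epsilon> where "\<epsilon> = \<eta> / (16 * (real CARD('n) + 1)\<^sup>2)"
  have e0: "0 < \<epsilon>" unfolding \<epsilon>_def using \<eta>_pos by simp
  have "norm_sq \<Omega> r = Re (ip_vec \<Omega> \<sigma> r) - Re (ip_vec \<Omega> (grad_h T w) r)"
    unfolding norm_sq_eq[OF r] Re_ip_vec[OF s r] Re_ip_vec[OF g r] sum_subtractf[symmetric]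
  proof (intro sum.cong refl)
    fix K assume K: "K \<in> T"
    have "(LINT x:K|lebesgue. ext K \<sigma> x \<bullet> ext K r x) - (LINT x:K|lebesgue. ext K (grad_h T w) x \<bullet> ext K r x) =
      (LINT x:K|lebesgue. ext K \<sigma> x \<bullet> ext K r x - ext K (grad_h T w) x \<bullet> ext K r x)"
      by (rule positive_functional_diff[OF pos_T[OF K], symmetric]) (intro continuous_intros continuous_ext K s g r)+
    then show "(LINT x:K|lebesgue. (norm (ext K r x))\<^sup>2) = (LINT x:K|lebesgue. ext K \<sigma> x \<bullet> ext K r x) - (LINT x:K|lebesgue. ext K (grad_h T w) x \<bullet> ext K r x)"
      by (simp add: inner_diff_left[symmetric] er[OF K, symmetric] power2_norm_eq_inner)
  qed
  also have "\<dots> = Re (ip_vec \<Omega> \<sigma> r - ip_vec \<Omega> (grad_h T w) r)" by simp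
  also have "\<dots> = (\<Sum>e\<in>?I. Re (\<i> * complex_of_real \<delta> * ip_face e (?js e) (?jr e)) - Re (ip_face_vec e (?jw e) (mean e r)))"
    unfolding S_hD(4)[OF S r] Re_sum minus_complex.sel ..
  also have "\<dots> \<le> (\<Sum>e\<in>?I. 4 * \<epsilon> * (FI e (\<lambda>x. (norm (ext (K1 e) r x))\<^sup>2) + FI e (\<lambda>x. (norm (ext (K2 e) r x))\<^sup>2))
    + (\<delta>\<^sup>2 * FI e (\<lambda>x. (norm (?js e x))\<^sup>2) + FI e (\<lambda>x. (norm (jmp e w x))\<^sup>2)) / (4 * \<epsilon>))"
  proof (rule sum_mono)
    fix e assume e: "e \<in> ?I"
    note sd = sides[OF e] and P = pos_int[OF e]
    let ?r1 = "ext (K1 e) r" and ?r2 = "ext (K2 e) r"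
    note ci = continuous_intros continuous_jmp[OF w e] continuous_jmp[OF s e] continuous_jmp[OF r e] continuous_ext[OF r sd(1)] continuous_ext[OF r sd(2)]
    have "Re (\<i> * complex_of_real \<delta> * ip_face e (?js e) (?jr e)) - Re (ip_face_vec e (?jw e) (mean e r))
      = FI e (\<lambda>x. (\<i> * complex_of_real \<delta> * ?js e x) \<bullet> ?jr e x) - FI e (\<lambda>x. ?jw e x \<bullet> mean e r x)"
      by (subst Re_ip_face[OF sd(8)], (intro ci)+, subst Re_ip_face_vec[OF sd(8)], (intro ci)+) simp
    also have "\<dots> = FI e (\<lambda>x. (\<i> * complex_of_real \<delta> * ?js e x) \<bullet> ?jr e x - ?jw e x \<bullet> mean e r x)"
      by (rule positive_functional_diff[OF P, symmetric]) (intro ci)+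
    \<comment> \<open>The factors \<open>1\<close> bring the integrand to the nested binary shape in
      which \<open>FI_comb\<close> splits it.\<close>
    also have "\<dots> \<le> FI e (\<lambda>x. 1 * (4 * \<epsilon> * (norm (?r1 x))\<^sup>2 + 4 * \<epsilon> * (norm (?r2 x))\<^sup>2) + 1 * (\<delta>\<^sup>2 / (4 * \<epsilon>) * (norm (?js e x))\<^sup>2 + 1 / (4 * \<epsilon>) * (norm (jmp e w x))\<^sup>2))"
    proof (rule positive_functional_mono[OF P])
      fix x assume "x \<in> e"
      have "norm (\<i> * complex_of_real \<delta> * ?js e x) \<le> \<delta> * norm (?js e x)" using d by (simp add: norm_mult)
      moreover have "norm (?jr e x) \<le> norm (jmp e r x)" using norm_dotc[of "jmp e r x" "nrm e"] sd(9) by simp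
      ultimately have 1: "\<bar>?jr e x \<bullet> (\<i> * complex_of_real \<delta> * ?js e x)\<bar> \<le> \<epsilon> * (norm (jmp e r x))\<^sup>2 + (\<delta> * norm (?js e x))\<^sup>2 / (4 * \<epsilon>)"
        by (intro inner_young[OF e0])
      have "norm (?jw e x) \<le> norm (jmp e w x)" unfolding norm_scale_cvec sd(9) by simp
      then have 2: "\<bar>mean e r x \<bullet> ?jw e x\<bar> \<le> \<epsilon> * (norm (mean e r x))\<^sup>2 + (norm (jmp e w x))\<^sup>2 / (4 * \<epsilon>)"
        by (intro inner_young[OF e0 order_refl])
      have j: "(norm (jmp e r x))\<^sup>2 \<le> 2 * ((norm (?r1 x))\<^sup>2 + (norm (?r2 x))\<^sup>2)"
        unfolding jmp_def by (rule norm_diff_sq_le)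
      have "(norm (mean e r x))\<^sup>2 \<le> (norm (?r1 x))\<^sup>2 + (norm (?r2 x))\<^sup>2" unfolding mean_def by (rule norm_half_sum_sq_le)
      then have m: "(norm (mean e r x))\<^sup>2 \<le> 2 * ((norm (?r1 x))\<^sup>2 + (norm (?r2 x))\<^sup>2)"
        using zero_le_power2[of "norm (?r1 x)"] zero_le_power2[of "norm (?r2 x)"] by argo
      have "\<epsilon> * (norm (jmp e r x))\<^sup>2 \<le> \<epsilon> * (2 * ((norm (?r1 x))\<^sup>2 + (norm (?r2 x))\<^sup>2))"
        "\<epsilon> * (norm (mean e r x))\<^sup>2 \<le> \<epsilon> * (2 * ((norm (?r1 x))\<^sup>2 + (norm (?r2 x))\<^sup>2))"
        using e0 j m by (auto intro!: mult_left_mono)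
      moreover have "(\<i> * complex_of_real \<delta> * ?js e x) \<bullet> ?jr e x - ?jw e x \<bullet> mean e r x \<le> \<bar>?jr e x \<bullet> (\<i> * complex_of_real \<delta> * ?js e x)\<bar> + \<bar>mean e r x \<bullet> ?jw e x\<bar>"
        unfolding inner_commute[of _ "?jr e x"] inner_commute[of _ "mean e r x"] by linarith
      moreover have "(\<delta> * norm (?js e x))\<^sup>2 / (4 * \<epsilon>) = \<delta>\<^sup>2 / (4 * \<epsilon>) * (norm (?js e x))\<^sup>2" "(norm (jmp e w x))\<^sup>2 / (4 * \<epsilon>) = 1 / (4 * \<epsilon>) * (norm (jmp e w x))\<^sup>2"
        by (simp_all add: power_mult_distrib)
      ultimately show "(\<i> * complex_of_real \<delta> * ?js e x) \<bullet> ?jr e x - ?jw e x \<bullet> mean e r x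
        \<le> 1 * (4 * \<epsilon> * (norm (?r1 x))\<^sup>2 + 4 * \<epsilon> * (norm (?r2 x))\<^sup>2) + 1 * (\<delta>\<^sup>2 / (4 * \<epsilon>) * (norm (?js e x))\<^sup>2 + 1 / (4 * \<epsilon>) * (norm (jmp e w x))\<^sup>2)"
        using 1 2 by (simp add: algebra_simps)
    qed (intro ci)+
    also have "\<dots> = 1 * (4 * \<epsilon> * FI e (\<lambda>x. (norm (?r1 x))\<^sup>2) + 4 * \<epsilon> * FI e (\<lambda>x. (norm (?r2 x))\<^sup>2))
      + 1 * (\<delta>\<^sup>2 / (4 * \<epsilon>) * FI e (\<lambda>x. (norm (?js e x))\<^sup>2) + 1 / (4 * \<epsilon>) * FI e (\<lambda>x. (norm (jmp e w x))\<^sup>2))"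
      by (subst FI_comb[OF P], (intro ci)+, subst FI_comb[OF P], (intro ci)+, subst FI_comb[OF P], (intro ci)+) simp
    finally show "Re (\<i> * complex_of_real \<delta> * ip_face e (?js e) (?jr e)) - Re (ip_face_vec e (?jw e) (mean e r))
      \<le> 4 * \<epsilon> * (FI e (\<lambda>x. (norm (?r1 x))\<^sup>2) + FI e (\<lambda>x. (norm (?r2 x))\<^sup>2))
      + (\<delta>\<^sup>2 * FI e (\<lambda>x. (norm (?js e x))\<^sup>2) + FI e (\<lambda>x. (norm (jmp e w x))\<^sup>2)) / (4 * \<epsilon>)"
      by (simp add: distrib_left add_divide_distrib)
  qed
  also have "\<dots> = 4 * \<epsilon> * (\<Sum>e\<in>?I. FI e (\<lambda>x. (norm (ext (K1 e) r x))\<^sup>2) + FI e (\<lambda>x. (norm (ext (K2 e) r x))\<^sup>2))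
    + (\<delta>\<^sup>2 * normal_jump_sq \<sigma> + jump_sq w) / (4 * \<epsilon>)"
    unfolding normal_jump_sq_def jump_sq_def by (simp add: sum.distrib sum_distrib_left sum_divide_distrib add_divide_distrib distrib_left)
  finally have 1: "norm_sq \<Omega> r \<le> 4 * \<epsilon> * (\<Sum>e\<in>?I. FI e (\<lambda>x. (norm (ext (K1 e) r x))\<^sup>2) + FI e (\<lambda>x. (norm (ext (K2 e) r x))\<^sup>2))
    + (\<delta>\<^sup>2 * normal_jump_sq \<sigma> + jump_sq w) / (4 * \<epsilon>)" .
  have "4 * \<epsilon> * (\<Sum>e\<in>?I. FI e (\<lambda>x. (norm (ext (K1 e) r x))\<^sup>2) + FI e (\<lambda>x. (norm (ext (K2 e) r x))\<^sup>2))
    = 1 / (4 * (real CARD('n) + 1)\<^sup>2) * (\<eta> * (\<Sum>e\<in>?I. FI e (\<lambda>x. (norm (ext (K1 e) r x))\<^sup>2) + FI e (\<lambda>x. (norm (ext (K2 e) r x))\<^sup>2)))"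
    unfolding \<epsilon>_def by simp
  also have "\<dots> \<le> 1 / (4 * (real CARD('n) + 1)\<^sup>2) * (2 * (real CARD('n) + 1)\<^sup>2 * norm_sq \<Omega> r)"
    by (rule mult_left_mono[OF trace_sum[OF r]]) simp
  also have "\<dots> = norm_sq \<Omega> r / 2" by simp
  finally have "norm_sq \<Omega> r \<le> 2 * ((\<delta>\<^sup>2 * normal_jump_sq \<sigma> + jump_sq w) / (4 * \<epsilon>))" using 1 by linarith
  also have "\<dots> = 8 * (real CARD('n) + 1)\<^sup>2 / \<eta> * (\<delta>\<^sup>2 * normal_jump_sq \<sigma> + jump_sq w)"
    unfolding \<epsilon>_def by simp
  finally show ?thesis unfolding r_def .
qed

text \<open>The signed distance of \<open>x0\<close> from the plane of the facet. The center serves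
  as reference, but every point of the facet gives the same value.\<close>

definition offset :: "(real^'n) set \<Rightarrow> (real^'n) set \<Rightarrow> real" where
  "offset K e = outward_normal K e \<bullet> (center e - x0)"

lemma center_in: assumes "K \<in> T" "e facet_of K" shows "center e \<in> e"
proof -
  obtain p where p: "p \<in> vertices K" "e = opp (vertices K) p" using facetE[OF assms] .
  interpret S: simplex_vertices "vertices K" by (rule sv(1)[OF assms(1)])
  show ?thesis using S.relint_point_in_opp(1)[OF p(1) S.center_opp[OF p(1)]] p(2) by simp
qed

lemma offset_const:
  assumes "K \<in> T" "e facet_of K" "x \<in> e"
  shows "(x - x0) \<bullet> outward_normal K e = offset K e"
  using unit_normalD(3)[OF unit_outward(1)[OF assms(1,2)] assms(3) center_in[OF assms(1,2)]]
  unfolding offset_def by (simp add: inner_diff_right inner_diff_left inner_commute)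

text \<open>The sum over vertices in \<open>divergence\<close> becomes a sum over facets, with
  \<open>offset\<close> for the product of height and barycentric coordinate.\<close>

lemma element_divergence:
  fixes W :: "real^'n \<Rightarrow> 'b::euclidean_space"
  assumes K: "K \<in> T" and W: "affine_map W L"
  shows "real CARD('n) * (LINT x:K|lebesgue. (norm (W x))\<^sup>2) + 2 * (LINT x:K|lebesgue. W x \<bullet> L (x - x0))
    = (\<Sum>e\<in>{e. e facet_of K}. offset K e * FI e (\<lambda>x. (norm (W x))\<^sup>2))"
proof -
  interpret S: simplex_vertices "vertices K" by (rule sv(1)[OF K])
  have SK: "S.K = K" by (rule sv(2)[OF K])
  have off: "offset K (S.opp p) = S.ht p * S.lam p x0" if p: "p \<in> vertices K" for p
  proof -
    have "S.opp p facet_of K" using facet_opp[OF K] p by blast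
    from S.nu_opp_base[OF p center_in[OF K this], of x0] S.outward_normal_opp[OF p, unfolded SK]
    show ?thesis unfolding offset_def by simp
  qed
  have "(\<Sum>e\<in>{e. e facet_of K}. offset K e * FI e (\<lambda>x. (norm (W x))\<^sup>2)) =
    (\<Sum>p\<in>vertices K. offset K (S.opp p) * FI (S.opp p) (\<lambda>x. (norm (W x))\<^sup>2))"
    unfolding facets_eq[OF K] by (simp add: sum.reindex[OF S.inj_opp])
  also have "\<dots> = (\<Sum>p\<in>vertices K. S.ht p * S.lam p x0 * FI (S.opp p) (\<lambda>x. (norm (W x))\<^sup>2))"
    by (intro sum.cong refl) (simp add: off)
  also have "\<dots> = real CARD('n) * (LINT x:K|lebesgue. (norm (W x))\<^sup>2) + 2 * (LINT x:K|lebesgue. W x \<bullet> L (x - x0))"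
    using S.divergence[OF W, of x0] unfolding SK by simp
  finally show ?thesis ..
qed

text \<open>The two sides of an interior face have opposite offsets, so differences of squares
  remain there.\<close>

lemma global_divergence:
  fixes W :: "(real^'n) set \<Rightarrow> real^'n \<Rightarrow> 'b::euclidean_space"
  assumes W: "\<And>K. K \<in> T \<Longrightarrow> affine_map (W K) (L K)"
  shows "real CARD('n) * (\<Sum>K\<in>T. LINT x:K|lebesgue. (norm (W K x))\<^sup>2) + 2 * (\<Sum>K\<in>T. LINT x:K|lebesgue. W K x \<bullet> L K (x - x0))
    = (\<Sum>(K, e)\<in>boundary_faces \<Omega> T. offset K e * FI e (\<lambda>x. (norm (W K x))\<^sup>2))
    + (\<Sum>e\<in>interior_faces T. offset (K1 e) e * (FI e (\<lambda>x. (norm (W (K1 e) x))\<^sup>2) - FI e (\<lambda>x. (norm (W (K2 e) x))\<^sup>2)))"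
proof -
  have "real CARD('n) * (\<Sum>K\<in>T. LINT x:K|lebesgue. (norm (W K x))\<^sup>2) + 2 * (\<Sum>K\<in>T. LINT x:K|lebesgue. W K x \<bullet> L K (x - x0))
    = (\<Sum>K\<in>T. \<Sum>e\<in>{e. e facet_of K}. offset K e * FI e (\<lambda>x. (norm (W K x))\<^sup>2))"
    unfolding sum_distrib_left sum.distrib[symmetric] by (intro sum.cong refl element_divergence W)
  also have "\<dots> = (\<Sum>(K, e)\<in>boundary_faces \<Omega> T. offset K e * FI e (\<lambda>x. (norm (W K x))\<^sup>2))
    + (\<Sum>e\<in>interior_faces T. \<Sum>K\<in>adjacent T e. offset K e * FI e (\<lambda>x. (norm (W K x))\<^sup>2))"
    by (rule sum_facets)
  also have "(\<Sum>e\<in>interior_faces T. \<Sum>K\<in>adjacent T e. offset K e * FI e (\<lambda>x. (norm (W K x))\<^sup>2))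
    = (\<Sum>e\<in>interior_faces T. offset (K1 e) e * (FI e (\<lambda>x. (norm (W (K1 e) x))\<^sup>2) - FI e (\<lambda>x. (norm (W (K2 e) x))\<^sup>2)))"
  proof (intro sum.cong refl)
    fix e assume e: "e \<in> interior_faces T"
    note s = sides[OF e]
    have "offset (K2 e) e = - offset (K1 e) e" unfolding offset_def s(7) nrm_def by simp
    then show "(\<Sum>K\<in>adjacent T e. offset K e * FI e (\<lambda>x. (norm (W K x))\<^sup>2)) = offset (K1 e) e * (FI e (\<lambda>x. (norm (W (K1 e) x))\<^sup>2) - FI e (\<lambda>x. (norm (W (K2 e) x))\<^sup>2))"
      unfolding s(6) using s(3) by (simp add: algebra_simps)
  qed
  finally show ?thesis .
qed

lemma element_in_ball: "K \<in> T \<Longrightarrow> x \<in> K \<Longrightarrow> norm (x - x0) \<le> R"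
  using R UnT by blast

lemma R_nonneg: "0 \<le> R"
proof -
  have "\<Omega> \<noteq> {}" using domain unfolding bounded_domain_def by blast
  then obtain x where "x \<in> closure \<Omega>" using closure_subset by blast
  then show ?thesis using R norm_ge_zero order_trans by blast
qed

section \<open>The multiplier and Rellich's inequality\<close>

definition multiplier :: "(real^'n \<Rightarrow> complex) \<Rightarrow> real^'n \<Rightarrow> complex" where
  "multiplier w x = pairing (x - x0) (grad_h T w x)"

text \<open>The gradient of \<open>w\<close> is constant on each element, so the multiplier is
  affine there and has \<nabla>w as its own gradient.\<close>

lemma multiplier:
  assumes w: "pw_affine w"
  shows "pw_affine (multiplier w)"
    "K \<in> T \<Longrightarrow> ext K (multiplier w) x = pairing (x - x0) (gradient (slope K w))"
    "K \<in> T \<Longrightarrow> slope K (multiplier w) = slope K w"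
proof -
  have a: "affine_map (\<lambda>x. pairing (x - x0) (gradient (slope K w))) (slope K w)" if K: "K \<in> T" for K
    unfolding linear_pairing[OF affine_mapD(1)[OF ext_affine(1)[OF w K]], symmetric]
    using affine_mapD(1)[OF ext_affine(1)[OF w K]] unfolding affine_map_def
    by (simp add: linear_diff[symmetric])
  have v: "multiplier w x = pairing (x - x0) (gradient (slope K w))" if "K \<in> T" "x \<in> interior K" for K x
    unfolding multiplier_def grad_interior[OF w that] ..
  show "pw_affine (multiplier w)" by (rule pw_affineI[OF a v])
  show "K \<in> T \<Longrightarrow> ext K (multiplier w) x = pairing (x - x0) (gradient (slope K w))"
    using ext_eqI(1)[OF _ a v, of K K] by simp
  show "K \<in> T \<Longrightarrow> slope K (multiplier w) = slope K w"
    using ext_eqI(2)[OF _ a v, of K K] by simp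
qed

text \<open>Star-shapedness enters here, at the center of the face; on the rest of the face the
  product with the normal is the same.\<close>

lemma offset_boundary:
  assumes "(K, e) \<in> boundary_faces \<Omega> T"
  shows "c \<le> offset K e" "offset K e \<le> R"
proof -
  have K: "K \<in> T" "e facet_of K" "e \<notin> interior_faces T" using assms unfolding boundary_faces_eq by auto
  show "c \<le> offset K e"
    using star[OF boundary_face_normal(1)[OF K]] unfolding offset_def by (simp add: inner_commute)
  have "center e \<in> K" using center_in[OF K(1,2)] facet_of_imp_subset[OF K(2)] by blast
  then have "norm (center e - x0) \<le> R" using element_in_ball[OF K(1)] by blast
  then show "offset K e \<le> R"
    unfolding offset_def using norm_cauchy_schwarz[of "outward_normal K e" "center e - x0"] unit_outward(2)[OF K(1,2)] by simp
qed

text \<open>Star-shapedness contributes \<open>c/2\<close> of the boundary gradient. Half of it is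
  spent, by Young's inequality with weight \<open>c/4\<close>, on the product of
  \<open>\<i> k w\<close> and the multiplier, at the price of \<open>R^2 k^2 / c\<close> times the
  boundary norm of \<open>w\<close>.\<close>

lemma rellich_boundary:
  assumes w: "pw_affine w" and Ke: "(K, e) \<in> boundary_faces \<Omega> T" and k: "0 \<le> k"
  shows "c / 4 * FI e (\<lambda>x. (norm (ext K (grad_h T w) x))\<^sup>2) + - ((R / 2 + R\<^sup>2 / c) * k\<^sup>2) * FI e (\<lambda>x. (norm (ext K w x))\<^sup>2)
    \<le> offset K e / 2 * FI e (\<lambda>x. (norm (ext K (grad_h T w) x))\<^sup>2) - k\<^sup>2 * offset K e / 2 * FI e (\<lambda>x. (norm (ext K w x))\<^sup>2)
      + FI e (\<lambda>x. (\<i> * complex_of_real k * ext K w x) \<bullet> ext K (multiplier w) x)"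
proof -
  have K: "K \<in> T" "e facet_of K" using bdry_facet[OF Ke] by auto
  note P = pos_face[OF K] and v = multiplier[OF w]
  let ?g = "ext K (grad_h T w)" and ?W = "ext K w" and ?V = "ext K (multiplier w)"
  note ci = continuous_intros continuous_ext[OF w K(1)] continuous_ext[OF v(1) K(1)] continuous_ext[OF pw_affine_grad[OF w] K(1)]
  have "c / 4 * FI e (\<lambda>x. (norm (?g x))\<^sup>2) + - ((R / 2 + R\<^sup>2 / c) * k\<^sup>2) * FI e (\<lambda>x. (norm (?W x))\<^sup>2)
    = FI e (\<lambda>x. c / 4 * (norm (?g x))\<^sup>2 + - ((R / 2 + R\<^sup>2 / c) * k\<^sup>2) * (norm (?W x))\<^sup>2)"
    by (rule FI_comb[OF P, symmetric]) (intro ci)+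
  also have "\<dots> \<le> FI e (\<lambda>x. 1 * (offset K e / 2 * (norm (?g x))\<^sup>2 + (- (k\<^sup>2 * offset K e / 2)) * (norm (?W x))\<^sup>2)
    + 1 * ((\<i> * complex_of_real k * ?W x) \<bullet> ?V x))"
  proof (rule positive_functional_mono[OF P])
    fix x assume "x \<in> e"
    then have xR: "norm (x - x0) \<le> R" using element_in_ball[OF K(1)] facet_of_imp_subset[OF K(2)] by blast
    have g: "?g x = gradient (slope K w)" using ext_grad[OF w K(1)] by simp
    have "norm (?V x) \<le> R * norm (?g x)"
      unfolding v(2)[OF K(1)] g using norm_pairing[of "x - x0" "gradient (slope K w)"]
        mult_right_mono[OF xR norm_ge_zero[of "gradient (slope K w)"]] by linarith
    moreover have "norm (\<i> * complex_of_real k * ?W x) = k * norm (?W x)" using k by (simp add: norm_mult)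
    ultimately have "norm (\<i> * complex_of_real k * ?W x) * norm (?V x) \<le> (k * norm (?W x)) * (R * norm (?g x))"
      using k by (simp add: mult_left_mono)
    then have "\<bar>(\<i> * complex_of_real k * ?W x) \<bullet> ?V x\<bar> \<le> norm (?g x) * (k * R * norm (?W x))"
      using Cauchy_Schwarz_ineq2[of "\<i> * complex_of_real k * ?W x" "?V x"] by (simp add: algebra_simps)
    also have "\<dots> \<le> c / 4 * (norm (?g x))\<^sup>2 + (k * R * norm (?W x))\<^sup>2 / (4 * (c / 4))"
      by (rule young) (use c_pos in simp)
    also have "(k * R * norm (?W x))\<^sup>2 / (4 * (c / 4)) = R\<^sup>2 / c * k\<^sup>2 * (norm (?W x))\<^sup>2"
      by (simp add: power_mult_distrib)
    finally have 1: "- (c / 4 * (norm (?g x))\<^sup>2 + R\<^sup>2 / c * k\<^sup>2 * (norm (?W x))\<^sup>2) \<le> (\<i> * complex_of_real k * ?W x) \<bullet> ?V x"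
      by linarith
    have 2: "c / 2 * (norm (?g x))\<^sup>2 \<le> offset K e / 2 * (norm (?g x))\<^sup>2"
      using offset_boundary(1)[OF Ke] by (intro mult_right_mono) auto
    have "offset K e / 2 * (k\<^sup>2 * (norm (?W x))\<^sup>2) \<le> R / 2 * (k\<^sup>2 * (norm (?W x))\<^sup>2)"
      using offset_boundary(2)[OF Ke] by (intro mult_right_mono) auto
    then have 3: "k\<^sup>2 * offset K e / 2 * (norm (?W x))\<^sup>2 \<le> R / 2 * k\<^sup>2 * (norm (?W x))\<^sup>2"
      by (simp add: algebra_simps)
    show "c / 4 * (norm (?g x))\<^sup>2 + - ((R / 2 + R\<^sup>2 / c) * k\<^sup>2) * (norm (?W x))\<^sup>2
      \<le> 1 * (offset K e / 2 * (norm (?g x))\<^sup>2 + (- (k\<^sup>2 * offset K e / 2)) * (norm (?W x))\<^sup>2) + 1 * ((\<i> * complex_of_real k * ?W x) \<bullet> ?V x)"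
    proof -
      \<comment> \<open>Replaces the nonlinear products by variables, so that linear arithmetic
        finishes.\<close>
      have aux: "p + l \<le> 1 * (r + m) + 1 * I" if "l = - u - s" "p = q - p" "m = - t" "- (p + s) \<le> I" "q \<le> r" "t \<le> u" for p l r m I u s q t :: real
        using that unfolding mult_1 by linarith
      show ?thesis
        by (rule aux[OF _ _ _ 1 2 3]) (simp_all add: algebra_simps)
    qed
  qed (intro ci)+
  also have "\<dots> = 1 * (offset K e / 2 * FI e (\<lambda>x. (norm (?g x))\<^sup>2) + (- (k\<^sup>2 * offset K e / 2)) * FI e (\<lambda>x. (norm (?W x))\<^sup>2))
    + 1 * FI e (\<lambda>x. (\<i> * complex_of_real k * ?W x) \<bullet> ?V x)"
    by (subst FI_comb[OF P], (intro ci)+, subst FI_comb[OF P], (intro ci)+) simp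
  finally show ?thesis by simp
qed

text \<open>The face integral of the error in \<open>rellich_face_pointwise\<close>, with positive
  sign. The terms with factor \<epsilon> are absorbed by a trace inequality; those divided by
  \<epsilon> are jumps and the defect.\<close>

definition face_defect :: "real \<Rightarrow> real \<Rightarrow> (real^'n \<Rightarrow> complex) \<Rightarrow> (real^'n \<Rightarrow> complex^'n) \<Rightarrow> real \<Rightarrow> (real^'n) set \<Rightarrow> real" where
  "face_defect k \<beta> w r \<epsilon> e =
     (2 + 4 * R\<^sup>2) * \<epsilon> * (FI e (\<lambda>x. (norm (ext (K1 e) (grad_h T w) x))\<^sup>2) + FI e (\<lambda>x. (norm (ext (K2 e) (grad_h T w) x))\<^sup>2))
     + 2 * \<epsilon> * k\<^sup>2 * (FI e (\<lambda>x. (norm (ext (K1 e) w x))\<^sup>2) + FI e (\<lambda>x. (norm (ext (K2 e) w x))\<^sup>2))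
     + (R\<^sup>2 * ((norm (tangential (nrm e) (gradient (slope (K1 e) w) - gradient (slope (K2 e) w))))\<^sup>2 * FI e (\<lambda>x. 1))
       + (k\<^sup>2 * R\<^sup>2 + \<beta>\<^sup>2) * FI e (\<lambda>x. (norm (jmp e w x))\<^sup>2)
       + (FI e (\<lambda>x. (norm (ext (K1 e) r x))\<^sup>2) + FI e (\<lambda>x. (norm (ext (K2 e) r x))\<^sup>2))) / (4 * \<epsilon>)"

text \<open>The integrated form of \<open>rellich_face_pointwise\<close>; gradients are constant on
  each side, so the tangential jump leaves the integral.\<close>

lemma rellich_interior:
  assumes w: "pw_affine w" and s: "pw_affine \<sigma>" and e: "e \<in> interior_faces T" and \<epsilon>: "0 < \<epsilon>" and k: "0 \<le> k" and b: "0 \<le> \<beta>"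
  shows "- face_defect k \<beta> w (\<lambda>x. \<sigma> x - grad_h T w x) \<epsilon> e
    \<le> offset (K1 e) e / 2 * (FI e (\<lambda>x. (norm (ext (K1 e) (grad_h T w) x))\<^sup>2) - FI e (\<lambda>x. (norm (ext (K2 e) (grad_h T w) x))\<^sup>2))
     - k\<^sup>2 * offset (K1 e) e / 2 * (FI e (\<lambda>x. (norm (ext (K1 e) w x))\<^sup>2) - FI e (\<lambda>x. (norm (ext (K2 e) w x))\<^sup>2))
     - FI e (\<lambda>x. (mean e \<sigma> x - (\<i> * complex_of_real \<beta>) *s (jmp e w x *s cvec (nrm e))) \<bullet> (jmp e (multiplier w) x *s cvec (nrm e)))"
proof -
  note sd = sides[OF e] and P = pos_int[OF e] and v = multiplier[OF w] and g = pw_affine_grad[OF w]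
  define r where "r = (\<lambda>x. \<sigma> x - grad_h T w x)"
  have r: "pw_affine r" unfolding r_def by (rule pw_affine_diff[OF s g])
  have er: "ext K \<sigma> x = ext K (grad_h T w) x + ext K r x" if "K \<in> T" for K x
    unfolding r_def ext_diff[OF s g that] by simp
  define o' where "o' = offset (K1 e) e"
  define G where "G = (norm (tangential (nrm e) (gradient (slope (K1 e) w) - gradient (slope (K2 e) w))))\<^sup>2"
  let ?g1 = "ext (K1 e) (grad_h T w)" and ?g2 = "ext (K2 e) (grad_h T w)" and ?r1 = "ext (K1 e) r" and ?r2 = "ext (K2 e) r"
    and ?W1 = "ext (K1 e) w" and ?W2 = "ext (K2 e) w"
  let ?P = "\<lambda>x. (mean e \<sigma> x - (\<i> * complex_of_real \<beta>) *s (jmp e w x *s cvec (nrm e))) \<bullet> (jmp e (multiplier w) x *s cvec (nrm e))"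
  note ci = continuous_intros continuous_jmp[OF w e] continuous_jmp[OF s e] continuous_jmp[OF v(1) e] continuous_ext[OF r sd(1)] continuous_ext[OF r sd(2)]
    continuous_ext[OF w sd(1)] continuous_ext[OF w sd(2)] continuous_ext[OF g sd(1)] continuous_ext[OF g sd(2)]
  define A where "A = - ((2 + 4 * R\<^sup>2) * \<epsilon>)"
  define B where "B = - (2 * \<epsilon> * k\<^sup>2)"
  define C where "C = - (R\<^sup>2 * G / (4 * \<epsilon>))"
  define D where "D = - ((k\<^sup>2 * R\<^sup>2 + \<beta>\<^sup>2) / (4 * \<epsilon>))"
  define E where "E = - (1 / (4 * \<epsilon>))"
  have "- face_defect k \<beta> w r \<epsilon> e = 1 * (A * FI e (\<lambda>x. (norm (?g1 x))\<^sup>2) + A * FI e (\<lambda>x. (norm (?g2 x))\<^sup>2))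
    + 1 * (1 * (B * FI e (\<lambda>x. (norm (?W1 x))\<^sup>2) + B * FI e (\<lambda>x. (norm (?W2 x))\<^sup>2))
    + 1 * (1 * (C * FI e (\<lambda>x. 1) + D * FI e (\<lambda>x. (norm (jmp e w x))\<^sup>2)) + 1 * (E * FI e (\<lambda>x. (norm (?r1 x))\<^sup>2) + E * FI e (\<lambda>x. (norm (?r2 x))\<^sup>2))))"
    unfolding face_defect_def G_def[symmetric] A_def B_def C_def D_def E_def
    by (simp add: add_divide_distrib algebra_simps)
  also have "\<dots> = FI e (\<lambda>x. 1 * (A * (norm (?g1 x))\<^sup>2 + A * (norm (?g2 x))\<^sup>2)
    + 1 * (1 * (B * (norm (?W1 x))\<^sup>2 + B * (norm (?W2 x))\<^sup>2)
    + 1 * (1 * (C * 1 + D * (norm (jmp e w x))\<^sup>2) + 1 * (E * (norm (?r1 x))\<^sup>2 + E * (norm (?r2 x))\<^sup>2))))"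
    by (simp only: FI_comb[OF P] ci continuous_on_const)
  also have "\<dots> \<le> FI e (\<lambda>x. 1 * (o' / 2 * (norm (?g1 x))\<^sup>2 + (- (o' / 2)) * (norm (?g2 x))\<^sup>2)
    + 1 * (1 * (- (k\<^sup>2 * o' / 2) * (norm (?W1 x))\<^sup>2 + (k\<^sup>2 * o' / 2) * (norm (?W2 x))\<^sup>2) + (-1) * ?P x))"
  proof (rule positive_functional_mono[OF P])
    fix x assume x: "x \<in> e"
    have "x \<in> K1 e" using x facet_of_imp_subset[OF sd(4)] by blast
    then have xR: "norm (x - x0) \<le> R" by (rule element_in_ball[OF sd(1)])
    have off: "(x - x0) \<bullet> nrm e = o'" unfolding nrm_def o'_def by (rule offset_const[OF sd(1,4) x])
    have g1: "?g1 x = gradient (slope (K1 e) w)" "?g2 x = gradient (slope (K2 e) w)" using ext_grad[OF w] sd(1,2) by simp_all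
    have hP: "?P x = ((1/2) *\<^sub>R ((?g1 x + ?r1 x) + (?g2 x + ?r2 x)) - (\<i> * complex_of_real \<beta>) *s ((?W1 x - ?W2 x) *s cvec (nrm e)))
      \<bullet> ((pairing (x - x0) (?g1 x) - pairing (x - x0) (?g2 x)) *s cvec (nrm e))"
      unfolding mean_def jmp_def er[OF sd(1)] er[OF sd(2)] v(2)[OF sd(1)] v(2)[OF sd(2)] g1 ..
    have hG: "G = (norm (tangential (nrm e) (?g1 x - ?g2 x)))\<^sup>2" unfolding G_def g1 ..
    have main: "- ((2 + 4 * R\<^sup>2) * \<epsilon> * ((norm (?g1 x))\<^sup>2 + (norm (?g2 x))\<^sup>2) + 2 * \<epsilon> * k\<^sup>2 * ((norm (?W1 x))\<^sup>2 + (norm (?W2 x))\<^sup>2)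
      + (R\<^sup>2 * G + (k\<^sup>2 * R\<^sup>2 + \<beta>\<^sup>2) * (norm (jmp e w x))\<^sup>2 + ((norm (?r1 x))\<^sup>2 + (norm (?r2 x))\<^sup>2)) / (4 * \<epsilon>))
      \<le> o' / 2 * ((norm (?g1 x))\<^sup>2 - (norm (?g2 x))\<^sup>2) - k\<^sup>2 * o' / 2 * ((norm (?W1 x))\<^sup>2 - (norm (?W2 x))\<^sup>2) - ?P x"
      unfolding hP hG unfolding jmp_def[of e w x] by (rule rellich_face_pointwise[OF sd(9) off xR \<epsilon> k b])
    have l: "- ((2 + 4 * R\<^sup>2) * \<epsilon> * ((norm (?g1 x))\<^sup>2 + (norm (?g2 x))\<^sup>2) + 2 * \<epsilon> * k\<^sup>2 * ((norm (?W1 x))\<^sup>2 + (norm (?W2 x))\<^sup>2)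
      + (R\<^sup>2 * G + (k\<^sup>2 * R\<^sup>2 + \<beta>\<^sup>2) * (norm (jmp e w x))\<^sup>2 + ((norm (?r1 x))\<^sup>2 + (norm (?r2 x))\<^sup>2)) / (4 * \<epsilon>))
      = 1 * (A * (norm (?g1 x))\<^sup>2 + A * (norm (?g2 x))\<^sup>2)
    + 1 * (1 * (B * (norm (?W1 x))\<^sup>2 + B * (norm (?W2 x))\<^sup>2)
    + 1 * (1 * (C * 1 + D * (norm (jmp e w x))\<^sup>2) + 1 * (E * (norm (?r1 x))\<^sup>2 + E * (norm (?r2 x))\<^sup>2)))"
      unfolding A_def B_def C_def D_def E_def by (simp add: add_divide_distrib algebra_simps)
    have u: "o' / 2 * ((norm (?g1 x))\<^sup>2 - (norm (?g2 x))\<^sup>2) - k\<^sup>2 * o' / 2 * ((norm (?W1 x))\<^sup>2 - (norm (?W2 x))\<^sup>2) - p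
      = 1 * (o' / 2 * (norm (?g1 x))\<^sup>2 + (- (o' / 2)) * (norm (?g2 x))\<^sup>2)
      + 1 * (1 * (- (k\<^sup>2 * o' / 2) * (norm (?W1 x))\<^sup>2 + (k\<^sup>2 * o' / 2) * (norm (?W2 x))\<^sup>2) + (-1) * p)" for p
      by (simp add: algebra_simps)
    show "1 * (A * (norm (?g1 x))\<^sup>2 + A * (norm (?g2 x))\<^sup>2)
    + 1 * (1 * (B * (norm (?W1 x))\<^sup>2 + B * (norm (?W2 x))\<^sup>2)
    + 1 * (1 * (C * 1 + D * (norm (jmp e w x))\<^sup>2) + 1 * (E * (norm (?r1 x))\<^sup>2 + E * (norm (?r2 x))\<^sup>2)))
      \<le> 1 * (o' / 2 * (norm (?g1 x))\<^sup>2 + (- (o' / 2)) * (norm (?g2 x))\<^sup>2)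
      + 1 * (1 * (- (k\<^sup>2 * o' / 2) * (norm (?W1 x))\<^sup>2 + (k\<^sup>2 * o' / 2) * (norm (?W2 x))\<^sup>2) + (-1) * ?P x)"
      using main unfolding l u .
  qed (intro ci)+
  also have "\<dots> = 1 * (o' / 2 * FI e (\<lambda>x. (norm (?g1 x))\<^sup>2) + (- (o' / 2)) * FI e (\<lambda>x. (norm (?g2 x))\<^sup>2))
    + 1 * (1 * (- (k\<^sup>2 * o' / 2) * FI e (\<lambda>x. (norm (?W1 x))\<^sup>2) + (k\<^sup>2 * o' / 2) * FI e (\<lambda>x. (norm (?W2 x))\<^sup>2)) + (-1) * FI e ?P)"
    by (simp only: FI_comb[OF P] ci continuous_on_const)
  finally show ?thesis unfolding r_def o'_def by (simp add: algebra_simps)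
qed

text \<open>The divergence theorem is used twice: for \<open>w\<close>, where the derivative term is
  the product with the multiplier, and for the piecewise constant \<nabla>w, where it trades
  \<open>d/2\<close> times the squared norm of \<nabla>w for face terms. These are the gradient
  terms that the facewise estimates ask for, and providing them lowers the coefficient of that norm
  from 1 to \<open>1 - d/2\<close>.\<close>

lemma rellich:
  assumes w: "pw_affine w" and s: "pw_affine \<sigma>" and \<epsilon>: "0 < \<epsilon>" and k: "0 \<le> k" and b: "0 \<le> \<beta>"
  shows "(1 - real CARD('n) / 2) * norm_sq \<Omega> (grad_h T w) + Re (ip_vec \<Omega> (\<lambda>x. \<sigma> x - grad_h T w x) (grad_h T w))
     + real CARD('n) / 2 * k\<^sup>2 * norm_sq \<Omega> w + c / 4 * norm_sq_bdry \<Omega> T (grad_h T w) - (R / 2 + R\<^sup>2 / c) * k\<^sup>2 * norm_sq_bdry \<Omega> T w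
     - (\<Sum>e\<in>interior_faces T. face_defect k \<beta> w (\<lambda>x. \<sigma> x - grad_h T w x) \<epsilon> e)
    \<le> Re (reduced_form k \<beta> w \<sigma> (multiplier w))"
proof -
  note v = multiplier[OF w] and g = pw_affine_grad[OF w]
  let ?d = "real CARD('n)" and ?Bd = "boundary_faces \<Omega> T" and ?I = "interior_faces T"
  define r where "r = (\<lambda>x. \<sigma> x - grad_h T w x)"
  have r: "pw_affine r" unfolding r_def by (rule pw_affine_diff[OF s g])
  have er: "ext K \<sigma> x = ext K r x + ext K (grad_h T w) x" if "K \<in> T" for K x
    unfolding r_def ext_diff[OF s g that] by simp
  define X Z rz where "X = norm_sq \<Omega> w" and "Z = norm_sq \<Omega> (grad_h T w)" and "rz = Re (ip_vec \<Omega> r (grad_h T w))"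
  define wb where "wb = (\<Sum>(K, e)\<in>?Bd. offset K e * FI e (\<lambda>x. (norm (ext K w x))\<^sup>2))"
  define gb where "gb = (\<Sum>(K, e)\<in>?Bd. offset K e * FI e (\<lambda>x. (norm (ext K (grad_h T w) x))\<^sup>2))"
  define wi where "wi = (\<Sum>e\<in>?I. offset (K1 e) e * (FI e (\<lambda>x. (norm (ext (K1 e) w x))\<^sup>2) - FI e (\<lambda>x. (norm (ext (K2 e) w x))\<^sup>2)))"
  define gi where "gi = (\<Sum>e\<in>?I. offset (K1 e) e * (FI e (\<lambda>x. (norm (ext (K1 e) (grad_h T w) x))\<^sup>2) - FI e (\<lambda>x. (norm (ext (K2 e) (grad_h T w) x))\<^sup>2)))"
  define bb where "bb = (\<Sum>(K, e)\<in>?Bd. FI e (\<lambda>x. (\<i> * complex_of_real k * ext K w x) \<bullet> ext K (multiplier w) x))"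
  let ?P = "\<lambda>e x. (mean e \<sigma> x - (\<i> * complex_of_real \<beta>) *s (jmp e w x *s cvec (nrm e))) \<bullet> (jmp e (multiplier w) x *s cvec (nrm e))"
  define pp where "pp = (\<Sum>e\<in>?I. FI e (?P e))"
  have eg: "ext K (grad_h T (multiplier w)) = ext K (grad_h T w)" if "K \<in> T" for K
    unfolding ext_grad[OF v(1) that] ext_grad[OF w that] v(3)[OF that] ..
  \<comment> \<open>By \<open>eg\<close> the multiplier has the gradient of \<open>w\<close>, so
    \<sigma>, split into \<nabla>w and the defect, is tested with \<nabla>w.\<close>
  have 1: "Re (ip_vec \<Omega> \<sigma> (grad_h T (multiplier w))) = Z + rz"
    unfolding Re_ip_vec[OF s pw_affine_grad[OF v(1)]] Z_def rz_def norm_sq_eq[OF g] Re_ip_vec[OF r g] sum.distrib[symmetric]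
  proof (intro sum.cong refl)
    fix K assume K: "K \<in> T"
    have "(LINT x:K|lebesgue. ext K (grad_h T w) x \<bullet> ext K (grad_h T w) x + ext K r x \<bullet> ext K (grad_h T w) x)
      = (LINT x:K|lebesgue. ext K (grad_h T w) x \<bullet> ext K (grad_h T w) x) + (LINT x:K|lebesgue. ext K r x \<bullet> ext K (grad_h T w) x)"
      by (rule positive_functional_add[OF pos_T[OF K]]) (intro continuous_intros continuous_ext K r g)+
    then show "(LINT x:K|lebesgue. ext K \<sigma> x \<bullet> ext K (grad_h T (multiplier w)) x)
      = (LINT x:K|lebesgue. (norm (ext K (grad_h T w) x))\<^sup>2) + (LINT x:K|lebesgue. ext K r x \<bullet> ext K (grad_h T w) x)"
      unfolding eg[OF K] er[OF K] by (simp add: inner_add_left add.commute power2_norm_eq_inner)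
  qed
  have sl: "ext K (multiplier w) x = slope K w (x - x0)" if "K \<in> T" for K x
    unfolding v(2)[OF that] linear_pairing[OF affine_mapD(1)[OF ext_affine(1)[OF w that]], symmetric] ..
  have "?d * X + 2 * Re (ip \<Omega> w (multiplier w)) = wb + wi"
  proof -
    have "Re (ip \<Omega> w (multiplier w)) = (\<Sum>K\<in>T. LINT x:K|lebesgue. ext K w x \<bullet> slope K w (x - x0))"
      unfolding Re_ip[OF w v(1)] by (intro sum.cong refl) (simp add: sl)
    then show ?thesis
      unfolding X_def norm_sq_eq[OF w] wb_def wi_def
      using global_divergence[of "\<lambda>K. ext K w" "\<lambda>K. slope K w", OF ext_affine(1)[OF w]] by simp
  qed
  then have 2: "Re (ip \<Omega> w (multiplier w)) = (wb + wi - ?d * X) / 2" by simp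
  \<comment> \<open>The field \<nabla>w has slope zero on each element, so the volume side reduces
    to its norm.\<close>
  have 3: "?d * Z = gb + gi"
    unfolding Z_def norm_sq_eq[OF g] gb_def gi_def
  proof -
    have a: "affine_map (ext K (grad_h T w)) (\<lambda>u. 0)" if "K \<in> T" for K
      unfolding ext_grad[OF w that] by (rule affine_map_const)
    from global_divergence[of "\<lambda>K. ext K (grad_h T w)" "\<lambda>K u. 0", OF a]
    show "?d * (\<Sum>K\<in>T. LINT x:K|lebesgue. (norm (ext K (grad_h T w) x))\<^sup>2)
      = (\<Sum>(K, e)\<in>?Bd. offset K e * FI e (\<lambda>x. (norm (ext K (grad_h T w) x))\<^sup>2))
      + (\<Sum>e\<in>?I. offset (K1 e) e * (FI e (\<lambda>x. (norm (ext (K1 e) (grad_h T w) x))\<^sup>2) - FI e (\<lambda>x. (norm (ext (K2 e) (grad_h T w) x))\<^sup>2)))"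
      by simp
  qed
  have 4: "Re (\<i> * complex_of_real k * ip_bdry \<Omega> T w (multiplier w)) = bb"
    unfolding bb_def by (rule Re_ip_bdry[OF w v(1)])
  have 5: "Re (\<Sum>e\<in>?I. ip_face_vec e (\<lambda>x. mean e \<sigma> x - (\<i> * complex_of_real \<beta>) *s (jmp e w x *s cvec (nrm e))) (\<lambda>x. jmp e (multiplier w) x *s cvec (nrm e))) = pp"
    unfolding pp_def Re_sum
  proof (intro sum.cong refl)
    fix e assume e: "e \<in> ?I"
    show "Re (ip_face_vec e (\<lambda>x. mean e \<sigma> x - (\<i> * complex_of_real \<beta>) *s (jmp e w x *s cvec (nrm e))) (\<lambda>x. jmp e (multiplier w) x *s cvec (nrm e))) = FI e (?P e)"
      by (rule Re_ip_face_vec[OF sides(8)[OF e]])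
         (intro continuous_intros continuous_jmp[OF w e] continuous_jmp[OF s e] continuous_jmp[OF v(1) e])+
  qed
  have 6: "Re (reduced_form k \<beta> w \<sigma> (multiplier w)) = Z + rz - k\<^sup>2 * ((wb + wi - ?d * X) / 2) + bb - pp"
  proof -
    have "Re (complex_of_real (k\<^sup>2) * ip \<Omega> w (multiplier w)) = k\<^sup>2 * ((wb + wi - ?d * X) / 2)"
      unfolding 2[symmetric] by simp
    then show ?thesis unfolding reduced_form_def by (simp only: minus_complex.sel plus_complex.sel 1 4 5)
  qed
  have 7: "c / 4 * norm_sq_bdry \<Omega> T (grad_h T w) + - ((R / 2 + R\<^sup>2 / c) * k\<^sup>2) * norm_sq_bdry \<Omega> T w \<le> gb / 2 - k\<^sup>2 * wb / 2 + bb"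
  proof -
    have "c / 4 * norm_sq_bdry \<Omega> T (grad_h T w) + - ((R / 2 + R\<^sup>2 / c) * k\<^sup>2) * norm_sq_bdry \<Omega> T w
      = (\<Sum>(K, e)\<in>?Bd. c / 4 * FI e (\<lambda>x. (norm (ext K (grad_h T w) x))\<^sup>2) + - ((R / 2 + R\<^sup>2 / c) * k\<^sup>2) * FI e (\<lambda>x. (norm (ext K w x))\<^sup>2))"
      unfolding norm_sq_bdry_eq[OF w] norm_sq_bdry_eq[OF g] sum_distrib_left sum.distrib[symmetric] by (intro sum.cong refl) auto
    also have "\<dots> \<le> (\<Sum>(K, e)\<in>?Bd. offset K e / 2 * FI e (\<lambda>x. (norm (ext K (grad_h T w) x))\<^sup>2) - k\<^sup>2 * offset K e / 2 * FI e (\<lambda>x. (norm (ext K w x))\<^sup>2)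
      + FI e (\<lambda>x. (\<i> * complex_of_real k * ext K w x) \<bullet> ext K (multiplier w) x))"
    proof (rule sum_mono)
      fix Ke assume "Ke \<in> ?Bd"
      then show "(case Ke of (K, e) \<Rightarrow> c / 4 * FI e (\<lambda>x. (norm (ext K (grad_h T w) x))\<^sup>2) + - ((R / 2 + R\<^sup>2 / c) * k\<^sup>2) * FI e (\<lambda>x. (norm (ext K w x))\<^sup>2))
        \<le> (case Ke of (K, e) \<Rightarrow> offset K e / 2 * FI e (\<lambda>x. (norm (ext K (grad_h T w) x))\<^sup>2) - k\<^sup>2 * offset K e / 2 * FI e (\<lambda>x. (norm (ext K w x))\<^sup>2)
      + FI e (\<lambda>x. (\<i> * complex_of_real k * ext K w x) \<bullet> ext K (multiplier w) x))"
        using rellich_boundary[OF w _ k] by (cases Ke) (simp only: prod.case)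
    qed
    also have "\<dots> = gb / 2 - k\<^sup>2 * wb / 2 + bb"
      unfolding gb_def wb_def bb_def by (simp add: split_beta sum.distrib sum_subtractf sum_divide_distrib sum_distrib_left algebra_simps)
    finally show ?thesis .
  qed
  have 8: "- (\<Sum>e\<in>?I. face_defect k \<beta> w r \<epsilon> e) \<le> gi / 2 - k\<^sup>2 * wi / 2 - pp"
  proof -
    have "- (\<Sum>e\<in>?I. face_defect k \<beta> w r \<epsilon> e) = (\<Sum>e\<in>?I. - face_defect k \<beta> w r \<epsilon> e)" by (simp add: sum_negf)
    also have "\<dots> \<le> (\<Sum>e\<in>?I. offset (K1 e) e / 2 * (FI e (\<lambda>x. (norm (ext (K1 e) (grad_h T w) x))\<^sup>2) - FI e (\<lambda>x. (norm (ext (K2 e) (grad_h T w) x))\<^sup>2))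
     - k\<^sup>2 * offset (K1 e) e / 2 * (FI e (\<lambda>x. (norm (ext (K1 e) w x))\<^sup>2) - FI e (\<lambda>x. (norm (ext (K2 e) w x))\<^sup>2)) - FI e (?P e))"
      unfolding r_def by (rule sum_mono) (rule rellich_interior[OF w s _ \<epsilon> k b])
    also have "\<dots> = gi / 2 - k\<^sup>2 * wi / 2 - pp"
    proof -
      have "(\<Sum>e\<in>?I. z e / 2 * a e - k\<^sup>2 * z e / 2 * b e - p e) = (\<Sum>e\<in>?I. z e * a e) / 2 - k\<^sup>2 * (\<Sum>e\<in>?I. z e * b e) / 2 - (\<Sum>e\<in>?I. p e)"
        for z a b p :: "(real^'n) set \<Rightarrow> real"
        by (simp add: sum_subtractf sum_divide_distrib sum_distrib_left mult.assoc)
      then show ?thesis unfolding gi_def wi_def pp_def .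
    qed
    finally show ?thesis .
  qed
  have 9: "(1 - ?d / 2) * Z = Z - (gb + gi) / 2" unfolding 3[symmetric] by (simp add: algebra_simps)
  have 10: "k\<^sup>2 * ((wb + wi - ?d * X) / 2) = k\<^sup>2 * wb / 2 + k\<^sup>2 * wi / 2 - ?d / 2 * k\<^sup>2 * X" by (simp add: algebra_simps add_divide_distrib diff_divide_distrib)
  have "(1 - ?d / 2) * Z + rz + ?d / 2 * k\<^sup>2 * X + (c / 4 * norm_sq_bdry \<Omega> T (grad_h T w) + - ((R / 2 + R\<^sup>2 / c) * k\<^sup>2) * norm_sq_bdry \<Omega> T w)
     + - (\<Sum>e\<in>?I. face_defect k \<beta> w r \<epsilon> e) \<le> Re (reduced_form k \<beta> w \<sigma> (multiplier w))"
  proof -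
    have aux: "Z - (gb + gi) / 2 + rz + DX + A + B \<le> Z + rz - (KB + KI - DX) + bb - pp"
      if "A \<le> gb / 2 - KB + bb" "B \<le> gi / 2 - KI - pp" for A B DX KB KI :: real
      using that by (simp add: field_simps)
    show ?thesis unfolding 6 9 10 by (rule aux[OF 7 8])
  qed
  then show ?thesis unfolding X_def Z_def rz_def r_def by (simp add: algebra_simps)
qed

end

section \<open>Stability estimate\<close>

text \<open>Bookkeeping with real numbers. \<open>X\<close>, \<open>Y\<close>, \<open>Z\<close>,
  \<rho> are the squared volume norms of \<open>w\<close>, \<sigma>, \<nabla>w and the defect,
  \<open>XB\<close> and \<open>ZB\<close> the squared boundary norms of \<open>w\<close> and
  \<nabla>w, \<open>J\<close> and \<open>JN\<close> the jump sums, \<open>rz\<close> the product of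
  the defect and \<nabla>w; \<open>V\<close>, \<open>W\<close>, \<open>I\<close> are the outcomes of
  the tests. The weights bounded by \<Gamma> are those of \<open>gamma2\<close>: each turns a jump
  divided by a power of \<eta>, as it occurs here, into \<Gamma> times a part of
  \<open>I\<close>.\<close>

lemma rellich_absorb:
  fixes d R c k \<beta> \<delta> \<eta> \<Gamma> X XB Y Z ZB \<rho> rz J JN V W :: real
  assumes d: "2 \<le> d" and R: "0 \<le> R" and c: "0 < c"
    and pos: "0 < k" "0 < \<beta>" "0 < \<delta>" "0 < \<eta>" and nn: "0 \<le> X" "0 \<le> XB" "0 \<le> Y" "0 \<le> Z" "0 \<le> ZB" "0 \<le> \<rho>" "0 \<le> J" "0 \<le> JN"
    and g: "k \<le> \<Gamma>" "(k\<^sup>2 + 1) / (\<beta> * \<eta>) \<le> \<Gamma>" "(\<beta> + \<delta>) / \<eta> \<le> \<Gamma>" "\<delta> / \<eta> ^ 3 \<le> \<Gamma>" "1 / (\<beta> * \<eta> ^ 3) \<le> \<Gamma>"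
    and I: "I = k * XB + \<beta> * J + \<delta> * JN" and W: "W = Y - k\<^sup>2 * X" and Y: "Y = Z + 2 * rz + \<rho>"
    and rz: "\<And>\<mu>. 0 < \<mu> \<Longrightarrow> \<bar>rz\<bar> \<le> \<mu> * Z + \<rho> / (4 * \<mu>)"
    and rho: "\<rho> \<le> 4 * CT / \<eta> * (\<delta>\<^sup>2 * JN + J)" and CT: "0 < CT" and Cg: "0 \<le> Cg"
    and rel: "\<And>\<mu>. 0 < \<mu> \<Longrightarrow> (1 - d / 2) * Z + rz + d / 2 * k\<^sup>2 * X + c / 4 * ZB - (R / 2 + R\<^sup>2 / c) * k\<^sup>2 * XB
      - ((2 + 4 * R\<^sup>2) * \<mu> * (CT * Z) + 2 * \<mu> * k\<^sup>2 * (CT * X) + (R\<^sup>2 * (Cg / \<eta>\<^sup>2 * J) + (k\<^sup>2 * R\<^sup>2 + \<beta>\<^sup>2) * J + CT * \<rho> / \<eta>) / (4 * (\<mu> * \<eta>))) \<le> V"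
    and C1: "C1 = (2 + 4 * R\<^sup>2) * CT" and C2: "C2 = (R\<^sup>2 * Cg + R\<^sup>2 + 1 + 4 * CT\<^sup>2) / 4"
    and C: "C = 4 * (R / 2 + R\<^sup>2 / c + 6 * (C1 + d) * (C2 + d * CT) + 4 / 3 * CT) + 1"
  shows "k\<^sup>2 * X + k\<^sup>2 * XB + Y + c * ZB \<le> 4 * V + (2 * d - 5 / 3) * W + C * (\<Gamma> * I)"
    "\<rho> \<le> 4 * CT * (\<Gamma> * I)" "Z \<le> 2 * Y + 2 * \<rho>"
proof -
  define Q where "Q = \<Gamma> * I"
  have G0: "0 \<le> \<Gamma>" using g(1) pos(1) by linarith
  have I0: "0 \<le> k * XB" "0 \<le> \<beta> * J" "0 \<le> \<delta> * JN" using pos nn by simp_all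
  have Q: "Q = \<Gamma> * (k * XB) + \<Gamma> * (\<beta> * J) + \<Gamma> * (\<delta> * JN)" unfolding Q_def I by (simp add: distrib_left)
  have Q3: "0 \<le> \<Gamma> * (k * XB)" "0 \<le> \<Gamma> * (\<beta> * J)" "0 \<le> \<Gamma> * (\<delta> * JN)" using G0 I0 by simp_all
  have bnd: "a * x \<le> \<Gamma> * x" if "a \<le> \<Gamma>" "0 \<le> x" for a x using that by (rule mult_right_mono)
  have q1: "k\<^sup>2 * XB \<le> Q"
    using bnd[OF g(1) I0(1)] Q Q3 by (simp add: power2_eq_square)
  have i1: "1 / (\<beta> * \<eta>) \<le> \<Gamma>" "k\<^sup>2 / (\<beta> * \<eta>) \<le> \<Gamma>" "\<beta> / \<eta> \<le> \<Gamma>" "\<delta> / \<eta> \<le> \<Gamma>"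
  proof -
    have "1 / (\<beta> * \<eta>) \<le> (k\<^sup>2 + 1) / (\<beta> * \<eta>)" "k\<^sup>2 / (\<beta> * \<eta>) \<le> (k\<^sup>2 + 1) / (\<beta> * \<eta>)"
      "\<beta> / \<eta> \<le> (\<beta> + \<delta>) / \<eta>" "\<delta> / \<eta> \<le> (\<beta> + \<delta>) / \<eta>"
      using pos by (auto intro!: divide_right_mono)
    then show "1 / (\<beta> * \<eta>) \<le> \<Gamma>" "k\<^sup>2 / (\<beta> * \<eta>) \<le> \<Gamma>" "\<beta> / \<eta> \<le> \<Gamma>" "\<delta> / \<eta> \<le> \<Gamma>" using g by linarith+
  qed
  have q2: "k\<^sup>2 * J / \<eta> \<le> Q" using bnd[OF i1(2) I0(2)] Q Q3 pos by simp
  have q3: "\<beta>\<^sup>2 * J / \<eta> \<le> Q" using bnd[OF i1(3) I0(2)] Q Q3 by (simp add: power2_eq_square)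
  have q4: "J / \<eta> ^ 3 \<le> Q" using bnd[OF g(5) I0(2)] Q Q3 pos by simp
  \<comment> \<open>The lifting carries \<open>\<delta>^2\<close> but \<open>I\<close> only
    \<delta>; the other \<delta> belongs to the weight.\<close>
  have "\<delta>\<^sup>2 * JN / \<eta> \<le> \<Gamma> * (\<delta> * JN)" using bnd[OF i1(4) I0(3)] by (simp add: power2_eq_square)
  moreover have "J / \<eta> \<le> \<Gamma> * (\<beta> * J)" using bnd[OF i1(1) I0(2)] pos by simp
  ultimately have q5: "(\<delta>\<^sup>2 * JN + J) / \<eta> \<le> Q" using Q Q3 by (simp add: add_divide_distrib)
  have "\<delta>\<^sup>2 * JN / \<eta> ^ 3 \<le> \<Gamma> * (\<delta> * JN)" using bnd[OF g(4) I0(3)] by (simp add: power2_eq_square)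
  moreover have "J / \<eta> ^ 3 \<le> \<Gamma> * (\<beta> * J)" using bnd[OF g(5) I0(2)] pos by simp
  ultimately have q6: "(\<delta>\<^sup>2 * JN + J) / \<eta> ^ 3 \<le> Q" using Q Q3 by (simp add: add_divide_distrib)
  have r1: "\<rho> \<le> 4 * CT * Q"
  proof -
    have "\<rho> \<le> 4 * CT * ((\<delta>\<^sup>2 * JN + J) / \<eta>)" using rho by simp
    also have "\<dots> \<le> 4 * CT * Q" using q5 CT by (intro mult_left_mono) auto
    finally show ?thesis .
  qed
  then show "\<rho> \<le> 4 * CT * (\<Gamma> * I)" unfolding Q_def .
  \<comment> \<open>The flux term divides the defect by \<open>\<eta>^2\<close>, once for the trace
    inequality and once for the choice of \<epsilon> as \<open>\<mu> \<eta>\<close>; with the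
    further \<eta> of the lifting this produces the cubes in \<open>gamma2\<close>.\<close>
  have r2: "\<rho> / \<eta>\<^sup>2 \<le> 4 * CT * Q"
  proof -
    have "\<rho> / \<eta>\<^sup>2 \<le> 4 * CT / \<eta> * (\<delta>\<^sup>2 * JN + J) / \<eta>\<^sup>2" using rho by (intro divide_right_mono) auto
    also have "\<dots> = 4 * CT * ((\<delta>\<^sup>2 * JN + J) / \<eta> ^ 3)" by (simp add: power3_eq_cube power2_eq_square)
    also have "\<dots> \<le> 4 * CT * Q" using q6 CT by (intro mult_left_mono) auto
    finally show ?thesis .
  qed
  have Q0: "0 \<le> Q" using Q Q3 by linarith
  \<comment> \<open>With weight 1/4 the mixed product \<open>2 rz\<close> costs only half of
    \<open>Z\<close>.\<close>
  have "\<bar>rz\<bar> \<le> 1/4 * Z + \<rho>" using rz[of "1/4"] by simp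
  then show Z2: "Z \<le> 2 * Y + 2 * \<rho>" using Y by linarith
  \<comment> \<open>Makes the absorbed terms add up to at most \<open>(Z + k^2 X) / 6\<close>. As
    \<open>Z\<close> is at most \<open>2 k^2 X\<close> up to controlled terms, they cost half of
    \<open>k^2 X\<close>.\<close>
  define \<mu> where "\<mu> = 1 / (6 * (C1 + d))"
  have C1p: "0 < C1" unfolding C1 using CT by (simp add: add_pos_nonneg)
  have \<mu>: "0 < \<mu>" unfolding \<mu>_def using C1p d by simp
  have i\<mu>: "1 / \<mu> = 6 * (C1 + d)" unfolding \<mu>_def by simp
  have m: "\<mu> * (C1 + d) = 1 / 6" unfolding \<mu>_def using C1p d by simp
  have tail: "(R\<^sup>2 * (Cg / \<eta>\<^sup>2 * J) + (k\<^sup>2 * R\<^sup>2 + \<beta>\<^sup>2) * J + CT * \<rho> / \<eta>) / (4 * (\<mu> * \<eta>)) \<le> C2 * Q / \<mu>"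
  proof -
    have "(R\<^sup>2 * (Cg / \<eta>\<^sup>2 * J) + (k\<^sup>2 * R\<^sup>2 + \<beta>\<^sup>2) * J + CT * \<rho> / \<eta>) / (4 * (\<mu> * \<eta>))
      = (R\<^sup>2 * Cg * (J / \<eta> ^ 3) + R\<^sup>2 * (k\<^sup>2 * J / \<eta>) + \<beta>\<^sup>2 * J / \<eta> + CT * (\<rho> / \<eta>\<^sup>2)) / 4 / \<mu>"
      using pos \<mu> by (simp add: field_simps power2_eq_square power3_eq_cube)
    also have "\<dots> \<le> (R\<^sup>2 * Cg * Q + R\<^sup>2 * Q + Q + CT * (4 * CT * Q)) / 4 / \<mu>"
      using q2 q3 q4 r2 \<mu> CT Cg by (intro divide_right_mono add_mono mult_left_mono) auto
    also have "\<dots> = C2 * Q / \<mu>" unfolding C2 by (simp add: field_simps power2_eq_square)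
    finally show ?thesis .
  qed
  have drop: "(2 + 4 * R\<^sup>2) * \<mu> * (CT * Z) + 2 * \<mu> * k\<^sup>2 * (CT * X) \<le> \<mu> * C1 * (Z + k\<^sup>2 * X)"
  proof -
    have "2 * CT \<le> C1" unfolding C1 using CT by (intro mult_right_mono) auto
    then have "2 * CT * (\<mu> * (k\<^sup>2 * X)) \<le> C1 * (\<mu> * (k\<^sup>2 * X))" using \<mu> nn(1) by (intro mult_right_mono) auto
    moreover have "(2 + 4 * R\<^sup>2) * \<mu> * (CT * Z) = C1 * (\<mu> * Z)" unfolding C1 by simp
    ultimately show ?thesis by (simp add: algebra_simps)
  qed
  have rzm: "(d - 1) * \<bar>rz\<bar> \<le> \<mu> * d * Z + d * CT * Q / \<mu>"
  proof -
    have "\<rho> / (4 * \<mu>) \<le> 4 * CT * Q / (4 * \<mu>)" using r1 \<mu> by (intro divide_right_mono) auto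
    then have "\<bar>rz\<bar> \<le> \<mu> * Z + CT * Q / \<mu>" using rz[OF \<mu>] by simp
    then have "(d - 1) * \<bar>rz\<bar> \<le> d * (\<mu> * Z + CT * Q / \<mu>)" using d by (intro mult_mono) auto
    then show ?thesis by (simp add: algebra_simps)
  qed
  \<comment> \<open>Replaces \<open>Z\<close>, whose coefficient is not positive, by
    \<open>k^2 X + W\<close> and defect terms; together with \<open>d/2\<close> times
    \<open>k^2 X\<close> from Rellich's identity, \<open>k^2 X\<close> keeps the coefficient
    one.\<close>
  have split: "(1 - d / 2) * Z + rz = (1 - d / 2) * (k\<^sup>2 * X + W) + (d - 1) * rz + (d / 2 - 1) * \<rho>"
    using Y W by (simp add: algebra_simps)
  have "- ((d - 1) * \<bar>rz\<bar>) \<le> (d - 1) * rz" using d mult_left_mono[of "-\<bar>rz\<bar>" rz "d - 1"] by simp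
  moreover have "0 \<le> (d / 2 - 1) * \<rho>" using d nn by simp
  moreover have "(1 - d / 2) * (k\<^sup>2 * X + W) + d / 2 * k\<^sup>2 * X = k\<^sup>2 * X - (d / 2 - 1) * W" by (simp add: algebra_simps)
  moreover have "(R / 2 + R\<^sup>2 / c) * k\<^sup>2 * XB \<le> (R / 2 + R\<^sup>2 / c) * Q"
    unfolding mult.assoc using q1 R c by (intro mult_left_mono) auto
  ultimately have main: "k\<^sup>2 * X + c / 4 * ZB \<le> V + (d / 2 - 1) * W + (R / 2 + R\<^sup>2 / c) * Q + (\<mu> * d * Z + d * CT * Q / \<mu>) + \<mu> * C1 * (Z + k\<^sup>2 * X) + C2 * Q / \<mu>"
    using rel[OF \<mu>] drop tail rzm split by linarith
  have "\<mu> * d * Z + \<mu> * C1 * (Z + k\<^sup>2 * X) \<le> \<mu> * (C1 + d) * (Z + k\<^sup>2 * X)"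
    using \<mu> d nn(1) by (simp add: algebra_simps)
  also have "\<dots> = (Z + k\<^sup>2 * X) / 6" unfolding m by simp
  finally have e1: "\<mu> * d * Z + \<mu> * C1 * (Z + k\<^sup>2 * X) \<le> (Z + k\<^sup>2 * X) / 6" .
  have e2: "d * CT * Q / \<mu> + C2 * Q / \<mu> = 6 * (C1 + d) * (C2 + d * CT) * Q"
    unfolding i\<mu>[symmetric] by (simp add: algebra_simps add_divide_distrib)
  have e3: "Z \<le> 2 * (k\<^sup>2 * X) + 2 * W + 8 * CT * Q" using Z2 r1 W by linarith
  have e4: "k\<^sup>2 * X + c / 4 * ZB \<le> V + (d / 2 - 1) * W + (R / 2 + R\<^sup>2 / c) * Q + (3 * (k\<^sup>2 * X) + 2 * W + 8 * CT * Q) / 6 + 6 * (C1 + d) * (C2 + d * CT) * Q"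
  proof -
    have "Z + k\<^sup>2 * X \<le> 3 * (k\<^sup>2 * X) + 2 * W + 8 * CT * Q" using e3 by linarith
    then have "(Z + k\<^sup>2 * X) / 6 \<le> (3 * (k\<^sup>2 * X) + 2 * W + 8 * CT * Q) / 6" by (rule divide_right_mono) simp
    moreover have "A \<le> v + dw + rq + u + s"
      if "A \<le> v + dw + rq + (p1 + p2) + p3 + p4" "p1 + p3 \<le> t" "t \<le> u" "p2 + p4 = s" for A v dw rq u s t p1 p2 p3 p4 :: real
      using that by linarith
    ultimately show ?thesis using main e1 e2 by blast
  qed
  have e5: "C * Q = 4 * ((R / 2 + R\<^sup>2 / c) * Q + 6 * (C1 + d) * (C2 + d * CT) * Q + 8 / 6 * (CT * Q)) + Q"
    unfolding C by (simp add: algebra_simps)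
  \<comment> \<open>Four times the previous estimate gives \<open>2 d - 4\<close> and
    \<open>4/3\<close>; the last summand stems from \<open>Y = W + k^2 X\<close>.\<close>
  have e6: "(2 * d - 5 / 3) * W = 4 * ((d / 2 - 1) * W) + 4 / 3 * W + W" by (simp add: algebra_simps)
  have e7: "(3 * (k\<^sup>2 * X) + 2 * W + 8 * CT * Q) / 6 = 1 / 2 * (k\<^sup>2 * X) + 1 / 3 * W + 8 / 6 * (CT * Q)" by (simp add: add_divide_distrib)
  have aux: "x + xb + y + zb \<le> 4 * v + (4 * dw + 4 / 3 * w + w) + (4 * (rq + cq + 8 / 6 * q') + q)"
    if "x + zb / 4 \<le> v + dw + rq + (1 / 2 * x + 1 / 3 * w + 8 / 6 * q') + cq" "xb \<le> q" "w = y - x" for x xb y zb v dw w rq cq q' q :: real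
    using that by (simp add: field_simps)
  show "k\<^sup>2 * X + k\<^sup>2 * XB + Y + c * ZB \<le> 4 * V + (2 * d - 5 / 3) * W + C * (\<Gamma> * I)"
    unfolding Q_def[symmetric] e5 e6
  proof (rule aux[OF _ q1 W])
    show "k\<^sup>2 * X + c * ZB / 4 \<le> V + (d / 2 - 1) * W + (R / 2 + R\<^sup>2 / c) * Q + (1 / 2 * (k\<^sup>2 * X) + 1 / 3 * W + 8 / 6 * (CT * Q)) + 6 * (C1 + d) * (C2 + d * CT) * Q"
      using e4 unfolding e7 by simp
  qed
qed

text \<open>\<open>S\<close> is the sum of the suprema. The norm of the multiplier involves the
  defect, which is bounded through \<open>I\<close>, hence through \<open>S\<close> again; arguing
  by contradiction gives \<open>S \<Gamma> \<le> N\<close> and breaks the circle. \<open>D\<close>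
  bounds \<Gamma> from below, so that a factor 1 can be traded for
  \<open>D \<Gamma>\<close>.\<close>

lemma sup_lower_bound:
  fixes S N \<Gamma> k M Rm c CT C D a V W I Y \<rho> Z ZB :: real
  assumes N: "0 < N" and S: "0 \<le> S" and G: "1 / D \<le> \<Gamma>" "k \<le> \<Gamma>" and D: "0 < D" and k: "0 < k" and pos: "0 < CT" "0 \<le> C" "0 < c" "0 \<le> a" "0 \<le> M"
    and main: "N\<^sup>2 \<le> 4 * V + a * W + C * (\<Gamma> * I)"
    and W: "W \<le> S * (2 * N)" and I: "I \<le> S * (2 * N)" and V: "V \<le> S * sqrt (M + N\<^sup>2)"
    and M: "M \<le> k\<^sup>2 * (Rm\<^sup>2 * Z) + k\<^sup>2 * (Rm\<^sup>2 * ZB) + c * ZB"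
    and Z: "Z \<le> 2 * Y + 2 * \<rho>" and YN: "Y \<le> N\<^sup>2" and ZB: "0 \<le> ZB" "c * ZB \<le> N\<^sup>2" and rho: "\<rho> \<le> 4 * CT * (\<Gamma> * I)"
    and C6: "C6 = 2 * Rm\<^sup>2 + 16 * CT * Rm\<^sup>2 + Rm\<^sup>2 / c + 2 * D\<^sup>2" and C8: "C8 = 4 * sqrt C6 + 2 * a * D + 2 * C + 1"
  shows "N / (C8 * \<Gamma>) \<le> S"
proof (rule ccontr)
  assume "\<not> N / (C8 * \<Gamma>) \<le> S"
  then have neg: "S < N / (C8 * \<Gamma>)" by simp
  have G0: "0 < \<Gamma>" using G(2) k by linarith
  have C60: "0 \<le> C6" unfolding C6 using pos D by auto
  have C81: "1 \<le> C8" unfolding C8 using C60 pos D by auto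
  define q where "q = S * \<Gamma> / N"
  have q0: "0 \<le> q" unfolding q_def using S G0 N by simp
  have q1: "q * C8 < 1"
    using neg N G0 C81 unfolding q_def by (simp add: field_simps)
  \<comment> \<open>The summand 1 of \<open>C8\<close> pays here: it makes \<open>q\<close> at most
    one, as the bound on \<rho> requires.\<close>
  have "q * 1 \<le> q * C8" using q0 C81 by (intro mult_left_mono)
  then have qle: "q \<le> 1" using q1 by linarith
  have SG: "S * \<Gamma> = q * N" unfolding q_def using N by simp
  have iD: "1 \<le> D * \<Gamma>" using G(1) D by (simp add: field_simps)
  have SN: "S * N \<le> q * N\<^sup>2 * D"
  proof -
    have "S * N * 1 \<le> S * N * (D * \<Gamma>)" using S N iD by (intro mult_left_mono) auto
    also have "\<dots> = (S * \<Gamma>) * N * D" by simp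
    finally show ?thesis unfolding SG by (simp add: power2_eq_square mult.assoc)
  qed
  have GI: "\<Gamma> * I \<le> 2 * q * N\<^sup>2"
  proof -
    have "\<Gamma> * I \<le> \<Gamma> * (S * (2 * N))" using I G0 by (intro mult_left_mono) auto
    also have "\<dots> = 2 * (S * \<Gamma>) * N" by simp
    finally show ?thesis unfolding SG by (simp add: power2_eq_square mult.assoc)
  qed
  have N2: "0 \<le> N\<^sup>2" by simp
  have "2 * q * N\<^sup>2 \<le> 2 * 1 * N\<^sup>2" using qle by (intro mult_right_mono) auto
  then have rho': "\<rho> \<le> 8 * CT * N\<^sup>2"
  proof -
    have "\<Gamma> * I \<le> 2 * N\<^sup>2" using GI \<open>2 * q * N\<^sup>2 \<le> 2 * 1 * N\<^sup>2\<close> by simp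
    then have "4 * CT * (\<Gamma> * I) \<le> 4 * CT * (2 * N\<^sup>2)" using pos by (intro mult_left_mono) auto
    also have "\<dots> = 8 * CT * N\<^sup>2" by simp
    finally show ?thesis using rho by (rule order_trans[rotated])
  qed
  have Z': "Z \<le> (2 + 16 * CT) * N\<^sup>2" using Z YN rho' by (simp add: algebra_simps)
  have ZB': "ZB \<le> N\<^sup>2 / c" using ZB(2) pos by (simp add: pos_le_divide_eq mult.commute)
  have k2: "k\<^sup>2 \<le> \<Gamma>\<^sup>2" using G(2) k by (intro power_mono) auto
  have "1\<^sup>2 \<le> (D * \<Gamma>)\<^sup>2" using iD by (intro power_mono) auto
  then have d2: "1 \<le> D\<^sup>2 * \<Gamma>\<^sup>2" by (simp add: power_mult_distrib)
  have "k\<^sup>2 * (Rm\<^sup>2 * Z) + k\<^sup>2 * (Rm\<^sup>2 * ZB) \<le> k\<^sup>2 * (Rm\<^sup>2 * ((2 + 16 * CT) * N\<^sup>2)) + k\<^sup>2 * (Rm\<^sup>2 * (N\<^sup>2 / c))"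
    using Z' ZB' by (intro add_mono mult_left_mono) auto
  also have "\<dots> = k\<^sup>2 * (Rm\<^sup>2 * ((2 + 16 * CT) * N\<^sup>2) + Rm\<^sup>2 * (N\<^sup>2 / c))" by (simp add: distrib_left)
  also have "\<dots> \<le> \<Gamma>\<^sup>2 * (Rm\<^sup>2 * ((2 + 16 * CT) * N\<^sup>2) + Rm\<^sup>2 * (N\<^sup>2 / c))"
    using k2 pos by (intro mult_right_mono) auto
  finally have m1: "k\<^sup>2 * (Rm\<^sup>2 * Z) + k\<^sup>2 * (Rm\<^sup>2 * ZB) \<le> \<Gamma>\<^sup>2 * (Rm\<^sup>2 * ((2 + 16 * CT) * N\<^sup>2) + Rm\<^sup>2 * (N\<^sup>2 / c))" .
  have m2: "1 * (2 * N\<^sup>2) \<le> D\<^sup>2 * \<Gamma>\<^sup>2 * (2 * N\<^sup>2)" using d2 by (intro mult_right_mono) auto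
  \<comment> \<open>The first two summands of \<open>C6\<close> come from the volume norm of the
    multiplier, through \<sigma> and through the defect, the third from its boundary norm;
    \<open>2 D^2\<close> covers the rest, which is at most \<open>2 N^2\<close>.\<close>
  have "M + N\<^sup>2 \<le> \<Gamma>\<^sup>2 * (Rm\<^sup>2 * ((2 + 16 * CT) * N\<^sup>2) + Rm\<^sup>2 * (N\<^sup>2 / c)) + D\<^sup>2 * \<Gamma>\<^sup>2 * (2 * N\<^sup>2)"
    using M ZB(2) m1 m2 by linarith
  also have "\<dots> = C6 * (\<Gamma> * N)\<^sup>2" unfolding C6 by (simp add: power_mult_distrib algebra_simps)
  finally have "sqrt (M + N\<^sup>2) \<le> sqrt (C6 * (\<Gamma> * N)\<^sup>2)" by (rule real_sqrt_le_mono)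
  also have "\<dots> = sqrt C6 * (\<Gamma> * N)" using G0 N by (simp add: real_sqrt_mult)
  finally have "S * sqrt (M + N\<^sup>2) \<le> S * (sqrt C6 * (\<Gamma> * N))" using S by (intro mult_left_mono)
  also have "\<dots> = sqrt C6 * ((S * \<Gamma>) * N)" by simp
  also have "\<dots> = sqrt C6 * (q * N\<^sup>2)" unfolding SG by (simp add: power2_eq_square mult.assoc)
  finally have V': "V \<le> sqrt C6 * (q * N\<^sup>2)" using V by linarith
  have W': "a * W \<le> a * (2 * (q * N\<^sup>2 * D))" using W SN pos by (intro mult_left_mono) auto
  have I': "C * (\<Gamma> * I) \<le> C * (2 * q * N\<^sup>2)" using GI pos by (intro mult_left_mono) auto
  have "N\<^sup>2 \<le> (C8 - 1) * (q * N\<^sup>2)"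
    using main V' W' I' unfolding C8 by (simp add: algebra_simps)
  also have "\<dots> = (C8 * q) * N\<^sup>2 - q * N\<^sup>2" by (simp add: algebra_simps)
  also have "\<dots> \<le> (C8 * q) * N\<^sup>2" using q0 N2 by simp
  finally have "N\<^sup>2 \<le> (q * C8) * N\<^sup>2" by (simp add: mult.commute)
  moreover have "(q * C8) * N\<^sup>2 < 1 * N\<^sup>2" using q1 N by (intro mult_strict_right_mono) auto
  ultimately show False by simp
qed

text \<open>\<open>CT\<close> is the constant of \<open>trace_sum\<close> and \<open>Cg\<close> that
  of \<open>tangential_jump\<close>. Apart from the dimension only \<open>R\<close>,
  \<open>c\<close> and \<open>D\<close> enter, neither the mesh nor \<open>k\<close>, \<beta>,
  \<delta>.\<close>

definition stability_constant :: "real \<Rightarrow> real \<Rightarrow> real \<Rightarrow> real \<Rightarrow> real" where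
  "stability_constant d R c D =
    (let CT = 2 * (d + 1)\<^sup>2; Cg = d * (d + 1) ^ 4;
         C1 = (2 + 4 * R\<^sup>2) * CT; C2 = (R\<^sup>2 * Cg + R\<^sup>2 + 1 + 4 * CT\<^sup>2) / 4;
         C = 4 * (R / 2 + R\<^sup>2 / c + 6 * (C1 + d) * (C2 + d * CT) + 4 / 3 * CT) + 1;
         C6 = 2 * R\<^sup>2 + 16 * CT * R\<^sup>2 + R\<^sup>2 / c + 2 * D\<^sup>2
     in 4 * sqrt C6 + 2 * (2 * d - 5 / 3) * D + 2 * C + 1)"

section \<open>Norms of the test functions and the suprema\<close>

context regular_mesh
begin

lemma norm_sq_sigma:
  assumes w: "pw_affine w" and s: "pw_affine \<sigma>"
  shows "norm_sq \<Omega> \<sigma> = norm_sq \<Omega> (grad_h T w) + 2 * Re (ip_vec \<Omega> (\<lambda>x. \<sigma> x - grad_h T w x) (grad_h T w)) + norm_sq \<Omega> (\<lambda>x. \<sigma> x - grad_h T w x)"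
proof -
  note g = pw_affine_grad[OF w]
  define r where "r = (\<lambda>x. \<sigma> x - grad_h T w x)"
  have r: "pw_affine r" unfolding r_def by (rule pw_affine_diff[OF s g])
  have er: "ext K \<sigma> x = ext K (grad_h T w) x + ext K r x" if "K \<in> T" for K x
    unfolding r_def ext_diff[OF s g that] by simp
  show ?thesis
    unfolding r_def[symmetric] norm_sq_eq[OF s] norm_sq_eq[OF g] norm_sq_eq[OF r] Re_ip_vec[OF r g] sum_distrib_left sum.distrib[symmetric]
  proof (intro sum.cong refl)
    fix K assume K: "K \<in> T"
    note P = pos_T[OF K]
    note ci = continuous_intros continuous_ext[OF r K] continuous_ext[OF g K]
    have "(LINT x:K|lebesgue. (norm (ext K \<sigma> x))\<^sup>2) = (LINT x:K|lebesgue. (norm (ext K (grad_h T w) x))\<^sup>2 + 2 * (ext K r x \<bullet> ext K (grad_h T w) x) + (norm (ext K r x))\<^sup>2)"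
      unfolding er[OF K] norm2_add by (simp only: inner_commute)
    also have "\<dots> = (LINT x:K|lebesgue. (norm (ext K (grad_h T w) x))\<^sup>2 + 2 * (ext K r x \<bullet> ext K (grad_h T w) x)) + (LINT x:K|lebesgue. (norm (ext K r x))\<^sup>2)"
      by (rule positive_functional_add[OF P]) (intro ci)+
    also have "(LINT x:K|lebesgue. (norm (ext K (grad_h T w) x))\<^sup>2 + 2 * (ext K r x \<bullet> ext K (grad_h T w) x))
      = (LINT x:K|lebesgue. (norm (ext K (grad_h T w) x))\<^sup>2) + (LINT x:K|lebesgue. 2 * (ext K r x \<bullet> ext K (grad_h T w) x))"
      by (rule positive_functional_add[OF P]) (intro ci)+
    also have "(LINT x:K|lebesgue. 2 * (ext K r x \<bullet> ext K (grad_h T w) x)) = 2 * (LINT x:K|lebesgue. ext K r x \<bullet> ext K (grad_h T w) x)"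
      by (rule positive_functional_cmult[OF P]) (intro ci)
    finally show "(LINT x:K|lebesgue. (norm (ext K \<sigma> x))\<^sup>2) = (LINT x:K|lebesgue. (norm (ext K (grad_h T w) x))\<^sup>2)
      + 2 * (LINT x:K|lebesgue. ext K r x \<bullet> ext K (grad_h T w) x) + (LINT x:K|lebesgue. (norm (ext K r x))\<^sup>2)" .
  qed
qed

lemma ip_vec_young:
  assumes r: "pw_affine r" and g: "pw_affine g" and \<mu>: "0 < \<mu>"
  shows "\<bar>Re (ip_vec \<Omega> r g)\<bar> \<le> \<mu> * norm_sq \<Omega> g + norm_sq \<Omega> r / (4 * \<mu>)"
proof -
  have "\<bar>Re (ip_vec \<Omega> r g)\<bar> \<le> (\<Sum>K\<in>T. \<bar>LINT x:K|lebesgue. ext K r x \<bullet> ext K g x\<bar>)"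
    unfolding Re_ip_vec[OF r g] by (rule sum_abs)
  also have "\<dots> \<le> (\<Sum>K\<in>T. \<mu> * (LINT x:K|lebesgue. (norm (ext K g x))\<^sup>2) + 1 / (4 * \<mu>) * (LINT x:K|lebesgue. (norm (ext K r x))\<^sup>2))"
  proof (rule sum_mono)
    fix K assume K: "K \<in> T"
    note P = pos_T[OF K]
    note ci = continuous_intros continuous_ext[OF r K] continuous_ext[OF g K]
    let ?u = "\<lambda>x. \<mu> * (norm (ext K g x))\<^sup>2 + 1 / (4 * \<mu>) * (norm (ext K r x))\<^sup>2"
    have pw: "\<bar>ext K g x \<bullet> ext K r x\<bar> \<le> ?u x" for x using inner_young[OF \<mu> order_refl order_refl, of "ext K g x" "ext K r x"] by simp
    have "(LINT x:K|lebesgue. ext K r x \<bullet> ext K g x) \<le> (LINT x:K|lebesgue. ?u x)"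
    proof (rule positive_functional_mono[OF P])
      show "ext K r x \<bullet> ext K g x \<le> ?u x" for x using pw[of x] unfolding inner_commute[of "ext K g x"] by linarith
    qed (intro ci)+
    moreover have "(LINT x:K|lebesgue. (-1) * (ext K r x \<bullet> ext K g x)) \<le> (LINT x:K|lebesgue. ?u x)"
    proof (rule positive_functional_mono[OF P])
      show "(-1) * (ext K r x \<bullet> ext K g x) \<le> ?u x" for x using pw[of x] unfolding inner_commute[of "ext K g x"] by linarith
    qed (intro ci)+
    moreover have "(LINT x:K|lebesgue. (-1) * (ext K r x \<bullet> ext K g x)) = (-1) * (LINT x:K|lebesgue. ext K r x \<bullet> ext K g x)"
      by (rule positive_functional_cmult[OF P]) (intro ci)
    moreover have "(LINT x:K|lebesgue. ?u x) = (LINT x:K|lebesgue. \<mu> * (norm (ext K g x))\<^sup>2) + (LINT x:K|lebesgue. 1 / (4 * \<mu>) * (norm (ext K r x))\<^sup>2)"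
      by (rule positive_functional_add[OF P]) (intro ci)+
    moreover have "(LINT x:K|lebesgue. \<mu> * (norm (ext K g x))\<^sup>2) = \<mu> * (LINT x:K|lebesgue. (norm (ext K g x))\<^sup>2)"
      by (rule positive_functional_cmult[OF P]) (intro ci)
    moreover have "(LINT x:K|lebesgue. 1 / (4 * \<mu>) * (norm (ext K r x))\<^sup>2) = 1 / (4 * \<mu>) * (LINT x:K|lebesgue. (norm (ext K r x))\<^sup>2)"
      by (rule positive_functional_cmult[OF P]) (intro ci)
    ultimately show "\<bar>LINT x:K|lebesgue. ext K r x \<bullet> ext K g x\<bar> \<le> \<mu> * (LINT x:K|lebesgue. (norm (ext K g x))\<^sup>2) + 1 / (4 * \<mu>) * (LINT x:K|lebesgue. (norm (ext K r x))\<^sup>2)"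
      by (intro abs_leI) simp_all
  qed
  also have "\<dots> = \<mu> * norm_sq \<Omega> g + norm_sq \<Omega> r / (4 * \<mu>)"
    unfolding norm_sq_eq[OF r] norm_sq_eq[OF g] by (simp add: sum.distrib sum_distrib_left sum_divide_distrib)
  finally show ?thesis .
qed

lemma norm_multiplier:
  assumes w: "pw_affine w" and K: "K \<in> T" "x \<in> K"
  shows "(norm (ext K (multiplier w) x))\<^sup>2 \<le> R\<^sup>2 * (norm (ext K (grad_h T w) x))\<^sup>2"
proof -
  have "norm (ext K (multiplier w) x) \<le> norm (x - x0) * norm (ext K (grad_h T w) x)"
    unfolding multiplier(2)[OF w K(1)] ext_grad[OF w K(1)] by (rule norm_pairing)
  also have "\<dots> \<le> R * norm (ext K (grad_h T w) x)" by (rule mult_right_mono[OF element_in_ball[OF K]]) simp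
  finally have "(norm (ext K (multiplier w) x))\<^sup>2 \<le> (R * norm (ext K (grad_h T w) x))\<^sup>2" by (rule power_mono) simp
  then show ?thesis by (simp only: power_mult_distrib)
qed

text \<open>Pointwise the multiplier is at most \<open>R\<close> times the gradient of
  \<open>w\<close>, and it has the same gradient, so its norms are controlled by \<nabla>w
  alone.\<close>

lemma multiplier_norms:
  assumes w: "pw_affine w"
  shows "norm_sq \<Omega> (multiplier w) \<le> R\<^sup>2 * norm_sq \<Omega> (grad_h T w)"
    "norm_sq_bdry \<Omega> T (multiplier w) \<le> R\<^sup>2 * norm_sq_bdry \<Omega> T (grad_h T w)"
    "norm_sq_bdry \<Omega> T (grad_h T (multiplier w)) = norm_sq_bdry \<Omega> T (grad_h T w)"
proof -
  note v = multiplier[OF w] and g = pw_affine_grad[OF w]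
  note ci = continuous_intros continuous_ext[OF v(1)] continuous_ext[OF g]
  show "norm_sq \<Omega> (multiplier w) \<le> R\<^sup>2 * norm_sq \<Omega> (grad_h T w)"
    unfolding norm_sq_eq[OF v(1)] norm_sq_eq[OF g] sum_distrib_left
  proof (rule sum_mono)
    fix K assume K: "K \<in> T"
    have "(LINT x:K|lebesgue. (norm (ext K (multiplier w) x))\<^sup>2) \<le> (LINT x:K|lebesgue. R\<^sup>2 * (norm (ext K (grad_h T w) x))\<^sup>2)"
      by (rule positive_functional_mono[OF pos_T[OF K]]) (intro ci K norm_multiplier[OF w K] | assumption)+
    also have "\<dots> = R\<^sup>2 * (LINT x:K|lebesgue. (norm (ext K (grad_h T w) x))\<^sup>2)"
      by (rule positive_functional_cmult[OF pos_T[OF K]]) (intro ci K)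
    finally show "(LINT x:K|lebesgue. (norm (ext K (multiplier w) x))\<^sup>2) \<le> R\<^sup>2 * (LINT x:K|lebesgue. (norm (ext K (grad_h T w) x))\<^sup>2)" .
  qed
  show "norm_sq_bdry \<Omega> T (multiplier w) \<le> R\<^sup>2 * norm_sq_bdry \<Omega> T (grad_h T w)"
    unfolding norm_sq_bdry_eq[OF v(1)] norm_sq_bdry_eq[OF g] sum_distrib_left
  proof (rule sum_mono)
    fix Ke assume "Ke \<in> boundary_faces \<Omega> T"
    then obtain K e where Ke: "Ke = (K, e)" "K \<in> T" "e facet_of K" using bdry_facet by (cases Ke) auto
    have "FI e (\<lambda>x. (norm (ext K (multiplier w) x))\<^sup>2) \<le> FI e (\<lambda>x. R\<^sup>2 * (norm (ext K (grad_h T w) x))\<^sup>2)"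
    proof (rule positive_functional_mono[OF pos_face[OF Ke(2,3)]])
      fix x assume "x \<in> e"
      then have "x \<in> K" using facet_of_imp_subset[OF Ke(3)] by blast
      then show "(norm (ext K (multiplier w) x))\<^sup>2 \<le> R\<^sup>2 * (norm (ext K (grad_h T w) x))\<^sup>2" by (rule norm_multiplier[OF w Ke(2)])
    qed (intro ci Ke(2))+
    also have "\<dots> = R\<^sup>2 * FI e (\<lambda>x. (norm (ext K (grad_h T w) x))\<^sup>2)"
      by (rule positive_functional_cmult[OF pos_face[OF Ke(2,3)]]) (intro ci Ke(2))
    finally show "(case Ke of (K, e) \<Rightarrow> FI e (\<lambda>x. (norm (ext K (multiplier w) x))\<^sup>2)) \<le> R\<^sup>2 * (case Ke of (K, e) \<Rightarrow> FI e (\<lambda>x. (norm (ext K (grad_h T w) x))\<^sup>2))"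
      unfolding Ke(1) by (simp only: prod.case)
  qed
  show "norm_sq_bdry \<Omega> T (grad_h T (multiplier w)) = norm_sq_bdry \<Omega> T (grad_h T w)"
    unfolding norm_sq_bdry_eq[OF pw_affine_grad[OF v(1)]] norm_sq_bdry_eq[OF g]
    by (intro sum.cong refl) (auto dest!: bdry_facet simp: ext_grad[OF v(1)] ext_grad[OF w] v(3))
qed

text \<open>With \<epsilon> equal to \<open>\<mu> \<eta>\<close>, the factor \<eta> cancels the
  inverse height from the trace inequality in the terms to be absorbed.\<close>

lemma sum_face_defect:
  assumes w: "pw_affine w" and r: "pw_affine r" and \<mu>: "0 < \<mu>"
  defines "CT \<equiv> 2 * (real CARD('n) + 1)\<^sup>2" and "Cg \<equiv> real CARD('n) * (real CARD('n) + 1) ^ 4"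
  shows "(\<Sum>e\<in>interior_faces T. face_defect k \<beta> w r (\<mu> * \<eta>) e)
    \<le> (2 + 4 * R\<^sup>2) * \<mu> * (CT * norm_sq \<Omega> (grad_h T w)) + 2 * \<mu> * k\<^sup>2 * (CT * norm_sq \<Omega> w)
      + (R\<^sup>2 * (Cg / \<eta>\<^sup>2 * jump_sq w) + (k\<^sup>2 * R\<^sup>2 + \<beta>\<^sup>2) * jump_sq w + CT * norm_sq \<Omega> r / \<eta>) / (4 * (\<mu> * \<eta>))"
proof -
  let ?I = "interior_faces T"
  note g = pw_affine_grad[OF w]
  define F :: "(real^'n \<Rightarrow> complex^'n) \<Rightarrow> real" where "F = (\<lambda>f. \<Sum>e\<in>?I. FI e (\<lambda>x. (norm (ext (K1 e) f x))\<^sup>2) + FI e (\<lambda>x. (norm (ext (K2 e) f x))\<^sup>2))"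
  define Fw where "Fw = (\<Sum>e\<in>?I. FI e (\<lambda>x. (norm (ext (K1 e) w x))\<^sup>2) + FI e (\<lambda>x. (norm (ext (K2 e) w x))\<^sup>2))"
  define Tg where "Tg = (\<Sum>e\<in>?I. (norm (tangential (nrm e) (gradient (slope (K1 e) w) - gradient (slope (K2 e) w))))\<^sup>2 * FI e (\<lambda>x. 1))"
  have eq: "(\<Sum>e\<in>?I. face_defect k \<beta> w r (\<mu> * \<eta>) e) = (2 + 4 * R\<^sup>2) * (\<mu> * \<eta>) * F (grad_h T w) + 2 * (\<mu> * \<eta>) * k\<^sup>2 * Fw
    + (R\<^sup>2 * Tg + (k\<^sup>2 * R\<^sup>2 + \<beta>\<^sup>2) * jump_sq w + F r) / (4 * (\<mu> * \<eta>))"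
    unfolding face_defect_def F_def Fw_def Tg_def jump_sq_def sum.distrib sum_divide_distrib[symmetric] sum_distrib_left[symmetric] ..
  have tr: "\<eta> * F f \<le> CT * norm_sq \<Omega> f" if "pw_affine f" for f
    unfolding F_def CT_def using trace_sum[OF that] .
  have trw: "\<eta> * Fw \<le> CT * norm_sq \<Omega> w" unfolding Fw_def CT_def using trace_sum[OF w] .
  have "(2 + 4 * R\<^sup>2) * (\<mu> * \<eta>) * F (grad_h T w) \<le> (2 + 4 * R\<^sup>2) * \<mu> * (CT * norm_sq \<Omega> (grad_h T w))"
    using mult_left_mono[OF tr[OF g], of "(2 + 4 * R\<^sup>2) * \<mu>"] \<mu> by (simp add: mult.assoc)
  moreover have "2 * (\<mu> * \<eta>) * k\<^sup>2 * Fw \<le> 2 * \<mu> * k\<^sup>2 * (CT * norm_sq \<Omega> w)"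
    using mult_left_mono[OF trw, of "2 * \<mu> * k\<^sup>2"] \<mu> by (simp add: algebra_simps)
  moreover have "Tg \<le> Cg / \<eta>\<^sup>2 * jump_sq w"
    unfolding Tg_def jump_sq_def Cg_def sum_distrib_left by (rule sum_mono) (rule tangential_jump[OF w])
  then have "R\<^sup>2 * Tg \<le> R\<^sup>2 * (Cg / \<eta>\<^sup>2 * jump_sq w)" by (rule mult_left_mono) simp
  moreover have "F r \<le> CT * norm_sq \<Omega> r / \<eta>"
    using tr[OF r] \<eta>_pos by (simp add: pos_le_divide_eq mult.commute)
  ultimately show ?thesis unfolding eq
    using \<mu> \<eta>_pos by (intro add_mono divide_right_mono order_refl) auto
qed

lemma jump_nonneg:
  assumes "pw_affine w" "pw_affine \<sigma>"
  shows "0 \<le> jump_sq w" "0 \<le> normal_jump_sq \<sigma>"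
  unfolding jump_sq_def normal_jump_sq_def
  by (intro sum_nonneg positive_functional_nonneg[OF pos_int];
      auto intro!: continuous_intros continuous_jmp assms)+

lemma measure_domain_pos: "0 < measure lebesgue \<Omega>"
proof -
  have b: "bounded \<Omega>" and ne: "\<Omega> \<noteq> {}" using domain unfolding bounded_domain_def by blast+
  have m: "\<Omega> \<in> lmeasurable" using b open_\<Omega> by (rule lmeasurable_open)
  have "\<not> negligible \<Omega>" by (rule open_not_negligible[OF open_\<Omega> ne])
  then have "measure lebesgue \<Omega> \<noteq> 0" using m negligible_iff_measure by blast
  then show ?thesis using measure_nonneg[of lebesgue \<Omega>] by linarith
qed

lemma norm_sq_const: "norm_sq \<Omega> (\<lambda>x. u :: 'b::real_normed_vector) = (norm u)\<^sup>2 * measure lebesgue \<Omega>"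
  unfolding norm_sq_def set_lebesgue_integral_def using open_\<Omega> by (simp add: borel_open)

text \<open>Since the form does not depend on \<open>\<tau>\<close> on \<open>S_h\<close>, a constant nonzero \<open>\<tau>\<close> makes every
  test pair nonzero.\<close>

lemma sup_ge_test:
  fixes F :: "complex \<Rightarrow> real"
  assumes S: "(w, \<sigma>) \<in> S_h \<Omega> T \<delta>" and v: "pw_affine v" and t: "0 < t"
  shows "ereal (F (reduced_form k \<beta> w \<sigma> v) / sqrt (k\<^sup>2 * norm_sq \<Omega> v + k\<^sup>2 * norm_sq_bdry \<Omega> T v + t\<^sup>2 + c * norm_sq_bdry \<Omega> T (grad_h T v)))
    \<le> (SUP (v, \<tau>)\<in>nonzero_pairs \<Omega> T. ereal (F (B_h \<Omega> T k \<beta> \<delta> w \<sigma> v \<tau>) / norm_DG \<Omega> T c k v \<tau>))"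
proof -
  \<comment> \<open>Scaled so that the constant field has squared norm \<open>t^2\<close> on
    \<Omega>; the free parameter \<open>t\<close> will be the norm of
    \<open>(w, \<sigma>)\<close>.\<close>
  define u :: "complex^'n" where "u = (t / sqrt (measure lebesgue \<Omega>)) *\<^sub>R axis undefined 1"
  have nu: "(norm u)\<^sup>2 * measure lebesgue \<Omega> = t\<^sup>2"
    unfolding u_def using measure_domain_pos by (simp add: norm_axis_1 power_divide)
  have u: "pw_affine (\<lambda>x. u)" by (rule pw_affine_const)
  have u0: "u \<noteq> 0" using nu t by auto
  have ne: "(v, \<lambda>x. u) \<in> nonzero_pairs \<Omega> T"
  proof -
    have s: "\<Omega> \<inter> space lebesgue \<in> sets lebesgue" using open_\<Omega> by (simp add: borel_open)
    have "\<not> (AE x in lebesgue_on \<Omega>. v x = 0 \<and> u = 0)"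
    proof
      assume "AE x in lebesgue_on \<Omega>. v x = 0 \<and> u = 0"
      then have "AE x in lebesgue. x \<notin> \<Omega>" using u0 AE_restrict_space_iff[OF s] by simp
      then have "\<Omega> \<in> null_sets lebesgue" using AE_iff_null_sets[of \<Omega> lebesgue] s by simp
      then have "negligible \<Omega>" by (simp add: negligible_iff_null_sets)
      moreover have "\<Omega> \<noteq> {}" using domain unfolding bounded_domain_def by blast
      ultimately show False using open_not_negligible[OF open_\<Omega>] by blast
    qed
    then show ?thesis unfolding nonzero_pairs_def using v u by (simp add: V_h_iff Sigma_h_iff)
  qed
  have "norm_DG \<Omega> T c k v (\<lambda>x. u) = sqrt (k\<^sup>2 * norm_sq \<Omega> v + k\<^sup>2 * norm_sq_bdry \<Omega> T v + t\<^sup>2 + c * norm_sq_bdry \<Omega> T (grad_h T v))"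
    unfolding norm_DG_def norm_sq_const nu ..
  moreover have "B_h \<Omega> T k \<beta> \<delta> w \<sigma> v (\<lambda>x. u) = reduced_form k \<beta> w \<sigma> v" by (rule B_h_S_h[OF S v u])
  ultimately show ?thesis using SUP_upper[OF ne, of "\<lambda>(v, \<tau>). ereal (F (B_h \<Omega> T k \<beta> \<delta> w \<sigma> v \<tau>) / norm_DG \<Omega> T c k v \<tau>)"] by simp
qed

text \<open>The test with \<open>v = 0\<close> shows that both suprema are nonnegative.\<close>

lemma reduced_form_zero: "reduced_form k \<beta> w \<sigma> (\<lambda>x. 0) = 0"
proof -
  have "grad_h T (\<lambda>x. 0 :: complex) = (\<lambda>x. 0)"
    unfolding grad_h_def grad_def by (auto simp: vec_eq_iff frechet_derivative_const)
  moreover have "jmp e (\<lambda>x. 0 :: complex) x = 0" if "e \<in> interior_faces T" for e x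
    unfolding jmp_def using sides(1,2)[OF that] by (simp add: ext_const)
  then have "(\<Sum>e\<in>interior_faces T. ip_face_vec e (\<lambda>x. mean e \<sigma> x - (\<i> * complex_of_real \<beta>) *s (jmp e w x *s cvec (nrm e))) (\<lambda>x. jmp e (\<lambda>x. 0) x *s cvec (nrm e))) = 0"
    by (intro sum.neutral ballI) (simp add: ip_face_vec_def dotc_def face_integral_def Let_def)
  moreover have "ip_bdry \<Omega> T w (\<lambda>x. 0) = 0"
    unfolding ip_bdry_def
  proof (intro sum.neutral ballI)
    fix Ke assume "Ke \<in> boundary_faces \<Omega> T"
    then obtain K e where Ke: "Ke = (K, e)" "K \<in> T" "e facet_of K" using bdry_facet by (cases Ke) auto
    have "trace_on K (\<lambda>x. 0 :: complex) x = 0" if "x \<in> e" for x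
    proof -
      have "x \<in> K" using that facet_of_imp_subset[OF Ke(3)] by blast
      from trace_ext[OF pw_affine_const Ke(2) this, of "0 :: complex"] show ?thesis by (simp add: ext_const[OF Ke(2)])
    qed
    then have "ip_face e (trace_on K w) (trace_on K (\<lambda>x. 0)) = face_integral e (\<lambda>x. 0)"
      unfolding ip_face_def by (intro face_integral_cong[OF hyperplane_piece_facet[OF Ke(2,3)]]) simp
    then show "(case Ke of (K, e) \<Rightarrow> ip_face e (trace_on K w) (trace_on K (\<lambda>x. 0))) = 0"
      unfolding Ke(1) by (simp add: face_integral_def Let_def)
  qed
  ultimately show ?thesis unfolding reduced_form_def by (simp add: ip_vec_def ip_def dotc_def)
qed

text \<open>\<Gamma> is any bound for the weights of \<open>gamma2\<close> at the single length
  \<eta>, so that the angle condition can be dealt with outside.\<close>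

lemma stability:
  assumes S: "(w, \<sigma>) \<in> S_h \<Omega> T \<delta>" and pos: "0 < k" "0 < \<beta>" "0 < \<delta>" "0 < D" and D: "1 / D \<le> \<Gamma>"
    and g: "k \<le> \<Gamma>" "(k\<^sup>2 + 1) / (\<beta> * \<eta>) \<le> \<Gamma>" "(\<beta> + \<delta>) / \<eta> \<le> \<Gamma>" "\<delta> / \<eta> ^ 3 \<le> \<Gamma>" "1 / (\<beta> * \<eta> ^ 3) \<le> \<Gamma>"
  shows "ereal (norm_DG \<Omega> T c k w \<sigma> / (stability_constant (real CARD('n)) R c D * \<Gamma>)) \<le>
    (SUP (v, \<tau>)\<in>nonzero_pairs \<Omega> T. ereal (Re (B_h \<Omega> T k \<beta> \<delta> w \<sigma> v \<tau>) / norm_DG \<Omega> T c k v \<tau>))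
    + (SUP (v, \<tau>)\<in>nonzero_pairs \<Omega> T. ereal (Im (B_h \<Omega> T k \<beta> \<delta> w \<sigma> v \<tau>) / norm_DG \<Omega> T c k v \<tau>))"
    (is "_ \<le> ?A + ?B")
proof -
  note w = S_hD(1)[OF S] and s = S_hD(2)[OF S]
  note gw = pw_affine_grad[OF w] and mv = multiplier[OF w]
  define N where "N = norm_DG \<Omega> T c k w \<sigma>"
  have A0: "0 \<le> ?A" using sup_ge_test[OF S pw_affine_const[of 0], of 1 Re k \<beta>] by (simp add: reduced_form_zero zero_ereal_def[symmetric])
  have B0: "0 \<le> ?B" using sup_ge_test[OF S pw_affine_const[of 0], of 1 Im k \<beta>] by (simp add: reduced_form_zero zero_ereal_def[symmetric])
  have nn: "0 \<le> norm_sq \<Omega> w" "0 \<le> norm_sq_bdry \<Omega> T w" "0 \<le> norm_sq \<Omega> \<sigma>" "0 \<le> norm_sq \<Omega> (grad_h T w)" "0 \<le> norm_sq_bdry \<Omega> T (grad_h T w)"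
    by (intro norm_sq_nonneg norm_sq_bdry_nonneg w s gw)+
  have N2: "N\<^sup>2 = k\<^sup>2 * norm_sq \<Omega> w + k\<^sup>2 * norm_sq_bdry \<Omega> T w + norm_sq \<Omega> \<sigma> + c * norm_sq_bdry \<Omega> T (grad_h T w)"
    unfolding N_def norm_DG_def using nn c_pos by simp
  have N0: "0 \<le> N" unfolding N_def norm_DG_def using nn c_pos by simp
  show ?thesis
  \<comment> \<open>With zero norm or an infinite supremum nothing is left to prove, as both suprema
    are nonnegative.\<close>
  proof (cases "N = 0 \<or> ?A = \<infinity> \<or> ?B = \<infinity>")
    case True
    then show ?thesis using A0 B0 unfolding N_def[symmetric] by (auto simp: zero_ereal_def[symmetric] intro: add_nonneg_nonneg)
  next
    case False
    then obtain a b where ab: "?A = ereal a" "?B = ereal b" using A0 B0 by (cases ?A; cases ?B) auto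
    have ab0: "0 \<le> a" "0 \<le> b" using A0 B0 unfolding ab by simp_all
    have Np: "0 < N" using False N0 by simp
    let ?d = "real CARD('n)"
    define CT Cg C1 C2 C C6 where "CT = 2 * (?d + 1)\<^sup>2" and "Cg = ?d * (?d + 1) ^ 4" and "C1 = (2 + 4 * R\<^sup>2) * CT"
      and "C2 = (R\<^sup>2 * Cg + R\<^sup>2 + 1 + 4 * CT\<^sup>2) / 4"
      and "C = 4 * (R / 2 + R\<^sup>2 / c + 6 * (C1 + ?d) * (C2 + ?d * CT) + 4 / 3 * CT) + 1"
      and "C6 = 2 * R\<^sup>2 + 16 * CT * R\<^sup>2 + R\<^sup>2 / c + 2 * D\<^sup>2"
    define C8 where "C8 = 4 * sqrt C6 + 2 * (2 * ?d - 5 / 3) * D + 2 * C + 1"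
    have sc: "stability_constant ?d R c D = C8"
      unfolding stability_constant_def Let_def C8_def C6_def C_def C2_def C1_def Cg_def CT_def ..
    have d2: "2 \<le> ?d" using card_n by auto
    have CTp: "0 < CT" unfolding CT_def by (simp add: add_nonneg_pos)
    have Cg0: "0 \<le> Cg" unfolding Cg_def by simp
    have C0: "0 \<le> C" unfolding C_def C1_def C2_def using R_nonneg c_pos CTp Cg0 d2 by simp
    define r where "r = (\<lambda>x. \<sigma> x - grad_h T w x)"
    have r: "pw_affine r" unfolding r_def by (rule pw_affine_diff[OF s gw])
    have r0: "0 \<le> norm_sq \<Omega> r" by (rule norm_sq_nonneg[OF r])
    define I where "I = k * norm_sq_bdry \<Omega> T w + \<beta> * jump_sq w + \<delta> * normal_jump_sq \<sigma>"
    define V where "V = Re (reduced_form k \<beta> w \<sigma> (multiplier w))"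
    define W where "W = norm_sq \<Omega> \<sigma> - k\<^sup>2 * norm_sq \<Omega> w"
    have rho: "norm_sq \<Omega> r \<le> 4 * CT / \<eta> * (\<delta>\<^sup>2 * normal_jump_sq \<sigma> + jump_sq w)"
      using lifting[OF S less_imp_le[OF pos(3)]] unfolding r_def CT_def by simp
    have rel: "(1 - ?d / 2) * norm_sq \<Omega> (grad_h T w) + Re (ip_vec \<Omega> r (grad_h T w)) + ?d / 2 * k\<^sup>2 * norm_sq \<Omega> w + c / 4 * norm_sq_bdry \<Omega> T (grad_h T w)
      - (R / 2 + R\<^sup>2 / c) * k\<^sup>2 * norm_sq_bdry \<Omega> T w
      - ((2 + 4 * R\<^sup>2) * \<mu> * (CT * norm_sq \<Omega> (grad_h T w)) + 2 * \<mu> * k\<^sup>2 * (CT * norm_sq \<Omega> w)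
      + (R\<^sup>2 * (Cg / \<eta>\<^sup>2 * jump_sq w) + (k\<^sup>2 * R\<^sup>2 + \<beta>\<^sup>2) * jump_sq w + CT * norm_sq \<Omega> r / \<eta>) / (4 * (\<mu> * \<eta>))) \<le> V" if "0 < \<mu>" for \<mu>
    proof -
      have "0 < \<mu> * \<eta>" using that \<eta>_pos by simp
      from rellich[OF w s this less_imp_le[OF pos(1)] less_imp_le[OF pos(2)]] sum_face_defect[OF w r that, of k \<beta>]
      show ?thesis unfolding V_def r_def[symmetric] CT_def Cg_def by linarith
    qed
    note ra = rellich_absorb[OF d2 R_nonneg c_pos pos(1-3) \<eta>_pos nn r0 jump_nonneg[OF w s] g I_def W_def
      norm_sq_sigma[OF w s, folded r_def] ip_vec_young[OF r gw] rho CTp Cg0 rel C1_def C2_def C_def]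
    have main: "N\<^sup>2 \<le> 4 * V + (2 * ?d - 5 / 3) * W + C * (\<Gamma> * I)" unfolding N2 by (rule ra(1))
    \<comment> \<open>In the norm of the test pair the constant \<tau> of norm \<open>N\<close>
      takes the place of \<sigma>, so the square is at most \<open>4 N^2\<close>.\<close>
    have DGw: "sqrt (k\<^sup>2 * norm_sq \<Omega> w + k\<^sup>2 * norm_sq_bdry \<Omega> T w + N\<^sup>2 + c * norm_sq_bdry \<Omega> T (grad_h T w)) \<le> 2 * N"
      (is "sqrt ?m \<le> _")
    proof (rule real_le_lsqrt)
      have aux: "p + p' + n + q \<le> 4 * n" if "n = p + p' + y + q" "0 \<le> y" "0 \<le> n" for p p' n q y :: real
        using that by linarith
      have "?m \<le> 4 * N\<^sup>2" by (rule aux[OF N2 nn(3)]) simp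
      then show "?m \<le> (2 * N)\<^sup>2" by (simp add: power_mult_distrib)
    qed (use Np in simp)
    have mpos: "0 < sqrt ?m"
      using Np nn c_pos pos(1) by (simp add: add_nonneg_pos add_pos_nonneg)
    have up: "x \<le> y * z" if "ereal (x / q) \<le> ereal y" "0 < q" "q \<le> z" "0 \<le> y" for x y z q :: real
    proof -
      have "x \<le> y * q" using that(1,2) by (simp add: pos_divide_le_eq)
      also have "\<dots> \<le> y * z" using that by (intro mult_left_mono) auto
      finally show ?thesis .
    qed
    note diag = reduced_form_diag[OF S, of k \<beta>]
    have Wle: "W \<le> a * (2 * N)"
      by (rule up[OF _ mpos DGw ab0(1)]) (use sup_ge_test[OF S w Np, of Re k \<beta>] ab(1) diag(1) W_def in simp)
    have Ile: "I \<le> b * (2 * N)"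
      by (rule up[OF _ mpos DGw ab0(2)]) (use sup_ge_test[OF S w Np, of Im k \<beta>] ab(2) diag(2) I_def in simp)
    define M where "M = k\<^sup>2 * norm_sq \<Omega> (multiplier w) + k\<^sup>2 * norm_sq_bdry \<Omega> T (multiplier w) + c * norm_sq_bdry \<Omega> T (grad_h T w)"
    have M0: "0 \<le> M" unfolding M_def
      using norm_sq_nonneg[OF mv(1)] norm_sq_bdry_nonneg[OF mv(1)] nn c_pos by simp
    have Mle: "M \<le> k\<^sup>2 * (R\<^sup>2 * norm_sq \<Omega> (grad_h T w)) + k\<^sup>2 * (R\<^sup>2 * norm_sq_bdry \<Omega> T (grad_h T w)) + c * norm_sq_bdry \<Omega> T (grad_h T w)"
      unfolding M_def using multiplier_norms(1,2)[OF w] by (intro add_mono mult_left_mono order_refl) auto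
    have Meq: "k\<^sup>2 * norm_sq \<Omega> (multiplier w) + k\<^sup>2 * norm_sq_bdry \<Omega> T (multiplier w) + N\<^sup>2 + c * norm_sq_bdry \<Omega> T (grad_h T (multiplier w)) = M + N\<^sup>2"
      unfolding M_def multiplier_norms(3)[OF w] by simp
    have "ereal (V / sqrt (M + N\<^sup>2)) \<le> ?A"
      unfolding V_def by (rule sup_ge_test[OF S mv(1) Np, of Re k \<beta>, unfolded Meq])
    then have "ereal (V / sqrt (M + N\<^sup>2)) \<le> ereal a" unfolding ab(1) .
    then have Vle: "V \<le> a * sqrt (M + N\<^sup>2)"
      by (rule up[OF _ _ order_refl ab0(1)]) (use M0 Np in \<open>simp add: add_nonneg_pos\<close>)
    have YN: "norm_sq \<Omega> \<sigma> \<le> N\<^sup>2" "c * norm_sq_bdry \<Omega> T (grad_h T w) \<le> N\<^sup>2" unfolding N2 using nn c_pos by simp_all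
    \<comment> \<open>Each test is bounded by its own supremum, hence by the sum of both.\<close>
    have more: "x * y \<le> (a + b) * y" if "x \<le> a + b" "0 \<le> y" for x y using that by (rule mult_right_mono)
    have "N / (C8 * \<Gamma>) \<le> a + b"
    proof (rule sup_lower_bound[OF Np _ D g(1) pos(4) pos(1) CTp C0 c_pos _ M0 main _ _ _ Mle ra(3) YN(1) nn(5) YN(2) ra(2) C6_def C8_def])
      show "0 \<le> a + b" using ab0 by simp
      show "0 \<le> 2 * ?d - 5 / 3" using d2 by simp
      show "W \<le> (a + b) * (2 * N)" using Wle more[of a "2 * N"] ab0 N0 by linarith
      show "I \<le> (a + b) * (2 * N)" using Ile more[of b "2 * N"] ab0 N0 by linarith
      show "V \<le> (a + b) * sqrt (M + N\<^sup>2)" using Vle more[of a "sqrt (M + N\<^sup>2)"] ab0 M0 by simp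
    qed
    then show ?thesis unfolding ab sc N_def[symmetric] by simp
  qed
qed

end

section \<open>Independence of the constant from mesh and wave number\<close>

lemma stability_constant_pos:
  assumes "0 < d" "0 < R" "0 < c" "1 \<le> d"
  shows "0 < stability_constant d R c (2 * R)"
proof -
  have "0 \<le> 2 * d - 5 / 3 + 1" using assms by simp
  have CT: "0 \<le> 2 * (d + 1)\<^sup>2" and Cg: "0 \<le> d * (d + 1) ^ 4" using assms by auto
  have d: "2 * (2 * d - 5 / 3) * (2 * R) \<ge> 0" using assms by simp
  show ?thesis
    unfolding stability_constant_def Let_def using assms d
    by (intro add_nonneg_pos add_nonneg_nonneg) (auto intro!: add_nonneg_nonneg mult_nonneg_nonneg divide_nonneg_nonneg)
qed

text \<open>Passing from \<open>s\<close> to \<open>\<kappa> s\<close> costs at most the inverse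
  cube of \<kappa>, the cube being the highest power that occurs.\<close>

lemma gamma_bounds:
  fixes k \<beta> \<delta> s \<kappa> g :: real
  assumes pos: "0 < k" "0 < \<beta>" "0 < \<delta>" "0 < s" and \<kappa>: "0 < \<kappa>" "\<kappa> \<le> 1"
    and g: "k + ((k\<^sup>2 + 1) / (\<beta> * s) + (\<beta> + \<delta>) / s + \<delta> / s ^ 3 + 1 / (\<beta> * s ^ 3)) \<le> g"
  shows "k \<le> g / \<kappa> ^ 3" "(k\<^sup>2 + 1) / (\<beta> * (\<kappa> * s)) \<le> g / \<kappa> ^ 3" "(\<beta> + \<delta>) / (\<kappa> * s) \<le> g / \<kappa> ^ 3"
    "\<delta> / (\<kappa> * s) ^ 3 \<le> g / \<kappa> ^ 3" "1 / (\<beta> * (\<kappa> * s) ^ 3) \<le> g / \<kappa> ^ 3" "1 / s \<le> g / \<kappa> ^ 3"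
proof -
  have t: "0 \<le> (k\<^sup>2 + 1) / (\<beta> * s)" "0 \<le> (\<beta> + \<delta>) / s" "0 \<le> \<delta> / s ^ 3" "0 \<le> 1 / (\<beta> * s ^ 3)" using pos by auto
  have b: "k \<le> g" "(k\<^sup>2 + 1) / (\<beta> * s) \<le> g" "(\<beta> + \<delta>) / s \<le> g" "\<delta> / s ^ 3 \<le> g" "1 / (\<beta> * s ^ 3) \<le> g"
    using g t pos(1) by linarith+
  have g0: "0 \<le> g" using b(1) pos by linarith
  have k3: "\<kappa> ^ 3 \<le> 1" "\<kappa> ^ 3 \<le> \<kappa>" "0 < \<kappa> ^ 3"
    using \<kappa> power_decreasing[of 1 3 \<kappa>] by (auto intro: power_le_one)
  have l1: "x \<le> g / \<kappa> ^ 3" if "x \<le> g" for x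
  proof -
    have "g / 1 \<le> g / \<kappa> ^ 3" using k3 g0 by (intro divide_left_mono) auto
    then show ?thesis using that by simp
  qed
  have l2: "x / \<kappa> \<le> g / \<kappa> ^ 3" if "x \<le> g" for x
  proof -
    have "x / \<kappa> \<le> g / \<kappa>" using that \<kappa> by (intro divide_right_mono) auto
    also have "\<dots> \<le> g / \<kappa> ^ 3" using k3 g0 \<kappa> by (intro divide_left_mono) auto
    finally show ?thesis .
  qed
  have l3: "x / \<kappa> ^ 3 \<le> g / \<kappa> ^ 3" if "x \<le> g" for x using that k3 by (intro divide_right_mono) auto
  show "k \<le> g / \<kappa> ^ 3" by (rule l1[OF b(1)])
  show "(k\<^sup>2 + 1) / (\<beta> * (\<kappa> * s)) \<le> g / \<kappa> ^ 3" using l2[OF b(2)] by (simp add: ac_simps)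
  show "(\<beta> + \<delta>) / (\<kappa> * s) \<le> g / \<kappa> ^ 3" using l2[OF b(3)] by (simp add: ac_simps)
  show "\<delta> / (\<kappa> * s) ^ 3 \<le> g / \<kappa> ^ 3" using l3[OF b(4)] by (simp add: power_mult_distrib ac_simps)
  show "1 / (\<beta> * (\<kappa> * s) ^ 3) \<le> g / \<kappa> ^ 3" using l3[OF b(5)] by (simp add: power_mult_distrib ac_simps)
  show "1 / s \<le> g / \<kappa> ^ 3"
  proof (rule l1, rule power2_le_imp_le[OF _ g0])
    have "1 / (\<beta> * s) \<le> (k\<^sup>2 + 1) / (\<beta> * s)" using pos by (intro divide_right_mono) auto
    then have 1: "1 / (\<beta> * s) \<le> g" using b(2) by linarith
    have "\<beta> / s \<le> (\<beta> + \<delta>) / s" using pos by (intro divide_right_mono) auto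
    then have 2: "\<beta> / s \<le> g" using b(3) by linarith
    \<comment> \<open>The geometric mean of two summands, in which \<beta> cancels: a lower bound of
      \<open>gamma2\<close> free of the penalty parameters.\<close>
    have "(1 / s)\<^sup>2 = 1 / (\<beta> * s) * (\<beta> / s)" using pos by (simp add: power2_eq_square)
    also have "\<dots> \<le> g * g" using 1 2 pos g0 by (intro mult_mono) auto
    finally show "(1 / s)\<^sup>2 \<le> g\<^sup>2" by (simp add: power2_eq_square)
  qed
qed

lemma angles_at_least_mono:
  assumes "angles_at_least \<theta> K" "\<theta>' \<le> \<theta>"
  shows "angles_at_least \<theta>' K"
  unfolding angles_at_least_def
  by (intro conjI allI impI; rule order_trans[OF assms(2)]; use assms(1) in \<open>unfold angles_at_least_def, blast\<close>)

text \<open>A facet has at least two vertices, hence positive diameter; the upper bound becomes a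
  lower bound of \<open>gamma2\<close> by way of \<open>1 / s\<close>.\<close>

lemma (in simplicial_mesh) diameter_facet:
  assumes "K \<in> T" "e facet_of K"
  shows "0 < diameter e" "(\<And>x. x \<in> closure \<Omega> \<Longrightarrow> norm (x - x0) \<le> R) \<Longrightarrow> diameter e \<le> 2 * R"
proof -
  obtain p where p: "p \<in> vertices K" "e = opp (vertices K) p" using facetE[OF assms] .
  interpret S: simplex_vertices "vertices K" by (rule sv(1)[OF assms(1)])
  have ce: "compact e" "e \<noteq> {}" using unit_outward[OF assms] by auto
  have "card (vertices K - {p}) = CARD('n)" using S.card_V p(1) S.fin by simp
  then have "1 < card (vertices K - {p})" using card_n by auto
  then obtain a b where ab: "a \<in> vertices K - {p}" "b \<in> vertices K - {p}" "a \<noteq> b"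
    using card_le_Suc0_iff_eq[of "vertices K - {p}"] S.fin by (metis One_nat_def finite_Diff not_le)
  then have "a \<in> e" "b \<in> e" unfolding p(2) by (auto intro: S.V_in_opp)
  then have "dist a b \<le> diameter e" using diameter_bounded_bound compact_imp_bounded[OF ce(1)] by blast
  then show "0 < diameter e" using ab(3) by (smt (verit) zero_less_dist_iff)
  assume R: "\<And>x. x \<in> closure \<Omega> \<Longrightarrow> norm (x - x0) \<le> R"
  show "diameter e \<le> 2 * R"
  proof (rule diameter_le)
    fix x y assume "x \<in> e" "y \<in> e"
    then have "x \<in> closure \<Omega>" "y \<in> closure \<Omega>" using assms UnT facet_of_imp_subset by blast+
    then have "norm (x - x0) \<le> R" "norm (y - x0) \<le> R" using R by blast+
    then show "norm (x - y) \<le> 2 * R" using norm_triangle_ineq4[of "x - x0" "y - x0"] by simp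
  qed (use ce in auto)
qed

theorem proposition3p2:
  fixes \<Omega> :: "(real^'n) set" and x0 :: "real^'n" and c\<Omega> :: real
    and H :: "real set" and Th :: "real \<Rightarrow> (real^'n) set set"
  assumes "CARD('n) = 2 \<or> CARD('n) = 3"
    and "bounded_domain \<Omega>"
    and "strictly_star_shaped \<Omega> x0 c\<Omega>"
    and "mesh_family \<Omega> H Th"
    and "\<forall>h\<in>H. interior_faces (Th h) \<noteq> {}"
  shows "\<exists>c2>0. \<forall>h\<in>H. \<forall>k>0. \<forall>\<beta>>0. \<forall>\<delta>>0. \<forall>(w, \<sigma>)\<in>S_h \<Omega> (Th h) \<delta>.
    (SUP (v, \<tau>)\<in>nonzero_pairs \<Omega> (Th h).
        ereal (Re (B_h \<Omega> (Th h) k \<beta> \<delta> w \<sigma> v \<tau>) / norm_DG \<Omega> (Th h) c\<Omega> k v \<tau>))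
    + (SUP (v, \<tau>)\<in>nonzero_pairs \<Omega> (Th h).
        ereal (Im (B_h \<Omega> (Th h) k \<beta> \<delta> w \<sigma> v \<tau>) / norm_DG \<Omega> (Th h) c\<Omega> k v \<tau>))
    \<ge> ereal (c2 / gamma2 (Th h) k \<beta> \<delta> * norm_DG \<Omega> (Th h) c\<Omega> k w \<sigma>)"
proof -
  obtain \<theta> where \<theta>: "0 < \<theta>" "\<And>h K. h \<in> H \<Longrightarrow> K \<in> Th h \<Longrightarrow> angles_at_least \<theta> K"
    using assms(4) unfolding mesh_family_def by blast
  \<comment> \<open>Capped at 1, the range in which \<open>height_lower_bound\<close> is
    available.\<close>
  define \<theta>' where "\<theta>' = min \<theta> 1"
  have th: "0 < \<theta>'" "\<theta>' \<le> 1" "\<theta>' \<le> \<theta>" unfolding \<theta>'_def using \<theta>(1) by auto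
  have ang: "angles_at_least \<theta>' K" if "h \<in> H" "K \<in> Th h" for h K
    by (rule angles_at_least_mono[OF \<theta>(2)[OF that] th(3)])
  \<comment> \<open>The factor of \<open>height_lower_bound\<close> between the height and the
    diameter of an element.\<close>
  define \<kappa> where "\<kappa> = (sin \<theta>') ^ 4"
  have "0 < sin \<theta>'" using th pi_gt3 by (intro sin_gt_zero) auto
  then have \<kappa>: "0 < \<kappa>" "\<kappa> \<le> 1" unfolding \<kappa>_def by (auto intro: power_le_one)
  have "bounded (closure \<Omega>)" using assms(2) unfolding bounded_domain_def by (simp add: bounded_closure)
  then obtain R where R: "0 < R" "\<And>x. x \<in> closure \<Omega> \<Longrightarrow> norm (x - x0) \<le> R"
    unfolding bounded_any_center[of _ x0] bounded_pos dist_norm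
    using bounded_any_center[of "closure \<Omega>" x0] \<open>bounded (closure \<Omega>)\<close>
    by (metis dist_commute dist_norm gt_ex less_eq_real_def linorder_not_le order_trans)
  have star: "c\<Omega> > 0" "\<And>x n. outward_normal_at \<Omega> x n \<Longrightarrow> c\<Omega> \<le> (x - x0) \<bullet> n"
    using assms(3) unfolding strictly_star_shaped_def by auto
  let ?C = "stability_constant (real CARD('n)) R c\<Omega> (2 * R)"
  have C: "0 < ?C" by (rule stability_constant_pos) (use assms(1) R(1) star(1) in auto)
  show ?thesis
  \<comment> \<open>The cube of \<kappa> is the price for passing from face diameters to heights in
    \<open>gamma2\<close>.\<close>
  proof (intro exI[of _ "\<kappa> ^ 3 / ?C"] conjI ballI allI impI)
    show "0 < \<kappa> ^ 3 / ?C" using \<kappa> C by simp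
  next
    fix h k \<beta> \<delta> :: real and P assume h: "h \<in> H" and k: "0 < k" and \<beta>: "0 < \<beta>" and \<delta>: "0 < \<delta>" and P: "P \<in> S_h \<Omega> (Th h) \<delta>"
    obtain w \<sigma> where P': "P = (w, \<sigma>)" by (cases P)
    have part: "simplicial_partition \<Omega> (Th h)" using assms(4) h unfolding mesh_family_def by blast
    interpret M: simplicial_mesh \<Omega> "Th h" by unfold_locales (use assms(1,2) part in auto)
    define I where "I = interior_faces (Th h)"
    have I: "finite I" "I \<noteq> {}" unfolding I_def using M.finite_interior_faces assms(5) h by auto
    \<comment> \<open>The smallest diameter of an interior face. The maximum in
      \<open>gamma2\<close> is at least its value at a face \<open>e0\<close> of this diameter,
      which bounds all powers of \<open>1 / s\<close> at once.\<close>
    define s where "s = Min (diameter ` I)"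
    have "s \<in> diameter ` I" unfolding s_def using I by (intro Min_in) auto
    then obtain e0 where e0: "e0 \<in> I" "s = diameter e0" by auto
    have sle: "s \<le> diameter e" if "e \<in> I" for e unfolding s_def using I that by simp
    have s0: "0 < s" and s2R: "s \<le> 2 * R"
      using M.diameter_facet[OF M.sides(1,4)] e0 M.sides(1,4)[of e0] R unfolding I_def by auto
    interpret L: regular_mesh \<Omega> "Th h" x0 c\<Omega> R "\<kappa> * s"
    proof
      fix K e p assume K: "K \<in> Th h" "e \<in> interior_faces (Th h)" "e facet_of K" "p \<in> vertices K"
      interpret S: simplex_vertices "vertices K" by (rule M.sv(1)[OF K(1)])
      \<comment> \<open>An element is at least as large as its interior face, whose diameter is at
        least \<open>s\<close>.\<close>
      have "\<kappa> * s \<le> \<kappa> * diameter K"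
        using sle[of e] K(2) diameter_subset[OF facet_of_imp_subset[OF K(3)] compact_imp_bounded[OF M.compact_T[OF K(1)]]] \<kappa>
        unfolding I_def by (intro mult_left_mono) auto
      also have "\<dots> \<le> S.ht p"
        using S.height_lower_bound[OF th(1,2) _ K(4)] ang[OF h K(1)] M.sv(2)[OF K(1)] unfolding \<kappa>_def by simp
      finally show "\<kappa> * s \<le> S.ht p" .
    qed (use star R \<kappa> s0 in auto)
    define \<Gamma> where "\<Gamma> = gamma2 (Th h) k \<beta> \<delta> / \<kappa> ^ 3"
    have g2: "k + ((k\<^sup>2 + 1) / (\<beta> * s) + (\<beta> + \<delta>) / s + \<delta> / s ^ 3 + 1 / (\<beta> * s ^ 3)) \<le> gamma2 (Th h) k \<beta> \<delta>"
      unfolding gamma2_def I_def[symmetric] e0(2) using I e0(1) by (intro add_left_mono Max_ge) auto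
    note gb = gamma_bounds[OF k \<beta> \<delta> s0 \<kappa> g2, folded \<Gamma>_def]
    \<comment> \<open>Faces lie in a ball of radius \<open>R\<close>, which bounds \<Gamma> from
      below independently of the mesh.\<close>
    have "1 / (2 * R) \<le> 1 / s" using s0 s2R R by (intro divide_left_mono) auto
    also have "\<dots> \<le> \<Gamma>" by (rule gb(6))
    finally have D: "1 / (2 * R) \<le> \<Gamma>" .
    have "ereal (norm_DG \<Omega> (Th h) c\<Omega> k w \<sigma> / (?C * \<Gamma>)) \<le>
      (SUP (v, \<tau>)\<in>nonzero_pairs \<Omega> (Th h). ereal (Re (B_h \<Omega> (Th h) k \<beta> \<delta> w \<sigma> v \<tau>) / norm_DG \<Omega> (Th h) c\<Omega> k v \<tau>))
      + (SUP (v, \<tau>)\<in>nonzero_pairs \<Omega> (Th h). ereal (Im (B_h \<Omega> (Th h) k \<beta> \<delta> w \<sigma> v \<tau>) / norm_DG \<Omega> (Th h) c\<Omega> k v \<tau>))"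
      by (rule L.stability[OF P[unfolded P'] k \<beta> \<delta> _ D gb(1-5)]) (use R in simp)
    moreover have "norm_DG \<Omega> (Th h) c\<Omega> k w \<sigma> / (?C * \<Gamma>) = \<kappa> ^ 3 / ?C / gamma2 (Th h) k \<beta> \<delta> * norm_DG \<Omega> (Th h) c\<Omega> k w \<sigma>"
      unfolding \<Gamma>_def by simp
    ultimately show "case P of (w, \<sigma>) \<Rightarrow>
      (SUP (v, \<tau>)\<in>nonzero_pairs \<Omega> (Th h). ereal (Re (B_h \<Omega> (Th h) k \<beta> \<delta> w \<sigma> v \<tau>) / norm_DG \<Omega> (Th h) c\<Omega> k v \<tau>))
      + (SUP (v, \<tau>)\<in>nonzero_pairs \<Omega> (Th h). ereal (Im (B_h \<Omega> (Th h) k \<beta> \<delta> w \<sigma> v \<tau>) / norm_DG \<Omega> (Th h) c\<Omega> k v \<tau>))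
      \<ge> ereal (\<kappa> ^ 3 / ?C / gamma2 (Th h) k \<beta> \<delta> * norm_DG \<Omega> (Th h) c\<Omega> k w \<sigma>)"
      unfolding P' by simp
  qed
qed

end
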